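(* ($C_2$-Cancellation.) Suppose $\xi$ and $\eta$ are $C_2$-vector bundles over a $C_2$-smooth manifold $M$, and let $V$ be a $C_2$-representation. If $\xi\oplus\epsilon_V\cong\eta\oplus\epsilon_V$ and - $\mathrm{rank}(\xi)>\dim(M)+1$, - $\mathrm{rank}(\xi^{\pm})>\dim(M^{C_2})+1$, then $\xi\cong\eta$.
   Context: $C_2$ is the cyclic group of order two. A $C_2$-vector bundle over $M$ is a real vector bundle $E\to M$ with a $C_2$-action on $E$ covering the action on $M$ and linear on fibers; isomorphisms are $C_2$-equivariant. For a finite-dimensional real $C_2$-representation $V$, $\epsilon_V$ is the trivial bundle $M\times V\to M$. For a $C_2$-vector bundle $\zeta$ over $M$ and $x\in M^{C_2}$, the fiber $\zeta_x$ carries a linear involution; the $+1$ and $-1$ eigenspaces assemble into a decomposition $\zeta|_{M^{C_2}}\cong\zeta^+\oplus\zeta^-$. The condition on $\mathrm{rank}(\xi^\pm)$ means it holds for both $\xi^+$ and $\xi^-$. *)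

theory Defs
  imports "HOL-Analysis.Analysis"
begin

section \<open>Smooth manifolds with an action of the cyclic group of order two\<close>

text \<open>
  \<^term>\<open>Euclidean_space n\<close> is $\mathbb{R}^n$, realised as the sequences vanishing from index \<open>n\<close>
  on. Unlike a type-indexed Euclidean space it allows $n = 0$, and it lets dimensions vary within
  a statement.
\<close>

text \<open>
  \<open>Ck_on n k W f\<close>: the partial derivatives of \<open>f\<close> up to order \<open>k\<close> exist and are continuous on the
  open subset \<open>W\<close> of $\mathbb{R}^n$. Only the values of \<open>f\<close> on \<open>W\<close> matter.
\<close>

primrec Ck_on :: "nat \<Rightarrow> nat \<Rightarrow> (nat \<Rightarrow> real) set \<Rightarrow> ((nat \<Rightarrow> real) \<Rightarrow> real) \<Rightarrow> bool" where
  "Ck_on n 0 W f \<longleftrightarrow> continuous_map (subtopology (Euclidean_space n) W) euclideanreal f"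
| "Ck_on n (Suc k) W f \<longleftrightarrow>
     continuous_map (subtopology (Euclidean_space n) W) euclideanreal f \<and>
     (\<forall>i<n. \<exists>g. (\<forall>x\<in>W. ((\<lambda>t. f (x(i := t))) has_real_derivative g x) (at (x i))) \<and>
                Ck_on n k W g)"

definition smooth_map_on ::
    "nat \<Rightarrow> (nat \<Rightarrow> real) set \<Rightarrow> ((nat \<Rightarrow> real) \<Rightarrow> (nat \<Rightarrow> real)) \<Rightarrow> bool" where
  "smooth_map_on n W F \<longleftrightarrow> (\<forall>j k. Ck_on n k W (\<lambda>x. F x j))"

type_synonym 'm chart = "'m set \<times> ('m \<Rightarrow> (nat \<Rightarrow> real))"

text \<open>
  An action of the cyclic group of order two is recorded by the involution through which the
  generator acts. The atlas need not be maximal.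
\<close>

record 'm c2_manifold =
  mtop  :: "'m topology"
  mdim  :: nat
  atlas :: "'m chart set"
  flip  :: "'m \<Rightarrow> 'm"

definition topological_chart :: "'m c2_manifold \<Rightarrow> 'm chart \<Rightarrow> bool" where
  "topological_chart M c \<longleftrightarrow>
     (case c of (U, \<phi>) \<Rightarrow>
        openin (mtop M) U \<and> openin (Euclidean_space (mdim M)) (\<phi> ` U) \<and>
        homeomorphic_map (subtopology (mtop M) U)
                         (subtopology (Euclidean_space (mdim M)) (\<phi> ` U)) \<phi>)"

definition smooth_in_charts :: "nat \<Rightarrow> ('m \<Rightarrow> 'm) \<Rightarrow> 'm chart \<Rightarrow> 'm chart \<Rightarrow> bool" where
  "smooth_in_charts n f c d \<longleftrightarrow>
     (case (c, d) of ((U, \<phi>), (V, \<psi>)) \<Rightarrow>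
        smooth_map_on n (\<phi> ` {x \<in> U. f x \<in> V}) (\<lambda>y. \<psi> (f (inv_into U \<phi> y))))"

definition smooth_chart :: "'m c2_manifold \<Rightarrow> 'm chart \<Rightarrow> bool" where
  "smooth_chart M c \<longleftrightarrow>
     topological_chart M c \<and>
     (\<forall>d\<in>atlas M. smooth_in_charts (mdim M) id c d \<and> smooth_in_charts (mdim M) id d c)"

definition smooth_manifold :: "'m c2_manifold \<Rightarrow> bool" where
  "smooth_manifold M \<longleftrightarrow>
     Hausdorff_space (mtop M) \<and> second_countable (mtop M) \<and>
     (\<Union>(U, \<phi>)\<in>atlas M. U) = topspace (mtop M) \<and>
     (\<forall>c\<in>atlas M. smooth_chart M c)"

definition smooth_c2_manifold :: "'m c2_manifold \<Rightarrow> bool" where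
  "smooth_c2_manifold M \<longleftrightarrow>
     smooth_manifold M \<and>
     continuous_map (mtop M) (mtop M) (flip M) \<and>
     (\<forall>x\<in>topspace (mtop M). flip M (flip M x) = x) \<and>
     (\<forall>c\<in>atlas M. \<forall>d\<in>atlas M. smooth_in_charts (mdim M) (flip M) c d)"

definition fixed_set :: "'m c2_manifold \<Rightarrow> 'm set" where
  "fixed_set M = {x \<in> topspace (mtop M). flip M x = x}"

definition slice_chart :: "'m c2_manifold \<Rightarrow> 'm set \<Rightarrow> nat \<Rightarrow> 'm chart \<Rightarrow> bool" where
  "slice_chart M S k c \<longleftrightarrow>
     smooth_chart M c \<and> k \<le> mdim M \<and>
     (case c of (U, \<phi>) \<Rightarrow> \<phi> ` (U \<inter> S) = \<phi> ` U \<inter> topspace (Euclidean_space k))"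

text \<open>
  The fixed set is an embedded submanifold whose components may have different dimensions; its
  dimension is the largest of these. The value is 0 if there are no fixed points.
\<close>

definition fixed_dim :: "'m c2_manifold \<Rightarrow> nat" where
  "fixed_dim M =
     Sup {k. \<exists>x\<in>fixed_set M. \<exists>U \<phi>. x \<in> U \<and> slice_chart M (fixed_set M) k (U, \<phi>)}"


section \<open>Equivariant vector bundles\<close>

record ('m, 'e) c2_bundle =
  total  :: "'e topology"
  proj   :: "'e \<Rightarrow> 'm"
  vadd   :: "'e \<Rightarrow> 'e \<Rightarrow> 'e"
  vscale :: "real \<Rightarrow> 'e \<Rightarrow> 'e"
  act    :: "'e \<Rightarrow> 'e"

definition fibre :: "('m, 'e) c2_bundle \<Rightarrow> 'm \<Rightarrow> 'e set" where
  "fibre \<xi> x = {e \<in> topspace (total \<xi>). proj \<xi> e = x}"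

definition local_trivialization ::
    "'m topology \<Rightarrow> ('m, 'e) c2_bundle \<Rightarrow> 'm set \<Rightarrow> nat \<Rightarrow> ('e \<Rightarrow> 'm \<times> (nat \<Rightarrow> real)) \<Rightarrow> bool" where
  "local_trivialization X \<xi> U r h \<longleftrightarrow>
     homeomorphic_map (subtopology (total \<xi>) {e \<in> topspace (total \<xi>). proj \<xi> e \<in> U})
                      (prod_topology (subtopology X U) (Euclidean_space r)) h \<and>
     (\<forall>x\<in>U. \<forall>e\<in>fibre \<xi> x.
        fst (h e) = x \<and>
        (\<forall>e'\<in>fibre \<xi> x. snd (h (vadd \<xi> e e')) = (\<lambda>i. snd (h e) i + snd (h e') i)) \<and>
        (\<forall>c. snd (h (vscale \<xi> c e)) = (\<lambda>i. c * snd (h e) i)))"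

text \<open>
  The vector space axioms on the fibres are not listed: closure under the operations is required,
  and a local trivialization maps each fibre bijectively onto some $\mathbb{R}^r$, compatibly with
  the operations. The rank \<open>r\<close> may differ between components of the base.
\<close>

definition vector_bundle :: "'m topology \<Rightarrow> ('m, 'e) c2_bundle \<Rightarrow> bool" where
  "vector_bundle X \<xi> \<longleftrightarrow>
     continuous_map (total \<xi>) X (proj \<xi>) \<and>
     (\<forall>x\<in>topspace X. \<forall>e\<in>fibre \<xi> x.
        (\<forall>e'\<in>fibre \<xi> x. vadd \<xi> e e' \<in> fibre \<xi> x) \<and> (\<forall>c. vscale \<xi> c e \<in> fibre \<xi> x)) \<and>
     (\<forall>x\<in>topspace X. \<exists>U r h. openin X U \<and> x \<in> U \<and> local_trivialization X \<xi> U r h)"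

definition c2_vector_bundle :: "'m c2_manifold \<Rightarrow> ('m, 'e) c2_bundle \<Rightarrow> bool" where
  "c2_vector_bundle M \<xi> \<longleftrightarrow>
     vector_bundle (mtop M) \<xi> \<and>
     continuous_map (total \<xi>) (total \<xi>) (act \<xi>) \<and>
     (\<forall>e\<in>topspace (total \<xi>). act \<xi> (act \<xi> e) = e \<and> proj \<xi> (act \<xi> e) = flip M (proj \<xi> e)) \<and>
     (\<forall>x\<in>topspace (mtop M). \<forall>e\<in>fibre \<xi> x.
        (\<forall>e'\<in>fibre \<xi> x. act \<xi> (vadd \<xi> e e') = vadd \<xi> (act \<xi> e) (act \<xi> e')) \<and>
        (\<forall>c. act \<xi> (vscale \<xi> c e) = vscale \<xi> c (act \<xi> e)))"

definition c2_bundle_iso ::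
    "('m, 'e) c2_bundle \<Rightarrow> ('m, 'f) c2_bundle \<Rightarrow> ('e \<Rightarrow> 'f) \<Rightarrow> bool" where
  "c2_bundle_iso \<xi> \<eta> h \<longleftrightarrow>
     homeomorphic_map (total \<xi>) (total \<eta>) h \<and>
     (\<forall>e\<in>topspace (total \<xi>).
        proj \<eta> (h e) = proj \<xi> e \<and>
        h (act \<xi> e) = act \<eta> (h e) \<and>
        (\<forall>e'\<in>fibre \<xi> (proj \<xi> e). h (vadd \<xi> e e') = vadd \<eta> (h e) (h e')) \<and>
        (\<forall>c. h (vscale \<xi> c e) = vscale \<eta> c (h e)))"

definition c2_isomorphic :: "('m, 'e) c2_bundle \<Rightarrow> ('m, 'f) c2_bundle \<Rightarrow> bool" where
  "c2_isomorphic \<xi> \<eta> \<longleftrightarrow> (\<exists>h. c2_bundle_iso \<xi> \<eta> h)"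

definition whitney_sum ::
    "('m, 'e) c2_bundle \<Rightarrow> ('m, 'f) c2_bundle \<Rightarrow> ('m, 'e \<times> 'f) c2_bundle" where
  "whitney_sum \<xi> \<eta> =
     \<lparr>total = subtopology (prod_topology (total \<xi>) (total \<eta>)) {(e, f). proj \<xi> e = proj \<eta> f},
      proj = (\<lambda>(e, f). proj \<xi> e),
      vadd = (\<lambda>(e, f) (e', f'). (vadd \<xi> e e', vadd \<eta> f f')),
      vscale = (\<lambda>c (e, f). (vscale \<xi> c e, vscale \<eta> c f)),
      act = (\<lambda>(e, f). (act \<xi> e, act \<eta> f))\<rparr>"

text \<open>
  Representations live on a subspace \<open>V\<close> of a Euclidean type, so that the zero representation is
  included; \<open>\<rho>\<close> is the action of the generator and only matters on \<open>V\<close>.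
\<close>

definition c2_representation :: "'v::euclidean_space set \<Rightarrow> ('v \<Rightarrow> 'v) \<Rightarrow> bool" where
  "c2_representation V \<rho> \<longleftrightarrow>
     subspace V \<and>
     (\<forall>v\<in>V. \<rho> v \<in> V \<and> \<rho> (\<rho> v) = v \<and>
        (\<forall>w\<in>V. \<rho> (v + w) = \<rho> v + \<rho> w) \<and> (\<forall>c. \<rho> (c *\<^sub>R v) = c *\<^sub>R \<rho> v))"

definition trivial_bundle ::
    "'m c2_manifold \<Rightarrow> 'v::euclidean_space set \<Rightarrow> ('v \<Rightarrow> 'v) \<Rightarrow> ('m, 'm \<times> 'v) c2_bundle" where
  "trivial_bundle M V \<rho> =
     \<lparr>total = prod_topology (mtop M) (top_of_set V),
      proj = fst,
      vadd = (\<lambda>(x, v) (y, w). (x, v + w)),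
      vscale = (\<lambda>c (x, v). (x, c *\<^sub>R v)),
      act = (\<lambda>(x, v). (flip M x, \<rho> v))\<rparr>"

text \<open>The dimension of the fibre over \<open>x\<close>, as the \<open>r\<close> for which it is linearly isomorphic to $\mathbb{R}^r$.\<close>

definition rank_at :: "('m, 'e) c2_bundle \<Rightarrow> 'm \<Rightarrow> nat" where
  "rank_at \<xi> x =
     (THE r. \<exists>L. bij_betw L (fibre \<xi> x) (topspace (Euclidean_space r)) \<and>
        (\<forall>e\<in>fibre \<xi> x.
           (\<forall>e'\<in>fibre \<xi> x. L (vadd \<xi> e e') = (\<lambda>i. L e i + L e' i)) \<and>
           (\<forall>c. L (vscale \<xi> c e) = (\<lambda>i. c * L e i))))"

text \<open>
  The restriction of \<open>\<xi>\<close> to the fixed set, cut down to the eigenspaces for the eigenvalue \<open>s\<close>; the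
  summands $\xi^+$ and $\xi^-$ are the cases $s = 1$ and $s = -1$.
\<close>

definition eigenbundle :: "'m c2_manifold \<Rightarrow> real \<Rightarrow> ('m, 'e) c2_bundle \<Rightarrow> ('m, 'e) c2_bundle" where
  "eigenbundle M s \<xi> =
     \<xi>\<lparr>total := subtopology (total \<xi>) {e. proj \<xi> e \<in> fixed_set M \<and> act \<xi> e = vscale \<xi> s e}\<rparr>"

end

theory Submission
  imports Defs "HOL-Homology.Invariance_of_Domain"
begin

text \<open>
  The involution splits \<open>V\<close> into lines on which it acts by a sign, so it suffices to cancel one line
  \<open>\<real> v0\<close> with \<open>\<rho> v0 = \<sigma> v0\<close> and to argue by induction on \<open>dim V\<close>. Let \<open>\<Phi>\<close> be an isomorphism from
  \<open>\<xi> \<oplus> \<epsilon>\<^sub>V\<close> to \<open>\<eta> \<oplus> \<epsilon>\<^sub>V\<close>. The preimage of the constant section \<open>(0, v0)\<close> is a nowhere vanishing section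
  \<open>a = (a1, a2)\<close> of \<open>\<xi> \<oplus> \<epsilon>\<^sub>V\<close> with \<open>act (a x) = \<sigma> a (g x)\<close>, where \<open>g\<close> is the involution of \<open>M\<close>. If some
  automorphism of \<open>\<xi> \<oplus> \<epsilon>\<^sub>V\<close> carries \<open>(0, v0)\<close> to \<open>a\<close>, then its composite with \<open>\<Phi>\<close> fixes the line, and
  compressing it to the orthogonal complement \<open>V'\<close> of the line gives an isomorphism from
  \<open>\<xi> \<oplus> \<epsilon>\<^sub>V'\<close> to \<open>\<eta> \<oplus> \<epsilon>\<^sub>V'\<close> (\<open>drop_line_iso\<close>, \<open>cancel_line\<close>).

  Such an automorphism is a product of two maps \<open>v \<mapsto> v + \<kappa>(v) d\<close> (\<open>transvection_iso\<close>). One of them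
  carries a section \<open>b\<close> to a section \<open>a\<close> as soon as an equivariant functional \<open>\<kappa>\<close> with \<open>\<kappa>(b) = 1\<close> does
  not vanish on \<open>a\<close>: take \<open>d = a - b\<close>. Functionals come from pairing with sections in an invariant
  metric. Since \<open>(0, v0)\<close> and \<open>a\<close> may point in opposite directions, they are joined through
  \<open>(t, a2)\<close>, where \<open>t\<close> is an equivariant section of \<open>\<xi>\<close> that vanishes nowhere and is close to \<open>a1\<close>
  (\<open>equivariant_transport\<close>).

  The existence of \<open>t\<close> is where the ranks enter (\<open>nonvanishing_section\<close>). It is an instance of general
  position: a continuous map from a compact subset of \<open>\<real>\<^sup>k\<close> to \<open>\<real>\<^sup>p\<close> with \<open>k < p\<close> is uniformly close
  to a map without zeros, because it is close to a Lipschitz map, whose image is too thin to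
  contain all small vectors (\<open>nonvanishing_approximation\<close>). Over the fixed set an equivariant section
  takes its values in the eigenbundle for \<open>\<sigma>\<close>, so the rank of that eigenbundle is compared with the
  dimension of the fixed set. Away from the fixed set the action is free, a section may be changed
  near \<open>x\<close> and correspondingly near \<open>g x\<close>, and the rank of \<open>\<xi>\<close> is compared with the dimension of \<open>M\<close>.
  The local changes are combined along an exhaustion by invariant compact sets
  (\<open>exhaustion_gluing\<close>), which also produces the invariant metric.

  Comparing dimensions over the fixed set requires charts of \<open>M\<close> in which the fixed set is a
  coordinate subspace (\<open>slice_chart_exists\<close>). They are found by replacing the coordinates of a
  chart, one at a time, by coordinates which the involution multiplies by a sign. The rank of a
  bundle is unambiguous because of invariance of dimension (\<open>rank_at_eqI\<close>).
\<close>

section \<open>Approximation by maps without zeros\<close>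

text \<open>
  Lipschitz maps do not raise box dimension. Cut the range of \<open>u\<close> into cubes; \<open>g\<close> is nearly
  constant on each of them, so each cube rules out at most one of the \<open>q\<^sup>p\<close> candidates
  \<open>c = (e/q) a\<close>. There are only about \<open>(D q)\<^sup>k\<close> cubes, which is less than \<open>q\<^sup>p\<close>.
\<close>

lemma lipschitz_avoids:
  fixes g :: "nat \<Rightarrow> 'a \<Rightarrow> real" and u :: "nat \<Rightarrow> 'a \<Rightarrow> real"
  assumes "k < p" and e: "e > 0"
    and bd: "\<And>x i. x \<in> S \<Longrightarrow> i < k \<Longrightarrow> \<bar>u i x\<bar> \<le> real B" 
    and lip: "\<And>x y j. x \<in> S \<Longrightarrow> y \<in> S \<Longrightarrow> j < p \<Longrightarrow> \<bar>g j x - g j y\<bar> \<le> L * (\<Sum>i<k. \<bar>u i x - u i y\<bar>)"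
  obtains c where "\<And>j. j < p \<Longrightarrow> \<bar>c j\<bar> < e" "\<And>x. x \<in> S \<Longrightarrow> \<exists>j<p. g j x + c j \<noteq> 0"
proof -
  obtain C :: nat where C: "real C > \<bar>L\<bar> * k / e" "C \<ge> 1"
    by (metis (no_types, opaque_lifting) One_nat_def Suc_leI max.cobounded1 max_less_iff_conj of_nat_0_less_iff of_nat_max reals_Archimedean2 zero_less_one neq0_conv order_less_le_trans)
  \<comment> \<open>With side length \<open>1 / N\<close>, the variation of \<open>g\<close> on a cube is below the spacing \<open>e / q\<close> of the candidates,
    by the choice of \<open>C\<close>. There are at most \<open>(D q)\<^sup>k\<close> cubes, fewer than \<open>q\<^sup>p\<close>, since \<open>q > D\<^sup>k\<close> and \<open>k < p\<close>.\<close>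
  define D where "D = (2 * B + 1) * C"
  define q where "q = D ^ k + 1"
  define N where "N = C * q"
  have q: "q > 0" and N: "N > 0" using C by (auto simp: q_def N_def)
  define cell where "cell x = (\<lambda>i\<in>{..<k}. nat \<lfloor>(u i x + B) * N\<rfloor>)" for x
  define cand where "cand a j = e * real (a j) / q" for a :: "nat \<Rightarrow> nat" and j :: nat
  let ?A = "PiE {..<p} (\<lambda>_. {..<q})"
  let ?B = "PiE {..<k} (\<lambda>_. {..<2 * B * N + 1})"
  have cell_in: "cell x \<in> ?B" if "x \<in> S" for x
  proof -
    have "nat \<lfloor>(u i x + B) * N\<rfloor> < 2 * B * N + 1" if i: "i < k" for i
    proof -
      have "u i x + B \<le> 2 * B" using bd[OF \<open>x \<in> S\<close> i] by auto
      then have "(u i x + B) * N \<le> real (2 * B * N)"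
        by (simp add: mult_right_mono)
      then show ?thesis by linarith
    qed
    then show ?thesis by (auto simp: cell_def)
  qed
  have close: "\<bar>u i x - u i y\<bar> \<le> 1 / N" if "x \<in> S" "y \<in> S" "cell x = cell y" "i < k" for x y i
  proof -
    have ge: "0 \<le> (u i z + B) * N" if "z \<in> S" for z using bd[OF that \<open>i < k\<close>] by auto
    have "nat \<lfloor>(u i x + B) * N\<rfloor> = nat \<lfloor>(u i y + B) * N\<rfloor>"
      using fun_cong[OF that(3), of i] \<open>i < k\<close> by (simp add: cell_def)
    then have "\<lfloor>(u i x + B) * N\<rfloor> = \<lfloor>(u i y + B) * N\<rfloor>"
      using ge that by (simp add: nat_eq_iff2)
    then have "\<bar>(u i x + B) * N - (u i y + B) * N\<bar> \<le> 1" by linarith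
    then have "\<bar>u i x - u i y\<bar> * N \<le> 1"
      by (simp add: left_diff_distrib[symmetric] abs_mult)
    then show ?thesis using N by (simp add: field_simps)
  qed
  have "\<exists>a\<in>?A. \<forall>x\<in>S. \<exists>j<p. g j x + cand a j \<noteq> 0"
  proof (rule ccontr)
    assume "\<not> ?thesis"
    then obtain X where X: "\<And>a. a \<in> ?A \<Longrightarrow> X a \<in> S \<and> (\<forall>j<p. g j (X a) + cand a j = 0)"
      by metis
    have "inj_on (\<lambda>a. cell (X a)) ?A"
    proof (rule inj_onI)
      fix a b assume ab: "a \<in> ?A" "b \<in> ?A" "cell (X a) = cell (X b)"
      have "a j = b j" if j: "j < p" for j
      proof (rule ccontr)
        assume "a j \<noteq> b j"
        then have "\<bar>real (a j) - real (b j)\<bar> \<ge> 1" by linarith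
        then have "e / q \<le> e / q * \<bar>real (a j) - real (b j)\<bar>"
          using e q by (simp add: divide_right_mono)
        also have "\<dots> = \<bar>cand a j - cand b j\<bar>"
          using e q by (simp add: cand_def diff_divide_distrib[symmetric] right_diff_distrib[symmetric] abs_mult)
        also have "\<dots> = \<bar>g j (X a) - g j (X b)\<bar>"
          using X ab j by (smt (verit))
        also have "\<dots> \<le> L * (\<Sum>i<k. \<bar>u i (X a) - u i (X b)\<bar>)"
          using lip X ab j by blast
        also have "\<dots> \<le> \<bar>L\<bar> * (\<Sum>i<k. \<bar>u i (X a) - u i (X b)\<bar>)"
          by (intro mult_right_mono sum_nonneg) auto
        also have "\<dots> \<le> \<bar>L\<bar> * (\<Sum>i<k. 1 / N)"
          using close X ab by (intro mult_left_mono sum_mono) auto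
        also have "\<dots> = (\<bar>L\<bar> * k) / (C * q)" by (simp add: N_def)
        finally have "e / q \<le> (\<bar>L\<bar> * k) / (C * q)" .
        then have "e \<le> (\<bar>L\<bar> * k) / C" using q C by (simp add: field_simps)
        then have "e * C \<le> \<bar>L\<bar> * k" using C by (simp add: field_simps)
        moreover have "\<bar>L\<bar> * k < e * C" using C e by (simp add: field_simps)
        ultimately show False by simp
      qed
      then show "a = b" by (intro PiE_ext[OF ab(1,2)]) auto
    qed
    then have "card ?A \<le> card ?B"
      using X cell_in by (intro card_inj_on_le[where f="\<lambda>a. cell (X a)"]) (auto intro!: finite_PiE)
    then have "q ^ p \<le> (2 * B * N + 1) ^ k" by (simp add: card_PiE)
    also have "\<dots> \<le> (D * q) ^ k"
    proof (rule power_mono)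
      have "1 \<le> C * q" using C q by simp
      then show "2 * B * N + 1 \<le> D * q" by (simp add: D_def N_def algebra_simps)
    qed simp
    also have "\<dots> = D ^ k * q ^ k" by (simp add: power_mult_distrib)
    also have "\<dots> < q * q ^ k" using q by (simp add: q_def)
    also have "\<dots> \<le> q ^ p" using \<open>k < p\<close> q by (metis Suc_leI One_nat_def power_Suc power_increasing_iff power_increasing)
    finally show False by simp
  qed
  then obtain a where a: "a \<in> ?A" "\<forall>x\<in>S. \<exists>j<p. g j x + cand a j \<noteq> 0" by blast
  show thesis
  proof
    show "\<bar>cand a j\<bar> < e" if "j < p" for j
    proof -
      have "a j < q" using a that by (auto simp: PiE_iff)
      then show ?thesis using e q by (simp add: cand_def abs_mult field_simps)
    qed
  qed (use a in auto)
qed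

text \<open>
  The functions that are Lipschitz for the sum distance form an algebra which separates points, so
  \<open>f\<close> is close to a Lipschitz map; a small translation removes the zeros of that map.
\<close>

lemma nonvanishing_approximation:
  fixes f :: "nat \<Rightarrow> (nat \<Rightarrow> real) \<Rightarrow> real"
  assumes S: "compact S" "S \<subseteq> topspace (Euclidean_space k)" and "k < p"
    and f: "\<And>j. j < p \<Longrightarrow> continuous_on S (f j)" and e: "e > 0"
  obtains g where "\<And>j. j < p \<Longrightarrow> continuous_on S (g j)"
    "\<And>j x. j < p \<Longrightarrow> x \<in> S \<Longrightarrow> \<bar>g j x - f j x\<bar> < e" "\<And>x. x \<in> S \<Longrightarrow> \<exists>j<p. g j x \<noteq> 0"
proof -
  define d where "d x y = (\<Sum>i<k. \<bar>x i - y i\<bar>)" for x y :: "nat \<Rightarrow> real"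
  have d0: "0 \<le> d x y" for x y by (simp add: d_def sum_nonneg)
  define P where "P f \<longleftrightarrow> continuous_on S f \<and> (\<exists>L. \<forall>x\<in>S. \<forall>y\<in>S. \<bar>f x - f y\<bar> \<le> L * d x y)" for f
  have P_bd: "\<exists>b. \<forall>x\<in>S. \<bar>f x\<bar> \<le> b" if "P f" for f
  proof -
    have "compact (f ` S)" using that S compact_continuous_image unfolding P_def by blast
    then show ?thesis by (metis compact_imp_bounded bounded_real imageI)
  qed
  have coord: "continuous_on S (\<lambda>x. x i)" for i :: nat
    by (rule continuous_on_product_coordinates[THEN continuous_on_subset]) auto
  have approx: "\<exists>g. P g \<and> (\<forall>x\<in>S. \<bar>f j x - g x\<bar> < e / 2)" if "j < p" for j
  proof (rule Stone_Weierstrass_HOL[OF S(1), of P])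
    show "P (\<lambda>x. c)" for c by (auto simp: P_def intro!: exI[of _ 0])
    show "P h \<Longrightarrow> continuous_on S h" for h by (simp add: P_def)
    show "P (\<lambda>x. h x + h' x)" if hh: "P h \<and> P h'" for h h'
    proof -
      from hh obtain L L' where "\<forall>x\<in>S. \<forall>y\<in>S. \<bar>h x - h y\<bar> \<le> L * d x y" "\<forall>x\<in>S. \<forall>y\<in>S. \<bar>h' x - h' y\<bar> \<le> L' * d x y"
        unfolding P_def by blast
      then have "\<forall>x\<in>S. \<forall>y\<in>S. \<bar>(h x + h' x) - (h y + h' y)\<bar> \<le> (L + L') * d x y"
        by (smt (verit) distrib_right)
      then show ?thesis using hh by (auto simp: P_def intro!: continuous_on_add)
    qed
    show "P (\<lambda>x. h x * h' x)" if hh: "P h \<and> P h'" for h h'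
    proof -
      from hh obtain L L' where L: "\<forall>x\<in>S. \<forall>y\<in>S. \<bar>h x - h y\<bar> \<le> L * d x y" "\<forall>x\<in>S. \<forall>y\<in>S. \<bar>h' x - h' y\<bar> \<le> L' * d x y"
        unfolding P_def by blast
      obtain b b' where b: "\<forall>x\<in>S. \<bar>h x\<bar> \<le> b" "\<forall>x\<in>S. \<bar>h' x\<bar> \<le> b'" using P_bd hh by metis
      have "\<bar>h x * h' x - h y * h' y\<bar> \<le> (b * L' + b' * L) * d x y" if "x \<in> S" "y \<in> S" for x y
      proof -
        have "h x * h' x - h y * h' y = h x * (h' x - h' y) + h' y * (h x - h y)" by (simp add: algebra_simps)
        also have "\<bar>\<dots>\<bar> \<le> \<bar>h x\<bar> * \<bar>h' x - h' y\<bar> + \<bar>h' y\<bar> * \<bar>h x - h y\<bar>"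
          by (metis abs_mult abs_triangle_ineq)
        also have "\<dots> \<le> b * (L' * d x y) + b' * (L * d x y)"
          using b L that by (intro add_mono mult_mono) (auto intro: order_trans[OF abs_ge_zero])
        finally show ?thesis by (simp add: algebra_simps)
      qed
      then show ?thesis using hh by (auto simp: P_def intro!: continuous_on_mult)
    qed
    show "\<exists>h. P h \<and> h x \<noteq> h y" if "x \<in> S \<and> y \<in> S \<and> x \<noteq> y" for x y
    proof -
      have "\<exists>i. x i \<noteq> y i" using that fun_eq_iff[of x y] by simp
      then obtain i where i: "x i \<noteq> y i" by blast
      then have "i < k" using that S(2) unfolding topspace_Euclidean_space
        by (metis (mono_tags, lifting) linorder_not_less mem_Collect_eq subset_eq)
      have "\<bar>x i - y i\<bar> \<le> 1 * d x y" for x y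
        unfolding d_def using \<open>i < k\<close> member_le_sum[of i "{..<k}" "\<lambda>i. \<bar>x i - y i\<bar>"] by simp
      then have "P (\<lambda>x. x i)" using coord by (auto simp: P_def intro!: exI[of _ 1])
      then show ?thesis using i by blast
    qed
  qed (use f that e in auto)
  then obtain g where g: "\<And>j. j < p \<Longrightarrow> P (g j)" "\<And>j x. j < p \<Longrightarrow> x \<in> S \<Longrightarrow> \<bar>f j x - g j x\<bar> < e / 2"
    by metis
  then obtain L where L: "\<And>j x y. j < p \<Longrightarrow> x \<in> S \<Longrightarrow> y \<in> S \<Longrightarrow> \<bar>g j x - g j y\<bar> \<le> L j * d x y"
    unfolding P_def by metis
  define L' where "L' = (\<Sum>j<p. \<bar>L j\<bar>)"
  have lip: "\<bar>g j x - g j y\<bar> \<le> L' * d x y" if "x \<in> S" "y \<in> S" "j < p" for x y j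
  proof -
    have "L j \<le> L'" 
    proof -
      have "\<bar>L j\<bar> \<le> L'" unfolding L'_def by (rule member_le_sum) (use that in auto)
      then show ?thesis by simp
    qed
    then show ?thesis using order_trans[OF L[OF that(3,1,2)] mult_right_mono[OF _ d0]] by simp
  qed
  have "\<exists>b. \<forall>x\<in>S. \<bar>x i\<bar> \<le> b" for i :: nat
    by (metis compact_continuous_image[OF coord S(1)] compact_imp_bounded bounded_real imageI)
  then obtain b where b: "\<And>i x. x \<in> S \<Longrightarrow> \<bar>x i\<bar> \<le> b i" by metis
  obtain B :: nat where B: "(\<Sum>i<k. \<bar>b i\<bar>) \<le> real B" using real_arch_simple by blast
  have bd: "\<bar>x i\<bar> \<le> real B" if "x \<in> S" "i < k" for x i
  proof -
    have "\<bar>b i\<bar> \<le> (\<Sum>i<k. \<bar>b i\<bar>)" using that by (intro member_le_sum) auto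
    then show ?thesis using b[OF that(1), of i] B by linarith
  qed
  obtain c where c: "\<And>j. j < p \<Longrightarrow> \<bar>c j\<bar> < e / 2" "\<And>x. x \<in> S \<Longrightarrow> \<exists>j<p. g j x + c j \<noteq> 0"
  proof (rule lipschitz_avoids[of k p "e/2" S "\<lambda>i x. x i" B g L'])
    show "\<bar>g j x - g j y\<bar> \<le> L' * (\<Sum>i<k. \<bar>x i - y i\<bar>)" if "x \<in> S" "y \<in> S" "j < p" for x y j
      using lip[OF that] by (simp add: d_def)
  qed (use \<open>k < p\<close> e bd in auto)
  show thesis
  proof
    show "continuous_on S (\<lambda>x. g j x + c j)" if "j < p" for j
      using g that by (auto simp: P_def intro!: continuous_on_add)
    show "\<bar>(g j x + c j) - f j x\<bar> < e" if "j < p" "x \<in> S" for j x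
      using g(2)[OF that] c(1)[OF that(1)] by linarith
  qed (use c in auto)
qed

section \<open>Calculus in several real variables\<close>

definition Eucl :: "nat \<Rightarrow> (nat \<Rightarrow> real) set" where
  "Eucl n = {x. \<forall>i\<ge>n. x i = 0}"

lemma topspace_Eucl [simp]: "topspace (Euclidean_space n) = Eucl n"
  by (simp add: Eucl_def topspace_Euclidean_space)

lemma Euclidean_space_eq: "Euclidean_space n = top_of_set (Eucl n)"
  by (simp add: Euclidean_space_def Eucl_def euclidean_product_topology)

lemma subtopology_Euclidean_space: "W \<subseteq> Eucl n \<Longrightarrow> subtopology (Euclidean_space n) W = top_of_set W"
  by (simp add: Euclidean_space_eq subtopology_subtopology inf_absorb2)

lemma openin_Eucl_subset: "openin (Euclidean_space n) W \<Longrightarrow> W \<subseteq> Eucl n"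
  using openin_subset[of "Euclidean_space n" W] by simp

lemma Eucl_upd: "x \<in> Eucl n \<Longrightarrow> i < n \<Longrightarrow> x(i := t) \<in> Eucl n"
  by (auto simp: Eucl_def)

definition open_cube :: "nat \<Rightarrow> (nat \<Rightarrow> real) \<Rightarrow> real \<Rightarrow> (nat \<Rightarrow> real) set" where
  "open_cube n y d = {z \<in> Eucl n. \<forall>i<n. \<bar>z i - y i\<bar> < d}"

lemma openin_open_cube: "openin (Euclidean_space n) (open_cube n y d)"
proof -
  have "open (\<Inter>i\<in>{..<n}. {z :: nat \<Rightarrow> real. \<bar>z i - y i\<bar> < d})"
    by (intro open_INT ballI open_Collect_less continuous_intros continuous_on_product_coordinates) auto
  moreover have "open_cube n y d = Eucl n \<inter> (\<Inter>i\<in>{..<n}. {z. \<bar>z i - y i\<bar> < d})"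
    by (auto simp: open_cube_def)
  ultimately show ?thesis by (simp add: Euclidean_space_eq openin_open_Int)
qed

lemma open_cube_subset:
  assumes "openin (Euclidean_space n) W" "y \<in> W"
  obtains d where "d > 0" "open_cube n y d \<subseteq> W"
proof -
  obtain T where T: "open T" "W = Eucl n \<inter> T"
    using assms by (auto simp: Euclidean_space_eq openin_open)
  then have "openin (powertop_real UNIV) T" "y \<in> T" using assms by (auto simp: euclidean_product_topology)
  then obtain X where X: "y \<in> (\<Pi>\<^sub>E i\<in>UNIV. X i)" "\<And>i. open (X i)" "(\<Pi>\<^sub>E i\<in>UNIV. X i) \<subseteq> T"
    using product_topology_open_contains_basis[of "\<lambda>_. euclideanreal" UNIV T y] by auto
  have "\<exists>e>0. \<forall>t. \<bar>t - y i\<bar> < e \<longrightarrow> t \<in> X i" for i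
  proof -
    have "y i \<in> X i" using X(1) by auto
    then show ?thesis using X(2)[of i] by (auto simp: open_dist dist_real_def)
  qed
  then obtain e where e: "\<And>i. e i > 0" "\<And>i t. \<bar>t - y i\<bar> < e i \<Longrightarrow> t \<in> X i" by metis
  define d where "d = Min (insert 1 (e ` {..<n}))"
  show thesis
  proof
    show "d > 0" using e by (auto simp: d_def)
    show "open_cube n y d \<subseteq> W"
    proof
      fix z assume z: "z \<in> open_cube n y d"
      have "z i \<in> X i" for i
      proof (cases "i < n")
        case True
        then have "d \<le> e i" by (auto simp: d_def intro!: Min_le)
        then show ?thesis using z True e(2)[of "z i" i] by (force simp: open_cube_def)
      next
        case False
        then have "z i = y i" using z assms T by (auto simp: open_cube_def Eucl_def)
        then show ?thesis using X(1) by auto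
      qed
      then show "z \<in> W" using X(3) z T by (auto simp: open_cube_def)
    qed
  qed
qed

lemma eventually_upd_in:
  assumes "openin (Euclidean_space n) W" "x \<in> W" "i < n"
  shows "\<forall>\<^sub>F t in nhds (x i). x(i := t) \<in> W"
proof -
  obtain d where d: "d > 0" "open_cube n x d \<subseteq> W" using open_cube_subset assms by blast
  have "x \<in> Eucl n" using assms openin_Eucl_subset[OF assms(1)] by auto
  then have "x(i := t) \<in> W" if "\<bar>t - x i\<bar> < d" for t
    using that d assms by (auto simp: open_cube_def Eucl_upd subset_iff)
  then show ?thesis using d by (auto simp: eventually_nhds_metric dist_real_def)
qed

lemma Ck_on_0 [simp]: "W \<subseteq> Eucl n \<Longrightarrow> Ck_on n 0 W f \<longleftrightarrow> continuous_on W f"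
  by (simp add: subtopology_Euclidean_space)

declare Ck_on.simps(1) [simp del]

lemma Ck_on_Suc_cont: "W \<subseteq> Eucl n \<Longrightarrow> Ck_on n (Suc k) W f \<longleftrightarrow> continuous_on W f \<and>
     (\<forall>i<n. \<exists>g. (\<forall>x\<in>W. ((\<lambda>t. f (x(i := t))) has_real_derivative g x) (at (x i))) \<and>
                Ck_on n k W g)"
  by (simp add: subtopology_Euclidean_space)

declare Ck_on.simps(2) [simp del]

lemma Ck_on_continuous: "W \<subseteq> Eucl n \<Longrightarrow> Ck_on n k W f \<Longrightarrow> continuous_on W f"
  by (cases k) (auto simp: Ck_on_Suc_cont)

lemma Ck_on_mono: "Ck_on n k W f \<Longrightarrow> V \<subseteq> W \<Longrightarrow> W \<subseteq> Eucl n \<Longrightarrow> Ck_on n k V f"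
proof (induction k arbitrary: f)
  case 0 then show ?case by (auto intro: continuous_on_subset)
next
  case (Suc k)
  then have "V \<subseteq> Eucl n" by auto
  then show ?case using Suc by (simp add: Ck_on_Suc_cont) (meson continuous_on_subset subsetD)
qed

lemma partial_cong:
  assumes "openin (Euclidean_space n) W" "x \<in> W" "i < n" "\<And>x. x \<in> W \<Longrightarrow> f x = g x"
  shows "((\<lambda>t. f (x(i := t))) has_real_derivative D) (at (x i)) \<longleftrightarrow>
         ((\<lambda>t. g (x(i := t))) has_real_derivative D) (at (x i))"
  by (rule DERIV_cong_ev) (use eventually_upd_in[OF assms(1-3)] assms(4) in \<open>auto elim: eventually_mono\<close>)

lemma Ck_on_cong:
  assumes "openin (Euclidean_space n) W" "\<And>x. x \<in> W \<Longrightarrow> f x = g x" "Ck_on n k W f"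
  shows "Ck_on n k W g"
proof (cases k)
  case 0 then show ?thesis using assms openin_Eucl_subset[OF assms(1)] by (auto cong: continuous_on_cong)
next
  case (Suc l)
  note W = openin_Eucl_subset[OF assms(1)]
  have "continuous_on W g" using assms W Ck_on_continuous continuous_on_cong by (metis (full_types))
  moreover have "\<forall>i<n. \<exists>h. (\<forall>x\<in>W. ((\<lambda>t. g (x(i := t))) has_real_derivative h x) (at (x i))) \<and> Ck_on n l W h"
  proof (intro allI impI)
    fix i assume i: "i < n"
    have "\<exists>h. (\<forall>x\<in>W. ((\<lambda>t. f (x(i := t))) has_real_derivative h x) (at (x i))) \<and> Ck_on n l W h"
      using assms(3) i by (simp add: Suc Ck_on_Suc_cont[OF W])
    then obtain h where h: "\<forall>x\<in>W. ((\<lambda>t. f (x(i := t))) has_real_derivative h x) (at (x i))" "Ck_on n l W h"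
      by blast
    have "((\<lambda>t. g (x(i := t))) has_real_derivative h x) (at (x i))" if "x \<in> W" for x
      using partial_cong[where f=f and g=g and D="h x", OF assms(1) that i assms(2)] h(1) that by simp
    then show "\<exists>h. (\<forall>x\<in>W. ((\<lambda>t. g (x(i := t))) has_real_derivative h x) (at (x i))) \<and> Ck_on n l W h"
      using h(2) by blast
  qed
  ultimately show ?thesis using W by (simp add: Suc Ck_on_Suc_cont)
qed

definition pd :: "nat \<Rightarrow> ((nat \<Rightarrow> real) \<Rightarrow> real) \<Rightarrow> (nat \<Rightarrow> real) \<Rightarrow> real" where
  "pd i f x = deriv (\<lambda>t. f (x(i := t))) (x i)"

lemma Ck_on_SucD:
  assumes W: "openin (Euclidean_space n) W" and f: "Ck_on n (Suc k) W f" and i: "i < n"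
  shows "Ck_on n k W (pd i f)"
    and "\<And>x. x \<in> W \<Longrightarrow> ((\<lambda>t. f (x(i := t))) has_real_derivative pd i f x) (at (x i))"
proof -
  have "\<exists>g. (\<forall>x\<in>W. ((\<lambda>t. f (x(i := t))) has_real_derivative g x) (at (x i))) \<and> Ck_on n k W g"
    using f i by (simp add: Ck_on_Suc_cont[OF openin_Eucl_subset[OF W]])
  then obtain g where g: "\<And>x. x \<in> W \<Longrightarrow> ((\<lambda>t. f (x(i := t))) has_real_derivative g x) (at (x i))" "Ck_on n k W g"
    by blast
  have eq: "g x = pd i f x" if "x \<in> W" for x using DERIV_imp_deriv[OF g(1)[OF that]] by (simp add: pd_def)
  show "Ck_on n k W (pd i f)" using Ck_on_cong[OF W eq g(2)] by simp
  show "((\<lambda>t. f (x(i := t))) has_real_derivative pd i f x) (at (x i))" if "x \<in> W" for x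
    using g(1)[OF that] eq[OF that] by simp
qed

lemma Ck_on_SucI:
  assumes W: "openin (Euclidean_space n) W" and "continuous_on W f"
    and "\<And>i x. i < n \<Longrightarrow> x \<in> W \<Longrightarrow> ((\<lambda>t. f (x(i := t))) has_real_derivative g i x) (at (x i))"
    and "\<And>i. i < n \<Longrightarrow> Ck_on n k W (g i)"
  shows "Ck_on n (Suc k) W f"
  using assms openin_Eucl_subset[OF W] by (auto simp: Ck_on_Suc_cont)

lemma Ck_on_pred: "openin (Euclidean_space n) W \<Longrightarrow> Ck_on n (Suc k) W f \<Longrightarrow> Ck_on n k W f"
proof (induction k arbitrary: f)
  case 0 then show ?case using Ck_on_continuous[OF openin_Eucl_subset] openin_Eucl_subset[OF 0(1)] by auto
next
  case (Suc k)
  show ?case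
    by (rule Ck_on_SucI[where g="\<lambda>i. pd i f"])
      (use Suc.IH[OF Suc.prems(1) Ck_on_SucD(1)[OF Suc.prems]] Ck_on_SucD(2)[OF Suc.prems]
         Ck_on_continuous[OF openin_Eucl_subset[OF Suc.prems(1)] Suc.prems(2)] Suc.prems in auto)
qed

lemma continuous_on_coordinate: "continuous_on W (\<lambda>x. x i :: real)"
  by (rule continuous_on_product_coordinates[THEN continuous_on_subset]) auto

lemma Ck_on_const: "openin (Euclidean_space n) W \<Longrightarrow> Ck_on n k W (\<lambda>x. c)"
proof (induction k arbitrary: c)
  case 0 then show ?case using openin_Eucl_subset[OF 0] by simp
next
  case (Suc k) show ?case
    by (rule Ck_on_SucI[where g="\<lambda>i x. 0"]) (use Suc in auto)
qed

lemma Ck_on_coordinate: "openin (Euclidean_space n) W \<Longrightarrow> Ck_on n k W (\<lambda>x. x j)"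
proof (cases k)
  case 0 assume "openin (Euclidean_space n) W" then show ?thesis using openin_Eucl_subset 0 by (simp add: continuous_on_coordinate)
next
  case (Suc l) assume W: "openin (Euclidean_space n) W" show ?thesis unfolding Suc
    by (rule Ck_on_SucI[where g="\<lambda>i x. if i = j then 1 else 0"])
       (use W in \<open>auto simp: Ck_on_const continuous_on_coordinate intro!: derivative_eq_intros\<close>)
qed

lemma Ck_on_add: 
  assumes W: "openin (Euclidean_space n) W"
  shows "Ck_on n k W f \<Longrightarrow> Ck_on n k W g \<Longrightarrow> Ck_on n k W (\<lambda>x. f x + g x)"
proof (induction k arbitrary: f g)
  case 0 then show ?case using openin_Eucl_subset[OF W] by (auto intro: continuous_on_add)
next
  case (Suc k) show ?case
  proof (rule Ck_on_SucI[where g="\<lambda>i x. pd i f x + pd i g x", OF W])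
    show "continuous_on W (\<lambda>x. f x + g x)"
      using Suc.prems by (intro continuous_on_add Ck_on_continuous[OF openin_Eucl_subset[OF W]])
    show "((\<lambda>t. f (x(i := t)) + g (x(i := t))) has_real_derivative pd i f x + pd i g x) (at (x i))"
      if "i < n" "x \<in> W" for i x
      using Suc.prems that by (intro DERIV_add Ck_on_SucD(2)[OF W])
    show "Ck_on n k W (\<lambda>x. pd i f x + pd i g x)" if "i < n" for i
      using Suc.prems that by (intro Suc.IH Ck_on_SucD(1)[OF W])
  qed
qed

lemma Ck_on_mult:
  assumes W: "openin (Euclidean_space n) W"
  shows "Ck_on n k W f \<Longrightarrow> Ck_on n k W g \<Longrightarrow> Ck_on n k W (\<lambda>x. f x * g x)"
proof (induction k arbitrary: f g)
  case 0 then show ?case using openin_Eucl_subset[OF W] by (auto intro: continuous_on_mult)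
next
  case (Suc k) show ?case
  proof (rule Ck_on_SucI[where g="\<lambda>i x. pd i f x * g x + pd i g x * f x", OF W])
    show "continuous_on W (\<lambda>x. f x * g x)"
      using Suc.prems by (intro continuous_on_mult Ck_on_continuous[OF openin_Eucl_subset[OF W]])
    show "((\<lambda>t. f (x(i := t)) * g (x(i := t))) has_real_derivative pd i f x * g x + pd i g x * f x) (at (x i))"
      if "i < n" "x \<in> W" for i x
      using DERIV_mult[where f="\<lambda>t. f (x(i := t))" and g="\<lambda>t. g (x(i := t))", OF Ck_on_SucD(2)[OF W Suc.prems(1) that] Ck_on_SucD(2)[OF W Suc.prems(2) that]] by simp
    show "Ck_on n k W (\<lambda>x. pd i f x * g x + pd i g x * f x)" if "i < n" for i
      using Ck_on_pred[OF W Suc.prems(1)] Ck_on_pred[OF W Suc.prems(2)] Suc.prems that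
      by (intro Ck_on_add[OF W] Suc.IH Ck_on_SucD(1)[OF W])
  qed
qed

lemma Ck_on_sum:
  assumes W: "openin (Euclidean_space n) W"
  shows "finite A \<Longrightarrow> (\<And>a. a \<in> A \<Longrightarrow> Ck_on n k W (f a)) \<Longrightarrow> Ck_on n k W (\<lambda>x. \<Sum>a\<in>A. f a x)"
proof (induction A rule: finite_induct)
  case empty then show ?case by (simp add: Ck_on_const[OF W])
next
  case (insert a A)
  then have "Ck_on n k W (\<lambda>x. f a x + (\<Sum>a\<in>A. f a x))" by (intro Ck_on_add[OF W]) auto
  then show ?case using insert by simp
qed

lemma Ck_on_inverse:
  assumes W: "openin (Euclidean_space n) W" and nz: "\<And>x. x \<in> W \<Longrightarrow> f x \<noteq> 0"
  shows "Ck_on n k W f \<Longrightarrow> Ck_on n k W (\<lambda>x. inverse (f x))"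
proof (induction k)
  case 0 then show ?case using openin_Eucl_subset[OF W] nz by (auto intro: continuous_on_inverse)
next
  case (Suc k) show ?case
  proof (rule Ck_on_SucI[where g="\<lambda>i x. (-1) * (inverse (f x) * (pd i f x * inverse (f x)))", OF W])
    show "continuous_on W (\<lambda>x. inverse (f x))"
      using Suc.prems nz by (intro continuous_on_inverse Ck_on_continuous[OF openin_Eucl_subset[OF W]]) auto
    show "((\<lambda>t. inverse (f (x(i := t)))) has_real_derivative (-1) * (inverse (f x) * (pd i f x * inverse (f x)))) (at (x i))"
      if "i < n" "x \<in> W" for i x
    proof -
      have "f (x(i := x i)) \<noteq> 0" using nz that by simp
      from DERIV_inverse'[where f="\<lambda>t. f (x(i := t))", OF Ck_on_SucD(2)[OF W Suc.prems that] this]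
      show ?thesis by (rule DERIV_cong) simp
    qed
    show "Ck_on n k W (\<lambda>x. (-1) * (inverse (f x) * (pd i f x * inverse (f x))))" if "i < n" for i
    proof -
      have inv: "Ck_on n k W (\<lambda>x. inverse (f x))" using Suc Ck_on_pred[OF W] by blast
      show ?thesis
        by (rule Ck_on_mult[OF W Ck_on_const[OF W] Ck_on_mult[OF W inv Ck_on_mult[OF W Ck_on_SucD(1)[OF W Suc.prems that] inv]]])
    qed
  qed
qed

text \<open>
  The mean value inequality along the coordinate directions, changing one coordinate at a time. That
  both points vary makes the estimate strong enough for injectivity and for derivatives of
  inverse maps.
\<close>

lemma C1_increment:
  assumes W: "openin (Euclidean_space n) W" and f: "Ck_on n 1 W f" and y: "y \<in> W" and e: "e > 0"
  shows "\<exists>d>0. open_cube n y d \<subseteq> W \<and> (\<forall>z\<in>open_cube n y d. \<forall>z'\<in>open_cube n y d. 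
       \<bar>f z - f z' - (\<Sum>i<n. pd i f y * (z i - z' i))\<bar> \<le> e * (\<Sum>i<n. \<bar>z i - z' i\<bar>))"
proof -
  have f': "Ck_on n (Suc 0) W f" using f by simp
  have cont: "continuous_on W (pd i f)" if "i < n" for i
    using Ck_on_SucD(1)[OF W f' that] Ck_on_continuous[OF openin_Eucl_subset[OF W]] by simp
  define V where "V = W \<inter> (\<Inter>i<n. {x \<in> W. pd i f x \<in> ball (pd i f y) e})"
  have "openin (Euclidean_space n) {x \<in> W. pd i f x \<in> ball (pd i f y) e}" if "i < n" for i
  proof -
    have "openin (top_of_set W) {x \<in> W. pd i f x \<in> ball (pd i f y) e}"
      using continuous_openin_preimage_gen[OF cont[OF that], of "ball (pd i f y) e"] by (simp add: vimage_def Int_def)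
    then show ?thesis
      using openin_open_subtopology[OF W] subtopology_Euclidean_space[OF openin_Eucl_subset[OF W]] by simp
  qed
  then have V: "openin (Euclidean_space n) V"
    unfolding V_def using W by (cases "n = 0") (auto intro!: openin_Int openin_Inter)
  have "y \<in> V" using y e by (auto simp: V_def)
  then obtain d where d: "d > 0" "open_cube n y d \<subseteq> V" using open_cube_subset V by blast
  show ?thesis
  proof (intro exI[of _ d] conjI ballI)
    show "d > 0" "open_cube n y d \<subseteq> W" using d by (auto simp: V_def)
    fix z z' assume z: "z \<in> open_cube n y d" "z' \<in> open_cube n y d"
    \<comment> \<open>a path from \<open>z'\<close> to \<open>z\<close> parallel to the axes\<close>
    define w where "w m = (\<lambda>i. if i < m then z i else z' i)" for m
    have E: "z \<in> Eucl n" "z' \<in> Eucl n" using z by (auto simp: open_cube_def)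
    have "w n = z" using E by (auto simp: w_def Eucl_def fun_eq_iff)
    have "w 0 = z'" by (simp add: w_def)
    have step: "\<bar>f (w (Suc m)) - f (w m) - pd m f y * (z m - z' m)\<bar> \<le> e * \<bar>z m - z' m\<bar>" if m: "m < n" for m
    proof -
      have cube: "(w m)(m := t) \<in> open_cube n y d" if "t \<in> ball (y m) d" for t
        using z that m by (auto simp: open_cube_def w_def Eucl_def dist_real_def)
      have bd: "pd m f ((w m)(m := t)) \<in> ball (pd m f y) e" and inW: "(w m)(m := t) \<in> W" if "t \<in> ball (y m) d" for t
        using cube[OF that] d(2) m by (auto simp: V_def)
      have "norm ((f ((w m)(m := z m)) - pd m f y * z m) - (f ((w m)(m := z' m)) - pd m f y * z' m)) \<le> e * norm (z m - z' m)"
      proof (rule field_differentiable_bound[where S="ball (y m) d" and f'="\<lambda>t. pd m f ((w m)(m := t)) - pd m f y"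
              and f="\<lambda>t. f ((w m)(m := t)) - pd m f y * t"])
        fix t assume t: "t \<in> ball (y m) d"
        have "((\<lambda>s. f ((w m)(m := s))) has_real_derivative pd m f ((w m)(m := t))) (at t)"
          using Ck_on_SucD(2)[OF W f' m inW[OF t]] by simp
        then have "((\<lambda>t. f ((w m)(m := t)) - pd m f y * t) has_real_derivative pd m f ((w m)(m := t)) - pd m f y * 1) (at t)"
          by (intro DERIV_diff DERIV_cmult DERIV_ident)
        then show "((\<lambda>t. f ((w m)(m := t)) - pd m f y * t) has_real_derivative pd m f ((w m)(m := t)) - pd m f y) (at t within ball (y m) d)"
          by (simp add: has_field_derivative_at_within)
        show "norm (pd m f ((w m)(m := t)) - pd m f y) \<le> e" using bd[OF t] by (simp add: dist_real_def)
      qed (use z m in \<open>auto simp: open_cube_def dist_real_def\<close>)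
      moreover have "(w m)(m := z m) = w (Suc m)" "(w m)(m := z' m) = w m"
        by (auto simp: w_def fun_eq_iff less_Suc_eq)
      ultimately show ?thesis by (simp add: algebra_simps)
    qed
    have "f z - f z' = (\<Sum>m<n. f (w (Suc m)) - f (w m))"
      using \<open>w n = z\<close> \<open>w 0 = z'\<close> sum_lessThan_telescope[of "\<lambda>m. f (w m)" n] by simp
    then have "f z - f z' - (\<Sum>i<n. pd i f y * (z i - z' i)) = (\<Sum>m<n. f (w (Suc m)) - f (w m) - pd m f y * (z m - z' m))"
      by (simp only: sum_subtractf)
    also have "\<bar>\<dots>\<bar> \<le> (\<Sum>m<n. e * \<bar>z m - z' m\<bar>)"
      by (rule order_trans[OF sum_abs]) (use step in \<open>auto intro!: sum_mono\<close>)
    finally show "\<bar>f z - f z' - (\<Sum>i<n. pd i f y * (z i - z' i))\<bar> \<le> e * (\<Sum>i<n. \<bar>z i - z' i\<bar>)"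
      by (simp add: sum_distrib_left)
  qed
qed

lemma Ck_on_le: 
  assumes "openin (Euclidean_space n) W" "Ck_on n k W f" "l \<le> k"
  shows "Ck_on n l W f"
  using assms(3,2) by (induction l rule: inc_induct) (auto intro: Ck_on_pred[OF assms(1)])

lemma line_tendsto:
  fixes f :: "(nat \<Rightarrow> real) \<Rightarrow> real"
  assumes W: "openin (Euclidean_space n) W" and f: "continuous_on W f" and x: "x \<in> W" "i < n"
  shows "((\<lambda>t. f (x(i := t))) \<longlongrightarrow> f x) (at (x i))"
proof -
  have "continuous_on UNIV (\<lambda>t. x(i := t))"
  proof (rule continuous_on_coordinatewise_then_product)
    fix j show "continuous_on UNIV (\<lambda>t. (x(i := t)) j)" by (cases "j = i") (auto intro: continuous_on_id)
  qed
  then have "isCont (\<lambda>t. x(i := t)) (x i)" by (simp add: continuous_on_eq_continuous_at)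
  then have lim: "((\<lambda>t. x(i := t)) \<longlongrightarrow> x) (at (x i))" by (simp add: isCont_def)
  have "\<forall>\<^sub>F t in at (x i). x(i := t) \<in> W"
    using eventually_upd_in[OF W x] by (simp add: eventually_nhds_conv_at)
  from continuous_on_tendsto_compose[OF f lim x(1) this] show ?thesis .
qed

lemma small_remainder_quotient:
  fixes r q :: "real \<Rightarrow> real"
  assumes r: "\<And>e. e > 0 \<Longrightarrow> \<forall>\<^sub>F t in at s. \<bar>r t\<bar> \<le> e * q t"
    and q: "\<forall>\<^sub>F t in at s. q t \<le> M * \<bar>t - s\<bar>"
  shows "((\<lambda>t. r t / (t - s)) \<longlongrightarrow> 0) (at s)"
proof (rule tendstoI)
  fix e :: real assume e: "e > 0"
  define e' where "e' = e / (\<bar>M\<bar> + 1)"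
  have e': "e' > 0" "e' * \<bar>M\<bar> < e" using e by (auto simp: e'_def field_simps)
  have "\<forall>\<^sub>F t in at s. t \<noteq> s" by (simp add: eventually_at_filter)
  with r[OF e'(1)] q show "\<forall>\<^sub>F t in at s. dist (r t / (t - s)) 0 < e"
  proof eventually_elim
    case (elim t)
    have "\<bar>r t\<bar> \<le> e' * (M * \<bar>t - s\<bar>)" using elim e' by (meson mult_left_mono order_trans less_imp_le)
    also have "\<dots> \<le> (e' * \<bar>M\<bar>) * \<bar>t - s\<bar>" using e' by (simp add: mult_right_mono)
    also have "\<dots> < e * \<bar>t - s\<bar>" using e' elim by (intro mult_strict_right_mono) auto
    finally show ?case using elim by (simp add: dist_real_def divide_less_eq)
  qed
qed

text \<open>
  The error term of \<open>C1_increment\<close> at \<open>F x\<close> is small compared to the increments of the components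
  of \<open>F\<close>, which are bounded by multiples of \<open>t - x i\<close>.
\<close>

lemma partial_compose:
  assumes W: "openin (Euclidean_space n) W" and W': "openin (Euclidean_space n) W'"
    and F: "\<And>x. x \<in> W \<Longrightarrow> F x \<in> W'" and f: "Ck_on n 1 W' f"
    and D: "\<And>j. j < n \<Longrightarrow> ((\<lambda>t. F (x(i := t)) j) has_real_derivative D j) (at (x i))"
    and x: "x \<in> W" "i < n"
  shows "((\<lambda>t. f (F (x(i := t)))) has_real_derivative (\<Sum>j<n. pd j f (F x) * D j)) (at (x i))"
proof -
  define s where "s = x i"
  define y where "y = F x"
  define H where "H t = F (x(i := t))" for t
  have Hs: "H s = y" by (simp add: H_def s_def y_def)
  have y: "y \<in> W'" using F x by (simp add: y_def)
  define r where "r t = f (H t) - f y - (\<Sum>j<n. pd j f y * (H t j - y j))" for t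
  define q where "q t = (\<Sum>j<n. \<bar>H t j - y j\<bar>)" for t
  have D': "((\<lambda>t. (H t j - y j) / (t - s)) \<longlongrightarrow> D j) (at s)" if "j < n" for j
    using D[OF that] by (simp add: has_field_derivative_iff H_def s_def y_def)
  have Hlim: "((\<lambda>t. H t j) \<longlongrightarrow> y j) (at s)" if "j < n" for j
    using DERIV_isCont[OF D[OF that]] by (simp add: isCont_def H_def s_def y_def)
  have HW: "\<forall>\<^sub>F t in at s. H t \<in> W'"
  proof -
    have "\<forall>\<^sub>F t in at s. x(i := t) \<in> W"
      using eventually_upd_in[OF W x] unfolding s_def eventually_nhds_conv_at by (rule conjunct1)
    then show ?thesis unfolding H_def by (rule eventually_mono) (rule F)
  qed
  have r: "\<forall>\<^sub>F t in at s. \<bar>r t\<bar> \<le> e * q t" if e: "e > 0" for e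
  proof -
    obtain d where d: "d > 0" "\<forall>z\<in>open_cube n y d. \<forall>z'\<in>open_cube n y d. 
       \<bar>f z - f z' - (\<Sum>i<n. pd i f y * (z i - z' i))\<bar> \<le> e * (\<Sum>i<n. \<bar>z i - z' i\<bar>)"
      using C1_increment[OF W' f y e] by blast
    have "\<forall>\<^sub>F t in at s. \<forall>j\<in>{..<n}. \<bar>H t j - y j\<bar> < d"
      using Hlim d(1) by (intro eventually_ball_finite) (auto simp: tendsto_iff dist_real_def)
    with HW show ?thesis
    proof eventually_elim
      case (elim t)
      then have "H t \<in> open_cube n y d" "y \<in> open_cube n y d"
        using openin_Eucl_subset[OF W'] y d(1) by (auto simp: open_cube_def)
      with d(2) show ?case by (simp add: r_def q_def)
    qed
  qed
  have "((\<lambda>t. \<Sum>j<n. \<bar>(H t j - y j) / (t - s)\<bar>) \<longlongrightarrow> (\<Sum>j<n. \<bar>D j\<bar>)) (at s)"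
    using D' by (intro tendsto_sum tendsto_rabs) auto
  then have "\<forall>\<^sub>F t in at s. (\<Sum>j<n. \<bar>(H t j - y j) / (t - s)\<bar>) < (\<Sum>j<n. \<bar>D j\<bar>) + 1"
    by (rule order_tendstoD) simp
  moreover have "\<forall>\<^sub>F t in at s. t \<noteq> s" by (simp add: eventually_at_filter)
  ultimately have "\<forall>\<^sub>F t in at s. q t \<le> ((\<Sum>j<n. \<bar>D j\<bar>) + 1) * \<bar>t - s\<bar>"
  proof eventually_elim
    case (elim t)
    then have "q t / \<bar>t - s\<bar> < (\<Sum>j<n. \<bar>D j\<bar>) + 1"
      by (simp add: q_def abs_divide sum_divide_distrib)
    then show ?case using elim by (simp add: divide_less_eq)
  qed
  from small_remainder_quotient[OF r this] have "((\<lambda>t. r t / (t - s)) \<longlongrightarrow> 0) (at s)" .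
  moreover have "((\<lambda>t. \<Sum>j<n. pd j f y * ((H t j - y j) / (t - s))) \<longlongrightarrow> (\<Sum>j<n. pd j f y * D j)) (at s)"
    using D' by (intro tendsto_sum tendsto_mult tendsto_const) auto
  ultimately have "((\<lambda>t. r t / (t - s) + (\<Sum>j<n. pd j f y * ((H t j - y j) / (t - s)))) \<longlongrightarrow> 0 + (\<Sum>j<n. pd j f y * D j)) (at s)"
    by (rule tendsto_add)
  moreover have "r t / (t - s) + (\<Sum>j<n. pd j f y * ((H t j - y j) / (t - s))) = (f (H t) - f (H s)) / (t - s)" for t
  proof -
    have "(\<Sum>j<n. pd j f y * ((H t j - y j) / (t - s))) = (\<Sum>j<n. pd j f y * (H t j - y j)) / (t - s)"
      by (simp add: sum_divide_distrib)
    then show ?thesis by (simp add: r_def Hs add_divide_distrib[symmetric])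
  qed
  ultimately have "((\<lambda>t. (f (H t) - f (H s)) / (t - s)) \<longlongrightarrow> (\<Sum>j<n. pd j f y * D j)) (at s)" by simp
  then have "((\<lambda>t. f (H t)) has_real_derivative (\<Sum>j<n. pd j f y * D j)) (at s)"
    by (simp add: has_field_derivative_iff)
  then show ?thesis by (simp add: H_def s_def y_def)
qed

text \<open>
  By the chain rule the partial derivatives of a composite are sums of products of functions to
  which the induction hypothesis applies.
\<close>

lemma Ck_on_compose:
  assumes W: "openin (Euclidean_space n) W" and W': "openin (Euclidean_space n) W'"
    and F: "\<And>x. x \<in> W \<Longrightarrow> F x \<in> W'"
  shows "(\<And>j. j < n \<Longrightarrow> Ck_on n k W (\<lambda>x. F x j)) \<Longrightarrow> Ck_on n k W' f \<Longrightarrow> Ck_on n k W (\<lambda>x. f (F x))"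
proof (induction k arbitrary: f)
  case 0
  have "continuous_on W F"
  proof (rule continuous_on_coordinatewise_then_product)
    fix j show "continuous_on W (\<lambda>x. F x j)"
    proof (cases "j < n")
      case True then show ?thesis using 0(1)[OF True] openin_Eucl_subset[OF W] by simp
    next
      case False
      then have "F x j = 0" if "x \<in> W" for x using F[OF that] openin_Eucl_subset[OF W'] by (auto simp: Eucl_def)
      then show ?thesis by (simp cong: continuous_on_cong)
    qed
  qed
  then show ?case using 0 F openin_Eucl_subset[OF W] openin_Eucl_subset[OF W']
    by (auto intro: continuous_on_compose2[of W' f W F])
next
  case (Suc k)
  have Fk: "Ck_on n k W (\<lambda>x. F x j)" if "j < n" for j using Ck_on_pred[OF W Suc.prems(1)[OF that]] .
  have "Ck_on n k W (\<lambda>x. f (F x))" using Suc.IH[OF Fk Ck_on_pred[OF W' Suc.prems(2)]] .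
  then have cont: "continuous_on W (\<lambda>x. f (F x))" using Ck_on_continuous[OF openin_Eucl_subset[OF W]] by blast
  show ?case
  proof (rule Ck_on_SucI[OF W cont, where g="\<lambda>i x. \<Sum>j<n. pd j f (F x) * pd i (\<lambda>x. F x j) x"])
    fix i x assume i: "i < n" "x \<in> W"
    have "Ck_on n 1 W' f" using Ck_on_le[OF W' Suc.prems(2)] by simp
    from partial_compose[where x=x and i=i and F=F and f=f and D="\<lambda>j. pd i (\<lambda>x. F x j) x", OF W W' F this Ck_on_SucD(2)[OF W Suc.prems(1) i] i(2,1)]
    show "((\<lambda>t. f (F (x(i := t)))) has_real_derivative (\<Sum>j<n. pd j f (F x) * pd i (\<lambda>x. F x j) x)) (at (x i))" .
  next
    fix i assume i: "i < n"
    show "Ck_on n k W (\<lambda>x. \<Sum>j<n. pd j f (F x) * pd i (\<lambda>x. F x j) x)"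
    proof (rule Ck_on_sum[OF W])
      fix j assume "j \<in> {..<n}" then have j: "j < n" by simp
      show "Ck_on n k W (\<lambda>x. pd j f (F x) * pd i (\<lambda>x. F x j) x)"
        by (rule Ck_on_mult[OF W Suc.IH[OF Fk Ck_on_SucD(1)[OF W' Suc.prems(2) j]] Ck_on_SucD(1)[OF W Suc.prems(1)[OF j] i]])
    qed simp
  qed
qed

text \<open>
  The error is small compared to the increments of both variables. As \<open>b \<noteq> 0\<close>, it first bounds the
  increment of \<open>u\<close> by that of \<open>t\<close>, and is therefore small compared to the latter alone.
\<close>

lemma implicit_derivative:
  fixes u :: "real \<Rightarrow> real"
  assumes b: "b \<noteq> 0"
    and r: "\<And>e. e > 0 \<Longrightarrow> \<forall>\<^sub>F t in at s. \<bar>a * (t - s) - b * (u t - u s)\<bar> \<le> e * (\<bar>t - s\<bar> + \<bar>u t - u s\<bar>)"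
  shows "(u has_real_derivative a / b) (at s)"
proof -
  have "\<forall>\<^sub>F t in at s. \<bar>t - s\<bar> + \<bar>u t - u s\<bar> \<le> (2 * \<bar>a\<bar> / \<bar>b\<bar> + 2) * \<bar>t - s\<bar>"
  proof (rule eventually_mono[OF r[of "\<bar>b\<bar> / 2"]])
    fix t assume "\<bar>a * (t - s) - b * (u t - u s)\<bar> \<le> \<bar>b\<bar> / 2 * (\<bar>t - s\<bar> + \<bar>u t - u s\<bar>)"
    moreover have "\<bar>b\<bar> * \<bar>u t - u s\<bar> \<le> \<bar>a * (t - s) - b * (u t - u s)\<bar> + \<bar>a\<bar> * \<bar>t - s\<bar>"
      by (simp add: abs_mult[symmetric])
    ultimately have "\<bar>b\<bar> * \<bar>u t - u s\<bar> \<le> (2 * \<bar>a\<bar> + \<bar>b\<bar>) * \<bar>t - s\<bar>"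
      by (simp add: algebra_simps)
    then show "\<bar>t - s\<bar> + \<bar>u t - u s\<bar> \<le> (2 * \<bar>a\<bar> / \<bar>b\<bar> + 2) * \<bar>t - s\<bar>"
      using b by (simp add: field_simps)
  qed (use b in simp)
  from small_remainder_quotient[OF r this]
  have "((\<lambda>t. (a * (t - s) - b * (u t - u s)) / (t - s)) \<longlongrightarrow> 0) (at s)" .
  then have "((\<lambda>t. a / b - ((a * (t - s) - b * (u t - u s)) / (t - s)) / b) \<longlongrightarrow> a / b - 0 / b) (at s)"
    using b by (intro tendsto_intros)
  moreover have "\<forall>\<^sub>F t in at s. a / b - ((a * (t - s) - b * (u t - u s)) / (t - s)) / b = (u t - u s) / (t - s)"
  proof -
    have "a / b - ((a * (t - s) - b * (u t - u s)) / (t - s)) / b = (u t - u s) / (t - s)" if "t \<noteq> s" for t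
    proof -
      have "(a * (t - s) - b * (u t - u s)) / (t - s) = a - b * ((u t - u s) / (t - s))"
        using that diff_divide_distrib[of "a * (t - s)" "b * (u t - u s)" "t - s"] by simp
      then show ?thesis using b by (simp add: diff_divide_distrib)
    qed
    then show ?thesis by (simp add: eventually_at_filter)
  qed
  ultimately have "((\<lambda>t. (u t - u s) / (t - s)) \<longlongrightarrow> a / b) (at s)"
    using tendsto_cong by fastforce
  then show ?thesis by (simp add: has_field_derivative_iff)
qed

text \<open>
  The inverse function theorem for the change of a single coordinate. Only one real variable has to
  be solved for: \<open>C1_increment\<close> gives injectivity, invariance of domain gives openness of the image,
  and the derivatives of the solution are rational expressions in those of \<open>h\<close> composed with the
  inverse, whence smoothness by induction.
\<close>

lemma coordinate_replacement:
  assumes W: "openin (Euclidean_space n) W" and p: "p \<in> W" and m: "m < n"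
    and h: "\<And>k. Ck_on n k W h" and nz: "pd m h p \<noteq> 0"
  obtains N u where "openin (Euclidean_space n) N" "p \<in> N" "N \<subseteq> W"
    "openin (Euclidean_space n) ((\<lambda>x. x(m := h x)) ` N)"
    "\<And>k. Ck_on n k ((\<lambda>x. x(m := h x)) ` N) u" "\<And>x. x \<in> N \<Longrightarrow> u (x(m := h x)) = x m"
proof -
  note WE = openin_Eucl_subset[OF W]
  define V where "V = {x \<in> W. pd m h x \<noteq> 0}"
  have "continuous_on W (pd m h)" using Ck_on_SucD(1)[OF W h m] Ck_on_continuous[OF WE] by blast
  then have "openin (top_of_set W) V"
    using continuous_openin_preimage_gen[of W "pd m h" "- {0}"] by (simp add: V_def vimage_def Int_def open_Compl)
  then have V: "openin (Euclidean_space n) V"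
    using openin_open_subtopology[OF W] subtopology_Euclidean_space[OF WE] by simp
  have VW: "V \<subseteq> W" by (auto simp: V_def)
  have hV: "Ck_on n k V h" for k by (rule Ck_on_mono[OF h VW WE])
  have pV: "p \<in> V" and pos: "\<bar>pd m h p\<bar> / 2 > 0" using nz p by (auto simp: V_def)
  obtain d where d: "d > 0" "open_cube n p d \<subseteq> V" and
    inc: "\<forall>z\<in>open_cube n p d. \<forall>z'\<in>open_cube n p d. 
       \<bar>h z - h z' - (\<Sum>i<n. pd i h p * (z i - z' i))\<bar> \<le> \<bar>pd m h p\<bar> / 2 * (\<Sum>i<n. \<bar>z i - z' i\<bar>)"
    using C1_increment[OF V hV pV pos] by blast
  define N where "N = open_cube n p d"
  define T where "T x = x(m := h x)" for x :: "nat \<Rightarrow> real"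
  have N: "openin (Euclidean_space n) N" unfolding N_def by (rule openin_open_cube)
  note NE = openin_Eucl_subset[OF N]
  have pN: "p \<in> N" using p WE d by (auto simp: N_def open_cube_def)
  have NV: "N \<subseteq> V" using d by (simp add: N_def)
  have hN: "Ck_on n k N h" for k by (rule Ck_on_mono[OF hV NV openin_Eucl_subset[OF V]])
  have inj: "inj_on T N"
  proof (rule inj_onI)
    fix x x' assume x: "x \<in> N" "x' \<in> N" "T x = T x'"
    have off: "x i = x' i" if "i \<noteq> m" for i using fun_cong[OF x(3), of i] that by (simp add: T_def)
    have "h x = h x'" using fun_cong[OF x(3), of m] by (simp add: T_def)
    moreover have "(\<Sum>i<n. pd i h p * (x i - x' i)) = (\<Sum>i<n. if i = m then pd m h p * (x m - x' m) else 0)"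
      using off by (intro sum.cong) auto
    moreover have "(\<Sum>i<n. \<bar>x i - x' i\<bar>) = (\<Sum>i<n. if i = m then \<bar>x m - x' m\<bar> else 0)"
      using off by (intro sum.cong) auto
    ultimately have "\<bar>pd m h p * (x m - x' m)\<bar> \<le> \<bar>pd m h p\<bar> / 2 * \<bar>x m - x' m\<bar>"
      using inc[rule_format, OF x(1,2)[unfolded N_def]] m by simp
    then have "\<bar>pd m h p\<bar> * \<bar>x m - x' m\<bar> \<le> 0" by (simp add: abs_mult)
    then have "x m = x' m" using nz by (simp add: mult_le_0_iff)
    then show "x = x'" using off by (metis ext)
  qed
  have contT: "continuous_on N T"
  proof (rule continuous_on_coordinatewise_then_product)
    fix j show "continuous_on N (\<lambda>x. T x j)"
      using Ck_on_continuous[OF NE hN[of 0]] continuous_on_coordinate by (cases "j = m") (auto simp: T_def)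
  qed
  have TE: "T ` N \<subseteq> Eucl n" using NE m by (auto simp: T_def Eucl_upd)
  have cm: "continuous_map (subtopology (Euclidean_space n) N) (Euclidean_space n) T"
    using contT TE NE by (simp add: cm_Euclidean_space_iff_continuous_on inf_absorb2 image_subset_iff Pi_iff)
  have TN: "openin (Euclidean_space n) (T ` N)" by (rule invariance_of_domain_Euclidean_space[OF N cm inj])
  have "homeomorphic_map (top_of_set N) (top_of_set (T ` N)) T"
    using invariance_of_domain_Euclidean_space_embedding_map[OF N cm inj]
    by (simp add: embedding_map_def subtopology_Euclidean_space[OF NE] subtopology_Euclidean_space[OF TE])
  then obtain S where S: "homeomorphic_maps (top_of_set N) (top_of_set (T ` N)) T S"
    using homeomorphic_map_maps by blast
  then have ST: "\<And>x. x \<in> N \<Longrightarrow> S (T x) = x" and contS: "continuous_on (T ` N) S"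
    by (auto simp: homeomorphic_maps_def)
  define u where "u w = S w m" for w
  have uT: "u (T x) = x m" if "x \<in> N" for x using ST[OF that] by (simp add: u_def)
  have S_upd: "S w = w(m := u w)" if "w \<in> T ` N" for w
    using that by (auto simp: ST uT) (simp add: T_def)
  have contu: "continuous_on (T ` N) u"
    unfolding u_def by (rule continuous_on_product_then_coordinatewise[OF contS])
  have deriv: "((\<lambda>t. u (w(i := t))) has_real_derivative (if i = m then 1 else - pd i h (S w)) / pd m h (S w)) (at (w i))"
    if w: "w \<in> T ` N" and i: "i < n" for w i
  proof (rule implicit_derivative)
    define x where "x = S w"
    have x: "x \<in> N" "T x = w" using w ST by (auto simp: x_def)
    show "pd m h (S w) \<noteq> 0" using x NV by (auto simp: V_def x_def[symmetric])
    fix e :: real assume e: "e > 0"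
    obtain d' where d': "d' > 0" "\<forall>z\<in>open_cube n x d'. \<forall>z'\<in>open_cube n x d'. 
       \<bar>h z - h z' - (\<Sum>i<n. pd i h x * (z i - z' i))\<bar> \<le> e * (\<Sum>i<n. \<bar>z i - z' i\<bar>)"
      using C1_increment[OF N hN x(1) e] by blast
    have ev1: "\<forall>\<^sub>F t in at (w i). w(i := t) \<in> T ` N"
      using eventually_upd_in[OF TN w i] by (simp add: eventually_nhds_conv_at)
    have ev2: "\<forall>\<^sub>F t in at (w i). \<bar>u (w(i := t)) - u w\<bar> < d'"
      using tendstoD[OF line_tendsto[OF TN contu w i] d'(1)] by (simp add: dist_real_def)
    have ev3: "\<forall>\<^sub>F t in at (w i). \<bar>t - w i\<bar> < d'"
      using tendstoD[OF tendsto_ident_at[of "w i" UNIV] d'(1)] by (simp add: dist_real_def)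
    show "\<forall>\<^sub>F t in at (w i). \<bar>(if i = m then 1 else - pd i h (S w)) * (t - w i) - pd m h (S w) * (u (w(i := t)) - u (w(i := w i)))\<bar>
            \<le> e * (\<bar>t - w i\<bar> + \<bar>u (w(i := t)) - u (w(i := w i))\<bar>)"
      using ev1 ev2 ev3
    proof eventually_elim
      case (elim t)
      define y where "y = S (w(i := t))"
      have y: "y \<in> N" "T y = w(i := t)" using elim(1) ST by (auto simp: y_def)
      have hx: "h x = w m" using fun_cong[OF x(2), of m] by (simp add: T_def)
      have hy: "h y = (w(i := t)) m" using fun_cong[OF y(2), of m] by (simp add: T_def)
      have diff: "y j - x j = (if j = i then (if i = m then 0 else t - w i) else 0) + (if j = m then u (w(i := t)) - u w else 0)" for j
        using S_upd[OF w] S_upd[OF elim(1)] by (auto simp: x_def y_def)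
      have "\<bar>y j - x j\<bar> < d'" for j using elim d'(1) by (auto simp: diff)
      then have "y \<in> open_cube n x d'" "x \<in> open_cube n x d'"
        using y(1) x(1) NE d'(1) by (auto simp: open_cube_def)
      from d'(2)[rule_format, OF this]
      have bd: "\<bar>h y - h x - (\<Sum>j<n. pd j h x * (y j - x j))\<bar> \<le> e * (\<Sum>j<n. \<bar>y j - x j\<bar>)" .
      have s1: "(\<Sum>j<n. pd j h x * (y j - x j)) = pd i h x * (if i = m then 0 else t - w i) + pd m h x * (u (w(i := t)) - u w)"
        using i m by (simp add: diff distrib_left sum.distrib if_distrib[of "\<lambda>z. _ * z"] cong: if_cong)
      have "(\<Sum>j<n. \<bar>y j - x j\<bar>) \<le> (\<Sum>j<n. (if j = i then \<bar>t - w i\<bar> else 0) + (if j = m then \<bar>u (w(i := t)) - u w\<bar> else 0))"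
        by (intro sum_mono) (auto simp: diff)
      also have "\<dots> = \<bar>t - w i\<bar> + \<bar>u (w(i := t)) - u w\<bar>" using i m by (simp add: sum.distrib)
      finally have s2: "e * (\<Sum>j<n. \<bar>y j - x j\<bar>) \<le> e * (\<bar>t - w i\<bar> + \<bar>u (w(i := t)) - u w\<bar>)"
        using e by simp
      have "h y - h x - (\<Sum>j<n. pd j h x * (y j - x j)) = (if i = m then 1 else - pd i h (S w)) * (t - w i) - pd m h (S w) * (u (w(i := t)) - u w)"
        unfolding s1 hx hy by (auto simp: x_def)
      then show ?case using bd s2 by simp
    qed
  qed
  have smooth: "Ck_on n k (T ` N) u" for k
  proof (induction k)
    case 0 then show ?case using contu TE by simp
  next
    case (Suc k)
    have Sk: "Ck_on n k (T ` N) (\<lambda>w. S w j)" if "j < n" for j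
    proof -
      have "Ck_on n k (T ` N) (\<lambda>w. if j = m then u w else w j)"
        using Suc Ck_on_coordinate[OF TN] by (cases "j = m") auto
      then show ?thesis by (rule Ck_on_cong[OF TN, rotated]) (auto simp: S_upd)
    qed
    have SN: "S w \<in> N" if "w \<in> T ` N" for w using that ST by auto
    have comp: "Ck_on n k (T ` N) (\<lambda>w. f (S w))" if "Ck_on n k N f" for f
      by (rule Ck_on_compose[OF TN N SN Sk that])
    have nzS: "pd m h (S w) \<noteq> 0" if "w \<in> T ` N" for w using SN[OF that] NV by (auto simp: V_def)
    show ?case
    proof (rule Ck_on_SucI[OF TN contu, where g="\<lambda>i w. (if i = m then 1 else - pd i h (S w)) * inverse (pd m h (S w))"])
      show "((\<lambda>t. u (w(i := t))) has_real_derivative (if i = m then 1 else - pd i h (S w)) * inverse (pd m h (S w))) (at (w i))"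
        if "i < n" "w \<in> T ` N" for i w using deriv[OF that(2,1)] by (simp add: divide_inverse)
      fix i assume i: "i < n"
      have inv: "Ck_on n k (T ` N) (\<lambda>w. inverse (pd m h (S w)))"
        by (rule Ck_on_inverse[OF TN nzS comp[OF Ck_on_SucD(1)[OF N hN m]]])
      have "Ck_on n k (T ` N) (\<lambda>w. (-1) * pd i h (S w))"
        by (rule Ck_on_mult[OF TN Ck_on_const[OF TN] comp[OF Ck_on_SucD(1)[OF N hN i]]])
      then have "Ck_on n k (T ` N) (\<lambda>w. if i = m then 1 else - pd i h (S w))"
        using Ck_on_const[OF TN] by (cases "i = m") auto
      from Ck_on_mult[OF TN this inv]
      show "Ck_on n k (T ` N) (\<lambda>w. (if i = m then 1 else - pd i h (S w)) * inverse (pd m h (S w)))" .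
    qed
  qed
  show thesis
    using that[of N u] N pN NV VW TN smooth uT by (auto simp: T_def)
qed

section \<open>Charts\<close>

lemma smooth_in_charts_iff:
  "smooth_in_charts n f (U, \<phi>) (V, \<psi>) \<longleftrightarrow>
     (\<forall>j k. Ck_on n k (\<phi> ` {x \<in> U. f x \<in> V}) (\<lambda>y. \<psi> (f (inv_into U \<phi> y)) j))"
  by (simp add: smooth_in_charts_def smooth_map_on_def)

lemma topological_chartD:
  assumes "topological_chart M (U, \<phi>)"
  shows "openin (mtop M) U" "openin (Euclidean_space (mdim M)) (\<phi> ` U)"
    "homeomorphic_map (subtopology (mtop M) U) (subtopology (Euclidean_space (mdim M)) (\<phi> ` U)) \<phi>"
    "inj_on \<phi> U" "\<phi> ` U \<subseteq> Eucl (mdim M)"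
    "continuous_map (subtopology (mtop M) U) (Euclidean_space (mdim M)) \<phi>"
proof -
  show 1: "openin (mtop M) U" "openin (Euclidean_space (mdim M)) (\<phi> ` U)"
    and 2: "homeomorphic_map (subtopology (mtop M) U) (subtopology (Euclidean_space (mdim M)) (\<phi> ` U)) \<phi>"
    using assms by (auto simp: topological_chart_def)
  have "topspace (mtop M) \<inter> U = U" using openin_subset[OF 1(1)] by auto
  then show "inj_on \<phi> U" using homeomorphic_imp_injective_map[OF 2] by simp
  show "\<phi> ` U \<subseteq> Eucl (mdim M)" using openin_Eucl_subset[OF 1(2)] .
  show "continuous_map (subtopology (mtop M) U) (Euclidean_space (mdim M)) \<phi>"
    using homeomorphic_imp_continuous_map[OF 2] continuous_map_in_subtopology by blast
qed

lemma topological_chart_open_image: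
  assumes "topological_chart M (U, \<phi>)" "openin (mtop M) U'" "U' \<subseteq> U"
  shows "openin (Euclidean_space (mdim M)) (\<phi> ` U')"
proof -
  note c = topological_chartD[OF assms(1)]
  have "openin (subtopology (mtop M) U) U'" using assms c(1) by (simp add: openin_open_subtopology)
  then have "openin (subtopology (Euclidean_space (mdim M)) (\<phi> ` U)) (\<phi> ` U')"
    using homeomorphic_imp_open_map[OF c(3)] by (simp add: open_map_def)
  then show ?thesis using c(2) by (simp add: openin_open_subtopology)
qed

lemma topological_chart_open_preimage:
  assumes "topological_chart M (U, \<phi>)" "openin (Euclidean_space (mdim M)) W"
  shows "openin (mtop M) {x \<in> U. \<phi> x \<in> W}"
proof -
  note c = topological_chartD[OF assms(1)]
  have "topspace (mtop M) \<inter> U = U" using openin_subset[OF c(1)] by auto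
  then have "openin (subtopology (mtop M) U) {x \<in> U. \<phi> x \<in> W}"
    using openin_continuous_map_preimage[OF c(6) assms(2)] by simp
  then show ?thesis using c(1) by (simp add: openin_open_subtopology)
qed

lemma topological_chart_restrict:
  assumes "topological_chart M (U, \<phi>)" "openin (mtop M) U'" "U' \<subseteq> U"
  shows "topological_chart M (U', \<phi>)"
proof -
  note c = topological_chartD[OF assms(1)]
  have "topspace (mtop M) \<inter> U = U" using openin_subset[OF c(1)] by auto
  then have "homeomorphic_map (subtopology (subtopology (mtop M) U) U')
               (subtopology (subtopology (Euclidean_space (mdim M)) (\<phi> ` U)) (\<phi> ` U')) \<phi>"
    using assms(3) c(5) by (intro homeomorphic_map_subtopologies[OF c(3)]) auto
  moreover have "U \<inter> U' = U'" "\<phi> ` U \<inter> \<phi> ` U' = \<phi> ` U'" using assms(3) by auto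
  ultimately show ?thesis
    using assms topological_chart_open_image[OF assms] by (simp add: topological_chart_def subtopology_subtopology)
qed

lemma inv_into_mem: "inj_on f A \<Longrightarrow> B \<subseteq> A \<Longrightarrow> x \<in> B \<Longrightarrow> inv_into A f (f x) = x"
  by (auto intro: inv_into_f_f)

lemma smooth_chart_restrict:
  assumes M: "smooth_manifold M" and c: "smooth_chart M (U, \<phi>)" and U': "openin (mtop M) U'" "U' \<subseteq> U"
  shows "smooth_chart M (U', \<phi>)"
proof -
  have tc: "topological_chart M (U, \<phi>)" using c by (simp add: smooth_chart_def)
  note cD = topological_chartD[OF tc]
  have "smooth_in_charts (mdim M) id (U', \<phi>) (V, \<psi>) \<and> smooth_in_charts (mdim M) id (V, \<psi>) (U', \<phi>)"
    if d: "(V, \<psi>) \<in> atlas M" for V \<psi>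
  proof
    have td: "topological_chart M (V, \<psi>)" using M d by (auto simp: smooth_manifold_def smooth_chart_def)
    have cd: "smooth_in_charts (mdim M) id (U, \<phi>) (V, \<psi>)" "smooth_in_charts (mdim M) id (V, \<psi>) (U, \<phi>)"
      using c d by (auto simp: smooth_chart_def)
    have "openin (mtop M) {x \<in> U'. x \<in> V}"
      using openin_Int[OF U'(1) topological_chartD(1)[OF td]] by (simp add: Int_def)
    then have op: "openin (Euclidean_space (mdim M)) (\<phi> ` {x \<in> U'. x \<in> V})"
      by (rule topological_chart_open_image[OF tc]) (use U' in auto)
    show "smooth_in_charts (mdim M) id (U', \<phi>) (V, \<psi>)"
      unfolding smooth_in_charts_iff
    proof (intro allI)
      fix j k
      have "Ck_on (mdim M) k (\<phi> ` {x \<in> U'. x \<in> V}) (\<lambda>y. \<psi> (inv_into U \<phi> y) j)"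
        by (rule Ck_on_mono[of _ _ "\<phi> ` {x \<in> U. id x \<in> V}"])
          (use cd(1) U'(2) cD(5) in \<open>auto simp: smooth_in_charts_iff\<close>)
      then show "Ck_on (mdim M) k (\<phi> ` {x \<in> U'. id x \<in> V}) (\<lambda>y. \<psi> (id (inv_into U' \<phi> y)) j)"
        unfolding id_apply
        by (rule Ck_on_cong[OF op, rotated])
          (use U'(2) inj_on_subset[OF cD(4) U'(2)] cD(4) in \<open>auto simp: inv_into_mem\<close>)
    qed
    show "smooth_in_charts (mdim M) id (V, \<psi>) (U', \<phi>)"
      unfolding smooth_in_charts_iff
    proof (intro allI)
      fix j k
      show "Ck_on (mdim M) k (\<psi> ` {x \<in> V. id x \<in> U'}) (\<lambda>y. \<phi> (id (inv_into V \<psi> y)) j)"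
        by (rule Ck_on_mono[of _ _ "\<psi> ` {x \<in> V. id x \<in> U}"])
          (use cd(2) U'(2) topological_chartD(5)[OF td] in \<open>auto simp: smooth_in_charts_iff\<close>)
    qed
  qed
  then show ?thesis using topological_chart_restrict[OF tc U'] by (auto simp: smooth_chart_def)
qed

lemma smooth_chart_postcompose:
  assumes M: "smooth_manifold M" and c: "smooth_chart M (U, \<phi>)"
    and T: "\<And>j k. Ck_on (mdim M) k (\<phi> ` U) (\<lambda>y. T y j)" 
    and TU: "openin (Euclidean_space (mdim M)) (T ` \<phi> ` U)"
    and S: "\<And>j k. Ck_on (mdim M) k (T ` \<phi> ` U) (\<lambda>y. S y j)" 
    and ST: "\<And>y. y \<in> \<phi> ` U \<Longrightarrow> S (T y) = y"
  shows "smooth_chart M (U, \<lambda>x. T (\<phi> x))"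
proof -
  let ?n = "mdim M"
  have tc: "topological_chart M (U, \<phi>)" using c by (simp add: smooth_chart_def)
  note cD = topological_chartD[OF tc]
  note TE = openin_Eucl_subset[OF TU]
  have eq: "(\<lambda>x. T (\<phi> x)) ` A = T ` \<phi> ` A" for A by auto
  have cT: "continuous_on (\<phi> ` U) T" 
    by (rule continuous_on_coordinatewise_then_product) (rule Ck_on_continuous[OF cD(5) T])
  have cS: "continuous_on (T ` \<phi> ` U) S" 
    by (rule continuous_on_coordinatewise_then_product) (rule Ck_on_continuous[OF TE S])
  have injT: "inj_on T (\<phi> ` U)" by (rule inj_on_inverseI[where g=S]) (rule ST)
  have "homeomorphic_maps (top_of_set (\<phi> ` U)) (top_of_set (T ` \<phi> ` U)) T S"
    using cT cS ST by (auto simp: homeomorphic_maps_def image_iff)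
  then have homT: "homeomorphic_map (subtopology (Euclidean_space ?n) (\<phi> ` U)) (subtopology (Euclidean_space ?n) (T ` \<phi> ` U)) T"
    unfolding subtopology_Euclidean_space[OF cD(5)] subtopology_Euclidean_space[OF TE]
    by (rule homeomorphic_maps_imp_map)
  have tc': "topological_chart M (U, \<lambda>x. T (\<phi> x))"
    using homeomorphic_map_compose[OF cD(3) homT] cD(1) TU by (simp add: topological_chart_def eq o_def)
  note cD' = topological_chartD[OF tc']
  have "smooth_in_charts ?n id (U, \<lambda>x. T (\<phi> x)) (V, \<psi>) \<and> smooth_in_charts ?n id (V, \<psi>) (U, \<lambda>x. T (\<phi> x))"
    if d: "(V, \<psi>) \<in> atlas M" for V \<psi>
  proof
    have td: "topological_chart M (V, \<psi>)" using M d by (auto simp: smooth_manifold_def smooth_chart_def)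
    note dD = topological_chartD[OF td]
    have cd: "smooth_in_charts ?n id (U, \<phi>) (V, \<psi>)" "smooth_in_charts ?n id (V, \<psi>) (U, \<phi>)"
      using c d by (auto simp: smooth_chart_def)
    define UV where "UV = {x \<in> U. x \<in> V}"
    have UV: "openin (mtop M) UV" "UV \<subseteq> U" "UV \<subseteq> V" 
      using openin_Int[OF cD(1) dD(1)] by (auto simp add: Int_def UV_def)
    note op = topological_chart_open_image[OF tc UV(1,2)] 
      topological_chart_open_image[OF tc' UV(1,2), unfolded eq]
      topological_chart_open_image[OF td UV(1,3)]
    have SUV: "S y \<in> \<phi> ` UV" if "y \<in> T ` \<phi> ` UV" for y using that ST UV by auto
    show "smooth_in_charts ?n id (U, \<lambda>x. T (\<phi> x)) (V, \<psi>)"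
      unfolding smooth_in_charts_iff id_apply UV_def[symmetric] eq
    proof (intro allI)
      fix j k
      have S_UV: "Ck_on ?n k (T ` \<phi> ` UV) (\<lambda>z. S z i)" for i
        by (rule Ck_on_mono[OF S _ TE]) (use UV in auto)
      have f_UV: "Ck_on ?n k (\<phi> ` UV) (\<lambda>y. \<psi> (inv_into U \<phi> y) j)"
        using cd(1) unfolding smooth_in_charts_iff id_apply UV_def[symmetric] by blast
      have "Ck_on ?n k (T ` \<phi> ` UV) (\<lambda>z. \<psi> (inv_into U \<phi> (S z)) j)"
        by (rule Ck_on_compose[where F=S and f="\<lambda>y. \<psi> (inv_into U \<phi> y) j", OF op(2) op(1) SUV S_UV f_UV])
      then show "Ck_on ?n k (T ` \<phi> ` UV) (\<lambda>z. \<psi> (inv_into U (\<lambda>x. T (\<phi> x)) z) j)"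
      proof (rule Ck_on_cong[OF op(2), rotated])
        fix z assume "z \<in> T ` \<phi> ` UV"
        then obtain x where x: "x \<in> UV" "z = T (\<phi> x)" by auto
        have "inv_into U (\<lambda>x. T (\<phi> x)) (T (\<phi> x)) = x" using inv_into_mem[OF cD'(4) UV(2) x(1)] .
        moreover have "inv_into U \<phi> (S z) = x" using inv_into_mem[OF cD(4) UV(2) x(1)] ST x UV by auto
        ultimately show "\<psi> (inv_into U \<phi> (S z)) j = \<psi> (inv_into U (\<lambda>x. T (\<phi> x)) z) j" using x by simp
      qed
    qed
    have UV': "{x \<in> V. x \<in> U} = UV" by (auto simp: UV_def)
    show "smooth_in_charts ?n id (V, \<psi>) (U, \<lambda>x. T (\<phi> x))"
      unfolding smooth_in_charts_iff id_apply UV'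
    proof (intro allI)
      fix j k
      have "Ck_on ?n k (\<psi> ` UV) (\<lambda>y. \<phi> (inv_into V \<psi> y) i)" for i
        using cd(2) unfolding smooth_in_charts_iff id_apply UV' by blast
      then show "Ck_on ?n k (\<psi> ` UV) (\<lambda>y. T (\<phi> (inv_into V \<psi> y)) j)"
      proof (rule Ck_on_compose[OF op(3) cD(2), rotated -2])
        show "\<phi> (inv_into V \<psi> y) \<in> \<phi> ` U" if "y \<in> \<psi> ` UV" for y
          using that UV by (auto simp: inv_into_mem[OF dD(4) UV(3)])
      qed (rule T)
    qed
  qed
  then show ?thesis using tc' by (auto simp: smooth_chart_def)
qed

section \<open>Slice charts at fixed points\<close>

text \<open>
  For \<open>s = 1\<close> and \<open>s = -1\<close>, the part of the coordinate function which the involution multiplies by \<open>s\<close>.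
\<close>

definition half_sum :: "'m c2_manifold \<Rightarrow> ('m \<Rightarrow> nat \<Rightarrow> real) \<Rightarrow> real \<Rightarrow> nat \<Rightarrow> 'm \<Rightarrow> real" where
  "half_sum M \<phi> s i y = (\<phi> y i + s * \<phi> (flip M y) i) / 2"

lemma half_sum_smooth:
  assumes M: "smooth_c2_manifold M" and d: "(V, \<psi>) \<in> atlas M"
    and c: "smooth_chart M (U, \<phi>)" and U: "U \<subseteq> V" "flip M ` U \<subseteq> V"
  shows "Ck_on (mdim M) k (\<phi> ` U) (\<lambda>y. half_sum M \<psi> s i (inv_into U \<phi> y))"
    and "Ck_on (mdim M) k (\<phi> ` U) (\<lambda>y. \<psi> (inv_into U \<phi> y) i)"
proof -
  let ?n = "mdim M"
  have M': "smooth_manifold M" using M by (simp add: smooth_c2_manifold_def)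
  have td: "topological_chart M (V, \<psi>)" using M' d by (auto simp: smooth_manifold_def smooth_chart_def)
  have tc: "topological_chart M (U, \<phi>)" using c by (simp add: smooth_chart_def)
  note cD = topological_chartD[OF tc] and dD = topological_chartD[OF td]
  have eqU: "{x \<in> U. x \<in> V} = U" using U by auto
  have cd: "Ck_on ?n k (\<phi> ` U) (\<lambda>y. \<psi> (inv_into U \<phi> y) j)" for j k
    using c d eqU by (auto simp: smooth_chart_def smooth_in_charts_iff dest!: bspec)
  then show "Ck_on ?n k (\<phi> ` U) (\<lambda>y. \<psi> (inv_into U \<phi> y) i)" .
  define W where "W = {x \<in> V. flip M x \<in> V}"
  have fl: "Ck_on ?n k (\<psi> ` W) (\<lambda>y. \<psi> (flip M (inv_into V \<psi> y)) i)"
    using M d by (auto simp: smooth_c2_manifold_def smooth_in_charts_iff W_def dest!: bspec)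
  have "openin (mtop M) ({x \<in> topspace (mtop M). flip M x \<in> V} \<inter> V)"
    using M dD(1) by (intro openin_Int openin_continuous_map_preimage) (auto simp: smooth_c2_manifold_def)
  moreover have "{x \<in> topspace (mtop M). flip M x \<in> V} \<inter> V = W"
    using openin_subset[OF dD(1)] by (auto simp: W_def)
  ultimately have W: "openin (Euclidean_space ?n) (\<psi> ` W)"
    by (intro topological_chart_open_image[OF td]) (auto simp: W_def)
  have UW: "U \<subseteq> W" using U by (auto simp: W_def)
  have "Ck_on ?n k (\<phi> ` U) (\<lambda>y. \<psi> (flip M (inv_into V \<psi> (\<psi> (inv_into U \<phi> y)))) i)"
    by (rule Ck_on_compose[OF cD(2) W _ cd fl]) (use UW in \<open>auto simp: inv_into_f_f[OF cD(4)]\<close>)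
  then have "Ck_on ?n k (\<phi> ` U) (\<lambda>y. \<psi> (flip M (inv_into U \<phi> y)) i)"
    by (rule Ck_on_cong[OF cD(2), rotated])
      (auto simp: inv_into_f_f[OF cD(4)] inv_into_mem[OF dD(4) U(1)])
  then have "Ck_on ?n k (\<phi> ` U) (\<lambda>y. (1/2) * (\<psi> (inv_into U \<phi> y) i + s * \<psi> (flip M (inv_into U \<phi> y)) i))"
    using cd by (intro Ck_on_mult[OF cD(2)] Ck_on_add[OF cD(2)] Ck_on_const[OF cD(2)])
  then show "Ck_on ?n k (\<phi> ` U) (\<lambda>y. half_sum M \<psi> s i (inv_into U \<phi> y))"
    by (simp add: half_sum_def)
qed

text \<open>
  The coordinates of \<open>\<psi>\<close> are sums of half sums. If the derivatives of all half sums in the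
  \<open>m\<close>-th direction vanished at \<open>x\<close>, then so would those of all coordinates of \<open>\<psi>\<close>, and by the chain
  rule that of the \<open>m\<close>-th coordinate of \<open>\<phi>\<close>, which is 1. So some half sum can replace it.
\<close>

lemma half_sum_exchange:
  assumes M: "smooth_c2_manifold M" and d: "(V, \<psi>) \<in> atlas M"
    and c: "smooth_chart M (U, \<phi>)" and U: "U \<subseteq> V" "flip M ` U \<subseteq> V"
    and x: "x \<in> U" and m: "m < mdim M"
  shows "\<exists>s\<in>{1,-1}. \<exists>i N \<phi>'. N \<subseteq> U \<and> x \<in> N \<and> smooth_chart M (N, \<phi>') \<and>
           (\<forall>y\<in>N. \<phi>' y = (\<phi> y)(m := half_sum M \<psi> s i y))"
proof -
  let ?n = "mdim M"
  have M': "smooth_manifold M" using M by (simp add: smooth_c2_manifold_def)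
  have td: "topological_chart M (V, \<psi>)" using M' d by (auto simp: smooth_manifold_def smooth_chart_def)
  have tc: "topological_chart M (U, \<phi>)" using c by (simp add: smooth_chart_def)
  note cD = topological_chartD[OF tc] and dD = topological_chartD[OF td]
  define h where "h s i y = half_sum M \<psi> s i (inv_into U \<phi> y)" for s i y
  have hS: "Ck_on ?n k (\<phi> ` U) (h s i)" for k s i
    using half_sum_smooth(1)[OF M d c U] by (simp add: h_def[abs_def])
  have inv: "inv_into U \<phi> (\<phi> y) = y" if "y \<in> U" for y using inv_into_f_f[OF cD(4) that] .
  define p where "p = \<phi> x"
  have p: "p \<in> \<phi> ` U" using x by (simp add: p_def)
  have "\<exists>s\<in>{1,-1}. \<exists>i. pd m (h s i) p \<noteq> 0"
  proof (rule ccontr)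
    assume "\<not> ?thesis"
    then have z: "pd m (h 1 i) p = 0" "pd m (h (-1) i) p = 0" for i by auto
    have hd: "((\<lambda>t. h s i (p(m := t))) has_real_derivative pd m (h s i) p) (at (p m))" for s i
      using Ck_on_SucD(2)[OF cD(2) hS m p] .
    have "((\<lambda>t. h 1 i (p(m := t)) + h (-1) i (p(m := t))) has_real_derivative 0) (at (p m))" for i
      using DERIV_add[OF hd[of 1 i] hd[of "-1" i]] z by simp
    then have D: "((\<lambda>t. \<psi> (inv_into U \<phi> (p(m := t))) i) has_real_derivative 0) (at (p m))" for i
      by (simp add: h_def half_sum_def add_divide_distrib[symmetric])
    \<comment> \<open>the \<open>m\<close>-th coordinate of \<open>\<phi>\<close> as a function of those of \<open>\<psi>\<close>\<close>
    define f where "f z = \<phi> (inv_into V \<psi> z) m" for z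
    have eq: "{x \<in> V. x \<in> U} = U" using U by auto
    have f: "Ck_on ?n k (\<psi> ` U) f" for k
      using c d eq by (auto simp: smooth_chart_def smooth_in_charts_iff f_def[abs_def] dest!: bspec)
    have opV: "openin (Euclidean_space ?n) (\<psi> ` U)" by (rule topological_chart_open_image[OF td cD(1) U(1)])
    have FW: "\<psi> (inv_into U \<phi> y) \<in> \<psi> ` U" if "y \<in> \<phi> ` U" for y using that by (auto simp: inv)
    have "((\<lambda>t. f (\<psi> (inv_into U \<phi> (p(m := t))))) has_real_derivative (\<Sum>j<?n. pd j f (\<psi> (inv_into U \<phi> p)) * 0)) (at (p m))"
      by (rule partial_compose[where F="\<lambda>y. \<psi> (inv_into U \<phi> y)" and f=f and x=p and i=m and D="\<lambda>_. 0", OF cD(2) opV FW f D p m])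
    moreover have "f (\<psi> (inv_into U \<phi> y)) = y m" if "y \<in> \<phi> ` U" for y
      using that U(1) by (auto simp: f_def inv inv_into_mem[OF dD(4) U(1)])
    ultimately have "((\<lambda>t. (p(m := t)) m) has_real_derivative 0) (at (p m))"
      using partial_cong[where f="\<lambda>y. f (\<psi> (inv_into U \<phi> y))" and g="\<lambda>y. y m" and D=0, OF cD(2) p m] by simp
    then have "((\<lambda>t. t) has_real_derivative 0) (at (p m))" by simp
    then show False using DERIV_unique[OF DERIV_ident] by fastforce
  qed
  then obtain s i where si: "s \<in> {1,-1}" "pd m (h s i) p \<noteq> 0" by blast
  define T where "T y = y(m := h s i y)" for y
  obtain N0 u where N0: "openin (Euclidean_space ?n) N0" "p \<in> N0" "N0 \<subseteq> \<phi> ` U"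
    "openin (Euclidean_space ?n) (T ` N0)" "\<And>k. Ck_on ?n k (T ` N0) u" "\<And>x. x \<in> N0 \<Longrightarrow> u (T x) = x m"
    unfolding T_def by (rule coordinate_replacement[OF cD(2) p m hS si(2)]) blast
  define N where "N = {y \<in> U. \<phi> y \<in> N0}"
  have N: "openin (mtop M) N" "N \<subseteq> U" using topological_chart_open_preimage[OF tc N0(1)] by (auto simp: N_def)
  have NN0: "\<phi> ` N = N0" using N0(3) by (auto simp: N_def)
  have cN: "smooth_chart M (N, \<phi>)" by (rule smooth_chart_restrict[OF M' c N])
  have "smooth_chart M (N, \<lambda>x. T (\<phi> x))"
  proof (rule smooth_chart_postcompose[OF M' cN, where S="\<lambda>w. w(m := u w)", unfolded NN0])
    show "openin (Euclidean_space ?n) (T ` N0)" by (rule N0(4))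
    show "Ck_on ?n k N0 (\<lambda>y. T y j)" for j k
      using Ck_on_mono[OF hS N0(3) cD(5)] Ck_on_coordinate[OF N0(1)] by (cases "j = m") (auto simp: T_def)
    show "Ck_on ?n k (T ` N0) (\<lambda>y. (y(m := u y)) j)" for j k
      using N0(5) Ck_on_coordinate[OF N0(4)] by (cases "j = m") auto
    show "(T y)(m := u (T y)) = y" if "y \<in> N0" for y using N0(6)[OF that] by (simp add: T_def)
  qed
  moreover have "T (\<phi> y) = (\<phi> y)(m := half_sum M \<psi> s i y)" if "y \<in> N" for y
    using that N(2) by (auto simp: T_def h_def inv)
  moreover have "x \<in> N" using N0(2) x by (simp add: N_def p_def)
  ultimately show ?thesis using si N by blast
qed

text \<open>All coordinates are exchanged, one after the other.\<close>

lemma half_sum_chart: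
  assumes M: "smooth_c2_manifold M" and d: "(V, \<psi>) \<in> atlas M" and x: "x \<in> V" "flip M x = x"
  obtains U \<phi> s i where "smooth_chart M (U, \<phi>)" "x \<in> U" "U \<subseteq> V" "flip M ` U \<subseteq> V"
    "\<And>m. m < mdim M \<Longrightarrow> s m \<in> {1,-1}"
    "\<And>m y. m < mdim M \<Longrightarrow> y \<in> U \<Longrightarrow> \<phi> y m = half_sum M \<psi> (s m) (i m) y"
proof -
  let ?n = "mdim M"
  have M': "smooth_manifold M" using M by (simp add: smooth_c2_manifold_def)
  have sd: "smooth_chart M (V, \<psi>)" using M' d by (auto simp: smooth_manifold_def)
  then have td: "topological_chart M (V, \<psi>)" by (auto simp: smooth_chart_def)
  note dD = topological_chartD[OF td]
  have "\<exists>U \<phi> s i. smooth_chart M (U, \<phi>) \<and> x \<in> U \<and> U \<subseteq> V \<and> flip M ` U \<subseteq> V \<and> (\<forall>m<q. s m \<in> {1,-1::real}) \<and>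
          (\<forall>m<q. \<forall>y\<in>U. \<phi> y m = half_sum M \<psi> (s m) (i m) y)" if "q \<le> ?n" for q
    using that
  proof (induction q)
    case 0
    define W where "W = {x \<in> V. flip M x \<in> V}"
    have "openin (mtop M) ({x \<in> topspace (mtop M). flip M x \<in> V} \<inter> V)"
      using M dD(1) by (intro openin_Int openin_continuous_map_preimage) (auto simp: smooth_c2_manifold_def)
    moreover have "{x \<in> topspace (mtop M). flip M x \<in> V} \<inter> V = W"
      using openin_subset[OF dD(1)] by (auto simp: W_def)
    ultimately have "smooth_chart M (W, \<psi>)"
      by (intro smooth_chart_restrict[OF M' sd]) (auto simp: W_def)
    then show ?case using x by (intro exI[of _ W] exI[of _ \<psi>]) (auto simp: W_def)
  next
    case (Suc q)
    then obtain U \<phi> s i where IH: "smooth_chart M (U, \<phi>)" "x \<in> U" "U \<subseteq> V" "flip M ` U \<subseteq> V" "\<forall>m<q. s m \<in> {1,-1::real}"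
          "\<forall>m<q. \<forall>y\<in>U. \<phi> y m = half_sum M \<psi> (s m) (i m) y" by auto
    obtain s' i' N \<phi>' where N: "s' \<in> {1,-1}" "N \<subseteq> U" "x \<in> N" "smooth_chart M (N, \<phi>')" 
           "\<forall>y\<in>N. \<phi>' y = (\<phi> y)(q := half_sum M \<psi> s' i' y)"
      using half_sum_exchange[OF M d IH(1,3,4,2), of q] Suc.prems by auto
    have a: "\<forall>m<Suc q. (s(q := s')) m \<in> {1,-1::real}"
      using N(1) IH(5) by (auto simp: less_Suc_eq)
    have b: "\<forall>m<Suc q. \<forall>y\<in>N. \<phi>' y m = half_sum M \<psi> ((s(q := s')) m) ((i(q := i')) m) y"
      using N(2,5) IH(6) by (auto simp: less_Suc_eq)
    have "N \<subseteq> V" "flip M ` N \<subseteq> V" using N(2) IH(3,4) by auto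
    then show ?case using N(3,4) a b
      by (intro exI[of _ N] exI[of _ \<phi>'] exI[of _ "s(q := s')"] exI[of _ "i(q := i')"] conjI)
  qed
  from this[OF order_refl] obtain U \<phi> s i where *: "smooth_chart M (U, \<phi>)" "x \<in> U" "U \<subseteq> V" "flip M ` U \<subseteq> V"
     "\<forall>m<?n. s m \<in> {1,-1::real}" "\<forall>m<?n. \<forall>y\<in>U. \<phi> y m = half_sum M \<psi> (s m) (i m) y" by blast
  show thesis by (rule that[OF *(1-4)]) (use *(5,6) in auto)
qed

text \<open>
  In a chart made of half sums the involution multiplies every coordinate by a sign, so the fixed set
  is given by the vanishing of the coordinates with sign \<open>-1\<close>. A permutation moves these to the end.
\<close>

lemma slice_chart_exists:
  assumes M: "smooth_c2_manifold M" and x: "x \<in> fixed_set M"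
  shows "\<exists>k U \<phi>. x \<in> U \<and> slice_chart M (fixed_set M) k (U, \<phi>)"
proof -
  let ?n = "mdim M" and ?g = "flip M"
  have M': "smooth_manifold M" using M by (simp add: smooth_c2_manifold_def)
  have xM: "x \<in> topspace (mtop M)" "?g x = x" using x by (auto simp: fixed_set_def)
  then obtain V \<psi> where d: "(V, \<psi>) \<in> atlas M" "x \<in> V"
    using M' unfolding smooth_manifold_def by fastforce
  obtain U \<phi> s i where U: "smooth_chart M (U, \<phi>)" "x \<in> U" "U \<subseteq> V" "?g ` U \<subseteq> V"
    and s: "\<And>m. m < ?n \<Longrightarrow> s m \<in> {1,-1}"
    and \<phi>: "\<And>m y. m < ?n \<Longrightarrow> y \<in> U \<Longrightarrow> \<phi> y m = half_sum M \<psi> (s m) (i m) y"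
    by (rule half_sum_chart[OF M d(1,2) xM(2)]) blast
  \<comment> \<open>\<open>\<pi>\<close> lists the coordinates with sign 1 first.\<close>
  define A where "A = {m. m < ?n \<and> s m = 1}"
  define k where "k = card A"
  have A: "finite A" "A \<subseteq> {..<?n}" by (auto simp: A_def)
  have k: "k \<le> ?n" using card_mono[of "{..<?n}" A] A by (simp add: k_def)
  obtain a where a: "bij_betw a {..<k} A"
    using ex_bij_betw_nat_finite[OF A(1)] by (auto simp: k_def atLeast0LessThan)
  have "card ({..<?n} - A) = card {k..<?n}" using A by (simp add: card_Diff_subset k_def)
  then obtain b where b: "bij_betw b {k..<?n} ({..<?n} - A)"
    using finite_same_card_bij[of "{k..<?n}" "{..<?n} - A"] by auto
  define \<pi> where "\<pi> j = (if j < k then a j else b j)" for j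
  have "bij_betw \<pi> {..<k} A" using bij_betw_cong[of "{..<k}" a \<pi> A] a by (auto simp: \<pi>_def)
  moreover have "bij_betw \<pi> {k..<?n} ({..<?n} - A)" using bij_betw_cong[of "{k..<?n}" b \<pi>] b by (auto simp: \<pi>_def)
  ultimately have "bij_betw \<pi> ({..<k} \<union> {k..<?n}) (A \<union> ({..<?n} - A))"
    by (rule bij_betw_combine) auto
  moreover have "{..<k} \<union> {k..<?n} = {..<?n}" "A \<union> ({..<?n} - A) = {..<?n}" using k A by auto
  ultimately have \<pi>: "bij_betw \<pi> {..<?n} {..<?n}" by simp
  have \<pi>n: "\<pi> j < ?n" if "j < ?n" for j using bij_betwE[OF \<pi>] that by auto
  have s\<pi>: "s (\<pi> j) = (if j < k then 1 else -1)" if "j < ?n" for j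
  proof (cases "j < k")
    case True then have "\<pi> j \<in> A" using bij_betwE[OF a] by (auto simp: \<pi>_def)
    then show ?thesis using True by (simp add: A_def)
  next
    case False then have "\<pi> j \<in> {..<?n} - A" using bij_betwE[OF b] that by (auto simp: \<pi>_def)
    then show ?thesis using False s[of "\<pi> j"] by (auto simp: A_def)
  qed
  define \<pi>' where "\<pi>' = inv_into {..<?n} \<pi>"
  have \<pi>'n: "\<pi>' j < ?n" and \<pi>\<pi>': "\<pi> (\<pi>' j) = j" if "j < ?n" for j
    using bij_betwE[OF bij_betw_inv_into[OF \<pi>]] bij_betw_inv_into_right[OF \<pi>] that by (auto simp: \<pi>'_def)
  have \<pi>'\<pi>: "\<pi>' (\<pi> j) = j" if "j < ?n" for j
    using bij_betw_inv_into_left[OF \<pi>] that by (auto simp: \<pi>'_def)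
  define T where "T y = (\<lambda>j. if j < ?n then y (\<pi> j) else 0 :: real)" for y :: "nat \<Rightarrow> real"
  define S where "S y = (\<lambda>j. if j < ?n then y (\<pi>' j) else 0 :: real)" for y :: "nat \<Rightarrow> real"
  have ST: "S (T y) = y" if "y \<in> Eucl ?n" for y using that \<pi>\<pi>' \<pi>'n by (auto simp: S_def T_def Eucl_def fun_eq_iff)
  have TS: "T (S y) = y" if "y \<in> Eucl ?n" for y using that \<pi>'\<pi> \<pi>n by (auto simp: S_def T_def Eucl_def fun_eq_iff)
  define U' where "U' = {y \<in> U. ?g y \<in> U}"
  have tc: "topological_chart M (U, \<phi>)" using U(1) by (simp add: smooth_chart_def)
  note cD = topological_chartD[OF tc]
  have "openin (mtop M) ({x \<in> topspace (mtop M). ?g x \<in> U} \<inter> U)"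
    using M cD(1) by (intro openin_Int openin_continuous_map_preimage) (auto simp: smooth_c2_manifold_def)
  moreover have "{x \<in> topspace (mtop M). ?g x \<in> U} \<inter> U = U'"
    using openin_subset[OF cD(1)] by (auto simp: U'_def)
  ultimately have U': "openin (mtop M) U'" "U' \<subseteq> U" by (auto simp: U'_def)
  have c': "smooth_chart M (U', \<phi>)" by (rule smooth_chart_restrict[OF M' U(1) U'])
  have tc': "topological_chart M (U', \<phi>)" using c' by (simp add: smooth_chart_def)
  note cD' = topological_chartD[OF tc']
  have coordE: "Ck_on ?n q W (\<lambda>y. if j < ?n then y (\<sigma> j) else 0)" if "openin (Euclidean_space ?n) W" for W q j and \<sigma> :: "nat \<Rightarrow> nat"
    using Ck_on_coordinate[OF that] Ck_on_const[OF that] by (cases "j < ?n") auto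
  have "T ` \<phi> ` U' = {z \<in> Eucl ?n. S z \<in> \<phi> ` U'}"
  proof (intro equalityI subsetI)
    fix z assume "z \<in> T ` \<phi> ` U'"
    then show "z \<in> {z \<in> Eucl ?n. S z \<in> \<phi> ` U'}" using ST cD'(5) by (auto simp: T_def Eucl_def)
  next
    fix z assume "z \<in> {z \<in> Eucl ?n. S z \<in> \<phi> ` U'}"
    then show "z \<in> T ` \<phi> ` U'" using TS by (metis (no_types, lifting) imageI mem_Collect_eq)
  qed
  moreover have "continuous_map (Euclidean_space ?n) (Euclidean_space ?n) S"
    unfolding S_def continuous_map_componentwise_Euclidean_space continuous_map_Euclidean_space_iff
    by (auto intro: continuous_on_coordinate)
  ultimately have TU: "openin (Euclidean_space ?n) (T ` \<phi> ` U')"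
    using openin_continuous_map_preimage[OF _ cD'(2)] by fastforce
  have ch: "smooth_chart M (U', \<lambda>x. T (\<phi> x))"
  proof (rule smooth_chart_postcompose[OF M' c' _ TU, where S=S])
    show "Ck_on ?n q (\<phi> ` U') (\<lambda>y. T y j)" for j q unfolding T_def by (rule coordE[OF cD'(2)])
    show "Ck_on ?n q (T ` \<phi> ` U') (\<lambda>y. S y j)" for j q unfolding S_def by (rule coordE[OF TU])
    show "S (T y) = y" if "y \<in> \<phi> ` U'" for y using ST that cD'(5) by auto
  qed
  have invol: "?g (?g y) = y" if "y \<in> U'" for y
    using M that openin_subset[OF U'(1)] by (auto simp: smooth_c2_manifold_def)
  have sgn: "\<phi> (?g y) m = s m * \<phi> y m" if "y \<in> U'" "m < ?n" for y m
  proof -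
    have g: "?g y \<in> U" "y \<in> U" using that by (auto simp: U'_def)
    show ?thesis using \<phi>[OF that(2) g(1)] \<phi>[OF that(2) g(2)] s[OF that(2)] invol[OF that(1)]
      by (auto simp: half_sum_def)
  qed
  have fixed_iff: "y \<in> fixed_set M \<longleftrightarrow> T (\<phi> y) \<in> Eucl k" if y: "y \<in> U'" for y
  proof
    assume "y \<in> fixed_set M"
    then have "?g y = y" by (simp add: fixed_set_def)
    then have "\<phi> y (\<pi> j) = 0" if "k \<le> j" "j < ?n" for j
      using sgn[OF y \<pi>n[OF that(2)]] s\<pi>[OF that(2)] that by auto
    then show "T (\<phi> y) \<in> Eucl k" by (auto simp: T_def Eucl_def)
  next
    assume E: "T (\<phi> y) \<in> Eucl k"
    have g: "?g y \<in> U" "y \<in> U" using y by (auto simp: U'_def)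
    have "\<phi> (?g y) j = \<phi> y j" for j
    proof (cases "j < ?n")
      case True
      show ?thesis
      proof (cases "\<pi>' j < k")
        case True
        then show ?thesis using sgn[OF y \<open>j < ?n\<close>] s\<pi>[OF \<pi>'n[OF \<open>j < ?n\<close>]] \<pi>\<pi>'[OF \<open>j < ?n\<close>] by simp
      next
        case False
        then have "T (\<phi> y) (\<pi>' j) = 0" using E by (auto simp: Eucl_def)
        then have "\<phi> y j = 0" using \<pi>'n[OF \<open>j < ?n\<close>] \<pi>\<pi>'[OF \<open>j < ?n\<close>] by (simp add: T_def)
        then show ?thesis using sgn[OF y \<open>j < ?n\<close>] by simp
      qed
    next
      case False
      then have "\<phi> y j = 0" "\<phi> (?g y) j = 0" using g cD(5) by (auto simp: Eucl_def)
      then show ?thesis by simp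
    qed
    then have "\<phi> (?g y) = \<phi> y" by (rule ext)
    then have "?g y = y" using inj_onD[OF cD(4)] g by blast
    then show "y \<in> fixed_set M" using y openin_subset[OF U'(1)] by (auto simp: fixed_set_def)
  qed
  have "(\<lambda>x. T (\<phi> x)) ` (U' \<inter> fixed_set M) = (\<lambda>x. T (\<phi> x)) ` U' \<inter> Eucl k"
    using fixed_iff by auto
  then have "slice_chart M (fixed_set M) k (U', \<lambda>x. T (\<phi> x))"
    using ch k by (simp add: slice_chart_def)
  moreover have "x \<in> U'" using U(2) xM by (simp add: U'_def)
  ultimately show ?thesis by blast
qed

lemma slice_dim_le_fixed_dim:
  assumes "x \<in> fixed_set M" "x \<in> U" "slice_chart M (fixed_set M) k (U, \<phi>)"
  shows "k \<le> fixed_dim M"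
  unfolding fixed_dim_def
proof (rule cSup_upper)
  show "k \<in> {k. \<exists>x\<in>fixed_set M. \<exists>U \<phi>. x \<in> U \<and> slice_chart M (fixed_set M) k (U, \<phi>)}" using assms by blast
  show "bdd_above {k. \<exists>x\<in>fixed_set M. \<exists>U \<phi>. x \<in> U \<and> slice_chart M (fixed_set M) k (U, \<phi>)}"
    by (rule bdd_aboveI[of _ "mdim M"]) (auto simp: slice_chart_def)
qed

section \<open>Bump functions and invariant exhaustions\<close>

lemma continuous_map_locally:
  assumes "\<And>x. x \<in> topspace X \<Longrightarrow> \<exists>U. openin X U \<and> x \<in> U \<and> continuous_map (subtopology X U) Y f"
  shows "continuous_map X Y f"
proof -
  obtain U where U: "\<And>x. x \<in> topspace X \<Longrightarrow> openin X (U x) \<and> x \<in> U x \<and> continuous_map (subtopology X (U x)) Y f"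
    using assms by metis
  show ?thesis
    by (rule pasting_lemma[where I="topspace X" and T=U and f="\<lambda>_. f"]) (use U in auto)
qed

lemma smooth_manifold_locally_compact:
  assumes M: "smooth_manifold M"
  shows "locally_compact_space (mtop M)"
  unfolding locally_compact_space_def
proof
  fix x assume x: "x \<in> topspace (mtop M)"
  then obtain U \<phi> where c: "(U, \<phi>) \<in> atlas M" "x \<in> U"
    using M unfolding smooth_manifold_def by fastforce
  then have tc: "topological_chart M (U, \<phi>)" using M by (auto simp: smooth_manifold_def smooth_chart_def)
  note cD = topological_chartD[OF tc]
  have "locally_compact_space (subtopology (Euclidean_space (mdim M)) (\<phi> ` U))"
    by (rule locally_compact_space_open_subset[OF _ locally_compact_Euclidean_space cD(2)])
       (simp add: Hausdorff_Euclidean_space)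
  then have "locally_compact_space (subtopology (mtop M) U)"
    using homeomorphic_locally_compact_space[OF homeomorphic_map_imp_homeomorphic_space[OF cD(3)]] by simp
  moreover have "x \<in> topspace (subtopology (mtop M) U)" using c x by simp
  ultimately obtain V K where VK: "openin (subtopology (mtop M) U) V" "compactin (subtopology (mtop M) U) K" "x \<in> V" "V \<subseteq> K"
    unfolding locally_compact_space_def by blast
  then show "\<exists>V K. openin (mtop M) V \<and> compactin (mtop M) K \<and> x \<in> V \<and> V \<subseteq> K"
    using cD(1) by (auto simp: openin_open_subtopology compactin_subtopology)
qed

lemma smooth_manifold_topology:
  assumes M: "smooth_manifold M"
  shows "Hausdorff_space (mtop M)" "regular_space (mtop M)" "normal_space (mtop M)" 
    "second_countable (mtop M)" "locally_compact_space (mtop M)"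
proof -
  show 1: "Hausdorff_space (mtop M)" "second_countable (mtop M)" "locally_compact_space (mtop M)"
    using M smooth_manifold_locally_compact[OF M] by (auto simp: smooth_manifold_def)
  then show 2: "regular_space (mtop M)" using locally_compact_Hausdorff_imp_regular_space by blast
  show "normal_space (mtop M)"
    using regular_Lindelof_imp_normal_space[OF 2 second_countable_imp_Lindelof_space[OF 1(2)]] .
qed

lemma compact_open_between:
  assumes X: "locally_compact_space X" "Hausdorff_space X" "normal_space X"
    and K: "compactin X K" and N: "openin X N" "K \<subseteq> N"
  obtains V D where "openin X V" "compactin X D" "closedin X D" "K \<subseteq> V" "V \<subseteq> D" "D \<subseteq> N"
proof -
  obtain U L where UL: "openin X U" "compactin X L" "closedin X L" "K \<subseteq> U" "U \<subseteq> L"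
    using X K locally_compact_space_compact_closed_compact[of X] by metis
  have clK: "closedin X K" using compactin_imp_closedin[OF X(2) K] .
  obtain V where V: "openin X V" "K \<subseteq> V" "X closure_of V \<subseteq> U \<inter> N"
    using X(3)[unfolded normal_space_alt, rule_format, of K "U \<inter> N"] clK UL N by auto
  show thesis
  proof
    show "openin X V" "K \<subseteq> V" "closedin X (X closure_of V)" using V by auto
    show "compactin X (X closure_of V)"
      by (rule closed_compactin[OF UL(2)]) (use V UL in auto)
    show "V \<subseteq> X closure_of V" using closure_of_subset[OF openin_subset[OF V(1)]] .
    show "X closure_of V \<subseteq> N" using V by auto
  qed
qed

lemma compact_bump:
  assumes X: "locally_compact_space X" "Hausdorff_space X" "normal_space X"
    and K: "compactin X K" and N: "openin X N" "K \<subseteq> N"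
  obtains b D where "continuous_map X euclideanreal b" "\<And>x. x \<in> topspace X \<Longrightarrow> 0 \<le> b x \<and> b x \<le> 1" 
    "\<And>x. x \<in> K \<Longrightarrow> b x = 1" "compactin X D" "closedin X D" "D \<subseteq> N" "\<And>x. x \<in> topspace X - D \<Longrightarrow> b x = 0"
proof -
  obtain V D where VD: "openin X V" "compactin X D" "closedin X D" "K \<subseteq> V" "V \<subseteq> D" "D \<subseteq> N"
    using compact_open_between[OF assms] by metis
  have clK: "closedin X K" using compactin_imp_closedin[OF X(2) K] .
  obtain f where f: "continuous_map X (top_of_set {0..1::real}) f" "f ` (topspace X - V) \<subseteq> {0}" "f ` K \<subseteq> {1}"
    by (rule Urysohn_lemma[of X "topspace X - V" K 0 1])
      (use X clK VD in \<open>auto simp: disjnt_def\<close>)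
  show thesis
  proof
    show "continuous_map X euclideanreal f" using f(1) by (simp add: continuous_map_in_subtopology)
    show "0 \<le> f x \<and> f x \<le> 1" if "x \<in> topspace X" for x
      using f(1) that by (auto simp: continuous_map_in_subtopology)
    show "f x = 1" if "x \<in> K" for x using f(3) that by auto
    show "f x = 0" if "x \<in> topspace X - D" for x using f(2) that VD by auto
  qed (use VD in auto)
qed

text \<open>
  The usual exhaustion of a locally compact space with a countable base; adding to each compact set its
  image under \<open>g\<close> makes it invariant.
\<close>

lemma invariant_exhaustion:
  assumes X: "locally_compact_space X" "Hausdorff_space X" "second_countable X"
    and g: "continuous_map X X g" "\<And>x. x \<in> topspace X \<Longrightarrow> g (g x) = x"
  shows "\<exists>Q R. (\<forall>n. compactin X (Q n) \<and> openin X (R n) \<and> g ` Q n \<subseteq> Q n \<and> Q n \<subseteq> R n \<and> R n \<subseteq> Q (Suc n)) \<and>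
    Q 0 = {} \<and> (\<Union>n. Q n) = topspace X"
proof -
  have "\<exists>U K. openin X U \<and> compactin X K \<and> x \<in> U \<and> U \<subseteq> K" if "x \<in> topspace X" for x
    using X(1) that unfolding locally_compact_space_def by blast
  then obtain U K where UK: "\<And>x. x \<in> topspace X \<Longrightarrow> openin X (U x) \<and> compactin X (K x) \<and> x \<in> U x \<and> U x \<subseteq> K x"
    by metis
  have "Lindelof_space X" using second_countable_imp_Lindelof_space[OF X(3)] .
  then obtain \<V> where V: "countable \<V>" "\<V> \<subseteq> U ` topspace X" "\<Union>\<V> = topspace X"
  proof -
    have sub: "U x \<subseteq> topspace X" if "x \<in> topspace X" for x
      using openin_subset[of X "U x"] UK[OF that] by simp
    have "\<Union>(U ` topspace X) = topspace X"
    proof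
      show "\<Union>(U ` topspace X) \<subseteq> topspace X" using sub by auto
      show "topspace X \<subseteq> \<Union>(U ` topspace X)" using UK by auto
    qed
    moreover have "\<forall>V\<in>U ` topspace X. openin X V" using UK by auto
    ultimately have "\<exists>\<V>. countable \<V> \<and> \<V> \<subseteq> U ` topspace X \<and> \<Union>\<V> = topspace X"
      using \<open>Lindelof_space X\<close> unfolding Lindelof_space_def by simp
    then show thesis by (elim exE conjE) (rule that)
  qed
  obtain C where C: "countable C" "C \<subseteq> topspace X" "\<V> = U ` C"
  proof -
    have "countable \<V> \<and> \<V> \<subseteq> U ` topspace X" using V(1,2) by simp
    then show thesis unfolding countable_subset_image by (elim exE conjE) (rule that)
  qed
  define P where "P n = (if C = {} then {} else K (from_nat_into C n))" for n
  have P: "compactin X (P n)" for n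
    using UK C(2) from_nat_into[of C n] by (auto simp: P_def)
  have cov: "(\<Union>n. P n) = topspace X"
  proof
    show "(\<Union>n. P n) \<subseteq> topspace X" using compactin_subset_topspace[OF P] by blast
    show "topspace X \<subseteq> (\<Union>n. P n)"
    proof
      fix x assume "x \<in> topspace X"
      then have "x \<in> (\<Union>c\<in>C. U c)" using V(3) C(3) by simp
      then obtain c where c: "c \<in> C" "x \<in> U c" by (rule UN_E)
      then obtain n where "from_nat_into C n = c" using from_nat_into_surj[OF C(1)] by blast
      then have "x \<in> P n" using c UK C(2) by (auto simp: P_def)
      then show "x \<in> (\<Union>n. P n)" by blast
    qed
  qed
  have "\<exists>Q. \<forall>n. (compactin X (Q n) \<and> g ` Q n \<subseteq> Q n \<and> (n = 0 \<longrightarrow> Q n = {})) \<and>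
           ((\<exists>R. openin X R \<and> Q n \<subseteq> R \<and> R \<subseteq> Q (Suc n)) \<and> P n \<subseteq> Q (Suc n))" (is "\<exists>Q. \<forall>n. ?E Q n")
  proof (rule dependent_nat_choice)
    show "\<exists>Q. compactin X Q \<and> g ` Q \<subseteq> Q \<and> (0 = (0::nat) \<longrightarrow> Q = {})" by (intro exI[of _ "{}"]) auto
  next
    fix Q :: "'a set" and n :: nat
    assume Q: "compactin X Q \<and> g ` Q \<subseteq> Q \<and> (n = 0 \<longrightarrow> Q = {})"
    then have "compactin X (Q \<union> P n)" using P compactin_Un by blast
    then obtain U L where UL: "openin X U" "compactin X L" "Q \<union> P n \<subseteq> U" "U \<subseteq> L"
      using X(1,2) locally_compact_space_compact_closed_compact[of X] by metis
    have "compactin X (L \<union> g ` L)" using UL(2) image_compactin[OF UL(2) g(1)] compactin_Un by blast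
    moreover have "g ` (L \<union> g ` L) \<subseteq> L \<union> g ` L"
      using g(2) compactin_subset_topspace[OF UL(2)] by auto
    ultimately show "\<exists>Q'. (compactin X Q' \<and> g ` Q' \<subseteq> Q' \<and> (Suc n = 0 \<longrightarrow> Q' = {})) \<and>
           ((\<exists>R. openin X R \<and> Q \<subseteq> R \<and> R \<subseteq> Q') \<and> P n \<subseteq> Q')"
      using UL by (intro exI[of _ "L \<union> g ` L"]) auto
  qed
  then obtain Q where "\<forall>n. ?E Q n" by (rule exE)
  then have Q: "\<And>n. compactin X (Q n)" "\<And>n. g ` Q n \<subseteq> Q n" "Q 0 = {}"
    "\<And>n. \<exists>R. openin X R \<and> Q n \<subseteq> R \<and> R \<subseteq> Q (Suc n)" "\<And>n. P n \<subseteq> Q (Suc n)"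
    by simp_all
  have "\<forall>n. \<exists>R. openin X R \<and> Q n \<subseteq> R \<and> R \<subseteq> Q (Suc n)" using Q(4) by simp
  from choice[OF this] obtain R where "\<forall>n. openin X (R n) \<and> Q n \<subseteq> R n \<and> R n \<subseteq> Q (Suc n)" by (rule exE)
  then have R: "\<And>n. openin X (R n)" "\<And>n. Q n \<subseteq> R n" "\<And>n. R n \<subseteq> Q (Suc n)"
    by simp_all
  have "(\<Union>n. Q n) = topspace X"
  proof
    show "(\<Union>n. Q n) \<subseteq> topspace X" using compactin_subset_topspace[OF Q(1)] by auto
    show "topspace X \<subseteq> (\<Union>n. Q n)" unfolding cov[symmetric] using Q(5) by auto
  qed
  then show ?thesis using Q(1-3) R by (intro exI[of _ Q] exI[of _ R]) simp
qed

text \<open>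
  \<open>S\<close> is a class of functions that is closed under locally stationary limits, and \<open>G\<close> is a condition
  to be achieved at the points of \<open>Z\<close>. By \<open>step\<close>, near every point of \<open>Z\<close> it can be achieved on
  compact sets without losing it on a closed set where it holds, by a change within a given
  invariant neighbourhood. Along the exhaustion, the step from \<open>Q n\<close> to \<open>Q (Suc n)\<close> leaves \<open>Q (n - 1)\<close>
  alone, so the successive functions become stationary near every point.
\<close>

lemma exhaustion_gluing:
  fixes S :: "('a \<Rightarrow> 'b) \<Rightarrow> bool"
  assumes X: "locally_compact_space X" "Hausdorff_space X" "second_countable X"
    and g: "continuous_map X X g" "\<And>x. x \<in> topspace X \<Longrightarrow> g (g x) = x"
    and Z: "closedin X Z" and C0: "closedin X C0"
    and lim: "\<And>(F :: nat \<Rightarrow> 'a \<Rightarrow> 'b) f. (\<And>n. S (F n)) \<Longrightarrow>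
       (\<And>x. x \<in> topspace X \<Longrightarrow> \<exists>U N. openin X U \<and> x \<in> U \<and> (\<forall>n\<ge>N. \<forall>y\<in>U. f y = F n y)) \<Longrightarrow> S f"
    and step: "\<And>x. x \<in> Z \<Longrightarrow> \<exists>W. openin X W \<and> x \<in> W \<and> (\<forall>K N C f. compactin X K \<longrightarrow> K \<subseteq> W \<inter> Z \<longrightarrow>
        openin X N \<longrightarrow> g ` N \<subseteq> N \<longrightarrow> K \<subseteq> N \<longrightarrow> closedin X C \<longrightarrow> C0 \<subseteq> C \<longrightarrow> S f \<longrightarrow> (\<forall>y\<in>C. G y (f y)) \<longrightarrow>
        (\<exists>f'. S f' \<and> (\<forall>y\<in>C \<union> K. G y (f' y)) \<and> (\<forall>y\<in>topspace X - N. f' y = f y)))"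
    and f0: "S f0" "\<And>y. y \<in> C0 \<Longrightarrow> G y (f0 y)"
  shows "\<exists>f. S f \<and> (\<forall>y\<in>C0 \<union> Z. G y (f y))"
proof -
  have reg: "regular_space X" using locally_compact_Hausdorff_imp_regular_space X by blast
  define P where "P x W \<longleftrightarrow> (\<forall>K N C f. compactin X K \<longrightarrow> K \<subseteq> W \<inter> Z \<longrightarrow>
        openin X N \<longrightarrow> g ` N \<subseteq> N \<longrightarrow> K \<subseteq> N \<longrightarrow> closedin X C \<longrightarrow> C0 \<subseteq> C \<longrightarrow> S f \<longrightarrow> (\<forall>y\<in>C. G y (f y)) \<longrightarrow>
        (\<exists>f'. S f' \<and> (\<forall>y\<in>C \<union> K. G y (f' y)) \<and> (\<forall>y\<in>topspace X - N. f' y = f y)))" for x :: 'a and W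
  have "\<exists>W. openin X W \<and> x \<in> W \<and> P x W" if "x \<in> Z" for x
    unfolding P_def by (rule step[OF that])
  then obtain W where W: "\<And>x. x \<in> Z \<Longrightarrow> openin X (W x)" "\<And>x. x \<in> Z \<Longrightarrow> x \<in> W x" and PW: "\<And>x. x \<in> Z \<Longrightarrow> P x (W x)"
    by metis
  note Wstep = PW[unfolded P_def, rule_format]
  have "\<exists>U V. openin X U \<and> compactin X V \<and> x \<in> U \<and> U \<subseteq> V \<and> V \<subseteq> W x" if "x \<in> Z" for x
    using locally_compact_imp_neighbourhood_base[OF X(1) reg] W[OF that] unfolding neighbourhood_base_of by blast
  then obtain U V where UV: "\<And>x. x \<in> Z \<Longrightarrow> openin X (U x) \<and> compactin X (V x) \<and> x \<in> U x \<and> U x \<subseteq> V x \<and> V x \<subseteq> W x"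
    by metis
  \<comment> \<open>the local modifications are combined along a finite cover of a compact set\<close>
  have compact_step: "\<exists>f'. S f' \<and> (\<forall>y\<in>C \<union> L. G y (f' y)) \<and> (\<forall>y\<in>topspace X - N. f' y = f y)"
    if L: "compactin X L" "L \<subseteq> Z" and N: "openin X N" "g ` N \<subseteq> N" "L \<subseteq> N"
      and C: "closedin X C" "C0 \<subseteq> C" and f: "S f" "\<forall>y\<in>C. G y (f y)" for L N C f
  proof -
    obtain D where D: "finite D" "D \<subseteq> L" "L \<subseteq> (\<Union>x\<in>D. U x)"
    proof -
      have "\<exists>\<F>. finite \<F> \<and> \<F> \<subseteq> U ` L \<and> L \<subseteq> \<Union>\<F>"
        by (rule compactinD[OF L(1)]) (use UV L(2) in blast)+
      then show thesis using that by (metis finite_subset_image)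
    qed
    have cK: "compactin X (L \<inter> V x)" if "x \<in> D" for x
      using that D(2) L(2) UV compactin_imp_closedin[OF X(2)] compact_Int_closedin[OF L(1)] by blast
    have "D' \<subseteq> D \<Longrightarrow> \<exists>f'. S f' \<and> (\<forall>y\<in>C \<union> (\<Union>x\<in>D'. L \<inter> V x). G y (f' y)) \<and> (\<forall>y\<in>topspace X - N. f' y = f y)"
      if "finite D'" for D' using that
    proof (induction D' rule: finite_induct)
      case empty then show ?case using f by auto
    next
      case (insert x D')
      then obtain f' where f': "S f'" "\<forall>y\<in>C \<union> (\<Union>x\<in>D'. L \<inter> V x). G y (f' y)" "\<forall>y\<in>topspace X - N. f' y = f y"
        by auto
      have xZ: "x \<in> Z" "x \<in> D" using insert.prems D(2) L(2) by auto
      have cl: "closedin X (C \<union> (\<Union>x\<in>D'. L \<inter> V x))"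
        using insert C(1) cK compactin_imp_closedin[OF X(2)] by (intro closedin_Un closedin_Union) auto
      have "\<exists>f''. S f'' \<and> (\<forall>y\<in>(C \<union> (\<Union>x\<in>D'. L \<inter> V x)) \<union> (L \<inter> V x). G y (f'' y)) \<and> (\<forall>y\<in>topspace X - N. f'' y = f' y)"
        by (rule Wstep[OF xZ(1) cK[OF xZ(2)] _ N(1,2)]) (use cl f' UV[OF xZ(1)] L N C in auto)
      then obtain f'' where "S f''" "\<forall>y\<in>(C \<union> (\<Union>x\<in>D'. L \<inter> V x)) \<union> (L \<inter> V x). G y (f'' y)" "\<forall>y\<in>topspace X - N. f'' y = f' y"
        by blast
      then show ?case using f'(3) by (intro exI[of _ f'']) auto
    qed
    from this[OF D(1) order_refl]
    obtain f' where f': "S f'" "\<forall>y\<in>C \<union> (\<Union>x\<in>D. L \<inter> V x). G y (f' y)" "\<forall>y\<in>topspace X - N. f' y = f y" by blast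
    have "L \<subseteq> (\<Union>x\<in>D. L \<inter> V x)" 
    proof
      fix y assume y: "y \<in> L"
      then obtain x where x: "x \<in> D" "y \<in> U x" using D(3) by auto
      then have "x \<in> Z" using D(2) L(2) by auto
      then have "y \<in> V x" using UV x(2) by auto
      then show "y \<in> (\<Union>x\<in>D. L \<inter> V x)" using x(1) y by auto
    qed
    then have "\<forall>y\<in>C \<union> L. G y (f' y)" using f'(2) by auto
    then show ?thesis using f'(1,3) by (intro exI[of _ f'] conjI)
  qed
  have "\<exists>Q R. (\<forall>n. compactin X (Q n) \<and> openin X (R n) \<and> g ` Q n \<subseteq> Q n \<and> Q n \<subseteq> R n \<and> R n \<subseteq> Q (Suc n)) \<and>
    Q 0 = {} \<and> (\<Union>n. Q n) = topspace X" (is "\<exists>Q R. ?E Q R")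
    using invariant_exhaustion[OF X g] by simp
  then obtain Q R where "?E Q R" by (elim exE)
  then have Q: "\<And>n. compactin X (Q n)" and R: "\<And>n. openin X (R n)" and gQ: "\<And>n. g ` Q n \<subseteq> Q n"
    and QR: "\<And>n. Q n \<subseteq> R n" "\<And>n. R n \<subseteq> Q (Suc n)" and Q0: "Q 0 = {}" and cov: "(\<Union>n. Q n) = topspace X"
    by simp_all
  have clQ: "closedin X (Q n)" for n using compactin_imp_closedin[OF X(2) Q] .
  have mono: "Q m \<subseteq> Q n" if "m \<le> n" for m n
    by (rule lift_Suc_mono_le[of Q, OF _ that]) (use QR in blast)
  have "\<exists>F. \<forall>n. (S (F n) \<and> (\<forall>y\<in>C0 \<union> (Q n \<inter> Z). G y (F n y))) \<and> (\<forall>y\<in>Q (n - 1). F (Suc n) y = F n y)" (is "\<exists>F. \<forall>n. ?E F n")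
  proof (rule dependent_nat_choice)
    show "\<exists>f. S f \<and> (\<forall>y\<in>C0 \<union> (Q 0 \<inter> Z). G y (f y))" using f0 Q0 by auto
  next
    fix f n assume f: "S f \<and> (\<forall>y\<in>C0 \<union> (Q n \<inter> Z). G y (f y))"
    \<comment> \<open>\<open>Q (n - 1) \<subseteq> I \<subseteq> Q n\<close>: the condition already holds on \<open>I\<close>, and changes outside \<open>I\<close> can avoid
      \<open>Q (n - 1)\<close>. For \<open>n = 0\<close> nothing has to be avoided, as \<open>Q 0\<close> is empty.\<close>
    define I where "I = (if n = 0 then {} else R (n - 1))"
    have I: "openin X I" "Q (n - 1) \<subseteq> I" "I \<subseteq> Q n"
      using R Q0 QR(1)[of "n - 1"] QR(2)[of "n - 1"] by (auto simp: I_def)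
    define L where "L = Q (Suc n) \<inter> (Z \<inter> (topspace X - I))"
    have L: "compactin X L" unfolding L_def
      by (intro compact_Int_closedin Q closedin_Int Z closedin_diff) (use I in auto)
    define N where "N = topspace X - Q (n - 1)"
    have N: "openin X N" using clQ by (auto simp: N_def)
    have gN: "g ` N \<subseteq> N"
    proof
      fix z assume "z \<in> g ` N"
      then obtain y where y: "y \<in> topspace X" "y \<notin> Q (n - 1)" "z = g y" by (auto simp: N_def)
      have "z \<in> topspace X" using continuous_map_image_subset_topspace[OF g(1)] y by blast
      moreover have "z \<notin> Q (n - 1)"
      proof
        assume "z \<in> Q (n - 1)"
        then have "g z \<in> Q (n - 1)" using gQ by blast
        then show False using y g(2) by simp
      qed
      ultimately show "z \<in> N" by (simp add: N_def)
    qed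
    have LN: "L \<subseteq> N" using I(2) by (auto simp: L_def N_def)
    have LZ: "L \<subseteq> Z" by (auto simp: L_def)
    obtain f' where f': "S f'" "\<forall>y\<in>(C0 \<union> (Q n \<inter> Z)) \<union> L. G y (f' y)" "\<forall>y\<in>topspace X - N. f' y = f y"
      using compact_step[OF L LZ N gN LN, of "C0 \<union> (Q n \<inter> Z)" f] f closedin_Un[OF C0 closedin_Int[OF clQ Z]] by blast
    have "Q (Suc n) \<inter> Z \<subseteq> (Q n \<inter> Z) \<union> L"
      using I(3) compactin_subset_topspace[OF Q] by (auto simp: L_def)
    moreover have "Q (n - 1) \<subseteq> topspace X - N"
      using compactin_subset_topspace[OF Q] by (auto simp: N_def)
    ultimately show "\<exists>f'. (S f' \<and> (\<forall>y\<in>C0 \<union> (Q (Suc n) \<inter> Z). G y (f' y))) \<and> (\<forall>y\<in>Q (n - 1). f' y = f y)"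
      using f' by (intro exI[of _ f']) blast
  qed
  then obtain F where "\<forall>n. ?E F n" by (rule exE)
  then have F: "\<And>n. S (F n)" "\<And>n y. y \<in> C0 \<union> (Q n \<inter> Z) \<Longrightarrow> G y (F n y)" 
    "\<And>n y. y \<in> Q (n - 1) \<Longrightarrow> F (Suc n) y = F n y"
    by simp_all
  have stat: "F n y = F (Suc k) y" if "y \<in> Q k" "n \<ge> Suc k" for n k y
    using that(2)
  proof (induction n rule: dec_induct)
    case (step n)
    then have "k \<le> n - 1" by linarith
    then have "y \<in> Q (n - 1)" using mono[of k "n - 1"] that(1) by auto
    then show ?case using F(3) step by simp
  qed simp
  \<comment> \<open>From stage \<open>Suc k\<close> on, the functions no longer change on \<open>Q k\<close>.\<close>
  define f where "f y = F (Suc (LEAST k. y \<in> Q k)) y" for y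
  have f_eq: "f y = F n y" if "y \<in> Q k" "n \<ge> Suc k" for y k n
  proof -
    have "y \<in> Q (LEAST k. y \<in> Q k)" "(LEAST k. y \<in> Q k) \<le> k" using that(1) by (auto intro: LeastI Least_le)
    then show ?thesis using stat[of y "LEAST k. y \<in> Q k" n] that(2) by (simp add: f_def)
  qed
  show ?thesis
  proof (intro exI[of _ f] conjI ballI)
    show "S f"
    proof (rule lim[of F f])
      show "S (F n)" for n by (rule F(1))
      fix x assume "x \<in> topspace X"
      then obtain k where "x \<in> Q k" using cov by blast
      then show "\<exists>U N. openin X U \<and> x \<in> U \<and> (\<forall>n\<ge>N. \<forall>y\<in>U. f y = F n y)"
        using R[of k] QR[of k] f_eq[of _ "Suc k"] by (intro exI[of _ "R k"] exI[of _ "Suc (Suc k)"]) auto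
    qed
    fix y assume y: "y \<in> C0 \<union> Z"
    then have "y \<in> topspace X" using closedin_subset[OF Z] closedin_subset[OF C0] by auto
    then obtain k where k: "y \<in> Q k" using cov by blast
    then have "y \<in> C0 \<union> (Q (Suc k) \<inter> Z)" using y mono[of k "Suc k"] by auto
    then show "G y (f y)" using F(2)[of y "Suc k"] f_eq[OF k order_refl] by simp
  qed
qed

section \<open>Fibrewise algebra\<close>

text \<open>A local trivialization, split into its fibre coordinate and its inverse.\<close>

definition local_frame ::
    "'m topology \<Rightarrow> ('m, 'e) c2_bundle \<Rightarrow> 'm set \<Rightarrow> nat \<Rightarrow> ('e \<Rightarrow> nat \<Rightarrow> real) \<Rightarrow> ('m \<Rightarrow> (nat \<Rightarrow> real) \<Rightarrow> 'e) \<Rightarrow> bool" where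
  "local_frame X \<xi> U r c k \<longleftrightarrow> openin X U \<and>
     continuous_map (subtopology (total \<xi>) {e \<in> topspace (total \<xi>). proj \<xi> e \<in> U}) (Euclidean_space r) c \<and>
     continuous_map (prod_topology (subtopology X U) (Euclidean_space r)) (total \<xi>) (\<lambda>(x, v). k x v) \<and>
     (\<forall>x\<in>U. \<forall>v\<in>Eucl r. k x v \<in> fibre \<xi> x \<and> c (k x v) = v) \<and>
     (\<forall>x\<in>U. \<forall>e\<in>fibre \<xi> x. c e \<in> Eucl r \<and> k x (c e) = e \<and>
        (\<forall>e'\<in>fibre \<xi> x. c (vadd \<xi> e e') = (\<lambda>i. c e i + c e' i)) \<and>
        (\<forall>a. c (vscale \<xi> a e) = (\<lambda>i. a * c e i)))"

lemma local_frame_exists: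
  assumes \<xi>: "vector_bundle X \<xi>" and x: "x \<in> topspace X"
  obtains U r c k where "x \<in> U" "local_frame X \<xi> U r c k"
proof -
  obtain U r h where U: "openin X U" "x \<in> U" and h: "local_trivialization X \<xi> U r h"
    using \<xi> x unfolding vector_bundle_def by blast
  define TU where "TU = {e \<in> topspace (total \<xi>). proj \<xi> e \<in> U}"
  have UX: "U \<subseteq> topspace X" using openin_subset[OF U(1)] .
  have "homeomorphic_map (subtopology (total \<xi>) TU) (prod_topology (subtopology X U) (Euclidean_space r)) h"
    using h by (simp add: local_trivialization_def TU_def)
  then obtain h' where hh: "homeomorphic_maps (subtopology (total \<xi>) TU) (prod_topology (subtopology X U) (Euclidean_space r)) h h'"
    using homeomorphic_map_maps by blast
  have ch: "continuous_map (subtopology (total \<xi>) TU) (prod_topology (subtopology X U) (Euclidean_space r)) h"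
    and ch': "continuous_map (prod_topology (subtopology X U) (Euclidean_space r)) (subtopology (total \<xi>) TU) h'"
    using hh by (auto simp: homeomorphic_maps_def)
  have TU: "topspace (total \<xi>) \<inter> TU = TU" by (auto simp: TU_def)
  have h'h: "h' (h e) = e" if "e \<in> TU" for e
    using hh that TU by (auto simp: homeomorphic_maps_def)
  have hh': "h (h' (x, v)) = (x, v)" if "x \<in> U" "v \<in> Eucl r" for x v
    using hh that UX by (auto simp: homeomorphic_maps_def)
  have h'TU: "h' (x, v) \<in> TU" if "x \<in> U" "v \<in> Eucl r" for x v
    using continuous_map_image_subset_topspace[OF ch'] that UX TU by auto
  have hE: "snd (h e) \<in> Eucl r" if "e \<in> TU" for e
    using continuous_map_image_subset_topspace[OF ch] that TU by auto
  have fst_h: "fst (h e) = proj \<xi> e" if "e \<in> TU" for e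
    using h that unfolding local_trivialization_def TU_def fibre_def by blast
  have fib: "fibre \<xi> x \<subseteq> TU" if "x \<in> U" for x using that by (auto simp: fibre_def TU_def)
  have "local_frame X \<xi> U r (\<lambda>e. snd (h e)) (\<lambda>x v. h' (x, v))"
    unfolding local_frame_def
  proof (intro conjI ballI allI)
    show "continuous_map (subtopology (total \<xi>) {e \<in> topspace (total \<xi>). proj \<xi> e \<in> U}) (Euclidean_space r) (\<lambda>e. snd (h e))"
      using continuous_map_compose[OF ch continuous_map_snd] by (simp add: o_def TU_def)
    show "continuous_map (prod_topology (subtopology X U) (Euclidean_space r)) (total \<xi>) (\<lambda>(x, v). h' (x, v))"
      using ch' by (simp add: continuous_map_in_subtopology)
    fix x assume x: "x \<in> U"
    { fix v assume v: "v \<in> Eucl r"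
      have "proj \<xi> (h' (x, v)) = x" using fst_h[OF h'TU[OF x v]] hh'[OF x v] by simp
      then show "h' (x, v) \<in> fibre \<xi> x" using h'TU[OF x v] by (simp add: fibre_def TU_def)
      show "snd (h (h' (x, v))) = v" using hh'[OF x v] by simp }
    fix e assume e: "e \<in> fibre \<xi> x"
    then have "e \<in> TU" "proj \<xi> e = x" using fib[OF x] by (auto simp: fibre_def)
    then show "snd (h e) \<in> Eucl r" "h' (x, snd (h e)) = e"
      using hE h'h fst_h by (metis prod.collapse)+
    show "snd (h (vadd \<xi> e e')) = (\<lambda>i. snd (h e) i + snd (h e') i)" if "e' \<in> fibre \<xi> x" for e'
      using h x e that unfolding local_trivialization_def by blast
    show "snd (h (vscale \<xi> a e)) = (\<lambda>i. a * snd (h e) i)" for a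
      using h x e unfolding local_trivialization_def by blast
  qed (rule U(1))
  then show thesis using that U(2) by blast
qed

lemma local_frameD:
  assumes "local_frame X \<xi> U r c k" "x \<in> U"
  shows "v \<in> Eucl r \<Longrightarrow> k x v \<in> fibre \<xi> x" "v \<in> Eucl r \<Longrightarrow> c (k x v) = v"
    "e \<in> fibre \<xi> x \<Longrightarrow> c e \<in> Eucl r" "e \<in> fibre \<xi> x \<Longrightarrow> k x (c e) = e"
    "e \<in> fibre \<xi> x \<Longrightarrow> e' \<in> fibre \<xi> x \<Longrightarrow> c (vadd \<xi> e e') = (\<lambda>i. c e i + c e' i)"
    "e \<in> fibre \<xi> x \<Longrightarrow> c (vscale \<xi> a e) = (\<lambda>i. a * c e i)"
  using assms unfolding local_frame_def by auto

text \<open>The record has no zero section; any vector of the fibre may be multiplied by 0.\<close>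

definition vzero :: "('m, 'e) c2_bundle \<Rightarrow> 'm \<Rightarrow> 'e" where
  "vzero \<xi> x = vscale \<xi> 0 (SOME e. e \<in> fibre \<xi> x)"

text \<open>
  The vector $e + \sum_{j<p} a_j w_j$, by recursion because the operations on the fibres are not
  those of a type class.
\<close>

primrec vcomb :: "('m, 'e) c2_bundle \<Rightarrow> nat \<Rightarrow> 'e \<Rightarrow> (nat \<Rightarrow> 'e) \<Rightarrow> (nat \<Rightarrow> real) \<Rightarrow> 'e" where
  "vcomb \<xi> 0 e w a = e"
| "vcomb \<xi> (Suc p) e w a = vadd \<xi> (vcomb \<xi> p e w a) (vscale \<xi> (a p) (w p))"

locale c2_bundle_over =
  fixes M :: "'m c2_manifold" and \<xi> :: "('m, 'e) c2_bundle"
  assumes manifold: "smooth_c2_manifold M" and is_bundle: "c2_vector_bundle M \<xi>"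
begin

abbreviation "X \<equiv> mtop M"
abbreviation "T \<equiv> total \<xi>"
abbreviation "g \<equiv> flip M"
abbreviation "fib \<equiv> fibre \<xi>"

lemma vbundle: "vector_bundle X \<xi>" using is_bundle by (simp add: c2_vector_bundle_def)

lemma g_cont: "continuous_map X X g" and gg: "x \<in> topspace X \<Longrightarrow> g (g x) = x"
  using manifold by (auto simp: smooth_c2_manifold_def)

lemma g_in: "x \<in> topspace X \<Longrightarrow> g x \<in> topspace X"
  using continuous_map_image_subset_topspace[OF g_cont] by blast

lemma proj_cont: "continuous_map T X (proj \<xi>)" using vbundle by (simp add: vector_bundle_def)

lemma proj_in: "e \<in> topspace T \<Longrightarrow> proj \<xi> e \<in> topspace X"
  using continuous_map_image_subset_topspace[OF proj_cont] by blast

lemma fib_iff: "e \<in> fib x \<longleftrightarrow> e \<in> topspace T \<and> proj \<xi> e = x" by (auto simp: fibre_def)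

lemma fib_base: "e \<in> fib x \<Longrightarrow> x \<in> topspace X" using proj_in by (auto simp: fib_iff)

lemma add_fib: "e \<in> fib x \<Longrightarrow> e' \<in> fib x \<Longrightarrow> vadd \<xi> e e' \<in> fib x"
  and scale_fib: "e \<in> fib x \<Longrightarrow> vscale \<xi> a e \<in> fib x"
  using vbundle fib_base unfolding vector_bundle_def by blast+

lemma act_cont: "continuous_map T T (act \<xi>)"
  and act_act: "e \<in> fib x \<Longrightarrow> act \<xi> (act \<xi> e) = e"
  and act_fib: "e \<in> fib x \<Longrightarrow> act \<xi> e \<in> fib (g x)"
proof -
  show c: "continuous_map T T (act \<xi>)" using is_bundle by (simp add: c2_vector_bundle_def)
  show "e \<in> fib x \<Longrightarrow> act \<xi> (act \<xi> e) = e" "e \<in> fib x \<Longrightarrow> act \<xi> e \<in> fib (g x)"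
    using is_bundle continuous_map_image_subset_topspace[OF c] by (auto simp: c2_vector_bundle_def fib_iff)
qed

lemma act_add: "e \<in> fib x \<Longrightarrow> e' \<in> fib x \<Longrightarrow> act \<xi> (vadd \<xi> e e') = vadd \<xi> (act \<xi> e) (act \<xi> e')"
  and act_scale: "e \<in> fib x \<Longrightarrow> act \<xi> (vscale \<xi> a e) = vscale \<xi> a (act \<xi> e)"
  using is_bundle fib_base unfolding c2_vector_bundle_def by blast+

lemma frame: 
  assumes "x \<in> topspace X"
  obtains U r c k where "x \<in> U" "local_frame X \<xi> U r c k"
  using local_frame_exists[OF vbundle assms] by blast

text \<open>Linear coordinates on a single fibre; every identity between vectors is checked in these.\<close>

lemma fib_coords:
  assumes "x \<in> topspace X"
  shows "\<exists>c r. inj_on c (fib x) \<and> c ` fib x = Eucl r \<and>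
    (\<forall>e\<in>fib x. (\<forall>e'\<in>fib x. c (vadd \<xi> e e') = (\<lambda>i. c e i + c e' i)) \<and> (\<forall>a. c (vscale \<xi> a e) = (\<lambda>i. a * c e i)))"
proof -
  obtain U r c k where U: "x \<in> U" "local_frame X \<xi> U r c k" by (rule frame[OF assms])
  show ?thesis
  proof (intro exI[of _ c] exI[of _ r] conjI)
    show "inj_on c (fib x)" using U by (intro inj_on_inverseI[where g="k x"]) (auto simp: local_frame_def)
    show "c ` fib x = Eucl r"
    proof
      show "c ` fib x \<subseteq> Eucl r" using U by (auto simp: local_frame_def)
      show "Eucl r \<subseteq> c ` fib x"
      proof
        fix v assume v: "v \<in> Eucl r"
        then have "k x v \<in> fib x" "c (k x v) = v" using U by (auto simp: local_frame_def)
        then show "v \<in> c ` fib x" by (metis imageI)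
      qed
    qed
  qed (use U in \<open>auto simp: local_frame_def\<close>)
qed

lemma fib_nonempty: 
  assumes "x \<in> topspace X" shows "(SOME e. e \<in> fib x) \<in> fib x"
proof -
  obtain c r where "c ` fib x = Eucl r" using fib_coords[OF assms] by blast
  moreover have "(\<lambda>i. 0) \<in> Eucl r" by (simp add: Eucl_def)
  ultimately have "\<exists>e. e \<in> fib x" by (metis image_iff)
  then show ?thesis by (rule someI_ex)
qed

lemma zero_fib: "x \<in> topspace X \<Longrightarrow> vzero \<xi> x \<in> fib x"
  unfolding vzero_def by (rule scale_fib[OF fib_nonempty])

lemma vec_add_commute: "e \<in> fib x \<Longrightarrow> e' \<in> fib x \<Longrightarrow> vadd \<xi> e e' = vadd \<xi> e' e"
  and vec_add_assoc: "e \<in> fib x \<Longrightarrow> e' \<in> fib x \<Longrightarrow> e'' \<in> fib x \<Longrightarrow> vadd \<xi> (vadd \<xi> e e') e'' = vadd \<xi> e (vadd \<xi> e' e'')"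
  and vec_add_zero: "e \<in> fib x \<Longrightarrow> vadd \<xi> e (vzero \<xi> x) = e"
  and vec_scale_add: "e \<in> fib x \<Longrightarrow> e' \<in> fib x \<Longrightarrow> vscale \<xi> a (vadd \<xi> e e') = vadd \<xi> (vscale \<xi> a e) (vscale \<xi> a e')"
  and vec_add_scale: "e \<in> fib x \<Longrightarrow> vadd \<xi> (vscale \<xi> a e) (vscale \<xi> b e) = vscale \<xi> (a + b) e"
  and vec_scale_scale: "e \<in> fib x \<Longrightarrow> vscale \<xi> a (vscale \<xi> b e) = vscale \<xi> (a * b) e"
  and vec_scale_one: "e \<in> fib x \<Longrightarrow> vscale \<xi> 1 e = e"
  and vec_scale_zero: "e \<in> fib x \<Longrightarrow> vscale \<xi> 0 e = vzero \<xi> x"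
proof -
  assume e: "e \<in> fib x"
  then have x: "x \<in> topspace X" by (rule fib_base)
  obtain c r where inj: "inj_on c (fib x)" and "c ` fib x = Eucl r" and
    lin: "\<forall>e\<in>fib x. (\<forall>e'\<in>fib x. c (vadd \<xi> e e') = (\<lambda>i. c e i + c e' i)) \<and> (\<forall>a. c (vscale \<xi> a e) = (\<lambda>i. a * c e i))"
    using fib_coords[OF x] by (elim exE conjE) (rule that)
  have add: "\<And>e e'. e \<in> fib x \<Longrightarrow> e' \<in> fib x \<Longrightarrow> c (vadd \<xi> e e') = (\<lambda>i. c e i + c e' i)"
    and scale: "\<And>a e. e \<in> fib x \<Longrightarrow> c (vscale \<xi> a e) = (\<lambda>i. a * c e i)" using lin by auto
  have zero: "c (vzero \<xi> x) = (\<lambda>i. 0)" unfolding vzero_def by (simp add: scale[OF fib_nonempty[OF x]])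
  note simps = add scale zero add_fib scale_fib zero_fib[OF x] e
  note eq = inj_onD[OF inj]
  show "vadd \<xi> e (vzero \<xi> x) = e" "vadd \<xi> (vscale \<xi> a e) (vscale \<xi> b e) = vscale \<xi> (a + b) e"
    "vscale \<xi> a (vscale \<xi> b e) = vscale \<xi> (a * b) e" "vscale \<xi> 1 e = e" "vscale \<xi> 0 e = vzero \<xi> x"
    by (rule eq; simp add: simps algebra_simps)+
  { assume e': "e' \<in> fib x"
    show "vadd \<xi> e e' = vadd \<xi> e' e" "vscale \<xi> a (vadd \<xi> e e') = vadd \<xi> (vscale \<xi> a e) (vscale \<xi> a e')"
      by (rule eq; simp add: simps e' algebra_simps)+
    show "vadd \<xi> (vadd \<xi> e e') e'' = vadd \<xi> e (vadd \<xi> e' e'')" if "e'' \<in> fib x"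
      by (rule eq; simp add: simps e' that algebra_simps) }
qed

lemma vec_scale_vzero: "x \<in> topspace X \<Longrightarrow> vscale \<xi> a (vzero \<xi> x) = vzero \<xi> x"
  using vec_scale_scale[OF fib_nonempty, of x a 0] by (simp add: vzero_def)

lemma act_vzero: "x \<in> topspace X \<Longrightarrow> act \<xi> (vzero \<xi> x) = vzero \<xi> (g x)"
  using act_scale[OF fib_nonempty, of x 0] vec_scale_zero[OF act_fib[OF fib_nonempty], of x] by (simp add: vzero_def[of _ x])

lemma frame_zero: 
  assumes "local_frame X \<xi> U r c k" "x \<in> U"
  shows "c (vzero \<xi> x) = (\<lambda>i. 0)"
proof -
  have "x \<in> topspace X" using assms openin_subset unfolding local_frame_def by blast
  then show ?thesis using local_frameD(6)[OF assms fib_nonempty[of x]] unfolding vzero_def by simp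
qed

lemma vcomb_fib: "e \<in> fib x \<Longrightarrow> (\<And>j. j < p \<Longrightarrow> w j \<in> fib x) \<Longrightarrow> vcomb \<xi> p e w a \<in> fib x"
  by (induction p) (auto intro: add_fib scale_fib)

lemma vcomb_coord:
  assumes "local_frame X \<xi> U r c k" "x \<in> U" "e \<in> fib x" "\<And>j. j < p \<Longrightarrow> w j \<in> fib x"
  shows "c (vcomb \<xi> p e w a) i = c e i + (\<Sum>j<p. a j * c (w j) i)"
  using assms(4)
proof (induction p)
  case (Suc p)
  then have "vcomb \<xi> p e w a \<in> fib x" "vscale \<xi> (a p) (w p) \<in> fib x" "w p \<in> fib x"
    using assms(3) by (auto intro!: vcomb_fib scale_fib)
  then show ?case using Suc assms(1,2) by (simp add: local_frame_def)
qed simp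

lemma vcomb_zero: "e \<in> fib x \<Longrightarrow> (\<And>j. j < p \<Longrightarrow> w j \<in> fib x) \<Longrightarrow> (\<And>j. j < p \<Longrightarrow> a j = 0) \<Longrightarrow> vcomb \<xi> p e w a = e"
proof (induction p)
  case (Suc p)
  then have "w p \<in> fib x" by simp
  then show ?case using Suc by (simp add: vec_scale_zero[of _ x] vec_add_zero)
qed simp

lemma vcomb_act: 
  assumes "e \<in> fib x" "\<And>j. j < p \<Longrightarrow> w j \<in> fib x"
  shows "act \<xi> (vcomb \<xi> p e w a) = vcomb \<xi> p (act \<xi> e) (\<lambda>j. act \<xi> (w j)) a"
  using assms(2)
proof (induction p)
  case (Suc p)
  then have "vcomb \<xi> p e w a \<in> fib x" "vscale \<xi> (a p) (w p) \<in> fib x" "w p \<in> fib x"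
    using assms(1) by (auto intro!: vcomb_fib scale_fib)
  then show ?case using Suc by (simp add: act_add[of _ x] act_scale[of _ x])
qed simp

lemma vcomb_scale: 
  assumes "e \<in> fib x" "\<And>j. j < p \<Longrightarrow> w j \<in> fib x"
  shows "vscale \<xi> b (vcomb \<xi> p e w a) = vcomb \<xi> p (vscale \<xi> b e) (\<lambda>j. vscale \<xi> b (w j)) a"
  using assms(2)
proof (induction p)
  case (Suc p)
  then have "vcomb \<xi> p e w a \<in> fib x" "vscale \<xi> (a p) (w p) \<in> fib x" "w p \<in> fib x"
    using assms(1) by (auto intro!: vcomb_fib scale_fib)
  then show ?case using Suc by (simp add: vec_scale_add[of _ x] vec_scale_scale[of _ x] mult.commute)
qed simp

lemma vcomb_cong: "(\<And>j. j < p \<Longrightarrow> w j = w' j) \<Longrightarrow> (\<And>j. j < p \<Longrightarrow> a j = a' j) \<Longrightarrow> vcomb \<xi> p e w a = vcomb \<xi> p e w' a'"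
  by (induction p) auto

subsection \<open>Continuity\<close>

lemma frame_assembly_continuous:
  assumes f: "local_frame X \<xi> U r c k" and b: "continuous_map Z X b" "b ` topspace Z \<subseteq> U"
    and v: "continuous_map Z (Euclidean_space r) v"
  shows "continuous_map Z T (\<lambda>z. k (b z) (v z))"
proof -
  have "continuous_map Z (prod_topology (subtopology X U) (Euclidean_space r)) (\<lambda>z. (b z, v z))"
    using b v by (auto simp: continuous_map_pairwise o_def continuous_map_in_subtopology)
  from continuous_map_compose[OF this, of T "\<lambda>(x, v). k x v"] f
  show ?thesis by (simp add: local_frame_def o_def)
qed

lemma frame_coord_continuous:
  assumes f: "local_frame X \<xi> U r c k" and e: "continuous_map Z T e" "\<And>z. z \<in> topspace Z \<Longrightarrow> proj \<xi> (e z) \<in> U"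
  shows "continuous_map Z (Euclidean_space r) (\<lambda>z. c (e z))"
proof -
  have "continuous_map Z (subtopology T {e \<in> topspace T. proj \<xi> e \<in> U}) e"
    using e continuous_map_image_subset_topspace[OF e(1)] by (auto simp: continuous_map_in_subtopology)
  from continuous_map_compose[OF this, of _ c] f show ?thesis by (auto simp: local_frame_def o_def)
qed

lemma base_continuous: "continuous_map Z T e \<Longrightarrow> continuous_map Z X (\<lambda>z. proj \<xi> (e z))"
  using continuous_map_compose[OF _ proj_cont] by (simp add: o_def)

lemma image_total: "continuous_map Z T e \<Longrightarrow> z \<in> topspace Z \<Longrightarrow> e z \<in> topspace T"
  using continuous_map_image_subset_topspace by blast

lemma continuous_via_frames:
  assumes b: "continuous_map Z X b"
    and loc: "\<And>U r c k. local_frame X \<xi> U r c k \<Longrightarrow> continuous_map (subtopology Z {z \<in> topspace Z. b z \<in> U}) Y f"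
  shows "continuous_map Z Y f"
proof (rule continuous_map_locally)
  fix z assume z: "z \<in> topspace Z"
  then have "b z \<in> topspace X" using continuous_map_image_subset_topspace[OF b] by blast
  then obtain U r c k where U: "b z \<in> U" "local_frame X \<xi> U r c k" by (rule frame)
  have "openin Z {z \<in> topspace Z. b z \<in> U}"
    by (rule openin_continuous_map_preimage[OF b]) (use U in \<open>simp add: local_frame_def\<close>)
  then show "\<exists>U. openin Z U \<and> z \<in> U \<and> continuous_map (subtopology Z U) Y f"
    using z U loc by blast
qed

lemma add_continuous:
  assumes e: "continuous_map Z T e" and e': "continuous_map Z T e'"
    and p: "\<And>z. z \<in> topspace Z \<Longrightarrow> proj \<xi> (e z) = proj \<xi> (e' z)"
  shows "continuous_map Z T (\<lambda>z. vadd \<xi> (e z) (e' z))"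
proof (rule continuous_via_frames[OF base_continuous[OF e]])
  fix U r c k assume f: "local_frame X \<xi> U r c k"
  define Z' where "Z' = subtopology Z {z \<in> topspace Z. proj \<xi> (e z) \<in> U}"
  have Z': "z \<in> topspace Z'" "z \<in> topspace Z \<and> proj \<xi> (e z) \<in> U" if "z \<in> topspace Z'" for z
    using that by (auto simp: Z'_def)
  have c1: "continuous_map Z' T e" "continuous_map Z' T e'"
    using e e' by (auto simp: Z'_def intro: continuous_map_from_subtopology)
  have "continuous_map Z' (Euclidean_space r) (\<lambda>z i. c (e z) i + c (e' z) i)"
    by (intro continuous_map_Euclidean_space_add frame_coord_continuous[OF f] c1) (use Z' p[symmetric] in auto)
  then have "continuous_map Z' T (\<lambda>z. k (proj \<xi> (e z)) (\<lambda>i. c (e z) i + c (e' z) i))"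
    by (intro frame_assembly_continuous[OF f] base_continuous c1) (use Z' in auto)
  then show "continuous_map (subtopology Z {z \<in> topspace Z. proj \<xi> (e z) \<in> U}) T (\<lambda>z. vadd \<xi> (e z) (e' z))"
    unfolding Z'_def[symmetric]
  proof (rule continuous_map_eq)
    fix z assume z: "z \<in> topspace Z'"
    define x where "x = proj \<xi> (e z)"
    have "e z \<in> fib x" "e' z \<in> fib x" "x \<in> U"
      using Z'[OF z] p image_total[OF e] image_total[OF e'] by (auto simp: fib_iff x_def)
    note e = this
    have "k x (c (vadd \<xi> (e z) (e' z))) = vadd \<xi> (e z) (e' z)"
      by (rule local_frameD(4)[OF f e(3) add_fib[OF e(1,2)]])
    moreover have "c (vadd \<xi> (e z) (e' z)) = (\<lambda>i. c (e z) i + c (e' z) i)"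
      by (rule local_frameD(5)[OF f e(3,1,2)])
    ultimately show "k (proj \<xi> (e z)) (\<lambda>i. c (e z) i + c (e' z) i) = vadd \<xi> (e z) (e' z)" by (simp add: x_def)
  qed
qed

lemma continuous_map_Euclidean_scale:
  assumes "continuous_map Z euclideanreal a" "continuous_map Z (Euclidean_space r) v"
  shows "continuous_map Z (Euclidean_space r) (\<lambda>z i. a z * v z i)"
  using assms unfolding Euclidean_space_def continuous_map_in_subtopology
  by (auto simp: continuous_map_componentwise_UNIV Pi_iff intro: continuous_map_real_mult)

lemma scale_continuous:
  assumes a: "continuous_map Z euclideanreal a" and e: "continuous_map Z T e"
  shows "continuous_map Z T (\<lambda>z. vscale \<xi> (a z) (e z))"
proof (rule continuous_via_frames[OF base_continuous[OF e]])
  fix U r c k assume f: "local_frame X \<xi> U r c k"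
  define Z' where "Z' = subtopology Z {z \<in> topspace Z. proj \<xi> (e z) \<in> U}"
  have Z': "z \<in> topspace Z \<and> proj \<xi> (e z) \<in> U" if "z \<in> topspace Z'" for z
    using that by (auto simp: Z'_def)
  have c1: "continuous_map Z' T e" "continuous_map Z' euclideanreal a"
    using e a by (auto simp: Z'_def intro: continuous_map_from_subtopology)
  have "continuous_map Z' (Euclidean_space r) (\<lambda>z i. a z * c (e z) i)"
    by (intro continuous_map_Euclidean_scale frame_coord_continuous[OF f] c1) (use Z' in auto)
  then have "continuous_map Z' T (\<lambda>z. k (proj \<xi> (e z)) (\<lambda>i. a z * c (e z) i))"
    by (intro frame_assembly_continuous[OF f] base_continuous c1) (use Z' in auto)
  then show "continuous_map (subtopology Z {z \<in> topspace Z. proj \<xi> (e z) \<in> U}) T (\<lambda>z. vscale \<xi> (a z) (e z))"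
    unfolding Z'_def[symmetric]
  proof (rule continuous_map_eq)
    fix z assume z: "z \<in> topspace Z'"
    define x where "x = proj \<xi> (e z)"
    have "e z \<in> fib x" "x \<in> U"
      using Z'[OF z] image_total[OF e] by (auto simp: fib_iff x_def)
    note e = this
    have "k x (c (vscale \<xi> (a z) (e z))) = vscale \<xi> (a z) (e z)" 
      by (rule local_frameD(4)[OF f e(2) scale_fib[OF e(1)]])
    moreover have "c (vscale \<xi> (a z) (e z)) = (\<lambda>i. a z * c (e z) i)"
      by (rule local_frameD(6)[OF f e(2,1)])
    ultimately show "k (proj \<xi> (e z)) (\<lambda>i. a z * c (e z) i) = vscale \<xi> (a z) (e z)" by (simp add: x_def)
  qed
qed

lemma vzero_continuous: "continuous_map X T (vzero \<xi>)"
proof (rule continuous_via_frames[OF continuous_map_id[unfolded id_def]])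
  fix U r c k assume f: "local_frame X \<xi> U r c k"
  define Z' where "Z' = subtopology X {z \<in> topspace X. z \<in> U}"
  have UX: "U \<subseteq> topspace X" using f openin_subset by (auto simp: local_frame_def)
  have "continuous_map Z' T (\<lambda>z. k z (\<lambda>i. 0))"
    by (rule frame_assembly_continuous[OF f])
      (auto simp: Z'_def Eucl_def intro: continuous_map_from_subtopology continuous_map_id[unfolded id_def])
  then show "continuous_map (subtopology X {z \<in> topspace X. z \<in> U}) T (vzero \<xi>)"
    unfolding Z'_def[symmetric]
  proof (rule continuous_map_eq)
    fix z assume "z \<in> topspace Z'"
    then have "z \<in> U" "z \<in> topspace X" by (auto simp: Z'_def)
    then have "k z (c (vzero \<xi> z)) = vzero \<xi> z" using f zero_fib[of z] by (simp add: local_frame_def)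
    then show "k z (\<lambda>i. 0) = vzero \<xi> z"
      using frame_zero[OF f \<open>z \<in> U\<close>] by simp
  qed
qed


lemmas X_top = smooth_manifold_topology[OF manifold[unfolded smooth_c2_manifold_def, THEN conjunct1]]

section \<open>Equivariant sections\<close>

text \<open>
  Equivariant sections of \<open>\<xi>\<close> twisted by the sign \<open>\<sigma>\<close>. Over the fixed set they take values in the
  eigenbundle for \<open>\<sigma>\<close>.
\<close>

definition eqsec :: "real \<Rightarrow> ('m \<Rightarrow> 'e) \<Rightarrow> bool" where
  "eqsec \<sigma> s \<longleftrightarrow> continuous_map X T s \<and>
     (\<forall>x\<in>topspace X. s x \<in> fib x \<and> act \<xi> (s x) = vscale \<xi> \<sigma> (s (g x)))"

lemma bump_between:
  assumes "compactin X K" "openin X N" "K \<subseteq> N"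
  shows "\<exists>b D. continuous_map X euclideanreal b \<and> (\<forall>x\<in>topspace X. 0 \<le> b x \<and> b x \<le> 1) \<and> (\<forall>x\<in>K. b x = 1) \<and>
    compactin X D \<and> closedin X D \<and> D \<subseteq> N \<and> (\<forall>x\<in>topspace X - D. b x = 0)"
  by (rule compact_bump[OF X_top(5,1,3) assms]) blast

lemma section_through:
  assumes x: "x \<in> topspace X" "v \<in> fib x" and N: "openin X N" "x \<in> N"
  shows "\<exists>s. continuous_map X T s \<and> (\<forall>y\<in>topspace X. s y \<in> fib y) \<and> s x = v \<and> (\<forall>y\<in>topspace X - N. s y = vzero \<xi> y)"
proof -
  obtain U r c k where U: "x \<in> U" and f: "local_frame X \<xi> U r c k" by (rule frame[OF x(1)])
  have oU: "openin X U" using f by (simp add: local_frame_def)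
  obtain b D where b: "continuous_map X euclideanreal b" "\<forall>y\<in>{x}. b y = 1" and
    D: "closedin X D" "D \<subseteq> N \<inter> U" "\<forall>y\<in>topspace X - D. b y = 0"
    using bump_between[of "{x}" "N \<inter> U"] x N U oU by (auto simp: openin_Int)
  define s where "s y = (if y \<in> U then vscale \<xi> (b y) (k y (c v)) else vzero \<xi> y)" for y
  have cv: "c v \<in> Eucl r" using local_frameD(3)[OF f U x(2)] .
  have s0: "s y = vzero \<xi> y" if "y \<in> topspace X - D" for y
  proof (cases "y \<in> U")
    case True
    then show ?thesis using that D(3) vec_scale_zero[OF local_frameD(1)[OF f True cv]] by (simp add: s_def)
  qed (simp add: s_def)
  have UX: "U \<subseteq> topspace X" using openin_subset[OF oU] .
  have "continuous_map X T s"
  proof (rule continuous_map_locally)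
    fix y assume y: "y \<in> topspace X"
    show "\<exists>V. openin X V \<and> y \<in> V \<and> continuous_map (subtopology X V) T s"
    proof (cases "y \<in> U")
      case True
      have "continuous_map (subtopology X U) T (\<lambda>y. k y (c v))"
        by (rule frame_assembly_continuous[OF f])
           (use UX cv in \<open>auto intro: continuous_map_from_subtopology continuous_map_id[unfolded id_def]\<close>)
      then have "continuous_map (subtopology X U) T (\<lambda>y. vscale \<xi> (b y) (k y (c v)))"
        by (intro scale_continuous continuous_map_from_subtopology[OF b(1)])
      then have "continuous_map (subtopology X U) T s"
        by (rule continuous_map_eq) (simp add: s_def)
      then show ?thesis using oU True by blast
    next
      case False
      have "continuous_map (subtopology X (topspace X - D)) T (vzero \<xi>)"
        by (rule continuous_map_from_subtopology[OF vzero_continuous])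
      then have "continuous_map (subtopology X (topspace X - D)) T s"
        by (rule continuous_map_eq) (use s0 in auto)
      moreover have "y \<in> topspace X - D" using False y D(2) by auto
      ultimately show ?thesis using D(1) by blast
    qed
  qed
  moreover have "s y \<in> fib y" if "y \<in> topspace X" for y
    using scale_fib[OF local_frameD(1)[OF f _ cv]] zero_fib[OF that] by (simp add: s_def)
  moreover have "s x = v"
    using U b(2) local_frameD(4)[OF f U x(2)] vec_scale_one[OF x(2)] by (simp add: s_def)
  moreover have "s y = vzero \<xi> y" if "y \<in> topspace X - N" for y
    using s0[of y] that D(2) by auto
  ultimately show ?thesis by blast
qed

lemma g_compose_continuous: "continuous_map X Y f \<Longrightarrow> continuous_map X Y (\<lambda>y. f (g y))"
  using continuous_map_compose[OF g_cont, of Y f] by (simp add: o_def)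

lemma act_compose_continuous: "continuous_map Z T f \<Longrightarrow> continuous_map Z T (\<lambda>y. act \<xi> (f y))"
  using continuous_map_compose[OF _ act_cont, of Z f] by (simp add: o_def)

lemma const_scale_continuous: "continuous_map Z T f \<Longrightarrow> continuous_map Z T (\<lambda>y. vscale \<xi> a (f y))"
  by (intro scale_continuous) auto

text \<open>Summation over the group, with the sign \<open>\<sigma>\<close>.\<close>

lemma symmetrize_section:
  assumes \<sigma>: "\<sigma> \<in> {1, -1::real}" and s: "continuous_map X T s" "\<And>y. y \<in> topspace X \<Longrightarrow> s y \<in> fib y"
  shows "eqsec \<sigma> (\<lambda>y. vadd \<xi> (s y) (vscale \<xi> \<sigma> (act \<xi> (s (g y)))))"
  unfolding eqsec_def
proof (intro conjI ballI)
  have ag: "act \<xi> (s (g y)) \<in> fib y" if "y \<in> topspace X" for y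
    using act_fib[OF s(2)[OF g_in[OF that]]] gg[OF that] by simp
  show "continuous_map X T (\<lambda>y. vadd \<xi> (s y) (vscale \<xi> \<sigma> (act \<xi> (s (g y)))))"
  proof (rule add_continuous)
    show "continuous_map X T (\<lambda>y. vscale \<xi> \<sigma> (act \<xi> (s (g y))))"
      by (intro const_scale_continuous act_compose_continuous g_compose_continuous s)
    show "proj \<xi> (s y) = proj \<xi> (vscale \<xi> \<sigma> (act \<xi> (s (g y))))" if "y \<in> topspace X" for y
      using s(2)[OF that] scale_fib[OF ag[OF that], of \<sigma>] by (simp add: fib_iff)
  qed (rule s)
  fix y assume y: "y \<in> topspace X"
  note f1 = s(2)[OF y] and f2 = s(2)[OF g_in[OF y]] and f3 = ag[OF y] and f4 = ag[OF g_in[OF y]]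
  show "vadd \<xi> (s y) (vscale \<xi> \<sigma> (act \<xi> (s (g y)))) \<in> fib y" using add_fib[OF f1 scale_fib[OF f3]] .
  have sq: "\<sigma> * \<sigma> = 1" using \<sigma> by auto
  have "act \<xi> (vadd \<xi> (s y) (vscale \<xi> \<sigma> (act \<xi> (s (g y))))) = vadd \<xi> (act \<xi> (s y)) (vscale \<xi> \<sigma> (s (g y)))"
    using act_add[OF f1 scale_fib[OF f3]] act_scale[OF f3] act_act[OF f2] by simp
  also have "\<dots> = vadd \<xi> (vscale \<xi> \<sigma> (s (g y))) (act \<xi> (s y))"
    by (rule vec_add_commute[OF act_fib[OF f1] scale_fib[OF f2]])
  also have "\<dots> = vscale \<xi> \<sigma> (vadd \<xi> (s (g y)) (vscale \<xi> \<sigma> (act \<xi> (s y))))"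
    using vec_scale_add[OF f2 scale_fib[OF act_fib[OF f1]]] vec_scale_scale[OF act_fib[OF f1]] vec_scale_one[OF act_fib[OF f1]] sq by simp
  finally show "act \<xi> (vadd \<xi> (s y) (vscale \<xi> \<sigma> (act \<xi> (s (g y))))) = vscale \<xi> \<sigma> (vadd \<xi> (s (g y)) (vscale \<xi> \<sigma> (act \<xi> (s (g (g y))))))"
    using gg[OF y] by simp
qed

lemma separate_from_image:
  assumes x: "x \<in> topspace X" "g x \<noteq> x" and W: "openin X W" "x \<in> W"
  shows "\<exists>N. openin X N \<and> x \<in> N \<and> N \<subseteq> W \<and> g ` N \<inter> N = {}"
proof -
  obtain A B where AB: "openin X A" "openin X B" "x \<in> A" "g x \<in> B" "disjnt A B"
    using X_top(1) x g_in[OF x(1)] unfolding Hausdorff_space_def by metis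
  define N where "N = A \<inter> W \<inter> {y \<in> topspace X. g y \<in> B}"
  have "openin X N" unfolding N_def
    by (intro openin_Int AB W openin_continuous_map_preimage[OF g_cont])
  moreover have "g ` N \<inter> N = {}" using AB(5) by (auto simp: N_def disjnt_def)
  ultimately show ?thesis using AB x W by (intro exI[of _ N]) (auto simp: N_def)
qed

text \<open>
  A section through \<open>v\<close> is symmetrized. At a fixed point this doubles the value, so one starts from
  \<open>v / 2\<close>; at other points the section is cut off near \<open>x\<close>, so that its mirror image vanishes at \<open>x\<close>.
\<close>

lemma eqsec_through:
  assumes \<sigma>: "\<sigma> \<in> {1, -1::real}" and x: "x \<in> topspace X" "v \<in> fib x" 
    and v: "g x = x \<Longrightarrow> act \<xi> v = vscale \<xi> \<sigma> v"
  shows "\<exists>W. eqsec \<sigma> W \<and> W x = v"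
proof (cases "g x = x")
  case True
  obtain s where s: "continuous_map X T s" "\<And>y. y \<in> topspace X \<Longrightarrow> s y \<in> fib y" "s x = vscale \<xi> (1/2) v"
    using section_through[OF x(1) scale_fib[OF x(2)] openin_topspace x(1)] by metis
  have sq: "\<sigma> * \<sigma> = 1" using \<sigma> by auto
  have "vadd \<xi> (s x) (vscale \<xi> \<sigma> (act \<xi> (s (g x)))) = vadd \<xi> (vscale \<xi> (1/2) v) (vscale \<xi> (1/2) v)"
    using True s(3) v sq act_scale[OF x(2)] vec_scale_scale[OF x(2)] by (simp add: mult.assoc[symmetric])
  also have "\<dots> = v" using vec_add_scale[OF x(2)] vec_scale_one[OF x(2)] by simp
  finally show ?thesis using symmetrize_section[OF \<sigma> s(1,2)] by blast
next
  case False
  obtain N where N: "openin X N" "x \<in> N" "g ` N \<inter> N = {}"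
    using separate_from_image[OF x(1) False openin_topspace x(1)] by blast
  obtain s where s: "continuous_map X T s" "\<And>y. y \<in> topspace X \<Longrightarrow> s y \<in> fib y" "s x = v"
     "\<forall>y\<in>topspace X - N. s y = vzero \<xi> y"
    using section_through[OF x(1) x(2) N(1,2)] by metis
  have gx: "g x \<in> topspace X" by (rule g_in[OF x(1)])
  have "g x \<notin> N" using N by auto
  then have "s (g x) = vzero \<xi> (g x)" using s(4) gx by simp
  then have "vadd \<xi> (s x) (vscale \<xi> \<sigma> (act \<xi> (s (g x)))) = v"
    using s(3) act_vzero[OF gx] gg[OF x(1)] vec_scale_vzero[OF x(1)] vec_add_zero[OF x(2)] by simp
  then show ?thesis using symmetrize_section[OF \<sigma> s(1,2)] by blast
qed

subsection \<open>An invariant metric\<close>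

definition fibprod :: "('e \<times> 'e) topology" where
  "fibprod = subtopology (prod_topology T T) {p. proj \<xi> (fst p) = proj \<xi> (snd p)}"

definition invariant_metric :: "('e \<Rightarrow> 'e \<Rightarrow> real) \<Rightarrow> bool" where
  "invariant_metric B \<longleftrightarrow> continuous_map fibprod euclideanreal (\<lambda>p. B (fst p) (snd p)) \<and>
     (\<forall>x\<in>topspace X. \<forall>e\<in>fib x. \<forall>e'\<in>fib x.
        B e e' = B e' e \<and> B (act \<xi> e) (act \<xi> e') = B e e' \<and>
        (\<forall>e''\<in>fib x. B (vadd \<xi> e e'') e' = B e e' + B e'' e') \<and>
        (\<forall>a. B (vscale \<xi> a e) e' = a * B e e') \<and> (e \<noteq> vzero \<xi> x \<longrightarrow> B e e > 0))"

definition semimetric_on :: "'m \<Rightarrow> ('e \<Rightarrow> 'e \<Rightarrow> real) \<Rightarrow> bool" where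
  "semimetric_on x b \<longleftrightarrow> (\<forall>e\<in>fib x. \<forall>e'\<in>fib x. b e e' = b e' e \<and> 0 \<le> b e e \<and>
        (\<forall>e''\<in>fib x. b (vadd \<xi> e e'') e' = b e e' + b e'' e') \<and>
        (\<forall>a. b (vscale \<xi> a e) e' = a * b e e'))"

lemma fibprod_base: 
  "continuous_map fibprod X (\<lambda>p. proj \<xi> (fst p))" "continuous_map fibprod T fst" "continuous_map fibprod T snd"
  "p \<in> topspace fibprod \<Longrightarrow> fst p \<in> fib (proj \<xi> (fst p)) \<and> snd p \<in> fib (proj \<xi> (fst p)) \<and> proj \<xi> (fst p) \<in> topspace X"
proof -
  show 1: "continuous_map fibprod T fst" "continuous_map fibprod T snd"
    unfolding fibprod_def by (auto intro: continuous_map_from_subtopology continuous_map_fst continuous_map_snd)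
  show "continuous_map fibprod X (\<lambda>p. proj \<xi> (fst p))" by (rule base_continuous[OF 1(1)])
  show "p \<in> topspace fibprod \<Longrightarrow> fst p \<in> fib (proj \<xi> (fst p)) \<and> snd p \<in> fib (proj \<xi> (fst p)) \<and> proj \<xi> (fst p) \<in> topspace X"
    using proj_in by (auto simp: fibprod_def fib_iff)
qed

lemma metric_continuous:
  assumes B: "continuous_map fibprod euclideanreal (\<lambda>p. B (fst p) (snd p))" 
    and e: "continuous_map Z T e" "continuous_map Z T e'" "\<And>z. z \<in> topspace Z \<Longrightarrow> proj \<xi> (e z) = proj \<xi> (e' z)"
  shows "continuous_map Z euclideanreal (\<lambda>z. B (e z) (e' z))"
proof -
  have "continuous_map Z fibprod (\<lambda>z. (e z, e' z))"
    unfolding fibprod_def using e by (auto simp: continuous_map_in_subtopology continuous_map_pairwise o_def)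
  from continuous_map_compose[OF this B] show ?thesis by (simp add: o_def)
qed

text \<open>The standard inner product in a frame, multiplied by a bump function.\<close>

lemma local_semimetric:
  assumes f: "local_frame X \<xi> U r c k" and K: "compactin X K" "K \<subseteq> U" and N: "openin X N" "K \<subseteq> N"
  shows "\<exists>q. continuous_map fibprod euclideanreal (\<lambda>p. q (proj \<xi> (fst p)) (fst p) (snd p)) \<and>
     (\<forall>x\<in>topspace X. semimetric_on x (q x)) \<and> (\<forall>x\<in>K. \<forall>e\<in>fib x. e \<noteq> vzero \<xi> x \<longrightarrow> q x e e > 0) \<and>
     (\<forall>x\<in>topspace X - N. \<forall>e e'. q x e e' = 0)"
proof -
  have oU: "openin X U" using f by (simp add: local_frame_def)
  obtain b D where b: "continuous_map X euclideanreal b" "\<forall>y\<in>topspace X. 0 \<le> b y \<and> b y \<le> 1" "\<forall>y\<in>K. b y = 1" and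
    D: "closedin X D" "D \<subseteq> N \<inter> U" "\<forall>y\<in>topspace X - D. b y = 0"
    using bump_between[of K "N \<inter> U"] K N oU by (auto simp: openin_Int)
  define Q where "Q e e' = (\<Sum>i<r. c e i * c e' i)" for e e'
  define q where "q x e e' = b x * Q e e'" for x e e'
  have b0: "b x = 0" if "x \<in> topspace X" "x \<notin> N \<inter> U" for x using that D by auto
  have "semimetric_on x (q x)" if x: "x \<in> topspace X" for x
  proof (cases "x \<in> U")
    case True
    show ?thesis unfolding semimetric_on_def
    proof (intro ballI conjI allI)
      fix e e' assume e: "e \<in> fib x" "e' \<in> fib x"
      show "q x e e' = q x e' e" by (simp add: q_def Q_def mult.commute)
      have "0 \<le> Q e e" unfolding Q_def by (rule sum_nonneg) (rule zero_le_square)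
      then show "0 \<le> q x e e" using b(2) x by (simp add: q_def)
      show "q x (vadd \<xi> e e'') e' = q x e e' + q x e'' e'" if "e'' \<in> fib x" for e''
        using local_frameD(5)[OF f True e(1) that] by (simp add: q_def Q_def algebra_simps sum.distrib)
      show "q x (vscale \<xi> a e) e' = a * q x e e'" for a
        using local_frameD(6)[OF f True e(1)] by (simp add: q_def Q_def sum_distrib_left mult_ac)
    qed
  next
    case False
    then show ?thesis using b0[OF x] by (simp add: semimetric_on_def q_def)
  qed
  moreover have "q x e e > 0" if x: "x \<in> K" and e: "e \<in> fib x" "e \<noteq> vzero \<xi> x" for x e
  proof -
    have xU: "x \<in> U" "x \<in> topspace X" using x K compactin_subset_topspace by auto
    have "c e \<noteq> c (vzero \<xi> x)"
      using local_frameD(4)[OF f xU(1) e(1)] local_frameD(4)[OF f xU(1) zero_fib[OF xU(2)]] e(2) by metis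
    then obtain i where i: "c e i \<noteq> 0" using frame_zero[OF f xU(1)] by (auto simp: fun_eq_iff)
    have "i < r" using local_frameD(3)[OF f xU(1) e(1)] i by (metis (mono_tags, lifting) Eucl_def linorder_not_less mem_Collect_eq)
    then have "Q e e > 0" unfolding Q_def using i by (intro sum_pos2[of _ i]) (auto simp: zero_less_mult_iff linorder_neq_iff)
    then show ?thesis using b(3) x by (simp add: q_def)
  qed
  moreover have "continuous_map fibprod euclideanreal (\<lambda>p. q (proj \<xi> (fst p)) (fst p) (snd p))"
  proof (rule continuous_map_locally)
    fix p assume p: "p \<in> topspace fibprod"
    define V where "V A = {p \<in> topspace fibprod. proj \<xi> (fst p) \<in> A}" for A
    have oV: "openin fibprod (V A)" if "openin X A" for A
      unfolding V_def by (rule openin_continuous_map_preimage[OF fibprod_base(1) that])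
    show "\<exists>V. openin fibprod V \<and> p \<in> V \<and> continuous_map (subtopology fibprod V) euclideanreal (\<lambda>p. q (proj \<xi> (fst p)) (fst p) (snd p))"
    proof (cases "proj \<xi> (fst p) \<in> U")
      case True
      have cc: "continuous_map (subtopology fibprod (V U)) (Euclidean_space r) (\<lambda>p. c (fst p))"
        "continuous_map (subtopology fibprod (V U)) (Euclidean_space r) (\<lambda>p. c (snd p))"
        by (rule frame_coord_continuous[OF f]; 
            auto simp: V_def fibprod_def intro: continuous_map_from_subtopology fibprod_base(2,3)[unfolded fibprod_def])+
      have ci: "continuous_map (Euclidean_space r) euclideanreal (\<lambda>v. v i)" for i
        by (simp add: continuous_map_Euclidean_space_iff continuous_on_coordinate)
      have "continuous_map (subtopology fibprod (V U)) euclideanreal (\<lambda>p. q (proj \<xi> (fst p)) (fst p) (snd p))"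
        unfolding q_def Q_def
        using continuous_map_compose[OF cc(1) ci] continuous_map_compose[OF cc(2) ci]
          continuous_map_from_subtopology[OF continuous_map_compose[OF fibprod_base(1) b(1)]]
        by (intro continuous_map_real_mult continuous_map_sum) (auto simp: o_def)
      then show ?thesis using True p oV[OF oU] by (intro exI[of _ "V U"]) (auto simp: V_def)
    next
      case False
      have "continuous_map (subtopology fibprod (V (topspace X - D))) euclideanreal (\<lambda>p. q (proj \<xi> (fst p)) (fst p) (snd p))"
        by (rule continuous_map_eq[where f="\<lambda>_. 0"]) (auto simp: V_def q_def D(3))
      moreover have "p \<in> V (topspace X - D)" using False D(2) p fibprod_base(4)[OF p] by (auto simp: V_def)
      ultimately show ?thesis using oV[of "topspace X - D"] D(1) by blast
    qed
  qed
  moreover have "q x e e' = 0" if "x \<in> topspace X - N" for x e e' using b0[of x] that by (auto simp: q_def)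
  ultimately show ?thesis by (intro exI[of _ q]) simp
qed

text \<open>
  A sum of semimetrics is definite where one of them is, so definiteness can be achieved step by step,
  adding a local semimetric and its mirror image. For the gluing, a metric is a function on \<open>M\<close> whose
  value at \<open>x\<close> is a form; the form matters on the fibre over \<open>x\<close> only.
\<close>

lemma invariant_metric_exists: "\<exists>B. invariant_metric B"
proof -
  define S where "S \<beta> \<longleftrightarrow> continuous_map fibprod euclideanreal (\<lambda>p. \<beta> (proj \<xi> (fst p)) (fst p) (snd p)) \<and>
     (\<forall>x\<in>topspace X. semimetric_on x (\<beta> x) \<and> (\<forall>e\<in>fib x. \<forall>e'\<in>fib x. \<beta> (g x) (act \<xi> e) (act \<xi> e') = \<beta> x e e'))"
    for \<beta> :: "'m \<Rightarrow> 'e \<Rightarrow> 'e \<Rightarrow> real"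
  define G where "G x b \<longleftrightarrow> (\<forall>e\<in>fib x. e \<noteq> vzero \<xi> x \<longrightarrow> b e e > (0::real))" for x b
  have "\<exists>\<beta>. S \<beta> \<and> (\<forall>x\<in>{} \<union> topspace X. G x (\<beta> x))"
  proof (rule exhaustion_gluing[of X g "topspace X" "{}" S G "\<lambda>x e e'. 0"])
    show "locally_compact_space X" "Hausdorff_space X" "second_countable X" using X_top by auto
    show "continuous_map X X g" "\<And>x. x \<in> topspace X \<Longrightarrow> g (g x) = x" using g_cont gg by auto
    show "closedin X (topspace X)" "closedin X {}" by auto
    show "S (\<lambda>x e e'. 0)" by (simp add: S_def semimetric_on_def)
    show "\<And>y. y \<in> {} \<Longrightarrow> G y (\<lambda>e e'. 0)" by simp
  next
    fix F :: "nat \<Rightarrow> 'm \<Rightarrow> 'e \<Rightarrow> 'e \<Rightarrow> real" and f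
    assume SF: "\<And>n. S (F n)" and lim: "\<And>x. x \<in> topspace X \<Longrightarrow> \<exists>U N. openin X U \<and> x \<in> U \<and> (\<forall>n\<ge>N. \<forall>y\<in>U. f y = F n y)"
    have pt: "\<exists>N. \<forall>n\<ge>N. f x = F n x" if "x \<in> topspace X" for x using lim[OF that] by blast
    show "S f" unfolding S_def
    proof (intro conjI ballI)
      show "continuous_map fibprod euclideanreal (\<lambda>p. f (proj \<xi> (fst p)) (fst p) (snd p))"
      proof (rule continuous_map_locally)
        fix p assume p: "p \<in> topspace fibprod"
        obtain U N where U: "openin X U" "proj \<xi> (fst p) \<in> U" "\<forall>n\<ge>N. \<forall>y\<in>U. f y = F n y"
          using lim[of "proj \<xi> (fst p)"] fibprod_base(4)[OF p] by blast
        define V where "V = {p \<in> topspace fibprod. proj \<xi> (fst p) \<in> U}"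
        have "openin fibprod V" unfolding V_def by (rule openin_continuous_map_preimage[OF fibprod_base(1) U(1)])
        moreover have "continuous_map (subtopology fibprod V) euclideanreal (\<lambda>p. F N (proj \<xi> (fst p)) (fst p) (snd p))"
          using SF[of N] by (auto simp: S_def intro: continuous_map_from_subtopology)
        then have "continuous_map (subtopology fibprod V) euclideanreal (\<lambda>p. f (proj \<xi> (fst p)) (fst p) (snd p))"
          by (rule continuous_map_eq) (use U(3) in \<open>auto simp: V_def\<close>)
        ultimately show "\<exists>V. openin fibprod V \<and> p \<in> V \<and> continuous_map (subtopology fibprod V) euclideanreal (\<lambda>p. f (proj \<xi> (fst p)) (fst p) (snd p))"
          using p U(2) by (intro exI[of _ V]) (auto simp: V_def)
      qed
      fix x assume x: "x \<in> topspace X"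
      obtain N where N: "\<forall>n\<ge>N. f x = F n x" using pt[OF x] by blast
      obtain N' where N': "\<forall>n\<ge>N'. f (g x) = F n (g x)" using pt[OF g_in[OF x]] by blast
      have eq: "f x = F (max N N') x" "f (g x) = F (max N N') (g x)" using N N' by auto
      show "semimetric_on x (f x)" using SF[of "max N N'"] x by (simp add: S_def eq)
      show "f (g x) (act \<xi> e) (act \<xi> e') = f x e e'" if "e \<in> fib x" "e' \<in> fib x" for e e'
        using SF[of "max N N'"] x that by (simp add: S_def eq)
    qed
  next
    fix x assume x: "x \<in> topspace X"
    obtain U r c k where U: "x \<in> U" and f: "local_frame X \<xi> U r c k" by (rule frame[OF x])
    have oU: "openin X U" using f by (simp add: local_frame_def)
    have "\<exists>f'. S f' \<and> (\<forall>y\<in>C \<union> K. G y (f' y)) \<and> (\<forall>y\<in>topspace X - N. f' y = f y)"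
      if K: "compactin X K" "K \<subseteq> U \<inter> topspace X" and N: "openin X N" "g ` N \<subseteq> N" "K \<subseteq> N" and C: "closedin X C"
        and Sf: "S f" "\<forall>y\<in>C. G y (f y)" for K N C f
    proof -
      obtain q where q: "continuous_map fibprod euclideanreal (\<lambda>p. q (proj \<xi> (fst p)) (fst p) (snd p))"
         "\<And>x. x \<in> topspace X \<Longrightarrow> semimetric_on x (q x)" "\<And>x e. x \<in> K \<Longrightarrow> e \<in> fib x \<Longrightarrow> e \<noteq> vzero \<xi> x \<Longrightarrow> q x e e > 0"
         "\<And>x e e'. x \<in> topspace X - N \<Longrightarrow> q x e e' = 0"
        using local_semimetric[OF \<open>local_frame X \<xi> U r c k\<close> K(1) _ N(1,3)] K(2) by auto
      define f' where "f' y e e' = f y e e' + (q y e e' + q (g y) (act \<xi> e) (act \<xi> e'))" for y e e'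
      have "continuous_map fibprod fibprod (\<lambda>p. (act \<xi> (fst p), act \<xi> (snd p)))"
      proof -
        have "continuous_map fibprod T (\<lambda>p. act \<xi> (fst p))" "continuous_map fibprod T (\<lambda>p. act \<xi> (snd p))"
          by (intro act_compose_continuous fibprod_base)+
        moreover have "proj \<xi> (act \<xi> (fst p)) = proj \<xi> (act \<xi> (snd p))" if "p \<in> topspace fibprod" for p
          using fibprod_base(4)[OF that] act_fib by (metis fib_iff)
        ultimately show ?thesis
          unfolding fibprod_def[of ] by (auto simp: continuous_map_in_subtopology continuous_map_pairwise o_def)
      qed
      from continuous_map_compose[OF this q(1)]
      have "continuous_map fibprod euclideanreal (\<lambda>p. q (proj \<xi> (act \<xi> (fst p))) (act \<xi> (fst p)) (act \<xi> (snd p)))"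
        by (simp add: o_def)
      then have qact: "continuous_map fibprod euclideanreal (\<lambda>p. q (g (proj \<xi> (fst p))) (act \<xi> (fst p)) (act \<xi> (snd p)))"
      proof (rule continuous_map_eq)
        fix p assume p: "p \<in> topspace fibprod"
        have "proj \<xi> (act \<xi> (fst p)) = g (proj \<xi> (fst p))" using fibprod_base(4)[OF p] act_fib by (metis fib_iff)
        then show "q (proj \<xi> (act \<xi> (fst p))) (act \<xi> (fst p)) (act \<xi> (snd p)) = q (g (proj \<xi> (fst p))) (act \<xi> (fst p)) (act \<xi> (snd p))" by simp
      qed
      have nonneg: "0 \<le> q y e e" if "y \<in> topspace X" "e \<in> fib y" for y e
        using q(2)[OF that(1)] that(2) by (auto simp: semimetric_on_def)
      have "S f'" unfolding S_def
      proof (intro conjI ballI)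
        show "continuous_map fibprod euclideanreal (\<lambda>p. f' (proj \<xi> (fst p)) (fst p) (snd p))"
          unfolding f'_def using Sf(1) q(1) qact by (intro continuous_map_add) (auto simp: S_def)
        fix y assume y: "y \<in> topspace X"
        note gy = g_in[OF y]
        have sm: "semimetric_on y (f y)" "semimetric_on y (q y)" "semimetric_on (g y) (q (g y))"
          using Sf(1) q(2) y gy by (auto simp: S_def)
        show "semimetric_on y (f' y)"
          unfolding semimetric_on_def
        proof (intro ballI conjI allI)
          fix e e' assume e: "e \<in> fib y" "e' \<in> fib y"
          note ae = act_fib[OF e(1)] act_fib[OF e(2)]
          show "f' y e e' = f' y e' e" using sm e ae unfolding semimetric_on_def f'_def by metis
          show "0 \<le> f' y e e" using sm e ae unfolding semimetric_on_def f'_def by (intro add_nonneg_nonneg) auto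
          show "f' y (vadd \<xi> e e'') e' = f' y e e' + f' y e'' e'" if "e'' \<in> fib y" for e''
            using sm e ae act_fib[OF that] that act_add[OF e(1) that] by (simp add: semimetric_on_def f'_def)
          show "f' y (vscale \<xi> a e) e' = a * f' y e e'" for a
            using sm e ae act_scale[OF e(1)] by (simp add: semimetric_on_def f'_def algebra_simps)
        qed
        fix e e' assume e: "e \<in> fib y" "e' \<in> fib y"
        show "f' (g y) (act \<xi> e) (act \<xi> e') = f' y e e'"
          using Sf(1) y e gg[OF y] act_act by (simp add: f'_def S_def)
      qed
      moreover have "G y (f' y)" if y: "y \<in> C \<union> K" for y
        unfolding G_def
      proof (intro ballI impI)
        fix e assume e: "e \<in> fib y" "e \<noteq> vzero \<xi> y"
        have yX: "y \<in> topspace X" using y K(2) closedin_subset[OF C] by auto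
        have n: "0 \<le> f y e e" "0 \<le> q y e e" "0 \<le> q (g y) (act \<xi> e) (act \<xi> e)"
          using Sf(1) nonneg[OF yX e(1)] nonneg[OF g_in[OF yX] act_fib[OF e(1)]] e yX by (auto simp: S_def semimetric_on_def)
        moreover have "0 < f y e e \<or> 0 < q y e e"
          using y Sf(2) q(3)[of y e] e by (auto simp: G_def)
        ultimately show "f' y e e > 0" by (auto simp: f'_def)
      qed
      moreover have "f' y = f y" if y: "y \<in> topspace X - N" for y
      proof -
        have "g y \<in> topspace X - N" using y N(2) gg[of y] g_in[of y] by (metis DiffD1 DiffD2 DiffI image_subset_iff)
        then show ?thesis using q(4)[OF y] q(4)[of "g y"] by (simp add: f'_def fun_eq_iff)
      qed
      ultimately show ?thesis by blast
    qed
    then show "\<exists>W. openin X W \<and> x \<in> W \<and> (\<forall>K N C f. compactin X K \<longrightarrow> K \<subseteq> W \<inter> topspace X \<longrightarrow>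
        openin X N \<longrightarrow> g ` N \<subseteq> N \<longrightarrow> K \<subseteq> N \<longrightarrow> closedin X C \<longrightarrow> {} \<subseteq> C \<longrightarrow> S f \<longrightarrow> (\<forall>y\<in>C. G y (f y)) \<longrightarrow>
        (\<exists>f'. S f' \<and> (\<forall>y\<in>C \<union> K. G y (f' y)) \<and> (\<forall>y\<in>topspace X - N. f' y = f y)))"
      using oU U by (intro exI[of _ U] conjI allI impI)
  qed
  then obtain \<beta> where \<beta>: "S \<beta>" "\<And>x. x \<in> {} \<union> topspace X \<Longrightarrow> G x (\<beta> x)" by blast
  have "invariant_metric (\<lambda>e e'. \<beta> (proj \<xi> e) e e')"
    unfolding invariant_metric_def
  proof (intro conjI ballI allI impI)
    show "continuous_map fibprod euclideanreal (\<lambda>p. \<beta> (proj \<xi> (fst p)) (fst p) (snd p))" using \<beta>(1) by (simp add: S_def)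
    fix x e e' assume x: "x \<in> topspace X" and e: "e \<in> fib x" "e' \<in> fib x"
    have sm: "semimetric_on x (\<beta> x)" using \<beta>(1) x by (simp add: S_def)
    have p: "proj \<xi> e = x" "proj \<xi> e' = x" using e by (auto simp: fib_iff)
    show "\<beta> (proj \<xi> e) e e' = \<beta> (proj \<xi> e') e' e" using sm e p by (simp add: semimetric_on_def)
    have "proj \<xi> (act \<xi> e) = g x" using act_fib[OF e(1)] by (simp add: fib_iff)
    then show "\<beta> (proj \<xi> (act \<xi> e)) (act \<xi> e) (act \<xi> e') = \<beta> (proj \<xi> e) e e'"
      using \<beta>(1) x e p by (simp add: S_def)
    show "\<beta> (proj \<xi> (vadd \<xi> e e'')) (vadd \<xi> e e'') e' = \<beta> (proj \<xi> e) e e' + \<beta> (proj \<xi> e'') e'' e'" if "e'' \<in> fib x" for e''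
    proof -
      have pp: "proj \<xi> (vadd \<xi> e e'') = x" "proj \<xi> e'' = x" using add_fib[OF e(1) that] that by (auto simp: fib_iff)
      show ?thesis unfolding p pp using sm e that unfolding semimetric_on_def by blast
    qed
    show "\<beta> (proj \<xi> (vscale \<xi> a e)) (vscale \<xi> a e) e' = a * \<beta> (proj \<xi> e) e e'" for a
    proof -
      have pp: "proj \<xi> (vscale \<xi> a e) = x" using scale_fib[OF e(1), of a] by (simp add: fib_iff)
      show ?thesis unfolding p pp using sm e unfolding semimetric_on_def by blast
    qed
    assume "e \<noteq> vzero \<xi> x"
    then show "0 < \<beta> (proj \<xi> e) e e" using \<beta>(2)[of x] x e p by (auto simp: G_def)
  qed
  then show ?thesis by blast
qed

end

section \<open>Perturbing a section\<close>

text \<open>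
  Gaussian elimination with continuous coefficients. Subtracting from \<open>w p\<close> its components along the
  earlier vectors leaves \<open>w'\<close>, some coordinate of which is nonzero at \<open>x\<close> and hence nearby. Dividing
  by that coordinate gives the last dual vector, which then corrects the earlier ones.
\<close>

lemma local_dual_frame:
  fixes w :: "nat \<Rightarrow> 'a \<Rightarrow> nat \<Rightarrow> real"
  assumes U: "openin X U" "x \<in> U"
  shows "(\<And>j l. j < p \<Longrightarrow> l < r \<Longrightarrow> continuous_map (subtopology X U) euclideanreal (\<lambda>y. w j y l)) \<Longrightarrow>
    (\<And>a. (\<And>l. l < r \<Longrightarrow> (\<Sum>j<p. a j * w j x l) = 0) \<Longrightarrow> (\<forall>j<p. a j = 0)) \<Longrightarrow>
    \<exists>V q. openin X V \<and> x \<in> V \<and> V \<subseteq> U \<and>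
      (\<forall>i<p. \<forall>l<r. continuous_map (subtopology X V) euclideanreal (\<lambda>y. q i y l)) \<and>
      (\<forall>y\<in>V. \<forall>i<p. \<forall>j<p. (\<Sum>l<r. q i y l * w j y l) = (if i = j then 1 else 0))"
proof (induction p)
  case 0 then show ?case using U by auto
next
  case (Suc p)
  have "\<exists>V q. openin X V \<and> x \<in> V \<and> V \<subseteq> U \<and>
      (\<forall>i<p. \<forall>l<r. continuous_map (subtopology X V) euclideanreal (\<lambda>y. q i y l)) \<and>
      (\<forall>y\<in>V. \<forall>i<p. \<forall>j<p. (\<Sum>l<r. q i y l * w j y l) = (if i = j then 1 else 0))" (is "\<exists>V q. ?E V q")
  proof (rule Suc.IH)
    show "continuous_map (subtopology X U) euclideanreal (\<lambda>y. w j y l)" if "j < p" "l < r" for j l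
      using Suc.prems(1) that by simp
    fix a :: "nat \<Rightarrow> real" assume a: "\<And>l. l < r \<Longrightarrow> (\<Sum>j<p. a j * w j x l) = 0"
    define a' where "a' = a(p := 0)"
    have "(\<Sum>j<p. a' j * w j x l) = (\<Sum>j<p. a j * w j x l)" for l
      by (rule sum.cong) (auto simp: a'_def)
    then have "(\<Sum>j<Suc p. a' j * w j x l) = 0" if "l < r" for l
      using a[OF that] by (simp add: a'_def)
    then have "\<forall>j<Suc p. a' j = 0" by (rule Suc.prems(2))
    then show "\<forall>j<p. a j = 0" unfolding a'_def by (metis fun_upd_other less_Suc_eq less_irrefl)
  qed
  then obtain V q where "?E V q" by (elim exE)
  then have V: "openin X V" "x \<in> V" "V \<subseteq> U"
    and q: "\<And>i l. i < p \<Longrightarrow> l < r \<Longrightarrow> continuous_map (subtopology X V) euclideanreal (\<lambda>y. q i y l)"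
    and dual: "\<And>y i j. y \<in> V \<Longrightarrow> i < p \<Longrightarrow> j < p \<Longrightarrow> (\<Sum>l<r. q i y l * w j y l) = (if i = j then 1 else 0)"
    by simp_all
  \<comment> \<open>the component of \<open>w p\<close> along \<open>w i\<close>\<close>
  define \<theta> where "\<theta> i y = (\<Sum>l<r. q i y l * w p y l)" for i y
  define w' where "w' y l = w p y l - (\<Sum>i<p. \<theta> i y * w i y l)" for y l
  have "\<exists>l0<r. w' x l0 \<noteq> 0"
  proof (rule ccontr)
    assume "\<not> ?thesis"
    then have w0: "w' x l = 0" if "l < r" for l using that by auto
    define a' where "a' j = (if j = p then 1 else - \<theta> j x)" for j
    have "(\<Sum>j<Suc p. a' j * w j x l) = 0" if "l < r" for l
    proof -
      have "(\<Sum>j<p. a' j * w j x l) = (\<Sum>j<p. - (\<theta> j x * w j x l))"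
        by (rule sum.cong) (auto simp: a'_def)
      then show ?thesis using w0[OF that] by (simp add: w'_def sum_negf a'_def)
    qed
    then have "\<forall>j<Suc p. a' j = 0" by (rule Suc.prems(2))
    then have "a' p = 0" by simp
    then show False by (simp add: a'_def)
  qed
  then obtain l0 where l0: "l0 < r" "w' x l0 \<noteq> 0" by blast
  have cw: "continuous_map (subtopology X V) euclideanreal (\<lambda>y. w j y l)" if "j < Suc p" "l < r" for j l
    using continuous_map_from_subtopology_mono[OF Suc.prems(1)[OF that] V(3)] .
  have c\<theta>: "continuous_map (subtopology X V) euclideanreal (\<theta> i)" if "i < p" for i
    unfolding \<theta>_def using that q cw by (intro continuous_map_sum continuous_map_real_mult) auto
  have cw': "continuous_map (subtopology X V) euclideanreal (\<lambda>y. w' y l0)"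
    unfolding w'_def using l0(1) c\<theta> cw by (intro continuous_map_diff continuous_map_sum continuous_map_real_mult) auto
  define V' where "V' = {y \<in> V. w' y l0 \<noteq> 0}"
  have topV: "topspace (subtopology X V) = V" using openin_subset[OF V(1)] by auto
  have "openin (subtopology X V) V'"
    using openin_continuous_map_preimage[OF cw', of "- {0}"] unfolding topV by (simp add: V'_def open_Compl)
  then have V': "openin X V'" "x \<in> V'" "V' \<subseteq> V"
    using V l0 by (auto simp: V'_def openin_open_subtopology)
  define Q where "Q y l = ((if l = l0 then 1 else 0) - (\<Sum>i<p. w i y l0 * q i y l)) / w' y l0" for y l
  define q' where "q' i y l = (if i = p then Q y l else q i y l - \<theta> i y * Q y l)" for i y l
  have sub: "continuous_map (subtopology X V') euclideanreal f" if "continuous_map (subtopology X V) euclideanreal f" for f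
    using continuous_map_from_subtopology_mono[OF that V'(3)] .
  have cQ: "continuous_map (subtopology X V') euclideanreal (\<lambda>y. Q y l)" if "l < r" for l
    unfolding Q_def
    by (intro continuous_map_real_divide continuous_map_diff continuous_map_sum continuous_map_real_mult sub[OF cw] sub[OF q] sub[OF cw'])
      (use that l0 in \<open>auto simp: V'_def\<close>)
  have cq': "continuous_map (subtopology X V') euclideanreal (\<lambda>y. q' i y l)" if "i < Suc p" "l < r" for i l
  proof (cases "i = p")
    case True then show ?thesis using cQ[OF that(2)] by (simp add: q'_def)
  next
    case False
    then have "continuous_map (subtopology X V') euclideanreal (\<lambda>y. q i y l - \<theta> i y * Q y l)"
      using that by (intro continuous_map_diff continuous_map_real_mult sub[OF q] sub[OF c\<theta>] cQ) auto
    then show ?thesis using False by (simp add: q'_def)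
  qed
  have Qw: "(\<Sum>l<r. Q y l * w j y l) = (if j = p then 1 else 0)" if y: "y \<in> V'" and j: "j < Suc p" for y j
  proof -
    have yV: "y \<in> V" and nz: "w' y l0 \<noteq> 0" using y by (auto simp: V'_def)
    have "(\<Sum>l<r. Q y l * w j y l) = (\<Sum>l<r. (if l = l0 then w j y l else 0) - (\<Sum>i<p. w i y l0 * (q i y l * w j y l))) / w' y l0"
      unfolding Q_def by (simp add: sum_divide_distrib left_diff_distrib sum_distrib_right mult.assoc if_distrib[of "\<lambda>z. z * _"] cong: if_cong)
    also have "\<dots> = (w j y l0 - (\<Sum>i<p. w i y l0 * (\<Sum>l<r. q i y l * w j y l))) / w' y l0"
      using l0(1) by (simp add: sum_subtractf sum.swap[of _ "{..<r}"] sum_distrib_left)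
    also have "\<dots> = (if j = p then 1 else 0)"
    proof (cases "j = p")
      case True
      then have "w j y l0 - (\<Sum>i<p. w i y l0 * (\<Sum>l<r. q i y l * w j y l)) = w' y l0"
        by (simp add: w'_def \<theta>_def mult.commute)
      then show ?thesis using nz True by simp
    next
      case False
      then have "j < p" using j by simp
      then have "(\<Sum>i<p. w i y l0 * (\<Sum>l<r. q i y l * w j y l)) = (\<Sum>i<p. if i = j then w i y l0 else 0)"
        using dual[OF yV _ \<open>j < p\<close>] by (intro sum.cong) auto
      then show ?thesis using \<open>j < p\<close> by simp
    qed
    finally show ?thesis .
  qed
  have "(\<Sum>l<r. q' i y l * w j y l) = (if i = j then 1 else 0)" if y: "y \<in> V'" and i: "i < Suc p" and j: "j < Suc p" for y i j
  proof (cases "i = p")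
    case True then show ?thesis using Qw[OF y j] by (simp add: q'_def)
  next
    case False
    then have ip: "i < p" using i by simp
    have "(\<Sum>l<r. q' i y l * w j y l) = (\<Sum>l<r. q i y l * w j y l) - \<theta> i y * (\<Sum>l<r. Q y l * w j y l)"
      using False by (simp add: q'_def left_diff_distrib sum_subtractf sum_distrib_left mult.assoc)
    also have "\<dots> = (\<Sum>l<r. q i y l * w j y l) - (if j = p then \<theta> i y else 0)" using Qw[OF y j] by simp
    also have "\<dots> = (if i = j then 1 else 0)"
      using dual[of y i j] y V'(3) ip j False by (cases "j = p") (auto simp: \<theta>_def)
    finally show ?thesis .
  qed
  then show ?case using V' V(3) cq' by (intro exI[of _ V'] exI[of _ q']) auto
qed

context c2_bundle_over begin

lemma vcomb_continuous:
  assumes "continuous_map Z T e" "\<And>z. z \<in> topspace Z \<Longrightarrow> e z \<in> fib (b z)"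
  shows "(\<And>j. j < p \<Longrightarrow> continuous_map Z T (w j)) \<Longrightarrow> (\<And>j z. j < p \<Longrightarrow> z \<in> topspace Z \<Longrightarrow> w j z \<in> fib (b z)) \<Longrightarrow>
    (\<And>j. j < p \<Longrightarrow> continuous_map Z euclideanreal (a j)) \<Longrightarrow>
    continuous_map Z T (\<lambda>z. vcomb \<xi> p (e z) (\<lambda>j. w j z) (\<lambda>j. a j z))"
proof (induction p)
  case 0 then show ?case using assms by simp
next
  case (Suc p)
  show ?case unfolding vcomb.simps
  proof (rule add_continuous)
    show "continuous_map Z T (\<lambda>z. vcomb \<xi> p (e z) (\<lambda>j. w j z) (\<lambda>j. a j z))" using Suc by simp
    show "continuous_map Z T (\<lambda>z. vscale \<xi> (a p z) (w p z))" using Suc.prems by (intro scale_continuous) auto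
    fix z assume z: "z \<in> topspace Z"
    have "vcomb \<xi> p (e z) (\<lambda>j. w j z) (\<lambda>j. a j z) \<in> fib (b z)" "vscale \<xi> (a p z) (w p z) \<in> fib (b z)"
      using Suc.prems(2) assms(2)[OF z] z by (auto intro!: vcomb_fib scale_fib)
    then show "proj \<xi> (vcomb \<xi> p (e z) (\<lambda>j. w j z) (\<lambda>j. a j z)) = proj \<xi> (vscale \<xi> (a p z) (w p z))"
      by (simp add: fib_iff)
  qed
qed

text \<open>The tube lemma around \<open>D \<times> {0}\<close>, where the perturbation is trivial.\<close>

lemma small_perturbation:
  assumes t: "continuous_map X T t" "\<And>y. y \<in> topspace X \<Longrightarrow> t y \<in> fib y"
    and W: "\<And>j. j < p \<Longrightarrow> continuous_map X T (W j)" "\<And>j y. j < p \<Longrightarrow> y \<in> topspace X \<Longrightarrow> W j y \<in> fib y"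
    and D: "compactin X D" and Op: "openin T Op" "\<And>y. y \<in> D \<Longrightarrow> t y \<in> Op"
  shows "\<exists>\<epsilon>>0. \<forall>y\<in>D. \<forall>a. (\<forall>j<p. \<bar>a j\<bar> < \<epsilon>) \<longrightarrow> vcomb \<xi> p (t y) (\<lambda>j. W j y) a \<in> Op"
proof -
  let ?P = "prod_topology X (Euclidean_space p)"
  have DX: "D \<subseteq> topspace X" using compactin_subset_topspace[OF D] .
  define Q where "Q z = vcomb \<xi> p (t (fst z)) (\<lambda>j. W j (fst z)) (snd z)" for z :: "'m \<times> (nat \<Rightarrow> real)"
  have fstc: "continuous_map ?P T (\<lambda>z. f (fst z))" if "continuous_map X T f" for f
    using continuous_map_compose[OF continuous_map_fst that] by (simp add: o_def)
  have sndc: "continuous_map ?P euclideanreal (\<lambda>z. snd z j)" for j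
  proof -
    have "continuous_map (Euclidean_space p) euclideanreal (\<lambda>v. v j)"
      by (simp add: continuous_map_Euclidean_space_iff continuous_on_coordinate)
    from continuous_map_compose[OF continuous_map_snd this] show ?thesis by (simp add: o_def)
  qed
  have "continuous_map ?P T Q"
    unfolding Q_def
    by (rule vcomb_continuous[where b=fst and e="\<lambda>z. t (fst z)" and w="\<lambda>j z. W j (fst z)" and a="\<lambda>j z. snd z j"])
      (use t W in \<open>auto intro!: fstc sndc\<close>)
  then have op: "openin ?P {z \<in> topspace ?P. Q z \<in> Op}" using Op(1) by (rule openin_continuous_map_preimage)
  have z0: "(\<lambda>i::nat. 0::real) \<in> Eucl p" by (simp add: Eucl_def)
  have "D \<times> {\<lambda>i::nat. 0::real} \<subseteq> {z \<in> topspace ?P. Q z \<in> Op}"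
  proof
    fix z assume "z \<in> D \<times> {\<lambda>i::nat. 0::real}"
    then obtain y where y: "y \<in> D" "z = (y, \<lambda>i::nat. 0::real)" by auto
    then have "Q z = t y" using vcomb_zero[OF t(2) W(2)] DX by (auto simp: Q_def)
    then show "z \<in> {z \<in> topspace ?P. Q z \<in> Op}" using y DX z0 Op(2) by auto
  qed
  then obtain A V where AV: "openin (Euclidean_space p) V" "D \<subseteq> A" "(\<lambda>i::nat. 0::real) \<in> V" "A \<times> V \<subseteq> {z \<in> topspace ?P. Q z \<in> Op}"
    using tube_lemma_left[OF op D, of "\<lambda>i::nat. 0::real"] z0 by auto
  obtain \<epsilon> where \<epsilon>: "\<epsilon> > 0" "open_cube p (\<lambda>i. 0) \<epsilon> \<subseteq> V" by (rule open_cube_subset[OF AV(1,3)])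
  have "vcomb \<xi> p (t y) (\<lambda>j. W j y) a \<in> Op" if y: "y \<in> D" and a: "\<forall>j<p. \<bar>a j\<bar> < \<epsilon>" for y a
  proof -
    define a' where "a' = (\<lambda>j. if j < p then a j else 0)"
    have "a' \<in> open_cube p (\<lambda>i. 0) \<epsilon>" using a by (auto simp: open_cube_def a'_def Eucl_def)
    then have "a' \<in> V" using \<epsilon>(2) by (rule subsetD[rotated])
    then have "(y, a') \<in> A \<times> V" using AV(2) y by auto
    then have "Q (y, a') \<in> Op" using subsetD[OF AV(4)] by simp
    moreover have "vcomb \<xi> p (t y) (\<lambda>j. W j y) a = vcomb \<xi> p (t y) (\<lambda>j. W j y) a'"
      by (rule vcomb_cong) (auto simp: a'_def)
    ultimately show ?thesis by (simp add: Q_def)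
  qed
  then show ?thesis using \<epsilon>(1) by blast
qed

lemma metric_zero:
  assumes B: "invariant_metric B" and x: "x \<in> topspace X" and e: "e \<in> fib x"
  shows "B (vzero \<xi> x) e = 0"
proof -
  have "B (vscale \<xi> 0 e) e = 0 * B e e" using B x e unfolding invariant_metric_def by blast
  then show ?thesis by (simp add: vec_scale_zero[OF e])
qed

lemma nonzero_open: "openin T {e \<in> topspace T. e \<noteq> vzero \<xi> (proj \<xi> e)}"
proof -
  obtain B where B: "invariant_metric B" using invariant_metric_exists by blast
  have "continuous_map T euclideanreal (\<lambda>e. B e e)"
    by (rule metric_continuous) (use B in \<open>auto simp: invariant_metric_def continuous_map_id[unfolded id_def]\<close>)
  then have "openin T {e \<in> topspace T. B e e \<in> {0<..}}" by (rule openin_continuous_map_preimage) simp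
  moreover have "B e e > 0 \<longleftrightarrow> e \<noteq> vzero \<xi> (proj \<xi> e)" if "e \<in> topspace T" for e
  proof -
    have e: "e \<in> fib (proj \<xi> e)" "proj \<xi> e \<in> topspace X" using that proj_in by (auto simp: fib_iff)
    show ?thesis
    proof
      assume "B e e > 0"
      then show "e \<noteq> vzero \<xi> (proj \<xi> e)" using metric_zero[OF B e(2,1)] by auto
    next
      assume "e \<noteq> vzero \<xi> (proj \<xi> e)"
      then show "B e e > 0" using B e unfolding invariant_metric_def by blast
    qed
  qed
  ultimately show ?thesis by (simp cong: conj_cong)
qed

text \<open>
  Near \<open>x\<close>, the sections \<open>W j\<close> through the vectors \<open>v j\<close> and a dual frame give \<open>p\<close> components
  \<open>F i\<close> of a section \<open>t\<close>. On \<open>K\<close>, which the chart maps into \<open>\<real>\<^sup>k\<close> with \<open>k < p\<close>, the components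
  are close to functions \<open>G i\<close> without a common zero. The differences, extended to \<open>M\<close>, cut off and
  made invariant, are the coefficients with which the \<open>W j\<close> are added to \<open>t\<close>. They are so small that
  the open condition \<open>Op\<close> and the absence of zeros on \<open>C\<close> persist.
\<close>

lemma local_nonvanishing:
  assumes \<sigma>: "\<sigma> \<in> {1, -1::real}" and x: "x \<in> topspace X" and Op: "openin T Op"
    and v: "\<And>j. j < p \<Longrightarrow> v j \<in> fib x" "\<And>j. j < p \<Longrightarrow> g x = x \<Longrightarrow> act \<xi> (v j) = vscale \<xi> \<sigma> (v j)"
      "\<And>a. vcomb \<xi> p (vzero \<xi> x) v a = vzero \<xi> x \<Longrightarrow> \<forall>j<p. a j = 0"
    and O1: "openin X O1" "x \<in> O1" "continuous_map (subtopology X O1) (Euclidean_space m) \<phi>" "inj_on \<phi> O1"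
      "\<phi> ` (O1 \<inter> Z) \<subseteq> Eucl k" "k < p"
    and sep: "(\<forall>y\<in>Z. g y = y) \<or> g ` O1 \<inter> O1 = {}"
  shows "\<exists>W. openin X W \<and> x \<in> W \<and> (\<forall>K N C t. compactin X K \<longrightarrow> K \<subseteq> W \<inter> Z \<longrightarrow> openin X N \<longrightarrow> g ` N \<subseteq> N \<longrightarrow> K \<subseteq> N \<longrightarrow>
     closedin X C \<longrightarrow> C0 \<subseteq> C \<longrightarrow> (eqsec \<sigma> t \<and> (\<forall>y\<in>topspace X. t y \<in> Op)) \<longrightarrow> (\<forall>y\<in>C. t y \<noteq> vzero \<xi> y) \<longrightarrow>
     (\<exists>t'. (eqsec \<sigma> t' \<and> (\<forall>y\<in>topspace X. t' y \<in> Op)) \<and> (\<forall>y\<in>C \<union> K. t' y \<noteq> vzero \<xi> y) \<and> (\<forall>y\<in>topspace X - N. t' y = t y)))"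
proof -
  obtain U r c k' where U: "x \<in> U" and f: "local_frame X \<xi> U r c k'" by (rule frame[OF x])
  have oU: "openin X U" using f by (simp add: local_frame_def)
  have "\<exists>W. eqsec \<sigma> W \<and> W x = v j" if "j < p" for j
    by (rule eqsec_through[OF \<sigma> x v(1)[OF that] v(2)[OF that]])
  then obtain W where W: "\<And>j. j < p \<Longrightarrow> eqsec \<sigma> (W j)" "\<And>j. j < p \<Longrightarrow> W j x = v j" by metis
  have WT: "continuous_map X T (W j)" "y \<in> topspace X \<Longrightarrow> W j y \<in> fib y" 
      "y \<in> topspace X \<Longrightarrow> act \<xi> (W j y) = vscale \<xi> \<sigma> (W j (g y))" if "j < p" for j y
    using W(1)[OF that] by (auto simp: eqsec_def)
  define O2 where "O2 = U \<inter> O1"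
  have O2: "openin X O2" "x \<in> O2" "O2 \<subseteq> topspace X" using oU O1 U openin_subset[of X O2] by (auto simp: O2_def openin_Int)
  have ccoord: "continuous_map (subtopology X O2) euclideanreal (\<lambda>y. c (s y) l)" 
    if "continuous_map X T s" "\<And>y. y \<in> topspace X \<Longrightarrow> s y \<in> fib y" for s l
  proof -
    have "continuous_map (subtopology X O2) (Euclidean_space r) (\<lambda>y. c (s y))"
      by (rule frame_coord_continuous[OF f continuous_map_from_subtopology[OF that(1)]])
        (use that(2) in \<open>auto simp: O2_def fib_iff\<close>)
    moreover have "continuous_map (Euclidean_space r) euclideanreal (\<lambda>v. v l)"
      by (simp add: continuous_map_Euclidean_space_iff continuous_on_coordinate)
    ultimately show ?thesis using continuous_map_compose by (fastforce simp: o_def)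
  qed
  have "\<exists>V q. openin X V \<and> x \<in> V \<and> V \<subseteq> O2 \<and>
      (\<forall>i<p. \<forall>l<r. continuous_map (subtopology X V) euclideanreal (\<lambda>y. q i y l)) \<and>
      (\<forall>y\<in>V. \<forall>i<p. \<forall>j<p. (\<Sum>l<r. q i y l * c (W j y) l) = (if i = j then 1 else 0))" (is "\<exists>V q. ?E V q")
  proof (rule local_dual_frame[OF O2(1,2), where w="\<lambda>j y. c (W j y)"])
    show "continuous_map (subtopology X O2) euclideanreal (\<lambda>y. c (W j y) l)" if "j < p" for j l
      using ccoord WT(1,2)[OF that] by blast
    fix a :: "nat \<Rightarrow> real" assume a: "\<And>l. l < r \<Longrightarrow> (\<Sum>j<p. a j * c (W j x) l) = 0"
    define e where "e = vcomb \<xi> p (vzero \<xi> x) v a"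
    have e: "e \<in> fib x" unfolding e_def by (rule vcomb_fib[OF zero_fib[OF x] v(1)])
    have "c e l = 0" for l
    proof (cases "l < r")
      case True
      have "c e l = c (vzero \<xi> x) l + (\<Sum>j<p. a j * c (v j) l)"
        unfolding e_def by (rule vcomb_coord[OF f U zero_fib[OF x] v(1)])
      then show ?thesis using a[OF True] W(2) frame_zero[OF f U] by simp
    next
      case False
      then show ?thesis using local_frameD(3)[OF f U e] by (auto simp: Eucl_def)
    qed
    then have "c e = c (vzero \<xi> x)" using frame_zero[OF f U] by (simp add: fun_eq_iff)
    then have "e = vzero \<xi> x" using local_frameD(4)[OF f U e] local_frameD(4)[OF f U zero_fib[OF x]] by metis
    then show "\<forall>j<p. a j = 0" using v(3) by (simp add: e_def)
  qed
  then obtain V q where "?E V q" by (elim exE)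
  then have V: "openin X V" "x \<in> V" "V \<subseteq> O2"
    and q: "\<And>i l. i < p \<Longrightarrow> l < r \<Longrightarrow> continuous_map (subtopology X V) euclideanreal (\<lambda>y. q i y l)"
    and dual: "\<And>y i j. y \<in> V \<Longrightarrow> i < p \<Longrightarrow> j < p \<Longrightarrow> (\<Sum>l<r. q i y l * c (W j y) l) = (if i = j then 1 else 0)"
    by simp_all
  have "\<exists>t'. (eqsec \<sigma> t' \<and> (\<forall>y\<in>topspace X. t' y \<in> Op)) \<and> (\<forall>y\<in>C \<union> K. t' y \<noteq> vzero \<xi> y) \<and> (\<forall>y\<in>topspace X - N. t' y = t y)"
    if K: "compactin X K" "K \<subseteq> V \<inter> Z" and N: "openin X N" "g ` N \<subseteq> N" "K \<subseteq> N" and C: "closedin X C"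
      and t: "eqsec \<sigma> t" "\<forall>y\<in>topspace X. t y \<in> Op" "\<forall>y\<in>C. t y \<noteq> vzero \<xi> y" for K N C t
  proof -
    have tT: "continuous_map X T t" "\<And>y. y \<in> topspace X \<Longrightarrow> t y \<in> fib y" 
      "\<And>y. y \<in> topspace X \<Longrightarrow> act \<xi> (t y) = vscale \<xi> \<sigma> (t (g y))" using t(1) by (auto simp: eqsec_def)
    have KX: "K \<subseteq> topspace X" using compactin_subset_topspace[OF K(1)] .
    have clK: "closedin X K" using compactin_imp_closedin[OF X_top(1) K(1)] .
    define F where "F i y = (\<Sum>l<r. q i y l * c (t y) l)" for i y
    have cF: "continuous_map (subtopology X V) euclideanreal (F i)" if "i < p" for i
    proof -
      have "continuous_map (subtopology X V) euclideanreal (\<lambda>y. c (t y) l)" for l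
        by (rule continuous_map_from_subtopology_mono[OF ccoord V(3)]) (use tT in auto)
      then show ?thesis unfolding F_def by (intro continuous_map_sum continuous_map_real_mult q that) auto
    qed
    obtain b D where b: "continuous_map X euclideanreal b" "\<forall>y\<in>topspace X. 0 \<le> b y \<and> b y \<le> 1" "\<forall>y\<in>K. b y = 1" and
      D: "compactin X D" "D \<subseteq> N \<inter> V" "\<forall>y\<in>topspace X - D. b y = 0"
      using bump_between[of K "N \<inter> V"] K N V(1) by (auto simp: openin_Int)
    define D' where "D' = D \<union> g ` D"
    have D': "compactin X D'" unfolding D'_def using D(1) image_compactin[OF D(1) g_cont] by (rule compactin_Un)
    have D'X: "D' \<subseteq> topspace X" using compactin_subset_topspace[OF D'] .
    have D'N: "D' \<subseteq> N" using D(2) N(2) by (auto simp: D'_def)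
    have stable: "\<exists>\<epsilon>>0. \<forall>y\<in>D''. \<forall>a. (\<forall>j<p. \<bar>a j\<bar> < \<epsilon>) \<longrightarrow> vcomb \<xi> p (t y) (\<lambda>j. W j y) a \<in> O''"
      if "compactin X D''" "openin T O''" "\<And>y. y \<in> D'' \<Longrightarrow> t y \<in> O''" for D'' O''
      by (rule small_perturbation) (use tT WT that in auto)
    obtain \<epsilon>1 where \<epsilon>1: "\<epsilon>1 > 0" "\<forall>y\<in>D'. \<forall>a. (\<forall>j<p. \<bar>a j\<bar> < \<epsilon>1) \<longrightarrow> vcomb \<xi> p (t y) (\<lambda>j. W j y) a \<in> Op"
      using stable[OF D' Op] t(2) D'X by blast
    have "t y \<in> {e \<in> topspace T. e \<noteq> vzero \<xi> (proj \<xi> e)}" if "y \<in> D' \<inter> C" for y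
      using tT(2)[of y] t(3) that D'X by (auto simp: fib_iff)
    then obtain \<epsilon>2 where \<epsilon>2: "\<epsilon>2 > 0" "\<forall>y\<in>D' \<inter> C. \<forall>a. (\<forall>j<p. \<bar>a j\<bar> < \<epsilon>2) \<longrightarrow> 
        vcomb \<xi> p (t y) (\<lambda>j. W j y) a \<in> {e \<in> topspace T. e \<noteq> vzero \<xi> (proj \<xi> e)}"
      using stable[OF compact_Int_closedin[OF D' C] nonzero_open] by blast
    define \<epsilon> where "\<epsilon> = min \<epsilon>1 \<epsilon>2 / 3"
    have \<epsilon>: "\<epsilon> > 0" "2 * \<epsilon> < \<epsilon>1" "2 * \<epsilon> < \<epsilon>2" using \<epsilon>1(1) \<epsilon>2(1) by (auto simp: \<epsilon>_def)
    \<comment> \<open>transport the coordinates to Euclidean space along the chart\<close>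
    have KO1: "K \<subseteq> O1" using K(2) V(3) by (auto simp: O2_def)
    define S where "S = \<phi> ` K"
    have cm\<phi>: "continuous_map (subtopology X K) (Euclidean_space m) \<phi>"
      using continuous_map_from_subtopology_mono[OF O1(3) KO1] .
    have "compactin (Euclidean_space m) S" unfolding S_def
      by (rule image_compactin[OF _ cm\<phi>]) (simp add: compactin_subtopology K(1))
    then have S: "compact S" "S \<subseteq> Eucl m" by (auto simp: Euclidean_space_eq[of m] compactin_subtopology)
    have "K \<subseteq> O1 \<inter> Z" using KO1 K(2) by simp
    then have Sk: "S \<subseteq> Eucl k" unfolding S_def using O1(5) by (meson image_mono order_trans)
    have topK: "topspace (subtopology X K) = K" using KX by auto
    have "homeomorphic_map (subtopology X K) (top_of_set S) \<phi>"
    proof (rule continuous_imp_homeomorphic_map)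
      show "compact_space (subtopology X K)" using K(1) by (simp add: compact_space_subtopology)
      show "Hausdorff_space (top_of_set S)" by (simp add: Hausdorff_space_subtopology)
      have "continuous_map (subtopology X K) (subtopology (Euclidean_space m) S) \<phi>"
        using cm\<phi> by (auto simp: continuous_map_in_subtopology S_def)
      then show "continuous_map (subtopology X K) (top_of_set S) \<phi>" using subtopology_Euclidean_space[OF S(2)] by simp
      show "\<phi> ` topspace (subtopology X K) = topspace (top_of_set S)" using topK by (simp add: S_def)
      show "inj_on \<phi> (topspace (subtopology X K))" using inj_on_subset[OF O1(4) KO1] topK by simp
    qed
    then obtain \<psi> where \<psi>: "homeomorphic_maps (subtopology X K) (top_of_set S) \<phi> \<psi>" using homeomorphic_map_maps by blast
    have c\<psi>: "continuous_map (top_of_set S) (subtopology X K) \<psi>" and \<psi>\<phi>: "\<And>y. y \<in> K \<Longrightarrow> \<psi> (\<phi> y) = y"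
      and c\<phi>: "continuous_map (subtopology X K) (top_of_set S) \<phi>"
      using \<psi> topK by (auto simp: homeomorphic_maps_def)
    have KV: "K \<subseteq> V" using K(2) by auto
    have cFK: "continuous_map (subtopology X K) euclideanreal (F i)" if "i < p" for i
      using continuous_map_from_subtopology_mono[OF cF[OF that] KV] .
    have "continuous_on S (\<lambda>z. F i (\<psi> z))" if "i < p" for i
      using continuous_map_compose[OF c\<psi> cFK[OF that]] by (simp add: o_def)
    then obtain G where G: "\<And>j. j < p \<Longrightarrow> continuous_on S (G j)" 
      "\<And>j z. j < p \<Longrightarrow> z \<in> S \<Longrightarrow> \<bar>G j z - F j (\<psi> z)\<bar> < \<epsilon>" "\<And>z. z \<in> S \<Longrightarrow> \<exists>j<p. G j z \<noteq> 0"
      using nonvanishing_approximation[of S k p "\<lambda>i z. F i (\<psi> z)" \<epsilon>] S(1) Sk O1(6) \<epsilon>(1) by (metis (no_types, lifting) topspace_Eucl)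
    have "\<exists>d. continuous_map X euclideanreal d \<and> (\<forall>y\<in>K. d y = G i (\<phi> y) - F i y) \<and> (\<forall>y\<in>topspace X. \<bar>d y\<bar> \<le> \<epsilon>)"
      if i: "i < p" for i
    proof -
      have "continuous_map (subtopology X K) euclideanreal (\<lambda>y. G i (\<phi> y))"
        using continuous_map_compose[OF c\<phi>, of euclideanreal "G i"] G(1)[OF i] by (simp add: o_def)
      then have c: "continuous_map (subtopology X K) euclideanreal (\<lambda>y. G i (\<phi> y) - F i y)"
        using cFK[OF i] by (rule continuous_map_diff)
      have "\<bar>G i (\<phi> y) - F i y\<bar> \<le> \<epsilon>" if "y \<in> K" for y
        using G(2)[OF i, of "\<phi> y"] \<psi>\<phi>[OF that] that by (auto simp: S_def)
      then have img: "(\<lambda>y. G i (\<phi> y) - F i y) ` K \<subseteq> {-\<epsilon>..\<epsilon>}" by (force simp: abs_le_iff)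
      have le: "- \<epsilon> \<le> \<epsilon>" using \<epsilon>(1) by simp
      show ?thesis
      proof (rule Tietze_extension_closed_real_interval[OF X_top(3) clK c img le])
        fix d assume d: "continuous_map X euclideanreal d" "\<And>y. y \<in> K \<Longrightarrow> d y = G i (\<phi> y) - F i y" "d ` topspace X \<subseteq> {-\<epsilon>..\<epsilon>}"
        have "\<bar>d y\<bar> \<le> \<epsilon>" if "y \<in> topspace X" for y
          using d(3) that by (auto simp: abs_le_iff image_subset_iff)
        then show "\<exists>d. continuous_map X euclideanreal d \<and> (\<forall>y\<in>K. d y = G i (\<phi> y) - F i y) \<and> (\<forall>y\<in>topspace X. \<bar>d y\<bar> \<le> \<epsilon>)"
          using d(1,2) by (intro exI[of _ d]) simp
      qed
    qed
    then obtain d where d: "\<And>i. i < p \<Longrightarrow> continuous_map X euclideanreal (d i)" 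
       "\<And>i y. i < p \<Longrightarrow> y \<in> K \<Longrightarrow> d i y = G i (\<phi> y) - F i y" "\<And>i y. i < p \<Longrightarrow> y \<in> topspace X \<Longrightarrow> \<bar>d i y\<bar> \<le> \<epsilon>"
      by metis
    \<comment> \<open>If \<open>Z\<close> is fixed pointwise, the two summands of \<open>a\<close> agree on \<open>K\<close>, hence the factor 1/2. Otherwise
      \<open>K\<close> is disjoint from the mirror image of the support of \<open>b\<close> and the second summand vanishes on \<open>K\<close>.\<close>
    define m' :: real where "m' = (if \<forall>y\<in>Z. g y = y then 1/2 else 1)"
    define a where "a i y = m' * (b y * d i y + b (g y) * d i (g y))" for i y
    have ca: "continuous_map X euclideanreal (a i)" if "i < p" for i
      unfolding a_def
      by (intro continuous_map_real_mult_left continuous_map_add continuous_map_real_mult b(1) d(1)[OF that]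
            g_compose_continuous[OF b(1)] g_compose_continuous[OF d(1)[OF that]])
    have ag: "a i (g y) = a i y" if "y \<in> topspace X" for i y using gg[OF that] by (simp add: a_def add.commute)
    have small: "\<bar>a i y\<bar> \<le> 2 * \<epsilon>" if "i < p" "y \<in> topspace X" for i y
    proof -
      have 1: "\<bar>b z * d i z\<bar> \<le> \<epsilon>" if "z \<in> topspace X" for z
      proof -
        have "\<bar>b z * d i z\<bar> \<le> 1 * \<epsilon>" unfolding abs_mult using b(2) that d(3)[OF \<open>i < p\<close> that] by (intro mult_mono) auto
        then show ?thesis by simp
      qed
      have "\<bar>a i y\<bar> \<le> \<bar>b y * d i y + b (g y) * d i (g y)\<bar>" unfolding a_def m'_def by (auto simp: abs_mult)
      also have "\<dots> \<le> 2 * \<epsilon>" using 1[OF that(2)] 1[OF g_in[OF that(2)]] by linarith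
      finally show ?thesis .
    qed
    have off: "a i y = 0" if "y \<in> topspace X - D'" for i y
    proof -
      have "y \<notin> D" "g y \<notin> D" using that gg[of y] by (auto simp: D'_def image_iff)
      then show ?thesis using D(3) that g_in[of y] by (simp add: a_def)
    qed
    have aK: "a i y = G i (\<phi> y) - F i y" if "i < p" "y \<in> K" for i y
    proof (cases "\<forall>y\<in>Z. g y = y")
      case True
      then have "g y = y" using that K(2) by auto
      then show ?thesis using True b(3) that d(2)[OF that] by (simp add: a_def m'_def)
    next
      case False
      then have "g ` O1 \<inter> O1 = {}" using sep by blast
      then have "g y \<notin> O1" using KO1 that by auto
      then have "g y \<notin> D" using D(2) V(3) by (auto simp: O2_def)
      then have "b (g y) = 0" using D(3) g_in KX that by auto
      then show ?thesis using False b(3) that d(2)[OF that] by (auto simp: a_def m'_def)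
    qed
    define t' where "t' y = vcomb \<xi> p (t y) (\<lambda>j. W j y) (\<lambda>j. a j y)" for y
    have t'fib: "t' y \<in> fib y" if "y \<in> topspace X" for y
      unfolding t'_def using tT(2)[OF that] WT(2)[OF _ that] by (intro vcomb_fib)
    have "eqsec \<sigma> t'"
      unfolding eqsec_def
    proof (intro conjI ballI)
      show "continuous_map X T t'"
        unfolding t'_def by (rule vcomb_continuous[where b="\<lambda>y. y", OF tT(1,2) WT(1,2) ca])
      fix y assume y: "y \<in> topspace X"
      show "t' y \<in> fib y" by (rule t'fib[OF y])
      note gy = g_in[OF y]
      have "act \<xi> (t' y) = vcomb \<xi> p (act \<xi> (t y)) (\<lambda>j. act \<xi> (W j y)) (\<lambda>j. a j y)"
        unfolding t'_def by (rule vcomb_act[OF tT(2)[OF y] WT(2)[OF _ y]])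
      also have "\<dots> = vcomb \<xi> p (vscale \<xi> \<sigma> (t (g y))) (\<lambda>j. vscale \<xi> \<sigma> (W j (g y))) (\<lambda>j. a j (g y))"
        unfolding tT(3)[OF y] by (rule vcomb_cong) (use WT(3) ag y in auto)
      also have "\<dots> = vscale \<xi> \<sigma> (t' (g y))"
        unfolding t'_def by (rule vcomb_scale[OF tT(2)[OF gy] WT(2)[OF _ gy], symmetric])
      finally show "act \<xi> (t' y) = vscale \<xi> \<sigma> (t' (g y))" .
    qed
    moreover have t'off: "t' y = t y" if "y \<in> topspace X - D'" for y
      unfolding t'_def using off[OF that] that tT(2) WT(2) by (intro vcomb_zero) auto
    moreover have "t' y \<in> Op" if "y \<in> topspace X" for y
    proof (cases "y \<in> D'")
      case True
      have "\<bar>a j y\<bar> < \<epsilon>1" if "j < p" for j using small[OF that \<open>y \<in> topspace X\<close>] \<epsilon>(2) by linarith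
      then show ?thesis unfolding t'_def by (rule \<epsilon>1(2)[rule_format, OF True])
    qed (use t'off t(2) that in auto)
    moreover have "t' y \<noteq> vzero \<xi> y" if y: "y \<in> C" for y
    proof (cases "y \<in> D'")
      case True
      then have yX: "y \<in> topspace X" using D'X by auto
      have yD: "y \<in> D' \<inter> C" using True y by simp
      have "\<bar>a j y\<bar> < \<epsilon>2" if "j < p" for j using small[OF that yX] \<epsilon>(3) by linarith
      then have "t' y \<in> {e \<in> topspace T. e \<noteq> vzero \<xi> (proj \<xi> e)}" unfolding t'_def by (rule \<epsilon>2(2)[rule_format, OF yD])
      then show ?thesis using t'fib[OF yX] by (simp add: fib_iff)
    qed (use t'off t(3) y closedin_subset[OF C] in auto)
    moreover have "t' y \<noteq> vzero \<xi> y" if y: "y \<in> K" for y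
    proof
      assume eq: "t' y = vzero \<xi> y"
      have yX: "y \<in> topspace X" and yV: "y \<in> V" and yU: "y \<in> U" using y KX KV V(3) by (auto simp: O2_def)
      have ct': "c (t' y) l = c (t y) l + (\<Sum>j<p. a j y * c (W j y) l)" for l
        unfolding t'_def by (rule vcomb_coord[OF f yU tT(2)[OF yX] WT(2)[OF _ yX]])
      have "G i (\<phi> y) = 0" if i: "i < p" for i
      proof -
        have "0 = (\<Sum>l<r. q i y l * c (t' y) l)" using frame_zero[OF f yU] by (simp add: eq)
        also have "\<dots> = F i y + (\<Sum>l<r. \<Sum>j<p. a j y * (q i y l * c (W j y) l))"
          by (simp add: ct' F_def distrib_left sum.distrib sum_distrib_left mult.left_commute)
        also have "(\<Sum>l<r. \<Sum>j<p. a j y * (q i y l * c (W j y) l)) = (\<Sum>j<p. a j y * (\<Sum>l<r. q i y l * c (W j y) l))"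
          by (subst sum.swap) (simp add: sum_distrib_left)
        also have "\<dots> = (\<Sum>j<p. if j = i then a j y else 0)"
          by (rule sum.cong) (use dual[OF yV i] in auto)
        also have "\<dots> = a i y" using i by simp
        finally show ?thesis using aK[OF i y] by simp
      qed
      moreover have "\<phi> y \<in> S" using y by (simp add: S_def)
      ultimately show False using G(3) by blast
    qed
    ultimately show ?thesis using D'N by (intro exI[of _ t']) blast
  qed
  then show ?thesis using V by (intro exI[of _ V] conjI allI impI) auto
qed

end

section \<open>Linear coordinates and the rank\<close>

definition linear_coords ::
    "('m, 'e) c2_bundle \<Rightarrow> 'e set \<Rightarrow> nat \<Rightarrow> ('e \<Rightarrow> nat \<Rightarrow> real) \<Rightarrow> bool" where
  "linear_coords \<xi> A r L \<longleftrightarrow> bij_betw L A (Eucl r) \<and>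
     (\<forall>e\<in>A. (\<forall>e'\<in>A. L (vadd \<xi> e e') = (\<lambda>i. L e i + L e' i)) \<and> (\<forall>c. L (vscale \<xi> c e) = (\<lambda>i. c * L e i)))"

definition unit_vec :: "nat \<Rightarrow> nat \<Rightarrow> real" where
  "unit_vec j = (\<lambda>i. if i = j then 1 else 0)"

lemma unit_vec_Eucl: "j < r \<Longrightarrow> unit_vec j \<in> Eucl r" by (auto simp: unit_vec_def Eucl_def)

lemma linear_Eucl_continuous:
  fixes F :: "(nat \<Rightarrow> real) \<Rightarrow> (nat \<Rightarrow> real)"
  assumes maps: "\<And>v. v \<in> Eucl r \<Longrightarrow> F v \<in> Eucl r'"
    and add: "\<And>v w. v \<in> Eucl r \<Longrightarrow> w \<in> Eucl r \<Longrightarrow> F (\<lambda>i. v i + w i) = (\<lambda>i. F v i + F w i)"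
    and scale: "\<And>v c. v \<in> Eucl r \<Longrightarrow> F (\<lambda>i. c * v i) = (\<lambda>i. c * F v i)"
  shows "continuous_map (Euclidean_space r) (Euclidean_space r') F"
proof -
  have part: "F (\<lambda>i. if i < m then v i else 0) = (\<lambda>l. \<Sum>j<m. v j * F (unit_vec j) l)" if "m \<le> r" "v \<in> Eucl r" for m v
    using that(1)
  proof (induction m)
    case 0
    have "F (\<lambda>i. 0 * v i) = (\<lambda>i. 0 * F v i)" by (rule scale[OF that(2)])
    then show ?case by simp
  next
    case (Suc m)
    have "(\<lambda>i. if i < Suc m then v i else 0) = (\<lambda>i. (if i < m then v i else 0) + v m * unit_vec m i)"
      by (auto simp: unit_vec_def less_Suc_eq fun_eq_iff)
    moreover have "(\<lambda>i. if i < m then v i else 0) \<in> Eucl r" using Suc.prems by (auto simp: Eucl_def)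
    moreover have "(\<lambda>i. v m * unit_vec m i) \<in> Eucl r" using Suc.prems by (auto simp: Eucl_def unit_vec_def)
    ultimately have "F (\<lambda>i. if i < Suc m then v i else 0) = (\<lambda>l. F (\<lambda>i. if i < m then v i else 0) l + F (\<lambda>i. v m * unit_vec m i) l)"
      using add by simp
    moreover have "F (\<lambda>i. v m * unit_vec m i) = (\<lambda>i. v m * F (unit_vec m) i)"
      using scale unit_vec_Eucl Suc.prems by simp
    ultimately show ?case using Suc by simp
  qed
  have expand: "F v l = (\<Sum>j<r. v j * F (unit_vec j) l)" if "v \<in> Eucl r" for v l
  proof -
    have "(\<lambda>i. if i < r then v i else 0) = v" using that by (auto simp: Eucl_def fun_eq_iff)
    then show ?thesis using part[OF order_refl that] by simp
  qed
  have "continuous_on (Eucl r) F"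
  proof (rule continuous_on_coordinatewise_then_product)
    fix l
    have "continuous_on (Eucl r) (\<lambda>v. \<Sum>j<r. v j * F (unit_vec j) l)"
      by (intro continuous_on_sum continuous_on_mult continuous_on_coordinate continuous_on_const)
    then show "continuous_on (Eucl r) (\<lambda>v. F v l)" by (simp add: expand cong: continuous_on_cong)
  qed
  then show ?thesis
    using maps cm_Euclidean_space_iff_continuous_on[of r "Eucl r" r' F]
    by (simp add: subtopology_Euclidean_space Euclidean_space_eq[symmetric] Pi_iff)
qed

lemma linear_coords_transition:
  assumes L: "linear_coords \<xi> A r L" and L': "linear_coords \<xi> A r' L'"
    and cl: "\<And>e e'. e \<in> A \<Longrightarrow> e' \<in> A \<Longrightarrow> vadd \<xi> e e' \<in> A" "\<And>c e. e \<in> A \<Longrightarrow> vscale \<xi> c e \<in> A"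
  shows "continuous_map (Euclidean_space r) (Euclidean_space r') (\<lambda>v. L' (inv_into A L v))"
proof (rule linear_Eucl_continuous)
  have bij: "bij_betw L A (Eucl r)" "bij_betw L' A (Eucl r')" using L L' by (auto simp: linear_coords_def)
  have inA: "inv_into A L v \<in> A" and LL: "L (inv_into A L v) = v" if "v \<in> Eucl r" for v
    using bij_betwE[OF bij_betw_inv_into[OF bij(1)]] bij_betw_inv_into_right[OF bij(1)] that by auto
  have inv: "inv_into A L (L e) = e" if "e \<in> A" for e using bij_betw_inv_into_left[OF bij(1) that] .
  show "L' (inv_into A L v) \<in> Eucl r'" if "v \<in> Eucl r" for v using bij_betwE[OF bij(2)] inA[OF that] by blast
  show "L' (inv_into A L (\<lambda>i. v i + w i)) = (\<lambda>i. L' (inv_into A L v) i + L' (inv_into A L w) i)"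
    if "v \<in> Eucl r" "w \<in> Eucl r" for v w
  proof -
    have "L (vadd \<xi> (inv_into A L v) (inv_into A L w)) = (\<lambda>i. v i + w i)"
      using L inA that LL by (simp add: linear_coords_def)
    then have "inv_into A L (\<lambda>i. v i + w i) = vadd \<xi> (inv_into A L v) (inv_into A L w)"
      using inv[OF cl(1)[OF inA[OF that(1)] inA[OF that(2)]]] by simp
    then show ?thesis using L' inA that by (simp add: linear_coords_def)
  qed
  show "L' (inv_into A L (\<lambda>i. c * v i)) = (\<lambda>i. c * L' (inv_into A L v) i)" if "v \<in> Eucl r" for v c
  proof -
    have "L (vscale \<xi> c (inv_into A L v)) = (\<lambda>i. c * v i)"
      using L inA that LL by (simp add: linear_coords_def)
    then have "inv_into A L (\<lambda>i. c * v i) = vscale \<xi> c (inv_into A L v)"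
      using inv[OF cl(2)[OF inA[OF that]]] by metis
    then show ?thesis using L' inA that by (simp add: linear_coords_def)
  qed
qed

text \<open>Linear coordinates are homeomorphic to each other, so invariance of dimension applies.\<close>

lemma linear_coords_unique:
  assumes L: "linear_coords \<xi> A r L" and L': "linear_coords \<xi> A r' L'"
    and cl: "\<And>e e'. e \<in> A \<Longrightarrow> e' \<in> A \<Longrightarrow> vadd \<xi> e e' \<in> A" "\<And>c e. e \<in> A \<Longrightarrow> vscale \<xi> c e \<in> A"
  shows "r = r'"
proof -
  have bij: "bij_betw L A (Eucl r)" "bij_betw L' A (Eucl r')" using L L' by (auto simp: linear_coords_def)
  have "homeomorphic_maps (Euclidean_space r) (Euclidean_space r') (\<lambda>v. L' (inv_into A L v)) (\<lambda>v. L (inv_into A L' v))"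
    unfolding homeomorphic_maps_def
  proof (intro conjI ballI)
    show "continuous_map (Euclidean_space r) (Euclidean_space r') (\<lambda>v. L' (inv_into A L v))"
      by (rule linear_coords_transition[OF L L' cl])
    show "continuous_map (Euclidean_space r') (Euclidean_space r) (\<lambda>v. L (inv_into A L' v))"
      by (rule linear_coords_transition[OF L' L cl])
    fix v assume "v \<in> topspace (Euclidean_space r)"
    then have v: "v \<in> Eucl r" by simp
    then have "inv_into A L v \<in> A" using bij_betwE[OF bij_betw_inv_into[OF bij(1)]] by blast
    then show "L (inv_into A L' (L' (inv_into A L v))) = v"
      using bij_betw_inv_into_left[OF bij(2)] bij_betw_inv_into_right[OF bij(1) v] by simp
  next
    fix v assume "v \<in> topspace (Euclidean_space r')"
    then have v: "v \<in> Eucl r'" by simp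
    then have "inv_into A L' v \<in> A" using bij_betwE[OF bij_betw_inv_into[OF bij(2)]] by blast
    then show "L' (inv_into A L (L (inv_into A L' v))) = v"
      using bij_betw_inv_into_left[OF bij(1)] bij_betw_inv_into_right[OF bij(2) v] by simp
  qed
  then have "Euclidean_space r homeomorphic_space Euclidean_space r'"
    by (auto simp: homeomorphic_space_def)
  then show ?thesis by (simp add: invariance_of_dimension_Euclidean_space)
qed

lemma rank_at_eqI:
  assumes L: "linear_coords \<xi> (fibre \<xi> x) r L"
    and cl: "\<And>e e'. e \<in> fibre \<xi> x \<Longrightarrow> e' \<in> fibre \<xi> x \<Longrightarrow> vadd \<xi> e e' \<in> fibre \<xi> x" 
      "\<And>c e. e \<in> fibre \<xi> x \<Longrightarrow> vscale \<xi> c e \<in> fibre \<xi> x"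
  shows "rank_at \<xi> x = r"
proof -
  have "rank_at \<xi> x = (THE r. \<exists>L. linear_coords \<xi> (fibre \<xi> x) r L)"
    by (simp add: rank_at_def linear_coords_def)
  also have "\<dots> = r"
    by (rule the_equality) (use L linear_coords_unique[OF _ L cl] in blast)+
  finally show ?thesis .
qed

text \<open>
  The vectors of \<open>S\<close> with vanishing last coordinate form a subspace of a smaller Euclidean space, and
  \<open>S\<close> is spanned by them and at most one more vector.
\<close>

lemma subspace_coords:
  fixes S :: "(nat \<Rightarrow> real) set"
  shows "S \<subseteq> Eucl r \<Longrightarrow> (\<lambda>i. 0) \<in> S \<Longrightarrow> (\<And>v w. v \<in> S \<Longrightarrow> w \<in> S \<Longrightarrow> (\<lambda>i. v i + w i) \<in> S) \<Longrightarrow>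
    (\<And>c v. v \<in> S \<Longrightarrow> (\<lambda>i. c * v i) \<in> S) \<Longrightarrow>
    \<exists>p L. bij_betw L S (Eucl p) \<and> (\<forall>v\<in>S. (\<forall>w\<in>S. L (\<lambda>i. v i + w i) = (\<lambda>i. L v i + L w i)) \<and>
       (\<forall>c. L (\<lambda>i. c * v i) = (\<lambda>i. c * L v i)))"
proof (induction r arbitrary: S)
  case 0
  then have "S = {\<lambda>i. 0}" by (auto simp: Eucl_def)
  moreover have "Eucl 0 = {\<lambda>i. 0}" by (auto simp: Eucl_def)
  ultimately show ?case
    by (intro exI[of _ 0] exI[of _ "\<lambda>v. v"]) (simp add: bij_betw_def)
next
  case (Suc r)
  define S0 where "S0 = {v \<in> S. v r = 0}"
  have "S0 \<subseteq> Eucl r"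
  proof
    fix v assume v: "v \<in> S0"
    have "v i = 0" if "i \<ge> r" for i
    proof (cases "i = r")
      case False
      then have "i \<ge> Suc r" using that by simp
      then show ?thesis using v Suc.prems(1) by (auto simp: S0_def Eucl_def)
    qed (use v in \<open>simp add: S0_def\<close>)
    then show "v \<in> Eucl r" by (simp add: Eucl_def)
  qed
  then have "\<exists>p L. bij_betw L S0 (Eucl p) \<and> (\<forall>v\<in>S0. (\<forall>w\<in>S0. L (\<lambda>i. v i + w i) = (\<lambda>i. L v i + L w i)) \<and>
       (\<forall>c. L (\<lambda>i. c * v i) = (\<lambda>i. c * L v i)))"
    by (rule Suc.IH) (use Suc.prems in \<open>auto simp: S0_def\<close>)
  then obtain p L where L: "bij_betw L S0 (Eucl p)" "\<And>v w. v \<in> S0 \<Longrightarrow> w \<in> S0 \<Longrightarrow> L (\<lambda>i. v i + w i) = (\<lambda>i. L v i + L w i)"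
    "\<And>v c. v \<in> S0 \<Longrightarrow> L (\<lambda>i. c * v i) = (\<lambda>i. c * L v i)" by blast
  show ?case
  proof (cases "S \<subseteq> S0")
    case True
    then have "S = S0" by (auto simp: S0_def)
    then show ?thesis using L by (intro exI[of _ p] exI[of _ L]) simp
  next
    case False
    then obtain u where u: "u \<in> S" "u r \<noteq> 0" by (auto simp: S0_def)
    define w where "w = (\<lambda>i. (1 / u r) * u i)"
    have w: "w \<in> S" "w r = 1" unfolding w_def by (rule Suc.prems(4)[OF u(1)]) (use u(2) in simp)
    define P where "P v = (\<lambda>i. v i + (- v r) * w i)" for v :: "nat \<Rightarrow> real"
    have P: "P v \<in> S0" if "v \<in> S" for v
      using Suc.prems(3)[OF that Suc.prems(4)[OF w(1), of "- v r"]] w(2) by (simp add: P_def S0_def)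
    define L' where "L' v = (\<lambda>i. L (P v) i + v r * unit_vec p i)" for v
    have LE: "L v \<in> Eucl p" if "v \<in> S0" for v using bij_betwE[OF L(1)] that by blast
    have L'p: "L' v p = v r" and L'lt: "i \<noteq> p \<Longrightarrow> L' v i = L (P v) i" if "v \<in> S" for v i
      using LE[OF P[OF that]] by (auto simp: L'_def unit_vec_def Eucl_def)
    have "bij_betw L' S (Eucl (Suc p))"
    proof (rule bij_betw_imageI)
      show "inj_on L' S"
      proof (rule inj_onI)
        fix v v' assume v: "v \<in> S" "v' \<in> S" "L' v = L' v'"
        have r: "v r = v' r" using L'p v by metis
        have "L (P v) i = L (P v') i" for i
          using L'lt[OF v(1)] L'lt[OF v(2)] v(3) LE[OF P[OF v(1)]] LE[OF P[OF v(2)]]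
          by (cases "i = p") (auto simp: Eucl_def)
        then have "L (P v) = L (P v')" by (rule ext)
        then have "P v = P v'" using inj_onD[OF bij_betw_imp_inj_on[OF L(1)] _ P[OF v(1)] P[OF v(2)]] by simp
        then have "P v i = P v' i" for i by simp
        then have "v i = v' i" for i using r by (simp add: P_def)
        then show "v = v'" by (rule ext)
      qed
      show "L' ` S = Eucl (Suc p)"
      proof (intro equalityI subsetI)
        fix z assume "z \<in> L' ` S"
        then obtain v where v: "v \<in> S" "z = L' v" by blast
        then show "z \<in> Eucl (Suc p)" using LE[OF P[OF v(1)]] by (auto simp: Eucl_def L'_def unit_vec_def)
      next
        fix z assume z: "z \<in> Eucl (Suc p)"
        define z0 where "z0 = z(p := 0)"
        have "z0 \<in> Eucl p" using z by (auto simp: Eucl_def z0_def)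
        then have "z0 \<in> L ` S0" using L(1) by (simp add: bij_betw_def)
        then obtain v0 where v0: "v0 \<in> S0" "L v0 = z0" by blast
        define v where "v = (\<lambda>i. v0 i + z p * w i)"
        have v: "v \<in> S" using Suc.prems(3)[OF _ Suc.prems(4)[OF w(1), of "z p"]] v0(1) by (simp add: v_def S0_def)
        have vr: "v r = z p" using v0(1) w(2) by (simp add: v_def S0_def)
        have "P v = v0" by (simp add: P_def vr) (simp add: v_def)
        then have "L (P v) = z0" using v0(2) by simp
        then have "L' v i = z i" for i using vr by (simp add: L'_def z0_def unit_vec_def)
        then have "L' v = z" by (rule ext)
        then show "z \<in> L' ` S" using v by blast
      qed
    qed
    moreover have "L' (\<lambda>i. v i + v' i) = (\<lambda>i. L' v i + L' v' i)" if "v \<in> S" "v' \<in> S" for v v'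
    proof -
      have "P (\<lambda>i. v i + v' i) = (\<lambda>i. P v i + P v' i)" by (simp add: P_def algebra_simps)
      then show ?thesis using L(2)[OF P[OF that(1)] P[OF that(2)]] by (simp add: L'_def algebra_simps)
    qed
    moreover have "L' (\<lambda>i. c * v i) = (\<lambda>i. c * L' v i)" if "v \<in> S" for v c
    proof -
      have "P (\<lambda>i. c * v i) = (\<lambda>i. c * P v i)" by (simp add: P_def algebra_simps)
      then show ?thesis using L(3)[OF P[OF that], of c] by (simp add: L'_def algebra_simps)
    qed
    ultimately show ?thesis by (intro exI[of _ "Suc p"] exI[of _ L']) simp
  qed
qed

context c2_bundle_over begin

definition eigenspace :: "real \<Rightarrow> 'm \<Rightarrow> 'e set" where
  "eigenspace \<sigma> x = {e \<in> fib x. act \<xi> e = vscale \<xi> \<sigma> e}"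

lemma fibre_linear_coords:
  assumes x: "x \<in> topspace X"
  shows "\<exists>L. linear_coords \<xi> (fib x) (rank_at \<xi> x) L"
proof -
  obtain c r where "inj_on c (fib x)" "c ` fib x = Eucl r"
    "\<forall>e\<in>fib x. (\<forall>e'\<in>fib x. c (vadd \<xi> e e') = (\<lambda>i. c e i + c e' i)) \<and> (\<forall>a. c (vscale \<xi> a e) = (\<lambda>i. a * c e i))"
    using fib_coords[OF x] by (elim exE conjE) (rule that)
  then have L: "linear_coords \<xi> (fib x) r c" by (simp add: linear_coords_def bij_betw_def)
  then have "rank_at \<xi> x = r" by (rule rank_at_eqI) (auto intro: add_fib scale_fib)
  then show ?thesis using L by blast
qed

lemma eigenspace_closed:
  assumes x: "x \<in> topspace X"
  shows "e \<in> eigenspace \<sigma> x \<Longrightarrow> e' \<in> eigenspace \<sigma> x \<Longrightarrow> vadd \<xi> e e' \<in> eigenspace \<sigma> x"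
    "e \<in> eigenspace \<sigma> x \<Longrightarrow> vscale \<xi> c e \<in> eigenspace \<sigma> x"
  by (auto simp: eigenspace_def add_fib scale_fib act_add[of _ x] act_scale[of _ x] vec_scale_add[of _ x] vec_scale_scale[of _ x] mult.commute)

lemma eigenspace_linear_coords:
  assumes x: "x \<in> fixed_set M"
  shows "\<exists>L. linear_coords \<xi> (eigenspace \<sigma> x) (rank_at (eigenbundle M \<sigma> \<xi>) x) L"
proof -
  have xX: "x \<in> topspace X" and gx: "g x = x" using x by (auto simp: fixed_set_def)
  have fe: "fibre (eigenbundle M \<sigma> \<xi>) x = eigenspace \<sigma> x"
    using x by (auto simp: fibre_def eigenbundle_def eigenspace_def)
  have ops: "vadd (eigenbundle M \<sigma> \<xi>) = vadd \<xi>" "vscale (eigenbundle M \<sigma> \<xi>) = vscale \<xi>"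
    by (auto simp: eigenbundle_def)
  obtain c where c: "linear_coords \<xi> (fib x) (rank_at \<xi> x) c" using fibre_linear_coords[OF xX] by blast
  have bij: "bij_betw c (fib x) (Eucl (rank_at \<xi> x))" using c by (simp add: linear_coords_def)
  have sub: "eigenspace \<sigma> x \<subseteq> fib x" by (auto simp: eigenspace_def)
  have lin: "c (vadd \<xi> e e') = (\<lambda>i. c e i + c e' i)" "c (vscale \<xi> a e) = (\<lambda>i. a * c e i)"
    if "e \<in> eigenspace \<sigma> x" "e' \<in> eigenspace \<sigma> x" for e e' a
    using c that sub by (auto simp: linear_coords_def)
  have z: "vzero \<xi> x \<in> eigenspace \<sigma> x"
    using zero_fib[OF xX] act_vzero[OF xX] vec_scale_vzero[OF xX] gx by (simp add: eigenspace_def)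
  have "\<exists>p L. bij_betw L (c ` eigenspace \<sigma> x) (Eucl p) \<and> (\<forall>v\<in>c ` eigenspace \<sigma> x. (\<forall>w\<in>c ` eigenspace \<sigma> x. L (\<lambda>i. v i + w i) = (\<lambda>i. L v i + L w i)) \<and>
       (\<forall>a. L (\<lambda>i. a * v i) = (\<lambda>i. a * L v i)))"
  proof (rule subspace_coords[of _ "rank_at \<xi> x"])
    show "c ` eigenspace \<sigma> x \<subseteq> Eucl (rank_at \<xi> x)" using bij_betwE[OF bij] sub by blast
    have "c (vscale \<xi> 0 (vzero \<xi> x)) = (\<lambda>i. 0)" using lin(2)[OF z z, of 0] by simp
    then show "(\<lambda>i. 0) \<in> c ` eigenspace \<sigma> x" using z vec_scale_vzero[OF xX, of 0] by (metis imageI)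
    show "(\<lambda>i. v i + w i) \<in> c ` eigenspace \<sigma> x" if vw: "v \<in> c ` eigenspace \<sigma> x" "w \<in> c ` eigenspace \<sigma> x" for v w
    proof -
      obtain e e' where e: "e \<in> eigenspace \<sigma> x" "v = c e" "e' \<in> eigenspace \<sigma> x" "w = c e'" using vw by blast
      then have "(\<lambda>i. v i + w i) = c (vadd \<xi> e e')" using lin(1) by simp
      then show ?thesis using eigenspace_closed(1)[OF xX e(1,3)] by blast
    qed
    show "(\<lambda>i. a * v i) \<in> c ` eigenspace \<sigma> x" if va: "v \<in> c ` eigenspace \<sigma> x" for v a
    proof -
      obtain e where e: "e \<in> eigenspace \<sigma> x" "v = c e" using va by blast
      then have "(\<lambda>i. a * v i) = c (vscale \<xi> a e)" using lin(2) by simp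
      then show ?thesis using eigenspace_closed(2)[OF xX e(1)] by blast
    qed
  qed
  then obtain p L where L: "bij_betw L (c ` eigenspace \<sigma> x) (Eucl p)"
    "\<And>v w. v \<in> c ` eigenspace \<sigma> x \<Longrightarrow> w \<in> c ` eigenspace \<sigma> x \<Longrightarrow> L (\<lambda>i. v i + w i) = (\<lambda>i. L v i + L w i)"
    "\<And>v a. v \<in> c ` eigenspace \<sigma> x \<Longrightarrow> L (\<lambda>i. a * v i) = (\<lambda>i. a * L v i)" by blast
  have "bij_betw c (eigenspace \<sigma> x) (c ` eigenspace \<sigma> x)"
    using inj_on_subset[OF bij_betw_imp_inj_on[OF bij] sub] by (simp add: bij_betw_def)
  then have "bij_betw (\<lambda>e. L (c e)) (eigenspace \<sigma> x) (Eucl p)" using bij_betw_trans[OF _ L(1)] by (simp add: o_def)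
  then have lc: "linear_coords \<xi> (eigenspace \<sigma> x) p (\<lambda>e. L (c e))"
    using L(2,3) lin by (simp add: linear_coords_def)
  then have "linear_coords (eigenbundle M \<sigma> \<xi>) (fibre (eigenbundle M \<sigma> \<xi>) x) p (\<lambda>e. L (c e))"
    by (simp add: linear_coords_def fe ops)
  then have "rank_at (eigenbundle M \<sigma> \<xi>) x = p"
    by (rule rank_at_eqI) (use eigenspace_closed[OF xX] in \<open>auto simp: fe ops\<close>)
  then show ?thesis using lc by blast
qed

lemma independent_vectors:
  assumes L: "linear_coords \<xi> A p L" and A: "A \<subseteq> fib x" "vzero \<xi> x \<in> A" and x: "x \<in> topspace X"
    and cl: "\<And>e e'. e \<in> A \<Longrightarrow> e' \<in> A \<Longrightarrow> vadd \<xi> e e' \<in> A" "\<And>c e. e \<in> A \<Longrightarrow> vscale \<xi> c e \<in> A"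
  shows "\<exists>v. (\<forall>j<p. v j \<in> A) \<and> (\<forall>a. vcomb \<xi> p (vzero \<xi> x) v a = vzero \<xi> x \<longrightarrow> (\<forall>j<p. a j = 0))"
proof -
  have bij: "bij_betw L A (Eucl p)" using L by (simp add: linear_coords_def)
  define v where "v j = inv_into A L (unit_vec j)" for j
  have v: "v j \<in> A" "L (v j) = unit_vec j" if "j < p" for j
    using bij_betwE[OF bij_betw_inv_into[OF bij]] bij_betw_inv_into_right[OF bij] unit_vec_Eucl[OF that] by (auto simp: v_def)
  have comb: "vcomb \<xi> q (vzero \<xi> x) v a \<in> A \<and> L (vcomb \<xi> q (vzero \<xi> x) v a) i = L (vzero \<xi> x) i + (\<Sum>j<q. a j * unit_vec j i)"
    if "q \<le> p" for q a i
    using that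
  proof (induction q)
    case 0 then show ?case using A(2) by simp
  next
    case (Suc q)
    then have IH: "vcomb \<xi> q (vzero \<xi> x) v a \<in> A" "L (vcomb \<xi> q (vzero \<xi> x) v a) i = L (vzero \<xi> x) i + (\<Sum>j<q. a j * unit_vec j i)"
      and vq: "v q \<in> A" "L (v q) = unit_vec q" using v Suc.prems by auto
    have "vscale \<xi> (a q) (v q) \<in> A" using cl(2)[OF vq(1)] .
    moreover have "L (vscale \<xi> (a q) (v q)) i = a q * unit_vec q i"
      using L vq by (simp add: linear_coords_def)
    ultimately show ?case using IH L cl(1) by (simp add: linear_coords_def)
  qed
  show ?thesis
  proof (intro exI[of _ v] conjI allI impI)
    show "v j \<in> A" if "j < p" for j using v(1)[OF that] .
    fix a :: "nat \<Rightarrow> real" and i assume "vcomb \<xi> p (vzero \<xi> x) v a = vzero \<xi> x"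
    then have "(\<Sum>j<p. a j * unit_vec j i) = 0" using comb[OF order_refl, of a i] by simp
    moreover assume "i < p"
    then have "(\<Sum>j<p. a j * unit_vec j i) = a i"
      by (simp add: unit_vec_def if_distrib[of "\<lambda>z. _ * z"] cong: if_cong)
    ultimately show "a i = 0" by simp
  qed
qed

section \<open>Nowhere vanishing equivariant sections\<close>

lemma fixed_set_closed: "closedin X (fixed_set M)"
proof -
  have "closedin X {x \<in> topspace X. g x = id x}"
    by (rule closedin_continuous_maps_eq[OF X_top(1) g_cont]) simp
  then show ?thesis by (simp add: fixed_set_def)
qed

lemma sections_stationary_limit:
  fixes F :: "nat \<Rightarrow> 'm \<Rightarrow> 'e"
  assumes F: "\<And>n. eqsec \<sigma> (F n) \<and> (\<forall>y\<in>topspace X. F n y \<in> Op)"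
    and lim: "\<And>x. x \<in> topspace X \<Longrightarrow> \<exists>U N. openin X U \<and> x \<in> U \<and> (\<forall>n\<ge>N. \<forall>y\<in>U. f y = F n y)"
  shows "eqsec \<sigma> f \<and> (\<forall>y\<in>topspace X. f y \<in> Op)"
proof -
  have pt: "\<exists>N. \<forall>n\<ge>N. f x = F n x" if "x \<in> topspace X" for x using lim[OF that] by blast
  have "continuous_map X T f"
  proof (rule continuous_map_locally)
    fix x assume "x \<in> topspace X"
    from lim[OF this] obtain U N where U: "openin X U" "x \<in> U" "\<forall>n\<ge>N. \<forall>y\<in>U. f y = F n y" by blast
    have "continuous_map (subtopology X U) T (F N)"
      using F[of N] by (auto simp: eqsec_def intro: continuous_map_from_subtopology)
    then have "continuous_map (subtopology X U) T f" by (rule continuous_map_eq) (use U(3) in auto)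
    then show "\<exists>U. openin X U \<and> x \<in> U \<and> continuous_map (subtopology X U) T f" using U by blast
  qed
  moreover have "f x \<in> fib x \<and> act \<xi> (f x) = vscale \<xi> \<sigma> (f (g x)) \<and> f x \<in> Op" if x: "x \<in> topspace X" for x
  proof -
    obtain N where N: "\<forall>n\<ge>N. f x = F n x" using pt[OF x] by blast
    obtain N' where N': "\<forall>n\<ge>N'. f (g x) = F n (g x)" using pt[OF g_in[OF x]] by blast
    have "f x = F (max N N') x" "f (g x) = F (max N N') (g x)" using N N' by auto
    then show ?thesis using F[of "max N N'"] x by (simp add: eqsec_def)
  qed
  ultimately show ?thesis by (simp add: eqsec_def)
qed

text \<open>
  At a fixed point the vectors used for the perturbation must be taken from the eigenspace for \<open>\<sigma>\<close>;
  a slice chart maps the fixed set into a space of smaller dimension than that eigenspace.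
\<close>

lemma nonvanishing_on_fixed_set:
  assumes \<sigma>: "\<sigma> \<in> {1, -1::real}" and Op: "openin T Op" 
    and s: "eqsec \<sigma> s" "\<forall>y\<in>topspace X. s y \<in> Op"
    and rk: "\<forall>x\<in>fixed_set M. rank_at (eigenbundle M \<sigma> \<xi>) x > fixed_dim M"
  shows "\<exists>t. (eqsec \<sigma> t \<and> (\<forall>y\<in>topspace X. t y \<in> Op)) \<and> (\<forall>y\<in>{} \<union> fixed_set M. t y \<noteq> vzero \<xi> y)"
proof (rule exhaustion_gluing[of X g "fixed_set M" "{}" "\<lambda>t. eqsec \<sigma> t \<and> (\<forall>y\<in>topspace X. t y \<in> Op)" "\<lambda>y e. e \<noteq> vzero \<xi> y" s])
  show "locally_compact_space X" "Hausdorff_space X" "second_countable X" using X_top by auto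
  show "continuous_map X X g" "\<And>x. x \<in> topspace X \<Longrightarrow> g (g x) = x" using g_cont gg by auto
  show "closedin X (fixed_set M)" "closedin X {}" using fixed_set_closed by auto
  show "eqsec \<sigma> s \<and> (\<forall>y\<in>topspace X. s y \<in> Op)" using s by simp
  show "\<And>y. y \<in> {} \<Longrightarrow> s y \<noteq> vzero \<xi> y" by simp
  show "eqsec \<sigma> f \<and> (\<forall>y\<in>topspace X. f y \<in> Op)"
    if "\<And>n. eqsec \<sigma> (F n) \<and> (\<forall>y\<in>topspace X. F n y \<in> Op)"
      "\<And>x. x \<in> topspace X \<Longrightarrow> \<exists>U N. openin X U \<and> x \<in> U \<and> (\<forall>n\<ge>N. \<forall>y\<in>U. f y = F n y)" for F :: "nat \<Rightarrow> 'm \<Rightarrow> 'e" and f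
    by (rule sections_stationary_limit[OF that])
  fix x assume xF: "x \<in> fixed_set M"
  have xX: "x \<in> topspace X" and gx: "g x = x" using xF by (auto simp: fixed_set_def)
  obtain k U \<phi> where U: "x \<in> U" "slice_chart M (fixed_set M) k (U, \<phi>)"
    using slice_chart_exists[OF manifold xF] by blast
  have k: "k \<le> fixed_dim M" using slice_dim_le_fixed_dim[OF xF U] .
  have tc: "topological_chart M (U, \<phi>)" and slice: "\<phi> ` (U \<inter> fixed_set M) = \<phi> ` U \<inter> Eucl k"
    using U(2) by (auto simp: slice_chart_def smooth_chart_def)
  note cD = topological_chartD[OF tc]
  define p where "p = rank_at (eigenbundle M \<sigma> \<xi>) x"
  have kp: "k < p" using rk xF k by (auto simp: p_def)
  obtain L where L: "linear_coords \<xi> (eigenspace \<sigma> x) p L"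
    using eigenspace_linear_coords[OF xF] by (auto simp: p_def)
  have z: "vzero \<xi> x \<in> eigenspace \<sigma> x"
    using zero_fib[OF xX] act_vzero[OF xX] vec_scale_vzero[OF xX] gx by (simp add: eigenspace_def)
  have sub: "eigenspace \<sigma> x \<subseteq> fib x" by (auto simp: eigenspace_def)
  have "\<exists>v. (\<forall>j<p. v j \<in> eigenspace \<sigma> x) \<and> (\<forall>a. vcomb \<xi> p (vzero \<xi> x) v a = vzero \<xi> x \<longrightarrow> (\<forall>j<p. a j = 0))"
    by (rule independent_vectors[OF L sub z xX]) (use eigenspace_closed[OF xX] in auto)
  then obtain v where v: "\<forall>j<p. v j \<in> eigenspace \<sigma> x" "\<forall>a. vcomb \<xi> p (vzero \<xi> x) v a = vzero \<xi> x \<longrightarrow> (\<forall>j<p. a j = 0)"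
    by (elim exE conjE)
  show "\<exists>W. openin X W \<and> x \<in> W \<and> (\<forall>K N C t. compactin X K \<longrightarrow> K \<subseteq> W \<inter> fixed_set M \<longrightarrow> openin X N \<longrightarrow> g ` N \<subseteq> N \<longrightarrow> K \<subseteq> N \<longrightarrow>
     closedin X C \<longrightarrow> {} \<subseteq> C \<longrightarrow> (eqsec \<sigma> t \<and> (\<forall>y\<in>topspace X. t y \<in> Op)) \<longrightarrow> (\<forall>y\<in>C. t y \<noteq> vzero \<xi> y) \<longrightarrow>
     (\<exists>t'. (eqsec \<sigma> t' \<and> (\<forall>y\<in>topspace X. t' y \<in> Op)) \<and> (\<forall>y\<in>C \<union> K. t' y \<noteq> vzero \<xi> y) \<and> (\<forall>y\<in>topspace X - N. t' y = t y)))"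
  proof (rule local_nonvanishing[OF \<sigma> xX Op, where p=p and v=v and ?O1.0=U and m="mdim M" and \<phi>=\<phi> and k=k])
    show "v j \<in> fib x" if "j < p" for j using v(1) that sub by auto
    show "act \<xi> (v j) = vscale \<xi> \<sigma> (v j)" if "j < p" for j using v(1) that by (simp add: eigenspace_def)
    show "\<phi> ` (U \<inter> fixed_set M) \<subseteq> Eucl k" using slice by auto
    show "(\<forall>y\<in>fixed_set M. g y = y) \<or> g ` U \<inter> U = {}" by (simp add: fixed_set_def)
  qed (use v U cD kp in auto)
qed

text \<open>
  A section without zeros on the fixed set has none on a closed neighbourhood \<open>C0\<close> of it, on which it
  is then kept nonzero. The other points have neighbourhoods disjoint from their mirror images, where
  all vectors of the fibre can be used for the perturbation.
\<close>

lemma nonvanishing_section: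
  assumes \<sigma>: "\<sigma> \<in> {1, -1::real}" and Op: "openin T Op" 
    and s: "eqsec \<sigma> s" "\<forall>y\<in>topspace X. s y \<in> Op"
    and rk: "\<forall>x\<in>topspace X. rank_at \<xi> x > mdim M"
    and rkF: "\<forall>x\<in>fixed_set M. rank_at (eigenbundle M \<sigma> \<xi>) x > fixed_dim M"
  shows "\<exists>t. eqsec \<sigma> t \<and> (\<forall>y\<in>topspace X. t y \<in> Op \<and> t y \<noteq> vzero \<xi> y)"
proof -
  obtain s' where s': "eqsec \<sigma> s' \<and> (\<forall>y\<in>topspace X. s' y \<in> Op)" "\<forall>y\<in>fixed_set M. s' y \<noteq> vzero \<xi> y"
    using nonvanishing_on_fixed_set[OF \<sigma> Op s rkF] by auto
  have s'T: "continuous_map X T s'" "\<And>y. y \<in> topspace X \<Longrightarrow> s' y \<in> fib y" using s'(1) by (auto simp: eqsec_def)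
  define A where "A = {y \<in> topspace X. s' y \<in> {e \<in> topspace T. e \<noteq> vzero \<xi> (proj \<xi> e)}}"
  have A: "openin X A" unfolding A_def by (rule openin_continuous_map_preimage[OF s'T(1) nonzero_open])
  have A_nz: "s' y \<noteq> vzero \<xi> y" if "y \<in> A" for y using that s'T(2)[of y] by (auto simp: A_def fib_iff)
  have "fixed_set M \<subseteq> A"
    using s'(2) s'T(2) by (auto simp: A_def fixed_set_def fib_iff)
  then obtain V where V: "openin X V" "fixed_set M \<subseteq> V" "X closure_of V \<subseteq> A"
    using X_top(3)[unfolded normal_space_alt, rule_format, of "fixed_set M" A] fixed_set_closed A by auto
  define C0 where "C0 = X closure_of V"
  have VC0: "V \<subseteq> C0" unfolding C0_def by (rule closure_of_subset[OF openin_subset[OF V(1)]])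
  have "\<exists>t. (eqsec \<sigma> t \<and> (\<forall>y\<in>topspace X. t y \<in> Op)) \<and> (\<forall>y\<in>C0 \<union> topspace X. t y \<noteq> vzero \<xi> y)"
  proof (rule exhaustion_gluing[of X g "topspace X" C0 "\<lambda>t. eqsec \<sigma> t \<and> (\<forall>y\<in>topspace X. t y \<in> Op)" "\<lambda>y e. e \<noteq> vzero \<xi> y" s'])
    show "locally_compact_space X" "Hausdorff_space X" "second_countable X" using X_top by auto
    show "continuous_map X X g" "\<And>x. x \<in> topspace X \<Longrightarrow> g (g x) = x" using g_cont gg by auto
    show "closedin X (topspace X)" "closedin X C0" by (auto simp: C0_def)
    show "eqsec \<sigma> s' \<and> (\<forall>y\<in>topspace X. s' y \<in> Op)" using s' by simp
    show "\<And>y. y \<in> C0 \<Longrightarrow> s' y \<noteq> vzero \<xi> y" using A_nz V(3) by (auto simp: C0_def)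
    show "eqsec \<sigma> f \<and> (\<forall>y\<in>topspace X. f y \<in> Op)"
      if "\<And>n. eqsec \<sigma> (F n) \<and> (\<forall>y\<in>topspace X. F n y \<in> Op)"
        "\<And>x. x \<in> topspace X \<Longrightarrow> \<exists>U N. openin X U \<and> x \<in> U \<and> (\<forall>n\<ge>N. \<forall>y\<in>U. f y = F n y)" for F :: "nat \<Rightarrow> 'm \<Rightarrow> 'e" and f
      by (rule sections_stationary_limit[OF that])
    fix x assume xX: "x \<in> topspace X"
    show "\<exists>W. openin X W \<and> x \<in> W \<and> (\<forall>K N C t. compactin X K \<longrightarrow> K \<subseteq> W \<inter> topspace X \<longrightarrow> openin X N \<longrightarrow> g ` N \<subseteq> N \<longrightarrow> K \<subseteq> N \<longrightarrow>
       closedin X C \<longrightarrow> C0 \<subseteq> C \<longrightarrow> (eqsec \<sigma> t \<and> (\<forall>y\<in>topspace X. t y \<in> Op)) \<longrightarrow> (\<forall>y\<in>C. t y \<noteq> vzero \<xi> y) \<longrightarrow>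
       (\<exists>t'. (eqsec \<sigma> t' \<and> (\<forall>y\<in>topspace X. t' y \<in> Op)) \<and> (\<forall>y\<in>C \<union> K. t' y \<noteq> vzero \<xi> y) \<and> (\<forall>y\<in>topspace X - N. t' y = t y)))"
    proof (cases "x \<in> V")
      case True
      \<comment> \<open>nothing has to be changed near the fixed set\<close>
      show ?thesis
      proof (intro exI[of _ V] conjI allI impI)
        fix K N C t
        assume K: "K \<subseteq> V \<inter> topspace X" and C: "C0 \<subseteq> C" and t: "eqsec \<sigma> t \<and> (\<forall>y\<in>topspace X. t y \<in> Op)" "\<forall>y\<in>C. t y \<noteq> vzero \<xi> y"
        have "K \<subseteq> C" using K C VC0 by blast
        then show "\<exists>t'. (eqsec \<sigma> t' \<and> (\<forall>y\<in>topspace X. t' y \<in> Op)) \<and> (\<forall>y\<in>C \<union> K. t' y \<noteq> vzero \<xi> y) \<and> (\<forall>y\<in>topspace X - N. t' y = t y)"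
          using t by (intro exI[of _ t]) auto
      qed (use V True in auto)
    next
      case False
      then have gx: "g x \<noteq> x" using V(2) xX by (auto simp: fixed_set_def)
      have "smooth_manifold M" using manifold by (simp add: smooth_c2_manifold_def)
      then obtain U \<phi> where U: "(U, \<phi>) \<in> atlas M" "x \<in> U" and tc: "topological_chart M (U, \<phi>)"
        using xX unfolding smooth_manifold_def smooth_chart_def by fastforce
      note cD = topological_chartD[OF tc]
      obtain O1 where O1: "openin X O1" "x \<in> O1" "O1 \<subseteq> U" "g ` O1 \<inter> O1 = {}"
        using separate_from_image[OF xX gx cD(1) U(2)] by blast
      define p where "p = rank_at \<xi> x"
      have kp: "mdim M < p" using rk xX by (simp add: p_def)
      obtain L where L: "linear_coords \<xi> (fib x) p L" using fibre_linear_coords[OF xX] by (auto simp: p_def)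
      have "\<exists>v. (\<forall>j<p. v j \<in> fib x) \<and> (\<forall>a. vcomb \<xi> p (vzero \<xi> x) v a = vzero \<xi> x \<longrightarrow> (\<forall>j<p. a j = 0))"
        by (rule independent_vectors[OF L order_refl zero_fib[OF xX] xX]) (auto intro: add_fib scale_fib)
      then obtain v where v: "\<forall>j<p. v j \<in> fib x" "\<forall>a. vcomb \<xi> p (vzero \<xi> x) v a = vzero \<xi> x \<longrightarrow> (\<forall>j<p. a j = 0)"
        by (elim exE conjE)
      show ?thesis
      proof (rule local_nonvanishing[OF \<sigma> xX Op, where p=p and v=v and ?O1.0=O1 and m="mdim M" and \<phi>=\<phi> and k="mdim M"])
        show "\<phi> ` (O1 \<inter> topspace X) \<subseteq> Eucl (mdim M)" using cD(5) O1(3) by auto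
        show "continuous_map (subtopology X O1) (Euclidean_space (mdim M)) \<phi>"
          by (rule continuous_map_from_subtopology_mono[OF cD(6) O1(3)])
        show "inj_on \<phi> O1" by (rule inj_on_subset[OF cD(4) O1(3)])
      qed (use v O1 gx kp in auto)
    qed
  qed
  then show ?thesis by auto
qed

end

section \<open>Moving one equivariant section to another\<close>

lemma whitney_trivial_simps:
  "proj (whitney_sum \<xi> (trivial_bundle M V \<rho>)) (e, (x, u)) = proj \<xi> e"
  "vadd (whitney_sum \<xi> (trivial_bundle M V \<rho>)) (e, (x, u)) (e', (x', u')) = (vadd \<xi> e e', (x, u + u'))"
  "vscale (whitney_sum \<xi> (trivial_bundle M V \<rho>)) c (e, (x, u)) = (vscale \<xi> c e, (x, c *\<^sub>R u))"
  "act (whitney_sum \<xi> (trivial_bundle M V \<rho>)) (e, (x, u)) = (act \<xi> e, (flip M x, \<rho> u))"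
  by (auto simp: whitney_sum_def trivial_bundle_def)

definition involution_on :: "'v::euclidean_space set \<Rightarrow> ('v \<Rightarrow> 'v) \<Rightarrow> bool" where
  "involution_on V \<rho> \<longleftrightarrow> subspace V \<and> linear \<rho> \<and> (\<forall>v\<in>V. \<rho> v \<in> V \<and> \<rho> (\<rho> v) = v)"

definition inv_inner :: "('v::euclidean_space \<Rightarrow> 'v) \<Rightarrow> 'v \<Rightarrow> 'v \<Rightarrow> real" where
  "inv_inner \<rho> u w = u \<bullet> w + \<rho> u \<bullet> \<rho> w"

lemma inv_inner_simps:
  assumes "linear \<rho>"
  shows "inv_inner \<rho> (u + u') w = inv_inner \<rho> u w + inv_inner \<rho> u' w" 
    "inv_inner \<rho> (c *\<^sub>R u) w = c * inv_inner \<rho> u w" "inv_inner \<rho> u (c *\<^sub>R w) = c * inv_inner \<rho> u w"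
    "inv_inner \<rho> u u \<ge> 0" "u \<noteq> 0 \<Longrightarrow> inv_inner \<rho> u u > 0"
proof -
  have "\<rho> (u + u') = \<rho> u + \<rho> u'" "\<And>c w. \<rho> (c *\<^sub>R w) = c *\<^sub>R \<rho> w" using assms by (auto simp: linear_add linear_scale)
  then show "inv_inner \<rho> (u + u') w = inv_inner \<rho> u w + inv_inner \<rho> u' w"
    "inv_inner \<rho> (c *\<^sub>R u) w = c * inv_inner \<rho> u w" "inv_inner \<rho> u (c *\<^sub>R w) = c * inv_inner \<rho> u w"
    by (auto simp: inv_inner_def inner_add_left distrib_left)
  show "inv_inner \<rho> u u \<ge> 0" by (simp add: inv_inner_def)
  show "u \<noteq> 0 \<Longrightarrow> inv_inner \<rho> u u > 0" by (simp add: inv_inner_def add_pos_nonneg)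
qed

lemma inv_inner_invariant:
  "involution_on V \<rho> \<Longrightarrow> u \<in> V \<Longrightarrow> w \<in> V \<Longrightarrow> inv_inner \<rho> (\<rho> u) (\<rho> w) = inv_inner \<rho> u w"
  by (simp add: inv_inner_def involution_on_def)

lemma continuous_map_scaleR:
  fixes u :: "'a \<Rightarrow> 'v::euclidean_space"
  shows "continuous_map Z euclideanreal c \<Longrightarrow> continuous_map Z euclidean u \<Longrightarrow> continuous_map Z euclidean (\<lambda>z. c z *\<^sub>R u z)"
  by (simp add: continuous_map_atin tendsto_scaleR)

lemma continuous_map_inner:
  fixes u w :: "'a \<Rightarrow> 'v::euclidean_space"
  shows "continuous_map Z euclidean u \<Longrightarrow> continuous_map Z euclidean w \<Longrightarrow> continuous_map Z euclideanreal (\<lambda>z. u z \<bullet> w z)"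
  by (simp add: continuous_map_atin tendsto_inner)

lemma continuous_map_linear:
  fixes u :: "'a \<Rightarrow> 'v::euclidean_space"
  assumes "linear (\<rho> :: 'v \<Rightarrow> 'v)" "continuous_map Z euclidean u"
  shows "continuous_map Z euclidean (\<lambda>z. \<rho> (u z))"
proof -
  have "bounded_linear \<rho>" by (rule linear_conv_bounded_linear[THEN iffD1, OF assms(1)])
  then have "continuous_on UNIV \<rho>" by (rule linear_continuous_on)
  then have "continuous_map euclidean euclidean \<rho>" by (simp only: continuous_map_iff_continuous2)
  from continuous_map_compose[OF assms(2) this] show ?thesis by (simp only: o_def)
qed

lemma inv_inner_continuous:
  fixes u w :: "'a \<Rightarrow> 'v::euclidean_space"
  assumes "linear \<rho>" "continuous_map Z euclidean u" "continuous_map Z euclidean w"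
  shows "continuous_map Z euclideanreal (\<lambda>z. inv_inner \<rho> (u z) (w z))"
  unfolding inv_inner_def
  by (rule continuous_map_add[OF continuous_map_inner[OF assms(2,3)]
        continuous_map_inner[OF continuous_map_linear[OF assms(1,2)] continuous_map_linear[OF assms(1,3)]]])

context c2_bundle_over begin

abbreviation "stab V \<rho> \<equiv> whitney_sum \<xi> (trivial_bundle M V \<rho>)"

lemma stab_total: "total (stab V \<rho>) = subtopology (prod_topology T (prod_topology X (top_of_set V))) {(e, f). proj \<xi> e = fst f}"
  by (simp add: whitney_sum_def trivial_bundle_def)

lemma stab_mem: "(e, (x, u)) \<in> topspace (total (stab V \<rho>)) \<longleftrightarrow> e \<in> fib x \<and> u \<in> V"
  using proj_in by (auto simp: stab_total fib_iff)

lemma stab_memE: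
  assumes "z \<in> topspace (total (stab V \<rho>))"
  obtains e x u where "z = (e, (x, u))" "e \<in> fib x" "u \<in> V" "x \<in> topspace X" "proj \<xi> e = x"
proof -
  obtain e x u where z: "z = (e, (x, u))" by (metis prod.exhaust)
  have "e \<in> fib x \<and> u \<in> V" using assms unfolding z stab_mem .
  then show thesis using that[OF z] fib_base[of e x] by (simp add: fib_iff)
qed

lemma stab_fibre: "(e, (y, u)) \<in> fibre (stab V \<rho>) x \<longleftrightarrow> y = x \<and> e \<in> fib x \<and> u \<in> V"
  using stab_mem[of e y u V \<rho>] by (auto simp: fibre_def whitney_trivial_simps)

lemma stab_continuousI:
  assumes "continuous_map Z T e" "continuous_map Z euclidean u" "\<And>z. z \<in> topspace Z \<Longrightarrow> u z \<in> V"
  shows "continuous_map Z (total (stab V \<rho>)) (\<lambda>z. (e z, (proj \<xi> (e z), u z)))"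
  unfolding stab_total using assms base_continuous[OF assms(1)]
  by (auto simp: continuous_map_in_subtopology continuous_map_pairwise o_def)

lemma stab_continuousD:
  "continuous_map (total (stab V \<rho>)) T fst" "continuous_map (total (stab V \<rho>)) euclidean (\<lambda>z. snd (snd z))"
proof -
  show "continuous_map (total (stab V \<rho>)) T fst"
    unfolding stab_total by (intro continuous_map_from_subtopology continuous_map_fst)
  have "continuous_map (prod_topology T (prod_topology X (top_of_set V))) (top_of_set V) (\<lambda>z. snd (snd z))"
    using continuous_map_compose[OF continuous_map_snd continuous_map_snd] by (simp add: o_def)
  then show "continuous_map (total (stab V \<rho>)) euclidean (\<lambda>z. snd (snd z))"
    unfolding stab_total by (intro continuous_map_from_subtopology) (simp add: continuous_map_in_subtopology)
qed

text \<open>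
  Continuous families of linear functionals on the fibres of \<open>\<xi> \<oplus> \<epsilon>\<^sub>V\<close>, on which the involution acts
  by the sign \<open>\<sigma>\<close>.
\<close>

definition stab_functional :: "real \<Rightarrow> 'v::euclidean_space set \<Rightarrow> ('v \<Rightarrow> 'v) \<Rightarrow> ('e \<Rightarrow> 'v \<Rightarrow> real) \<Rightarrow> bool" where
  "stab_functional \<sigma> V \<rho> \<kappa> \<longleftrightarrow>
     continuous_map (total (stab V \<rho>)) euclideanreal (\<lambda>z. \<kappa> (fst z) (snd (snd z))) \<and>
     (\<forall>x\<in>topspace X. \<forall>e\<in>fib x. \<forall>u\<in>V.
        (\<forall>e'\<in>fib x. \<forall>u'\<in>V. \<kappa> (vadd \<xi> e e') (u + u') = \<kappa> e u + \<kappa> e' u') \<and>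
        (\<forall>c. \<kappa> (vscale \<xi> c e) (c *\<^sub>R u) = c * \<kappa> e u) \<and> \<kappa> (act \<xi> e) (\<rho> u) = \<sigma> * \<kappa> e u)"

definition vsec :: "real \<Rightarrow> 'v::euclidean_space set \<Rightarrow> ('v \<Rightarrow> 'v) \<Rightarrow> ('m \<Rightarrow> 'v) \<Rightarrow> bool" where
  "vsec \<sigma> V \<rho> d \<longleftrightarrow> continuous_map X euclidean d \<and>
     (\<forall>x\<in>topspace X. d x \<in> V \<and> \<rho> (d x) = \<sigma> *\<^sub>R d (g x))"

text \<open>
  The map \<open>v \<mapsto> v + \<kappa>(v) d\<close> with \<open>d = (d1, d2)\<close>. If \<open>\<kappa>\<close> and \<open>d\<close> both change by \<open>\<sigma>\<close>, it is equivariant.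
\<close>

definition transvection :: "('e \<Rightarrow> 'v::euclidean_space \<Rightarrow> real) \<Rightarrow> ('m \<Rightarrow> 'e) \<Rightarrow> ('m \<Rightarrow> 'v) \<Rightarrow> 'e \<times> ('m \<times> 'v) \<Rightarrow> 'e \<times> ('m \<times> 'v)" where
  "transvection \<kappa> d1 d2 = (\<lambda>(e, (x, u)). (vadd \<xi> e (vscale \<xi> (\<kappa> e u) (d1 x)), (x, u + \<kappa> e u *\<^sub>R d2 x)))"

lemma transvection_continuous:
  fixes V :: "'v::euclidean_space set"
  assumes V: "subspace V" and c: "continuous_map (total (stab V \<rho>)) euclideanreal (\<lambda>z. \<kappa> (fst z) (snd (snd z)))"
    and d: "continuous_map X T d1" "\<And>x. x \<in> topspace X \<Longrightarrow> d1 x \<in> fib x" "continuous_map X euclidean d2" "\<And>x. x \<in> topspace X \<Longrightarrow> d2 x \<in> V"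
  shows "continuous_map (total (stab V \<rho>)) (total (stab V \<rho>)) (transvection \<kappa> d1 d2)"
proof -
  let ?E = "total (stab V \<rho>)"
  have b: "continuous_map ?E X (\<lambda>z. proj \<xi> (fst z))" by (rule base_continuous[OF stab_continuousD(1)])
  have d1: "continuous_map ?E T (\<lambda>z. d1 (proj \<xi> (fst z)))" using continuous_map_compose[OF b d(1)] by (simp add: o_def)
  have d2: "continuous_map ?E euclidean (\<lambda>z. d2 (proj \<xi> (fst z)))" using continuous_map_compose[OF b d(3)] by (simp add: o_def)
  define f where "f z = vadd \<xi> (fst z) (vscale \<xi> (\<kappa> (fst z) (snd (snd z))) (d1 (proj \<xi> (fst z))))" for z :: "'e \<times> ('m \<times> 'v)"
  define w where "w z = snd (snd z) + \<kappa> (fst z) (snd (snd z)) *\<^sub>R d2 (proj \<xi> (fst z))" for z :: "'e \<times> ('m \<times> 'v)"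
  have ffib: "f z \<in> fib (proj \<xi> (fst z))" "w z \<in> V" if "z \<in> topspace ?E" for z
    using that by (elim stab_memE; simp add: f_def w_def add_fib scale_fib d subspace_add[OF V] subspace_scale[OF V])+
  have "continuous_map ?E T f" unfolding f_def
  proof (rule add_continuous[OF stab_continuousD(1) scale_continuous[OF c d1]])
    fix z assume "z \<in> topspace ?E"
    then show "proj \<xi> (fst z) = proj \<xi> (vscale \<xi> (\<kappa> (fst z) (snd (snd z))) (d1 (proj \<xi> (fst z))))"
    proof (rule stab_memE)
      fix e x u assume z: "z = (e, (x, u))" "e \<in> fib x" "x \<in> topspace X" "proj \<xi> e = x"
      have "vscale \<xi> (\<kappa> e u) (d1 x) \<in> fib x" by (rule scale_fib[OF d(2)[OF z(3)]])
      then show ?thesis using z by (simp add: fib_iff)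
    qed
  qed
  moreover have "continuous_map ?E euclidean w" unfolding w_def
    by (intro continuous_map_add continuous_map_scaleR stab_continuousD c d2)
  ultimately have "continuous_map ?E ?E (\<lambda>z. (f z, (proj \<xi> (f z), w z)))"
    by (rule stab_continuousI) (rule ffib(2))
  then show ?thesis
  proof (rule continuous_map_eq)
    fix z assume z: "z \<in> topspace ?E"
    show "(f z, (proj \<xi> (f z), w z)) = transvection \<kappa> d1 d2 z"
    proof (rule stab_memE[OF z])
      fix e x u assume "z = (e, (x, u))" "proj \<xi> e = x"
      then show ?thesis using ffib(1)[OF z] by (simp add: transvection_def f_def w_def fib_iff)
    qed
  qed
qed

text \<open>
  As \<open>\<kappa>(v + \<kappa>(v) d) = \<kappa>(v) (1 + \<kappa>(d))\<close>, the vector \<open>v\<close> can be recovered from its image.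
\<close>

lemma transvection_iso:
  assumes V: "involution_on V \<rho>" and \<kappa>: "stab_functional \<sigma> V \<rho> \<kappa>" and d1: "eqsec \<sigma> d1" and d2: "vsec \<sigma> V \<rho> d2"
    and \<sigma>: "\<sigma> \<in> {1, -1::real}" and nz: "\<And>x. x \<in> topspace X \<Longrightarrow> 1 + \<kappa> (d1 x) (d2 x) \<noteq> 0"
  shows "c2_bundle_iso (stab V \<rho>) (stab V \<rho>) (transvection \<kappa> d1 d2)"
proof -
  let ?E = "total (stab V \<rho>)"
  have sV: "subspace V" and lin\<rho>: "linear \<rho>" using V by (auto simp: involution_on_def)
  have d1T: "continuous_map X T d1" "\<And>x. x \<in> topspace X \<Longrightarrow> d1 x \<in> fib x" "\<And>x. x \<in> topspace X \<Longrightarrow> act \<xi> (d1 x) = vscale \<xi> \<sigma> (d1 (g x))"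
    using d1 by (auto simp: eqsec_def)
  have d2V: "continuous_map X euclidean d2" "\<And>x. x \<in> topspace X \<Longrightarrow> d2 x \<in> V" "\<And>x. x \<in> topspace X \<Longrightarrow> \<rho> (d2 x) = \<sigma> *\<^sub>R d2 (g x)"
    using d2 by (auto simp: vsec_def)
  have \<kappa>c: "continuous_map ?E euclideanreal (\<lambda>z. \<kappa> (fst z) (snd (snd z)))" using \<kappa> by (simp add: stab_functional_def)
  have \<kappa>add: "\<kappa> (vadd \<xi> e e') (u + u') = \<kappa> e u + \<kappa> e' u'" if "e \<in> fib x" "u \<in> V" "e' \<in> fib x" "u' \<in> V" for e e' u u' x
    using \<kappa> that fib_base[of e x] unfolding stab_functional_def by blast
  have \<kappa>scale: "\<kappa> (vscale \<xi> c e) (c *\<^sub>R u) = c * \<kappa> e u" and \<kappa>act: "\<kappa> (act \<xi> e) (\<rho> u) = \<sigma> * \<kappa> e u" if "e \<in> fib x" "u \<in> V" for e u c x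
    using \<kappa> that fib_base[of e x] unfolding stab_functional_def by blast+
  \<comment> \<open>the inverse is the transvection along the same section with functional \<open>\<kappa>'\<close>\<close>
  define n where "n x = 1 + \<kappa> (d1 x) (d2 x)" for x
  define \<kappa>' where "\<kappa>' e u = - \<kappa> e u / n (proj \<xi> e)" for e u
  have "continuous_map X (total (stab V \<rho>)) (\<lambda>x. (d1 x, (proj \<xi> (d1 x), d2 x)))"
    by (rule stab_continuousI[OF d1T(1) d2V(1,2)])
  from continuous_map_compose[OF this \<kappa>c] have "continuous_map X euclideanreal n"
    unfolding n_def by (intro continuous_map_add) (auto simp: o_def)
  then have "continuous_map ?E euclideanreal (\<lambda>z. n (proj \<xi> (fst z)))"
    using continuous_map_compose[OF base_continuous[OF stab_continuousD(1)]] by (fastforce simp: o_def)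
  moreover have "n (proj \<xi> (fst z)) \<noteq> 0" if "z \<in> topspace ?E" for z
    using that nz by (elim stab_memE) (auto simp: n_def)
  ultimately have \<kappa>'c: "continuous_map ?E euclideanreal (\<lambda>z. \<kappa>' (fst z) (snd (snd z)))"
    unfolding \<kappa>'_def by (intro continuous_map_real_divide) (auto intro: \<kappa>c)
  have \<kappa>d: "\<kappa> (vadd \<xi> e (vscale \<xi> a (d1 x))) (u + a *\<^sub>R d2 x) = \<kappa> e u + a * \<kappa> (d1 x) (d2 x)"
    if "e \<in> fib x" "u \<in> V" "x \<in> topspace X" for e u a x
    using \<kappa>add[OF that(1,2) scale_fib[OF d1T(2)[OF that(3)]] subspace_scale[OF sV d2V(2)[OF that(3)]]]
      \<kappa>scale[OF d1T(2)[OF that(3)] d2V(2)[OF that(3)]] by simp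
  have cancel: "vadd \<xi> (vadd \<xi> e (vscale \<xi> a (d1 x))) (vscale \<xi> (- a) (d1 x)) = e" if "e \<in> fib x" "x \<in> topspace X" for e a x
    using vec_add_assoc[OF that(1) scale_fib[OF d1T(2)[OF that(2)]] scale_fib[OF d1T(2)[OF that(2)]]]
      vec_add_scale[OF d1T(2)[OF that(2)]] vec_scale_zero[OF d1T(2)[OF that(2)]] vec_add_zero[OF that(1)] by simp
  have inv1: "transvection \<kappa>' d1 d2 (transvection \<kappa> d1 d2 z) = z" if "z \<in> topspace ?E" for z
    using that
  proof (rule stab_memE)
    fix e x u assume z: "z = (e, (x, u))" "e \<in> fib x" "u \<in> V" "x \<in> topspace X" "proj \<xi> e = x"
    define e' where "e' = vadd \<xi> e (vscale \<xi> (\<kappa> e u) (d1 x))"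
    have e': "e' \<in> fib x" unfolding e'_def by (intro add_fib scale_fib z d1T)
    have "\<kappa> e' (u + \<kappa> e u *\<^sub>R d2 x) = \<kappa> e u * n x"
      unfolding e'_def using \<kappa>d[OF z(2-4), of "\<kappa> e u"] by (simp add: n_def distrib_left)
    then have "\<kappa>' e' (u + \<kappa> e u *\<^sub>R d2 x) = - \<kappa> e u" using e' nz[OF z(4)] by (simp add: \<kappa>'_def fib_iff n_def[symmetric])
    then show ?thesis using cancel[OF z(2,4)] by (simp add: transvection_def z(1) e'_def)
  qed
  have inv2: "transvection \<kappa> d1 d2 (transvection \<kappa>' d1 d2 z) = z" if "z \<in> topspace ?E" for z
    using that
  proof (rule stab_memE)
    fix e x u assume z: "z = (e, (x, u))" "e \<in> fib x" "u \<in> V" "x \<in> topspace X" "proj \<xi> e = x"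
    have n0: "n x \<noteq> 0" using nz[OF z(4)] by (simp add: n_def)
    have "\<kappa> (vadd \<xi> e (vscale \<xi> (\<kappa>' e u) (d1 x))) (u + \<kappa>' e u *\<^sub>R d2 x) = \<kappa> e u + \<kappa>' e u * (n x - 1)"
      using \<kappa>d[OF z(2-4), of "\<kappa>' e u"] by (simp add: n_def)
    also have "\<dots> = - \<kappa>' e u" using n0 by (simp add: \<kappa>'_def z(5) field_simps)
    finally show ?thesis using cancel[OF z(2,4), of "\<kappa>' e u"] by (simp add: transvection_def z(1))
  qed
  have "homeomorphic_maps ?E ?E (transvection \<kappa> d1 d2) (transvection \<kappa>' d1 d2)"
    unfolding homeomorphic_maps_def
    using transvection_continuous[OF sV \<kappa>c d1T(1,2) d2V(1,2)] transvection_continuous[OF sV \<kappa>'c d1T(1,2) d2V(1,2)] inv1 inv2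
    by blast
  then have homeo: "homeomorphic_map ?E ?E (transvection \<kappa> d1 d2)" by (rule homeomorphic_maps_imp_map)
  show ?thesis
    unfolding c2_bundle_iso_def
  proof (intro conjI ballI allI)
    fix z assume "z \<in> topspace ?E"
    then obtain e x u where z: "z = (e, (x, u))" "e \<in> fib x" "u \<in> V" "x \<in> topspace X" "proj \<xi> e = x"
      by (rule stab_memE)
    note dx = d1T(2)[OF z(4)] d2V(2)[OF z(4)]
    have "vadd \<xi> e (vscale \<xi> (\<kappa> e u) (d1 x)) \<in> fib x" by (intro add_fib scale_fib z dx)
    then show "proj (stab V \<rho>) (transvection \<kappa> d1 d2 z) = proj (stab V \<rho>) z"
      using z by (simp add: transvection_def whitney_trivial_simps fib_iff)
    have "vadd \<xi> (act \<xi> e) (vscale \<xi> (\<sigma> * \<kappa> e u) (d1 (g x))) = act \<xi> (vadd \<xi> e (vscale \<xi> (\<kappa> e u) (d1 x)))"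
      using act_add[OF z(2) scale_fib[OF dx(1)]] act_scale[OF dx(1)] d1T(3)[OF z(4)] vec_scale_scale[OF d1T(2)[OF g_in[OF z(4)]]]
      by (simp add: mult.commute)
    moreover have "\<rho> u + (\<sigma> * \<kappa> e u) *\<^sub>R d2 (g x) = \<rho> (u + \<kappa> e u *\<^sub>R d2 x)"
      using d2V(3)[OF z(4)] lin\<rho> by (simp add: linear_add linear_scale mult.commute)
    ultimately show "transvection \<kappa> d1 d2 (act (stab V \<rho>) z) = act (stab V \<rho>) (transvection \<kappa> d1 d2 z)"
      using \<kappa>act[OF z(2,3)] by (simp add: transvection_def z(1) whitney_trivial_simps)
    { fix z' assume z'_fib: "z' \<in> fibre (stab V \<rho>) (proj (stab V \<rho>) z)"
      obtain e' y u' where z': "z' = (e', (y, u'))" by (metis prod.exhaust)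
      have e': "y = x" "e' \<in> fib x" "u' \<in> V"
        using z'_fib z(5) unfolding z' z(1) whitney_trivial_simps stab_fibre by auto
      define a b where "a = vscale \<xi> (\<kappa> e u) (d1 x)" and "b = vscale \<xi> (\<kappa> e' u') (d1 x)"
      have ab: "a \<in> fib x" "b \<in> fib x" by (auto simp: a_def b_def intro: scale_fib dx)
      have s: "vscale \<xi> (\<kappa> e u + \<kappa> e' u') (d1 x) = vadd \<xi> a b" using vec_add_scale[OF dx(1)] by (simp add: a_def b_def)
      have "vadd \<xi> (vadd \<xi> e e') (vadd \<xi> a b) = vadd \<xi> (vadd \<xi> e a) (vadd \<xi> e' b)"
        using vec_add_assoc[OF z(2) e'(2) add_fib[OF ab]] vec_add_assoc[OF z(2) ab(1) add_fib[OF e'(2) ab(2)]]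
          vec_add_assoc[OF e'(2) ab] vec_add_assoc[OF ab(1) e'(2) ab(2)] vec_add_commute[OF e'(2) ab(1)] by simp
      then show "transvection \<kappa> d1 d2 (vadd (stab V \<rho>) z z') = vadd (stab V \<rho>) (transvection \<kappa> d1 d2 z) (transvection \<kappa> d1 d2 z')"
        using \<kappa>add[OF z(2,3) e'(2,3)] s
        by (simp add: transvection_def z(1) z' e'(1) whitney_trivial_simps scaleR_add_left a_def b_def) }
    fix c
    have "vadd \<xi> (vscale \<xi> c e) (vscale \<xi> (c * \<kappa> e u) (d1 x)) = vscale \<xi> c (vadd \<xi> e (vscale \<xi> (\<kappa> e u) (d1 x)))"
      using vec_scale_add[OF z(2) scale_fib[OF dx(1)]] vec_scale_scale[OF dx(1)] by simp
    then show "transvection \<kappa> d1 d2 (vscale (stab V \<rho>) c z) = vscale (stab V \<rho>) c (transvection \<kappa> d1 d2 z)"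
      using \<kappa>scale[OF z(2,3)] by (simp add: transvection_def z(1) whitney_trivial_simps scaleR_add_right)
  qed (rule homeo)
qed


text \<open>
  Pairing with the equivariant section \<open>(C s, w)\<close>, divided by an invariant function. The functions
  \<open>C\<close> and \<open>n\<close> serve to adjust the values on prescribed sections.
\<close>

lemma metric_functional:
  fixes V :: "'v::euclidean_space set"
  assumes B: "invariant_metric B" and V: "involution_on V \<rho>" and \<sigma>: "\<sigma> \<in> {1, -1::real}"
    and s: "eqsec \<sigma> s" and w: "vsec \<sigma> V \<rho> w"
    and C: "continuous_map X euclideanreal C" "\<And>x. x \<in> topspace X \<Longrightarrow> C (g x) = C x"
    and n: "continuous_map X euclideanreal n" "\<And>x. x \<in> topspace X \<Longrightarrow> n (g x) = n x" "\<And>x. x \<in> topspace X \<Longrightarrow> n x \<noteq> 0"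
  shows "stab_functional \<sigma> V \<rho> (\<lambda>e u. (B e (s (proj \<xi> e)) * C (proj \<xi> e) + inv_inner \<rho> u (w (proj \<xi> e))) / n (proj \<xi> e))"
  unfolding stab_functional_def
proof (intro conjI ballI allI)
  let ?E = "total (stab V \<rho>)"
  have lin: "linear \<rho>" using V by (simp add: involution_on_def)
  have sT: "continuous_map X T s" "\<And>x. x \<in> topspace X \<Longrightarrow> s x \<in> fib x" "\<And>x. x \<in> topspace X \<Longrightarrow> act \<xi> (s x) = vscale \<xi> \<sigma> (s (g x))"
    using s by (auto simp: eqsec_def)
  have wV: "continuous_map X euclidean w" "\<And>x. x \<in> topspace X \<Longrightarrow> w x \<in> V" "\<And>x. x \<in> topspace X \<Longrightarrow> \<rho> (w x) = \<sigma> *\<^sub>R w (g x)"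
    using w by (auto simp: vsec_def)
  have sq: "\<sigma> * \<sigma> = 1" using \<sigma> by auto
  have b: "continuous_map ?E X (\<lambda>z. proj \<xi> (fst z))" by (rule base_continuous[OF stab_continuousD(1)])
  have pull: "continuous_map ?E Y (\<lambda>z. f (proj \<xi> (fst z)))" if "continuous_map X Y f" for Y and f :: "'m \<Rightarrow> 'y"
    using continuous_map_compose[OF b that] by (simp add: o_def)
  have Bc: "continuous_map fibprod euclideanreal (\<lambda>p. B (fst p) (snd p))" using B by (simp add: invariant_metric_def)
  have c1: "continuous_map ?E euclideanreal (\<lambda>z. B (fst z) (s (proj \<xi> (fst z))))"
  proof (rule metric_continuous[OF Bc stab_continuousD(1) pull[OF sT(1)]])
    show "proj \<xi> (fst z) = proj \<xi> (s (proj \<xi> (fst z)))" if "z \<in> topspace ?E" for z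
      using that by (elim stab_memE) (use sT(2) in \<open>simp add: fib_iff\<close>)
  qed
  have c2: "continuous_map ?E euclideanreal (\<lambda>z. inv_inner \<rho> (snd (snd z)) (w (proj \<xi> (fst z))))"
    by (rule inv_inner_continuous[OF lin stab_continuousD(2) pull[OF wV(1)]])
  show "continuous_map ?E euclideanreal (\<lambda>z. (B (fst z) (s (proj \<xi> (fst z))) * C (proj \<xi> (fst z)) +
      inv_inner \<rho> (snd (snd z)) (w (proj \<xi> (fst z)))) / n (proj \<xi> (fst z)))"
  proof (rule continuous_map_real_divide[OF continuous_map_add[OF continuous_map_real_mult[OF c1 pull[OF C(1)]] c2] pull[OF n(1)]])
    show "n (proj \<xi> (fst z)) \<noteq> 0" if "z \<in> topspace ?E" for z using that by (elim stab_memE) (use n(3) in simp)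
  qed
  fix x e u assume x: "x \<in> topspace X" and e: "e \<in> fib x" and u: "u \<in> V"
  note sx = sT(2)[OF x]
  have p: "proj \<xi> e = x" using e by (simp add: fib_iff)
  show "(B (vadd \<xi> e e') (s (proj \<xi> (vadd \<xi> e e'))) * C (proj \<xi> (vadd \<xi> e e')) + inv_inner \<rho> (u + u') (w (proj \<xi> (vadd \<xi> e e')))) / n (proj \<xi> (vadd \<xi> e e')) =
      (B e (s (proj \<xi> e)) * C (proj \<xi> e) + inv_inner \<rho> u (w (proj \<xi> e))) / n (proj \<xi> e) +
      (B e' (s (proj \<xi> e')) * C (proj \<xi> e') + inv_inner \<rho> u' (w (proj \<xi> e'))) / n (proj \<xi> e')"
    if e': "e' \<in> fib x" "u' \<in> V" for e' u'
  proof -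
    have p': "proj \<xi> e' = x" "proj \<xi> (vadd \<xi> e e') = x" using e' add_fib[OF e e'(1)] by (auto simp: fib_iff)
    have "B (vadd \<xi> e e') (s x) = B e (s x) + B e' (s x)" using B x e e'(1) sx unfolding invariant_metric_def by blast
    then show ?thesis unfolding p p' by (simp add: inv_inner_simps[OF lin] add_divide_distrib distrib_right)
  qed
  show "(B (vscale \<xi> c e) (s (proj \<xi> (vscale \<xi> c e))) * C (proj \<xi> (vscale \<xi> c e)) + inv_inner \<rho> (c *\<^sub>R u) (w (proj \<xi> (vscale \<xi> c e)))) / n (proj \<xi> (vscale \<xi> c e)) =
      c * ((B e (s (proj \<xi> e)) * C (proj \<xi> e) + inv_inner \<rho> u (w (proj \<xi> e))) / n (proj \<xi> e))" for c
  proof -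
    have p': "proj \<xi> (vscale \<xi> c e) = x" using scale_fib[OF e, of c] by (simp add: fib_iff)
    have "B (vscale \<xi> c e) (s x) = c * B e (s x)" using B x e sx unfolding invariant_metric_def by blast
    then show ?thesis unfolding p p' by (simp add: inv_inner_simps[OF lin] distrib_left mult.assoc)
  qed
  have p': "proj \<xi> (act \<xi> e) = g x" using act_fib[OF e] by (simp add: fib_iff)
  have gs: "s (g x) = vscale \<xi> \<sigma> (act \<xi> (s x))"
    using sT(3)[OF x] vec_scale_scale[OF sT(2)[OF g_in[OF x]]] vec_scale_one[OF sT(2)[OF g_in[OF x]]] sq by simp
  have gw: "w (g x) = \<sigma> *\<^sub>R \<rho> (w x)" using wV(3)[OF x] sq by simp
  have ae: "act \<xi> e \<in> fib (g x)" "act \<xi> (s x) \<in> fib (g x)" using act_fib e sx by auto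
  have "B (act \<xi> e) (s (g x)) = B (s (g x)) (act \<xi> e)"
    using B g_in[OF x] ae(1) sT(2)[OF g_in[OF x]] unfolding invariant_metric_def by blast
  also have "\<dots> = \<sigma> * B (act \<xi> (s x)) (act \<xi> e)"
    unfolding gs using B g_in[OF x] ae unfolding invariant_metric_def by blast
  also have "B (act \<xi> (s x)) (act \<xi> e) = B (s x) e"
    using B x e sx unfolding invariant_metric_def by blast
  also have "B (s x) e = B e (s x)"
    using B x e sx unfolding invariant_metric_def by blast
  finally have 1: "B (act \<xi> e) (s (g x)) = \<sigma> * B e (s x)" .
  have 2: "inv_inner \<rho> (\<rho> u) (w (g x)) = \<sigma> * inv_inner \<rho> u (w x)"
    unfolding gw using inv_inner_invariant[OF V u wV(2)[OF x]] by (simp add: inv_inner_simps[OF lin])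
  show "(B (act \<xi> e) (s (proj \<xi> (act \<xi> e))) * C (proj \<xi> (act \<xi> e)) + inv_inner \<rho> (\<rho> u) (w (proj \<xi> (act \<xi> e)))) / n (proj \<xi> (act \<xi> e)) =
      \<sigma> * ((B e (s (proj \<xi> e)) * C (proj \<xi> e) + inv_inner \<rho> u (w (proj \<xi> e))) / n (proj \<xi> e))"
    unfolding p p' 1 2 C(2)[OF x] n(2)[OF x] by (simp add: distrib_left mult.assoc)
qed

lemma eqsec_diff:
  assumes a: "eqsec \<sigma> a" and t: "eqsec \<sigma> t"
  shows "eqsec \<sigma> (\<lambda>x. vadd \<xi> (a x) (vscale \<xi> (-1) (t x)))"
  unfolding eqsec_def
proof (intro conjI ballI)
  have aT: "continuous_map X T a" "\<And>x. x \<in> topspace X \<Longrightarrow> a x \<in> fib x" "\<And>x. x \<in> topspace X \<Longrightarrow> act \<xi> (a x) = vscale \<xi> \<sigma> (a (g x))"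
    and tT: "continuous_map X T t" "\<And>x. x \<in> topspace X \<Longrightarrow> t x \<in> fib x" "\<And>x. x \<in> topspace X \<Longrightarrow> act \<xi> (t x) = vscale \<xi> \<sigma> (t (g x))"
    using a t by (auto simp: eqsec_def)
  show "continuous_map X T (\<lambda>x. vadd \<xi> (a x) (vscale \<xi> (-1) (t x)))"
  proof (rule add_continuous[OF aT(1) const_scale_continuous[OF tT(1)]])
    show "proj \<xi> (a z) = proj \<xi> (vscale \<xi> (-1) (t z))" if "z \<in> topspace X" for z
      using aT(2)[OF that] scale_fib[OF tT(2)[OF that], of "-1"] by (simp add: fib_iff)
  qed
  fix x assume x: "x \<in> topspace X"
  note gx = g_in[OF x]
  show "vadd \<xi> (a x) (vscale \<xi> (-1) (t x)) \<in> fib x" by (intro add_fib scale_fib aT tT x)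
  show "act \<xi> (vadd \<xi> (a x) (vscale \<xi> (-1) (t x))) = vscale \<xi> \<sigma> (vadd \<xi> (a (g x)) (vscale \<xi> (-1) (t (g x))))"
    using act_add[OF aT(2)[OF x] scale_fib[OF tT(2)[OF x]]] act_scale[OF tT(2)[OF x]] aT(3)[OF x] tT(3)[OF x]
      vec_scale_add[OF aT(2)[OF gx] scale_fib[OF tT(2)[OF gx]]] vec_scale_scale[OF tT(2)[OF gx]] by simp
qed

end

lemma c2_bundle_iso_compose:
  assumes h: "c2_bundle_iso \<xi> \<eta> h" and k: "c2_bundle_iso \<eta> \<zeta> k"
  shows "c2_bundle_iso \<xi> \<zeta> (\<lambda>e. k (h e))"
  unfolding c2_bundle_iso_def
proof (intro conjI ballI allI)
  have hh: "homeomorphic_map (total \<xi>) (total \<eta>) h" and kk: "homeomorphic_map (total \<eta>) (total \<zeta>) k"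
    using h k by (auto simp: c2_bundle_iso_def)
  show "homeomorphic_map (total \<xi>) (total \<zeta>) (\<lambda>e. k (h e))" using homeomorphic_map_compose[OF hh kk] by (simp add: o_def)
  have hin: "h e \<in> topspace (total \<eta>)" if "e \<in> topspace (total \<xi>)" for e
    using homeomorphic_imp_surjective_map[OF hh] that by blast
  have hp: "proj \<eta> (h e) = proj \<xi> e" if "e \<in> topspace (total \<xi>)" for e using h that by (simp add: c2_bundle_iso_def)
  fix e assume e: "e \<in> topspace (total \<xi>)"
  show "proj \<zeta> (k (h e)) = proj \<xi> e" using k hin[OF e] hp[OF e] by (simp add: c2_bundle_iso_def)
  show "k (h (act \<xi> e)) = act \<zeta> (k (h e))" using h k e hin[OF e] by (simp add: c2_bundle_iso_def)
  show "k (h (vscale \<xi> c e)) = vscale \<zeta> c (k (h e))" for c using h k e hin[OF e] by (simp add: c2_bundle_iso_def)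
  fix e' assume e': "e' \<in> fibre \<xi> (proj \<xi> e)"
  then have "h e' \<in> fibre \<eta> (proj \<eta> (h e))" using hin hp e by (simp add: fibre_def)
  then have "k (vadd \<eta> (h e) (h e')) = vadd \<zeta> (k (h e)) (k (h e'))" using k hin[OF e] by (simp add: c2_bundle_iso_def)
  moreover have "h (vadd \<xi> e e') = vadd \<eta> (h e) (h e')" using h e e' by (simp add: c2_bundle_iso_def)
  ultimately show "k (h (vadd \<xi> e e')) = vadd \<zeta> (k (h e)) (k (h e'))" by simp
qed

lemma c2_bundle_iso_inverse:
  assumes h: "c2_bundle_iso \<xi> \<eta> h"
    and cl: "\<And>e e'. e \<in> topspace (total \<xi>) \<Longrightarrow> e' \<in> fibre \<xi> (proj \<xi> e) \<Longrightarrow> vadd \<xi> e e' \<in> topspace (total \<xi>)"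
      "\<And>e c. e \<in> topspace (total \<xi>) \<Longrightarrow> vscale \<xi> c e \<in> topspace (total \<xi>)"
      "\<And>e. e \<in> topspace (total \<xi>) \<Longrightarrow> act \<xi> e \<in> topspace (total \<xi>)"
  shows "\<exists>k. c2_bundle_iso \<eta> \<xi> k \<and> (\<forall>e\<in>topspace (total \<xi>). k (h e) = e) \<and> (\<forall>f\<in>topspace (total \<eta>). h (k f) = f)"
proof -
  have hh: "homeomorphic_map (total \<xi>) (total \<eta>) h" using h by (simp add: c2_bundle_iso_def)
  then obtain k where k: "homeomorphic_maps (total \<xi>) (total \<eta>) h k" using homeomorphic_map_maps by blast
  have kh: "k (h e) = e" if "e \<in> topspace (total \<xi>)" for e using k that by (simp add: homeomorphic_maps_def)
  have hk: "h (k f) = f" if "f \<in> topspace (total \<eta>)" for f using k that by (simp add: homeomorphic_maps_def)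
  have khomeo: "homeomorphic_map (total \<eta>) (total \<xi>) k"
    using k homeomorphic_maps_sym homeomorphic_maps_imp_map by blast
  have kin: "k f \<in> topspace (total \<xi>)" if "f \<in> topspace (total \<eta>)" for f
    using homeomorphic_imp_surjective_map[OF khomeo] that by blast
  have kp: "proj \<xi> (k f) = proj \<eta> f" if "f \<in> topspace (total \<eta>)" for f
    using h kin[OF that] hk[OF that] unfolding c2_bundle_iso_def by metis
  have "c2_bundle_iso \<eta> \<xi> k"
    unfolding c2_bundle_iso_def
  proof (intro conjI ballI allI)
    fix f assume f: "f \<in> topspace (total \<eta>)"
    note kf = kin[OF f]
    show "proj \<xi> (k f) = proj \<eta> f" by (rule kp[OF f])
    have "h (act \<xi> (k f)) = act \<eta> f" using h kf hk[OF f] by (simp add: c2_bundle_iso_def)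
    then show "k (act \<eta> f) = act \<xi> (k f)" using kh[OF cl(3)[OF kf]] by simp
    have "h (vscale \<xi> c (k f)) = vscale \<eta> c f" for c using h kf hk[OF f] by (simp add: c2_bundle_iso_def)
    then show "k (vscale \<eta> c f) = vscale \<xi> c (k f)" for c using kh[OF cl(2)[OF kf, of c]] by simp
    fix f' assume f': "f' \<in> fibre \<eta> (proj \<eta> f)"
    then have f'T: "f' \<in> topspace (total \<eta>)" by (simp add: fibre_def)
    have kf': "k f' \<in> fibre \<xi> (proj \<xi> (k f))" using kin[OF f'T] kp[OF f'T] kp[OF f] f' by (simp add: fibre_def)
    then have "h (vadd \<xi> (k f) (k f')) = vadd \<eta> f f'" using h kf hk[OF f] hk[OF f'T] by (simp add: c2_bundle_iso_def)
    then show "k (vadd \<eta> f f') = vadd \<xi> (k f) (k f')" using kh[OF cl(1)[OF kf kf']] by simp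
  qed (rule khomeo)
  then show ?thesis using kh hk by (intro exI[of _ k]) simp
qed

context c2_bundle_over begin

lemma stab_closed:
  assumes V: "involution_on V \<rho>"
  shows "z \<in> topspace (total (stab V \<rho>)) \<Longrightarrow> z' \<in> fibre (stab V \<rho>) (proj (stab V \<rho>) z) \<Longrightarrow> vadd (stab V \<rho>) z z' \<in> topspace (total (stab V \<rho>))"
    "z \<in> topspace (total (stab V \<rho>)) \<Longrightarrow> vscale (stab V \<rho>) c z \<in> topspace (total (stab V \<rho>))"
    "z \<in> topspace (total (stab V \<rho>)) \<Longrightarrow> act (stab V \<rho>) z \<in> topspace (total (stab V \<rho>))"
proof -
  assume "z \<in> topspace (total (stab V \<rho>))"
  then obtain e x u where z: "z = (e, (x, u))" "e \<in> fib x" "u \<in> V" "x \<in> topspace X" "proj \<xi> e = x"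
    by (rule stab_memE)
  have sV: "subspace V" "\<rho> u \<in> V" using V z(3) by (auto simp: involution_on_def)
  show "vscale (stab V \<rho>) c z \<in> topspace (total (stab V \<rho>))"
    unfolding z(1) whitney_trivial_simps stab_mem using scale_fib[OF z(2)] subspace_scale[OF sV(1) z(3)] by simp
  show "act (stab V \<rho>) z \<in> topspace (total (stab V \<rho>))"
    unfolding z(1) whitney_trivial_simps stab_mem using act_fib[OF z(2)] sV(2) by simp
  assume z'f: "z' \<in> fibre (stab V \<rho>) (proj (stab V \<rho>) z)"
  obtain e' y u' where z': "z' = (e', (y, u'))" by (metis prod.exhaust)
  have e': "e' \<in> fib x" "u' \<in> V"
    using z'f z(5) unfolding z' z(1) whitney_trivial_simps stab_fibre by auto
  show "vadd (stab V \<rho>) z z' \<in> topspace (total (stab V \<rho>))"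
    unfolding z(1) z' whitney_trivial_simps stab_mem using add_fib[OF z(2) e'(1)] subspace_add[OF sV(1) z(3) e'(2)] by simp
qed

text \<open>
  Pairing with \<open>(C t, v0)\<close> is positive on \<open>(0, v0)\<close>, and also on \<open>(t, a2)\<close> if \<open>C\<close> is large: this gives
  a transvection from the former to the latter. Pairing with \<open>a\<close> is positive on \<open>a\<close>, and also on
  \<open>(t, a2)\<close> if \<open>t\<close> is close to \<open>a1\<close>: this gives a transvection from \<open>(t, a2)\<close> to \<open>a\<close>.
\<close>

lemma equivariant_transport:
  fixes V :: "'v::euclidean_space set"
  assumes V: "involution_on V \<rho>" and \<sigma>: "\<sigma> \<in> {1, -1::real}"
    and v0: "v0 \<in> V" "v0 \<noteq> 0" "\<rho> v0 = \<sigma> *\<^sub>R v0"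
    and a: "eqsec \<sigma> a1" "vsec \<sigma> V \<rho> a2" "\<And>x. x \<in> topspace X \<Longrightarrow> a1 x \<noteq> vzero \<xi> x \<or> a2 x \<noteq> 0"
    and rk: "\<forall>x\<in>topspace X. rank_at \<xi> x > mdim M"
    and rkF: "\<forall>x\<in>fixed_set M. rank_at (eigenbundle M \<sigma> \<xi>) x > fixed_dim M"
  shows "\<exists>A. c2_bundle_iso (stab V \<rho>) (stab V \<rho>) A \<and> (\<forall>x\<in>topspace X. A (vzero \<xi> x, (x, v0)) = (a1 x, (x, a2 x)))"
proof -
  have lin: "linear \<rho>" and sV: "subspace V" using V by (auto simp: involution_on_def)
  have sq: "\<sigma> * \<sigma> = 1" using \<sigma> by auto
  have aT: "continuous_map X T a1" "\<And>x. x \<in> topspace X \<Longrightarrow> a1 x \<in> fib x" "\<And>x. x \<in> topspace X \<Longrightarrow> act \<xi> (a1 x) = vscale \<xi> \<sigma> (a1 (g x))"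
    using a(1) by (auto simp: eqsec_def)
  have aV: "continuous_map X euclidean a2" "\<And>x. x \<in> topspace X \<Longrightarrow> a2 x \<in> V" "\<And>x. x \<in> topspace X \<Longrightarrow> \<rho> (a2 x) = \<sigma> *\<^sub>R a2 (g x)"
    using a(2) by (auto simp: vsec_def)
  obtain B where B: "invariant_metric B" using invariant_metric_exists by blast
  have Bc: "continuous_map fibprod euclideanreal (\<lambda>p. B (fst p) (snd p))" using B by (simp add: invariant_metric_def)
  have Badd: "B (vadd \<xi> e e'') e' = B e e' + B e'' e'" if "x \<in> topspace X" "e \<in> fib x" "e' \<in> fib x" "e'' \<in> fib x" for x e e' e''
    using B that unfolding invariant_metric_def by blast
  have Bscale: "B (vscale \<xi> c e) e' = c * B e e'" and Bact: "B (act \<xi> e) (act \<xi> e') = B e e'" and Bsym: "B e e' = B e' e"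
    and Bpos: "e \<noteq> vzero \<xi> x \<Longrightarrow> B e e > 0" 
    if "x \<in> topspace X" "e \<in> fib x" "e' \<in> fib x" for x e e' c
    using B that unfolding invariant_metric_def by blast+
  have Bge: "0 \<le> B e e" if "x \<in> topspace X" "e \<in> fib x" for x e
    using Bpos[OF that that(2)] metric_zero[OF B that(1,2)] by (cases "e = vzero \<xi> x") auto
  \<comment> \<open>invariance of the pairings of equivariant sections\<close>
  have Binv: "B (s (g x)) (t (g x)) = B (s x) (t x)" if "eqsec \<sigma> s" "eqsec \<sigma> t" "x \<in> topspace X" for s t x
  proof -
    have f: "s x \<in> fib x" "t x \<in> fib x" "s (g x) \<in> fib (g x)" "t (g x) \<in> fib (g x)"
      "act \<xi> (s x) = vscale \<xi> \<sigma> (s (g x))" "act \<xi> (t x) = vscale \<xi> \<sigma> (t (g x))"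
      using that g_in[OF that(3)] by (auto simp: eqsec_def)
    note gx = g_in[OF that(3)]
    have "B (s x) (t x) = B (vscale \<xi> \<sigma> (s (g x))) (vscale \<xi> \<sigma> (t (g x)))"
      using Bact[OF that(3) f(1,2)] f(5,6) by simp
    also have "\<dots> = \<sigma> * B (s (g x)) (vscale \<xi> \<sigma> (t (g x)))" by (rule Bscale[OF gx f(3) scale_fib[OF f(4)]])
    also have "B (s (g x)) (vscale \<xi> \<sigma> (t (g x))) = B (vscale \<xi> \<sigma> (t (g x))) (s (g x))" by (rule Bsym[OF gx f(3) scale_fib[OF f(4)]])
    also have "\<dots> = \<sigma> * B (t (g x)) (s (g x))" by (rule Bscale[OF gx f(4,3)])
    also have "B (t (g x)) (s (g x)) = B (s (g x)) (t (g x))" by (rule Bsym[OF gx f(4,3)])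
    finally show ?thesis using sq by (simp add: mult.assoc[symmetric])
  qed
  have ipinv: "inv_inner \<rho> (d (g x)) (d' (g x)) = inv_inner \<rho> (d x) (d' x)" if "vsec \<sigma> V \<rho> d" "vsec \<sigma> V \<rho> d'" "x \<in> topspace X" for d d' x
  proof -
    have f: "d x \<in> V" "d' x \<in> V" "\<rho> (d x) = \<sigma> *\<^sub>R d (g x)" "\<rho> (d' x) = \<sigma> *\<^sub>R d' (g x)" using that by (auto simp: vsec_def)
    have "inv_inner \<rho> (d x) (d' x) = inv_inner \<rho> (\<sigma> *\<^sub>R d (g x)) (\<sigma> *\<^sub>R d' (g x))"
      using inv_inner_invariant[OF V f(1,2)] f(3,4) by simp
    also have "\<dots> = (\<sigma> * \<sigma>) * inv_inner \<rho> (d (g x)) (d' (g x))" by (simp only: inv_inner_simps[OF lin] mult.assoc)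
    finally show ?thesis using sq by simp
  qed
  have Bcont: "continuous_map X euclideanreal (\<lambda>x. B (s x) (t x))" if "eqsec \<sigma> s" "eqsec \<sigma> t" for s t
    by (rule metric_continuous[OF Bc]) (use that in \<open>auto simp: eqsec_def fib_iff\<close>)
  have vsec_v0: "vsec \<sigma> V \<rho> (\<lambda>x. v0)" using v0 by (simp add: vsec_def)
  have vsec_0: "vsec \<sigma> V \<rho> (\<lambda>x. 0)" using subspace_0[OF sV] linear_0[OF lin] by (simp add: vsec_def)
  have vsec_diff: "vsec \<sigma> V \<rho> (\<lambda>x. a2 x - v0)"
    unfolding vsec_def
    using aV v0 by (auto simp: linear_diff[OF lin] scaleR_diff_right subspace_diff[OF sV] intro: continuous_map_diff)
  \<comment> \<open>a nowhere vanishing section of the bundle, near the first component of the given section\<close>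
  define Op where "Op = {e \<in> topspace T. B e (a1 (proj \<xi> e)) + inv_inner \<rho> (a2 (proj \<xi> e)) (a2 (proj \<xi> e)) \<in> {0<..}}"
  have pull: "continuous_map T Y (\<lambda>e. f (proj \<xi> e))" if "continuous_map X Y f" for Y and f :: "'m \<Rightarrow> 'y"
    using continuous_map_compose[OF proj_cont that] by (simp add: o_def)
  have "continuous_map T euclideanreal (\<lambda>e. B e (a1 (proj \<xi> e)))"
    by (rule metric_continuous[OF Bc continuous_map_id[unfolded id_def] pull[OF aT(1)]])
      (use aT(2) proj_in in \<open>auto simp: fib_iff\<close>)
  then have Op: "openin T Op" unfolding Op_def
    by (intro openin_continuous_map_preimage[where Y=euclideanreal] continuous_map_add inv_inner_continuous[OF lin] pull[OF aV(1)]) auto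
  have a1Op: "a1 x \<in> Op" if x: "x \<in> topspace X" for x
  proof -
    have "B (a1 x) (a1 x) + inv_inner \<rho> (a2 x) (a2 x) > 0"
      using a(3)[OF x] Bge[OF x aT(2)[OF x]] Bpos[OF x aT(2)[OF x] aT(2)[OF x]] inv_inner_simps(4,5)[OF lin, of "a2 x"]
      by (meson add_nonneg_pos add_pos_nonneg)
    then show ?thesis using aT(2)[OF x] by (simp add: Op_def fib_iff)
  qed
  obtain t where t: "eqsec \<sigma> t" "\<And>x. x \<in> topspace X \<Longrightarrow> t x \<in> Op" "\<And>x. x \<in> topspace X \<Longrightarrow> t x \<noteq> vzero \<xi> x"
    using nonvanishing_section[OF \<sigma> Op a(1) _ rk rkF] a1Op by blast
  have tT: "\<And>x. x \<in> topspace X \<Longrightarrow> t x \<in> fib x" using t(1) by (auto simp: eqsec_def)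
  have pt: "B (t x) (a1 x) + inv_inner \<rho> (a2 x) (a2 x) > 0" if x: "x \<in> topspace X" for x
    using t(2)[OF x] tT[OF x] by (simp add: Op_def fib_iff)
  have tt: "B (t x) (t x) > 0" if x: "x \<in> topspace X" for x using Bpos[OF x tT[OF x] tT[OF x] t(3)[OF x]] .
  \<comment> \<open>first transvection: from the constant section to the intermediate one\<close>
  define N2 where "N2 = inv_inner \<rho> v0 v0"
  have N2: "N2 > 0" using inv_inner_simps(5)[OF lin v0(2)] by (simp add: N2_def)
  \<comment> \<open>large enough for \<open>C x * B (t x) (t x)\<close> to outweigh a negative pairing of \<open>a2 x\<close> with \<open>v0\<close>\<close>
  define C where "C x = (1 + \<bar>inv_inner \<rho> (a2 x) v0\<bar>) / B (t x) (t x)" for x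
  define \<kappa>2 where "\<kappa>2 e u = (B e (t (proj \<xi> e)) * C (proj \<xi> e) + inv_inner \<rho> u v0) / N2" for e u
  have f2: "stab_functional \<sigma> V \<rho> \<kappa>2"
    unfolding \<kappa>2_def
  proof (rule metric_functional[OF B V \<sigma> t(1) vsec_v0, where n="\<lambda>_. N2"])
    have "continuous_map X euclideanreal (\<lambda>x. inv_inner \<rho> (a2 x) v0)"
      by (rule inv_inner_continuous[OF lin aV(1)]) simp
    then show "continuous_map X euclideanreal C" unfolding C_def
      by (intro continuous_map_real_divide continuous_map_add continuous_map_real_abs Bcont[OF t(1) t(1)]) (use tt in force)+
    show "C (g x) = C x" if "x \<in> topspace X" for x
      using ipinv[OF a(2) vsec_v0 that] Binv[OF t(1) t(1) that] by (simp add: C_def)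
  qed (use N2 in auto)
  define d2 where "d2 x = a2 x - v0" for x
  have nz2: "1 + \<kappa>2 (t x) (d2 x) \<noteq> 0" if x: "x \<in> topspace X" for x
  proof -
    have "inv_inner \<rho> (d2 x) v0 = inv_inner \<rho> (a2 x) v0 - N2"
      using inv_inner_simps(1)[OF lin, of "d2 x" v0 v0] by (simp add: d2_def N2_def)
    moreover have "proj \<xi> (t x) = x" "B (t x) (t x) * C x = 1 + \<bar>inv_inner \<rho> (a2 x) v0\<bar>"
      using tT[OF x] tt[OF x] by (auto simp: fib_iff C_def)
    ultimately have "1 + \<kappa>2 (t x) (d2 x) = (1 + \<bar>inv_inner \<rho> (a2 x) v0\<bar> + inv_inner \<rho> (a2 x) v0) / N2"
      using N2 by (simp add: \<kappa>2_def field_simps)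
    also have "\<dots> > 0" using N2 by (intro divide_pos_pos) linarith+
    finally show ?thesis by simp
  qed
  have iso2: "c2_bundle_iso (stab V \<rho>) (stab V \<rho>) (transvection \<kappa>2 t d2)"
    by (rule transvection_iso[OF V f2 t(1) _ \<sigma> nz2]) (use vsec_diff in \<open>simp_all add: d2_def[abs_def]\<close>)
  have move2: "transvection \<kappa>2 t d2 (vzero \<xi> x, (x, v0)) = (t x, (x, a2 x))" if x: "x \<in> topspace X" for x
  proof -
    have "B (vzero \<xi> x) (t x) = 0" by (rule metric_zero[OF B x tT[OF x]])
    then have "\<kappa>2 (vzero \<xi> x) v0 = 1" using zero_fib[OF x] N2 by (simp add: \<kappa>2_def fib_iff N2_def)
    moreover have "vadd \<xi> (vzero \<xi> x) (t x) = t x"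
      using vec_add_commute[OF zero_fib[OF x] tT[OF x]] vec_add_zero[OF tT[OF x]] by simp
    ultimately show ?thesis using vec_scale_one[OF tT[OF x]] by (simp add: transvection_def d2_def)
  qed
  \<comment> \<open>second transvection: from the intermediate section to the given one\<close>
  define N1 where "N1 x = B (t x) (a1 x) + inv_inner \<rho> (a2 x) (a2 x)" for x
  define \<kappa>1 where "\<kappa>1 e u = (B e (a1 (proj \<xi> e)) * 1 + inv_inner \<rho> u (a2 (proj \<xi> e))) / N1 (proj \<xi> e)" for e u
  have f1: "stab_functional \<sigma> V \<rho> \<kappa>1"
    unfolding \<kappa>1_def
  proof (rule metric_functional[OF B V \<sigma> a(1,2), where C="\<lambda>_. 1"])
    show "continuous_map X euclideanreal N1" unfolding N1_def
      by (intro continuous_map_add Bcont[OF t(1) a(1)] inv_inner_continuous[OF lin aV(1) aV(1)])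
    show "N1 (g x) = N1 x" if "x \<in> topspace X" for x
      using Binv[OF t(1) a(1) that] ipinv[OF a(2) a(2) that] by (simp add: N1_def)
    show "N1 x \<noteq> 0" if "x \<in> topspace X" for x using pt[OF that] by (simp add: N1_def)
  qed auto
  define d1 where "d1 x = vadd \<xi> (a1 x) (vscale \<xi> (-1) (t x))" for x
  have nz1: "1 + \<kappa>1 (d1 x) 0 \<noteq> 0" if x: "x \<in> topspace X" for x
  proof -
    have d1f: "d1 x \<in> fib x" unfolding d1_def by (intro add_fib scale_fib aT(2)[OF x] tT[OF x])
    have "B (d1 x) (a1 x) = B (a1 x) (a1 x) - B (t x) (a1 x)"
      unfolding d1_def using Badd[OF x aT(2)[OF x] aT(2)[OF x] scale_fib[OF tT[OF x]]] Bscale[OF x tT[OF x] aT(2)[OF x]] by simp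
    moreover have "inv_inner \<rho> 0 (a2 x) = 0" using linear_0[OF lin] by (simp add: inv_inner_def)
    moreover have N: "N1 x > 0" using pt[OF x] by (simp add: N1_def)
    ultimately have "1 + \<kappa>1 (d1 x) 0 = (B (a1 x) (a1 x) + inv_inner \<rho> (a2 x) (a2 x)) / N1 x"
      using d1f by (simp add: \<kappa>1_def fib_iff field_simps) (simp add: N1_def)
    moreover have "B (a1 x) (a1 x) + inv_inner \<rho> (a2 x) (a2 x) > 0"
      using a1Op[OF x] aT(2)[OF x] by (simp add: Op_def fib_iff)
    ultimately show ?thesis using N by simp
  qed
  have iso1: "c2_bundle_iso (stab V \<rho>) (stab V \<rho>) (transvection \<kappa>1 d1 (\<lambda>x. 0))"
    by (rule transvection_iso[OF V f1 _ vsec_0 \<sigma> nz1]) (use eqsec_diff[OF a(1) t(1)] in \<open>simp_all add: d1_def[abs_def]\<close>)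
  have move1: "transvection \<kappa>1 d1 (\<lambda>x. 0) (t x, (x, a2 x)) = (a1 x, (x, a2 x))" if x: "x \<in> topspace X" for x
  proof -
    note f = tT[OF x] aT(2)[OF x]
    have "\<kappa>1 (t x) (a2 x) = 1" using pt[OF x] f(1) by (simp add: \<kappa>1_def N1_def fib_iff)
    moreover have "vadd \<xi> (t x) (d1 x) = a1 x"
    proof -
      have "vadd \<xi> (t x) (d1 x) = vadd \<xi> (vadd \<xi> (a1 x) (vscale \<xi> (-1) (t x))) (t x)"
        unfolding d1_def by (rule vec_add_commute[OF f(1) add_fib[OF f(2) scale_fib[OF f(1)]]])
      also have "\<dots> = vadd \<xi> (a1 x) (vadd \<xi> (vscale \<xi> (-1) (t x)) (vscale \<xi> 1 (t x)))"
        using vec_add_assoc[OF f(2) scale_fib[OF f(1)] f(1)] vec_scale_one[OF f(1)] by simp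
      also have "\<dots> = a1 x" using vec_add_scale[OF f(1), of "-1" 1] vec_scale_zero[OF f(1)] vec_add_zero[OF f(2)] by simp
      finally show ?thesis .
    qed
    moreover have "d1 x \<in> fib x" unfolding d1_def by (intro add_fib scale_fib f)
    ultimately show ?thesis using vec_scale_one by (simp add: transvection_def)
  qed
  show ?thesis
    using c2_bundle_iso_compose[OF iso2 iso1] move1 move2
    by (intro exI[of _ "\<lambda>z. transvection \<kappa>1 d1 (\<lambda>x. 0) (transvection \<kappa>2 t d2 z)"]) simp
qed

end

section \<open>Cancelling one line at a time\<close>

definition line_proj :: "('v::euclidean_space \<Rightarrow> 'v) \<Rightarrow> 'v \<Rightarrow> 'v \<Rightarrow> 'v" where
  "line_proj \<rho> v0 u = u - (inv_inner \<rho> u v0 / inv_inner \<rho> v0 v0) *\<^sub>R v0"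

definition orth_part :: "'v::euclidean_space set \<Rightarrow> ('v \<Rightarrow> 'v) \<Rightarrow> 'v \<Rightarrow> 'v set" where
  "orth_part V \<rho> v0 = {u \<in> V. inv_inner \<rho> u v0 = 0}"

lemma line_proj_facts:
  assumes V: "involution_on V \<rho>" and v0: "v0 \<in> V" "v0 \<noteq> 0" "\<rho> v0 = \<sigma> *\<^sub>R v0" and \<sigma>: "\<sigma> \<in> {1, -1::real}"
  shows "u \<in> V \<Longrightarrow> line_proj \<rho> v0 u \<in> orth_part V \<rho> v0" "u \<in> orth_part V \<rho> v0 \<Longrightarrow> line_proj \<rho> v0 u = u"
    "line_proj \<rho> v0 (u + w) = line_proj \<rho> v0 u + line_proj \<rho> v0 w" "line_proj \<rho> v0 (c *\<^sub>R u) = c *\<^sub>R line_proj \<rho> v0 u"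
    "line_proj \<rho> v0 v0 = 0" "u \<in> V \<Longrightarrow> line_proj \<rho> v0 (\<rho> u) = \<rho> (line_proj \<rho> v0 u)"
    "involution_on (orth_part V \<rho> v0) \<rho>" "orth_part V \<rho> v0 \<subseteq> V" "dim (orth_part V \<rho> v0) < dim V"
proof -
  have lin: "linear \<rho>" and sV: "subspace V" using V by (auto simp: involution_on_def)
  have sq: "\<sigma> * \<sigma> = 1" using \<sigma> by auto
  note ip = inv_inner_simps[OF lin]
  have pos: "inv_inner \<rho> v0 v0 > 0" by (rule ip(5)[OF v0(2)])
  have diff: "inv_inner \<rho> (u - c *\<^sub>R v0) v0 = inv_inner \<rho> u v0 - c * inv_inner \<rho> v0 v0" for u c
    using ip(1)[of "u - c *\<^sub>R v0" "c *\<^sub>R v0" v0] ip(2)[of c v0 v0] by simp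
  show "u \<in> V \<Longrightarrow> line_proj \<rho> v0 u \<in> orth_part V \<rho> v0"
    using pos by (simp add: orth_part_def line_proj_def diff subspace_diff[OF sV] subspace_scale[OF sV] v0)
  show "u \<in> orth_part V \<rho> v0 \<Longrightarrow> line_proj \<rho> v0 u = u" by (simp add: orth_part_def line_proj_def)
  show "line_proj \<rho> v0 (u + w) = line_proj \<rho> v0 u + line_proj \<rho> v0 w"
    by (simp add: line_proj_def ip(1) add_divide_distrib scaleR_add_left)
  show "line_proj \<rho> v0 (c *\<^sub>R u) = c *\<^sub>R line_proj \<rho> v0 u"
    by (simp add: line_proj_def ip(2) scaleR_diff_right)
  show "line_proj \<rho> v0 v0 = 0" using pos by (simp add: line_proj_def)
  have rot: "inv_inner \<rho> (\<rho> u) v0 = \<sigma> * inv_inner \<rho> u v0" if "u \<in> V" for u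
  proof -
    have "v0 = \<sigma> *\<^sub>R \<rho> v0" using v0(3) sq by simp
    then have "inv_inner \<rho> (\<rho> u) v0 = inv_inner \<rho> (\<rho> u) (\<sigma> *\<^sub>R \<rho> v0)" by simp
    also have "\<dots> = \<sigma> * inv_inner \<rho> u v0" using inv_inner_invariant[OF V that v0(1)] by (simp only: ip(3))
    finally show ?thesis .
  qed
  show "u \<in> V \<Longrightarrow> line_proj \<rho> v0 (\<rho> u) = \<rho> (line_proj \<rho> v0 u)"
    by (simp add: line_proj_def rot linear_diff[OF lin] linear_scale[OF lin] v0(3) mult.commute)
  have z: "inv_inner \<rho> 0 v0 = 0" using ip(2)[of 0 0 v0] by simp
  have sub: "subspace (orth_part V \<rho> v0)"
    unfolding subspace_def orth_part_def using sV by (auto simp: ip z subspace_0 subspace_add subspace_scale)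
  then show "involution_on (orth_part V \<rho> v0) \<rho>"
    using V rot by (auto simp: involution_on_def orth_part_def)
  show le: "orth_part V \<rho> v0 \<subseteq> V" by (auto simp: orth_part_def)
  have "v0 \<notin> orth_part V \<rho> v0" using pos by (simp add: orth_part_def)
  then have "orth_part V \<rho> v0 \<subset> V" using le v0(1) by blast
  then have "span (orth_part V \<rho> v0) \<subset> span V" using sub sV by (simp add: span_eq_iff[THEN iffD2])
  then show "dim (orth_part V \<rho> v0) < dim V" by (rule dim_psubset)
qed

definition drop_line :: "('v::euclidean_space \<Rightarrow> 'v) \<Rightarrow> 'v \<Rightarrow> 'e \<times> ('m \<times> 'v) \<Rightarrow> 'e \<times> ('m \<times> 'v)" where
  "drop_line \<rho> v0 = (\<lambda>(e, (x, u)). (e, (x, line_proj \<rho> v0 u)))"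

text \<open>
  A linear isomorphism that fixes the line induces a bijection of the complements; this is one of
  the two inverse identities.
\<close>

lemma drop_line_retract:
  fixes M :: "'m c2_manifold" and \<xi> :: "('m, 'e) c2_bundle" and \<eta> :: "('m, 'f) c2_bundle"
    and V :: "'v::euclidean_space set"
  assumes X1: "c2_bundle_over M \<xi>" and X2: "c2_bundle_over M \<eta>"
    and V: "involution_on V \<rho>" and v0: "v0 \<in> V" "v0 \<noteq> 0" "\<rho> v0 = \<sigma> *\<^sub>R v0" and \<sigma>: "\<sigma> \<in> {1, -1::real}"
    and \<Psi>: "c2_bundle_iso (whitney_sum \<xi> (trivial_bundle M V \<rho>)) (whitney_sum \<eta> (trivial_bundle M V \<rho>)) \<Psi>"
    and fixes_line: "\<And>x. x \<in> topspace (mtop M) \<Longrightarrow> \<Psi> (vzero \<xi> x, (x, v0)) = (vzero \<eta> x, (x, v0))"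
    and \<Psi>': "\<And>z. z \<in> topspace (total (whitney_sum \<eta> (trivial_bundle M V \<rho>))) \<Longrightarrow>
         \<Psi>' z \<in> topspace (total (whitney_sum \<xi> (trivial_bundle M V \<rho>))) \<and> \<Psi> (\<Psi>' z) = z"
    and z: "z \<in> topspace (total (whitney_sum \<eta> (trivial_bundle M (orth_part V \<rho> v0) \<rho>)))"
  shows "drop_line \<rho> v0 (\<Psi> (drop_line \<rho> v0 (\<Psi>' z))) = z"
proof -
  interpret X1: c2_bundle_over M \<xi> by (rule X1)
  interpret X2: c2_bundle_over M \<eta> by (rule X2)
  note P = line_proj_facts[OF V v0 \<sigma>]
  have sV: "subspace V" using V by (simp add: involution_on_def)
  obtain f x w where zz: "z = (f, (x, w))" "f \<in> fibre \<eta> x" "w \<in> orth_part V \<rho> v0" "x \<in> topspace (mtop M)"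
    by (rule X2.stab_memE[OF z])
  have wV: "w \<in> V" using zz(3) P(8) by blast
  have zV: "z \<in> topspace (total (whitney_sum \<eta> (trivial_bundle M V \<rho>)))"
    unfolding zz(1) X2.stab_mem using zz(2) wV by simp
  have y: "\<Psi>' z \<in> topspace (total (whitney_sum \<xi> (trivial_bundle M V \<rho>)))" "\<Psi> (\<Psi>' z) = z" using \<Psi>'[OF zV] by auto
  obtain e x' u where yy: "\<Psi>' z = (e, (x', u))" "e \<in> fibre \<xi> x'" "u \<in> V" "x' \<in> topspace (mtop M)" "proj \<xi> e = x'"
    by (rule X1.stab_memE[OF y(1)])
  define \<alpha> where "\<alpha> = inv_inner \<rho> u v0 / inv_inner \<rho> v0 v0"
  define y1 where "y1 = (e, (x', line_proj \<rho> v0 u))"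
  define b1 where "b1 = (vzero \<xi> x', (x', v0))"
  have y1: "y1 \<in> topspace (total (whitney_sum \<xi> (trivial_bundle M V \<rho>)))"
    unfolding y1_def X1.stab_mem using yy(2) P(1)[OF yy(3)] P(8) by blast
  have b1: "b1 \<in> topspace (total (whitney_sum \<xi> (trivial_bundle M V \<rho>)))"
    unfolding b1_def X1.stab_mem using X1.zero_fib[OF yy(4)] v0(1) by simp
  have sb1: "vscale (whitney_sum \<xi> (trivial_bundle M V \<rho>)) \<alpha> b1 \<in> fibre (whitney_sum \<xi> (trivial_bundle M V \<rho>)) x'"
    unfolding b1_def whitney_trivial_simps X1.stab_fibre
    using X1.scale_fib[OF X1.zero_fib[OF yy(4)]] subspace_scale[OF sV v0(1)] by simp
  have split: "\<Psi>' z = vadd (whitney_sum \<xi> (trivial_bundle M V \<rho>)) y1 (vscale (whitney_sum \<xi> (trivial_bundle M V \<rho>)) \<alpha> b1)"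
    unfolding yy(1) y1_def b1_def whitney_trivial_simps
    using X1.vec_scale_vzero[OF yy(4)] X1.vec_add_zero[OF yy(2)] by (simp add: line_proj_def \<alpha>_def)
  have py1: "proj (whitney_sum \<xi> (trivial_bundle M V \<rho>)) y1 = x'" by (simp add: y1_def whitney_trivial_simps yy(5))
  have "\<Psi> (\<Psi>' z) = vadd (whitney_sum \<eta> (trivial_bundle M V \<rho>)) (\<Psi> y1) (\<Psi> (vscale (whitney_sum \<xi> (trivial_bundle M V \<rho>)) \<alpha> b1))"
    unfolding split using \<Psi> y1 sb1 py1 unfolding c2_bundle_iso_def by blast
  also have "\<Psi> (vscale (whitney_sum \<xi> (trivial_bundle M V \<rho>)) \<alpha> b1) = vscale (whitney_sum \<eta> (trivial_bundle M V \<rho>)) \<alpha> (\<Psi> b1)"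
    using \<Psi> b1 unfolding c2_bundle_iso_def by blast
  also have "\<Psi> b1 = (vzero \<eta> x', (x', v0))" unfolding b1_def by (rule fixes_line[OF yy(4)])
  finally have eq: "z = vadd (whitney_sum \<eta> (trivial_bundle M V \<rho>)) (\<Psi> y1) (vscale (whitney_sum \<eta> (trivial_bundle M V \<rho>)) \<alpha> (vzero \<eta> x', (x', v0)))"
    using y(2) by simp
  have "\<Psi> y1 \<in> topspace (total (whitney_sum \<eta> (trivial_bundle M V \<rho>)))"
    using \<Psi> y1 homeomorphic_imp_surjective_map unfolding c2_bundle_iso_def by blast
  then obtain f1 x1 w1 where k: "\<Psi> y1 = (f1, (x1, w1))" "f1 \<in> fibre \<eta> x1" "w1 \<in> V" "proj \<eta> f1 = x1"
    by (rule X2.stab_memE)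
  have "proj (whitney_sum \<eta> (trivial_bundle M V \<rho>)) (\<Psi> y1) = x'" using \<Psi> y1 py1 unfolding c2_bundle_iso_def by blast
  then have x1: "x1 = x'" unfolding k(1) whitney_trivial_simps k(4) .
  have "(f, (x, w)) = (vadd \<eta> f1 (vscale \<eta> \<alpha> (vzero \<eta> x')), (x1, w1 + \<alpha> *\<^sub>R v0))"
    using eq unfolding zz(1) k(1) whitney_trivial_simps .
  moreover have "vadd \<eta> f1 (vscale \<eta> \<alpha> (vzero \<eta> x')) = f1"
    using X2.vec_scale_vzero[OF yy(4)] X2.vec_add_zero k(2) x1 by simp
  ultimately have fin: "f = f1" "x = x1" "w = w1 + \<alpha> *\<^sub>R v0" by auto
  have "line_proj \<rho> v0 w = line_proj \<rho> v0 w1" unfolding fin(3) P(3,4,5) by simp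
  then have "line_proj \<rho> v0 w1 = w" using P(2)[OF zz(3)] by simp
  moreover have "drop_line \<rho> v0 (\<Psi>' z) = y1" by (simp add: drop_line_def yy(1) y1_def)
  ultimately show ?thesis by (simp add: k(1) drop_line_def zz(1) fin(1,2))
qed

context c2_bundle_over begin

lemma drop_line_continuous:
  assumes V: "involution_on V \<rho>" and v0: "v0 \<in> V" "v0 \<noteq> 0" "\<rho> v0 = \<sigma> *\<^sub>R v0" and \<sigma>: "\<sigma> \<in> {1, -1::real}"
  shows "continuous_map (total (stab V \<rho>)) (total (stab (orth_part V \<rho> v0) \<rho>)) (drop_line \<rho> v0)"
proof -
  let ?E = "total (stab V \<rho>)"
  have lin: "linear \<rho>" using V by (simp add: involution_on_def)
  note P = line_proj_facts[OF V v0 \<sigma>]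
  have "inv_inner \<rho> v0 v0 \<noteq> 0" using inv_inner_simps(5)[OF lin v0(2)] by simp
  moreover have "continuous_map ?E euclideanreal (\<lambda>z. inv_inner \<rho> (snd (snd z)) v0)"
    by (rule inv_inner_continuous[OF lin stab_continuousD(2)]) simp
  ultimately have c: "continuous_map ?E euclidean (\<lambda>z. line_proj \<rho> v0 (snd (snd z)))"
    unfolding line_proj_def
    by (intro continuous_map_diff continuous_map_scaleR continuous_map_real_divide stab_continuousD(2)) auto
  have "continuous_map ?E (total (stab (orth_part V \<rho> v0) \<rho>)) (\<lambda>z. (fst z, (proj \<xi> (fst z), line_proj \<rho> v0 (snd (snd z)))))"
  proof (rule stab_continuousI[OF stab_continuousD(1) c])
    fix z assume "z \<in> topspace ?E"
    then obtain e x u where "z = (e, (x, u))" "u \<in> V" by (rule stab_memE)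
    then show "line_proj \<rho> v0 (snd (snd z)) \<in> orth_part V \<rho> v0" using P(1) by simp
  qed
  then show ?thesis
  proof (rule continuous_map_eq)
    fix z assume "z \<in> topspace ?E"
    then obtain e x u where "z = (e, (x, u))" "proj \<xi> e = x" by (rule stab_memE)
    then show "(fst z, (proj \<xi> (fst z), line_proj \<rho> v0 (snd (snd z)))) = drop_line \<rho> v0 z" by (simp add: drop_line_def)
  qed
qed

lemma stab_inclusion: "V' \<subseteq> V \<Longrightarrow> continuous_map (total (stab V' \<rho>)) (total (stab V \<rho>)) (\<lambda>z. z)"
proof -
  assume V': "V' \<subseteq> V"
  have "continuous_map (total (stab V' \<rho>)) (total (stab V \<rho>)) (\<lambda>z. (fst z, (proj \<xi> (fst z), snd (snd z))))"
  proof (rule stab_continuousI[OF stab_continuousD])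
    fix z assume "z \<in> topspace (total (stab V' \<rho>))"
    then obtain e x u where "z = (e, (x, u))" "u \<in> V'" by (rule stab_memE)
    then show "snd (snd z) \<in> V" using V' by auto
  qed
  then show ?thesis
  proof (rule continuous_map_eq)
    fix z assume "z \<in> topspace (total (stab V' \<rho>))"
    then obtain e x u where "z = (e, (x, u))" "proj \<xi> e = x" by (rule stab_memE)
    then show "(fst z, (proj \<xi> (fst z), snd (snd z))) = z" by simp
  qed
qed

end

text \<open>
  The compressions of an isomorphism and of its inverse to the complements of the line are inverse to
  each other, by \<open>drop_line_retract\<close> in both directions.
\<close>

lemma drop_line_iso:
  fixes M :: "'m c2_manifold" and \<xi> :: "('m, 'e) c2_bundle" and \<eta> :: "('m, 'f) c2_bundle"
    and V :: "'v::euclidean_space set"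
  assumes X1: "c2_bundle_over M \<xi>" and X2: "c2_bundle_over M \<eta>"
    and V: "involution_on V \<rho>" and v0: "v0 \<in> V" "v0 \<noteq> 0" "\<rho> v0 = \<sigma> *\<^sub>R v0" and \<sigma>: "\<sigma> \<in> {1, -1::real}"
    and \<Psi>: "c2_bundle_iso (whitney_sum \<xi> (trivial_bundle M V \<rho>)) (whitney_sum \<eta> (trivial_bundle M V \<rho>)) \<Psi>"
    and fixes_line: "\<And>x. x \<in> topspace (mtop M) \<Longrightarrow> \<Psi> (vzero \<xi> x, (x, v0)) = (vzero \<eta> x, (x, v0))"
  shows "c2_isomorphic (whitney_sum \<xi> (trivial_bundle M (orth_part V \<rho> v0) \<rho>)) (whitney_sum \<eta> (trivial_bundle M (orth_part V \<rho> v0) \<rho>))"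
proof -
  interpret X1: c2_bundle_over M \<xi> by (rule X1)
  interpret X2: c2_bundle_over M \<eta> by (rule X2)
  note P = line_proj_facts[OF V v0 \<sigma>]
  let ?V' = "orth_part V \<rho> v0"
  let ?A = "whitney_sum \<xi> (trivial_bundle M V \<rho>)" and ?B = "whitney_sum \<eta> (trivial_bundle M V \<rho>)"
  let ?A' = "whitney_sum \<xi> (trivial_bundle M ?V' \<rho>)" and ?B' = "whitney_sum \<eta> (trivial_bundle M ?V' \<rho>)"
  obtain \<Psi>' where \<Psi>': "c2_bundle_iso ?B ?A \<Psi>'" "\<forall>z\<in>topspace (total ?A). \<Psi>' (\<Psi> z) = z" "\<forall>z\<in>topspace (total ?B). \<Psi> (\<Psi>' z) = z"
    using c2_bundle_iso_inverse[OF \<Psi> X1.stab_closed[OF V]] by blast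
  have into: "\<Psi> z \<in> topspace (total ?B)" if "z \<in> topspace (total ?A)" for z
    using \<Psi> that homeomorphic_imp_surjective_map unfolding c2_bundle_iso_def by blast
  have into': "\<Psi>' z \<in> topspace (total ?A)" if "z \<in> topspace (total ?B)" for z
    using \<Psi>'(1) that homeomorphic_imp_surjective_map unfolding c2_bundle_iso_def by blast
  have fixes': "\<Psi>' (vzero \<eta> x, (x, v0)) = (vzero \<xi> x, (x, v0))" if x: "x \<in> topspace (mtop M)" for x
  proof -
    have "(vzero \<xi> x, (x, v0)) \<in> topspace (total ?A)" unfolding X1.stab_mem using X1.zero_fib[OF x] v0(1) by simp
    then have "\<Psi>' (\<Psi> (vzero \<xi> x, (x, v0))) = (vzero \<xi> x, (x, v0))" using \<Psi>'(2) by blast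
    then show ?thesis unfolding fixes_line[OF x] .
  qed
  define \<Omega> where "\<Omega> z = drop_line \<rho> v0 (\<Psi> z)" for z
  define \<Omega>' where "\<Omega>' z = drop_line \<rho> v0 (\<Psi>' z)" for z
  have cont: "continuous_map (total ?A) (total ?B) \<Psi>" "continuous_map (total ?B) (total ?A) \<Psi>'"
    using \<Psi> \<Psi>'(1) by (auto simp: c2_bundle_iso_def homeomorphic_imp_continuous_map)
  have c1: "continuous_map (total ?A') (total ?B') \<Omega>"
    using continuous_map_compose[OF continuous_map_compose[OF X1.stab_inclusion[OF P(8)] cont(1)] X2.drop_line_continuous[OF V v0 \<sigma>]]
    by (simp add: \<Omega>_def[abs_def] o_def)
  have c2: "continuous_map (total ?B') (total ?A') \<Omega>'"
    using continuous_map_compose[OF continuous_map_compose[OF X2.stab_inclusion[OF P(8)] cont(2)] X1.drop_line_continuous[OF V v0 \<sigma>]]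
    by (simp add: \<Omega>'_def[abs_def] o_def)
  have r1: "\<Omega> (\<Omega>' z) = z" if "z \<in> topspace (total ?B')" for z
    unfolding \<Omega>_def \<Omega>'_def
    by (rule drop_line_retract[OF X1 X2 V v0 \<sigma> \<Psi> fixes_line _ that]) (use \<Psi>'(3) into' in auto)
  have r2: "\<Omega>' (\<Omega> z) = z" if "z \<in> topspace (total ?A')" for z
    unfolding \<Omega>_def \<Omega>'_def
    by (rule drop_line_retract[OF X2 X1 V v0 \<sigma> \<Psi>'(1) fixes' _ that]) (use \<Psi>'(2) into in auto)
  have "homeomorphic_maps (total ?A') (total ?B') \<Omega> \<Omega>'"
    unfolding homeomorphic_maps_def using c1 c2 r1 r2 by blast
  then have homeo: "homeomorphic_map (total ?A') (total ?B') \<Omega>" by (rule homeomorphic_maps_imp_map)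
  have "c2_bundle_iso ?A' ?B' \<Omega>"
    unfolding c2_bundle_iso_def
  proof (intro conjI ballI allI)
    fix z assume z: "z \<in> topspace (total ?A')"
    then obtain e x u where zz: "z = (e, (x, u))" "e \<in> fibre \<xi> x" "u \<in> ?V'" "x \<in> topspace (mtop M)" "proj \<xi> e = x"
      by (rule X1.stab_memE)
    have zV: "z \<in> topspace (total ?A)" unfolding zz(1) X1.stab_mem using zz P(8) by blast
    obtain f y w where k: "\<Psi> z = (f, (y, w))" "f \<in> fibre \<eta> y" "w \<in> V" "proj \<eta> f = y"
      by (rule X2.stab_memE[OF into[OF zV]])
    have "proj ?B (\<Psi> z) = proj ?A z" using \<Psi> zV unfolding c2_bundle_iso_def by blast
    then have yx: "y = x" unfolding k(1) unfolding zz(1) whitney_trivial_simps k(4) zz(5) .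
    show "proj ?B' (\<Omega> z) = proj ?A' z"
      unfolding \<Omega>_def k(1) unfolding zz(1) by (simp add: drop_line_def whitney_trivial_simps k(4) zz(5) yx)
    have "\<Psi> (act ?A z) = act ?B (\<Psi> z)" using \<Psi> zV unfolding c2_bundle_iso_def by blast
    then have "\<Psi> (act ?A' z) = (act \<eta> f, (flip M y, \<rho> w))" unfolding zz(1) k(1)[unfolded zz(1)] whitney_trivial_simps .
    then show "\<Omega> (act ?A' z) = act ?B' (\<Omega> z)"
      by (simp add: \<Omega>_def k(1) drop_line_def whitney_trivial_simps P(6)[OF k(3)])
    have "\<Psi> (vscale ?A c z) = vscale ?B c (\<Psi> z)" for c using \<Psi> zV unfolding c2_bundle_iso_def by blast
    then have "\<Psi> (vscale ?A' c z) = (vscale \<eta> c f, (y, c *\<^sub>R w))" for c unfolding zz(1) k(1)[unfolded zz(1)] whitney_trivial_simps .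
    then show "\<Omega> (vscale ?A' c z) = vscale ?B' c (\<Omega> z)" for c
      by (simp add: \<Omega>_def k(1) drop_line_def whitney_trivial_simps P(4))
    fix z' assume z': "z' \<in> fibre ?A' (proj ?A' z)"
    then have z'T: "z' \<in> topspace (total ?A')" by (simp add: fibre_def)
    then obtain e' x' u' where zz': "z' = (e', (x', u'))" "e' \<in> fibre \<xi> x'" "u' \<in> ?V'" "proj \<xi> e' = x'"
      by (rule X1.stab_memE)
    have x'x: "x' = x" using z' unfolding zz(1) zz'(1) fibre_def whitney_trivial_simps by (simp add: whitney_trivial_simps zz'(4) zz(5))
    have z'V: "z' \<in> fibre ?A (proj ?A z)"
      unfolding zz(1) zz'(1) whitney_trivial_simps X1.stab_fibre using zz'(2,3) x'x zz(5) P(8) by auto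
    then have "z' \<in> topspace (total ?A)" by (simp add: fibre_def)
    then obtain f' y' w' where k': "\<Psi> z' = (f', (y', w'))" "w' \<in> V" 
      using X2.stab_memE[OF into] by metis
    have "\<Psi> (vadd ?A z z') = vadd ?B (\<Psi> z) (\<Psi> z')" using \<Psi> zV z'V unfolding c2_bundle_iso_def by blast
    then have "\<Psi> (vadd ?A' z z') = (vadd \<eta> f f', (y, w + w'))"
      unfolding zz(1) zz'(1) k(1)[unfolded zz(1)] k'(1)[unfolded zz'(1)] whitney_trivial_simps .
    then show "\<Omega> (vadd ?A' z z') = vadd ?B' (\<Omega> z) (\<Omega> z')"
      by (simp add: \<Omega>_def k(1) k'(1) drop_line_def whitney_trivial_simps P(3))
  qed (rule homeo)
  then show ?thesis by (auto simp: c2_isomorphic_def)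
qed

text \<open>
  The preimage of the constant section \<open>v0\<close> is moved to that section by an automorphism of the
  source, so that the isomorphism may be assumed to fix the line.
\<close>

lemma cancel_line:
  fixes M :: "'m c2_manifold" and \<xi> :: "('m, 'e) c2_bundle" and \<eta> :: "('m, 'f) c2_bundle"
    and V :: "'v::euclidean_space set"
  assumes X1: "c2_bundle_over M \<xi>" and X2: "c2_bundle_over M \<eta>"
    and V: "involution_on V \<rho>" and v0: "v0 \<in> V" "v0 \<noteq> 0" "\<rho> v0 = \<sigma> *\<^sub>R v0" and \<sigma>: "\<sigma> \<in> {1, -1::real}"
    and iso: "c2_isomorphic (whitney_sum \<xi> (trivial_bundle M V \<rho>)) (whitney_sum \<eta> (trivial_bundle M V \<rho>))"
    and rk: "\<forall>x\<in>topspace (mtop M). rank_at \<xi> x > mdim M"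
    and rkF: "\<forall>x\<in>fixed_set M. rank_at (eigenbundle M \<sigma> \<xi>) x > fixed_dim M"
  shows "c2_isomorphic (whitney_sum \<xi> (trivial_bundle M (orth_part V \<rho> v0) \<rho>)) (whitney_sum \<eta> (trivial_bundle M (orth_part V \<rho> v0) \<rho>))"
proof -
  interpret X1: c2_bundle_over M \<xi> by (rule X1)
  interpret X2: c2_bundle_over M \<eta> by (rule X2)
  let ?A = "whitney_sum \<xi> (trivial_bundle M V \<rho>)" and ?B = "whitney_sum \<eta> (trivial_bundle M V \<rho>)"
  have sV: "subspace V" using V by (simp add: involution_on_def)
  obtain \<Phi> where \<Phi>: "c2_bundle_iso ?A ?B \<Phi>" using iso by (auto simp: c2_isomorphic_def)
  obtain \<Phi>' where \<Phi>': "c2_bundle_iso ?B ?A \<Phi>'" "\<forall>z\<in>topspace (total ?A). \<Phi>' (\<Phi> z) = z" "\<forall>z\<in>topspace (total ?B). \<Phi> (\<Phi>' z) = z"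
    using c2_bundle_iso_inverse[OF \<Phi> X1.stab_closed[OF V]] by blast
  define b where "b x = (vzero \<eta> x, (x, v0))" for x
  have bB: "b x \<in> topspace (total ?B)" if "x \<in> topspace (mtop M)" for x
    unfolding b_def X2.stab_mem using X2.zero_fib[OF that] v0(1) by simp
  define a1 where "a1 x = fst (\<Phi>' (b x))" for x
  define a2 where "a2 x = snd (snd (\<Phi>' (b x)))" for x
  have a: "\<Phi>' (b x) = (a1 x, (x, a2 x)) \<and> a1 x \<in> fibre \<xi> x \<and> a2 x \<in> V" if x: "x \<in> topspace (mtop M)" for x
  proof -
    have "\<Phi>' (b x) \<in> topspace (total ?A)"
      using \<Phi>'(1) bB[OF x] homeomorphic_imp_surjective_map unfolding c2_bundle_iso_def by blast
    then obtain e y u where k: "\<Phi>' (b x) = (e, (y, u))" "e \<in> fibre \<xi> y" "u \<in> V" "proj \<xi> e = y" by (rule X1.stab_memE)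
    have "proj ?A (\<Phi>' (b x)) = proj ?B (b x)" using \<Phi>'(1) bB[OF x] unfolding c2_bundle_iso_def by blast
    then have "y = x" using X2.zero_fib[OF x] unfolding k(1) unfolding b_def whitney_trivial_simps k(4) by (simp add: X2.fib_iff)
    then show ?thesis using k by (simp add: a1_def a2_def)
  qed
  have "continuous_map (mtop M) (total ?B) (\<lambda>x. (vzero \<eta> x, (proj \<eta> (vzero \<eta> x), v0)))"
    by (rule X2.stab_continuousI[OF X2.vzero_continuous]) (use v0 in auto)
  then have "continuous_map (mtop M) (total ?B) b"
    by (rule continuous_map_eq) (use X2.zero_fib in \<open>simp add: b_def X2.fib_iff\<close>)
  then have c: "continuous_map (mtop M) (total ?A) (\<lambda>x. \<Phi>' (b x))"
    using continuous_map_compose[OF _ homeomorphic_imp_continuous_map] \<Phi>'(1) by (fastforce simp: c2_bundle_iso_def o_def)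
  have eq: "act \<xi> (a1 x) = vscale \<xi> \<sigma> (a1 (flip M x)) \<and> \<rho> (a2 x) = \<sigma> *\<^sub>R a2 (flip M x)" if x: "x \<in> topspace (mtop M)" for x
  proof -
    note gx = X2.g_in[OF x]
    have "act ?B (b x) = vscale ?B \<sigma> (b (flip M x))"
      unfolding b_def whitney_trivial_simps using X2.act_vzero[OF x] X2.vec_scale_vzero[OF gx] v0(3) by simp
    then have "act ?A (\<Phi>' (b x)) = vscale ?A \<sigma> (\<Phi>' (b (flip M x)))"
      using \<Phi>'(1) bB[OF x] bB[OF gx] unfolding c2_bundle_iso_def by metis
    then show ?thesis using a[OF x] a[OF gx] by (simp add: whitney_trivial_simps)
  qed
  have sec: "X1.eqsec \<sigma> a1"
    unfolding X1.eqsec_def a1_def[abs_def]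
    using continuous_map_compose[OF c X1.stab_continuousD(1)] eq a by (simp add: o_def a1_def[symmetric])
  have vs: "X1.vsec \<sigma> V \<rho> a2"
    unfolding X1.vsec_def a2_def[abs_def]
    using continuous_map_compose[OF c X1.stab_continuousD(2)] eq a by (simp add: o_def a2_def[symmetric])
  have nz: "a1 x \<noteq> vzero \<xi> x \<or> a2 x \<noteq> 0" if x: "x \<in> topspace (mtop M)" for x
  proof (rule ccontr)
    assume "\<not> ?thesis"
    then have "vscale ?A 0 (\<Phi>' (b x)) = \<Phi>' (b x)"
      using a[OF x] X1.vec_scale_vzero[OF x] by (simp add: whitney_trivial_simps)
    then have "\<Phi>' (vscale ?B 0 (b x)) = \<Phi>' (b x)" using \<Phi>'(1) bB[OF x] unfolding c2_bundle_iso_def by simp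
    then have "vscale ?B 0 (b x) = b x" using \<Phi>'(3) bB[OF x] X2.stab_closed(2)[OF V bB[OF x], of 0] by metis
    then show False using v0(2) by (simp add: b_def whitney_trivial_simps)
  qed
  obtain A where A: "c2_bundle_iso ?A ?A A" "\<forall>x\<in>topspace (mtop M). A (vzero \<xi> x, (x, v0)) = (a1 x, (x, a2 x))"
    using X1.equivariant_transport[OF V \<sigma> v0 sec vs nz rk rkF] by blast
  show ?thesis
  proof (rule drop_line_iso[OF X1 X2 V v0 \<sigma> c2_bundle_iso_compose[OF A(1) \<Phi>]])
    fix x assume x: "x \<in> topspace (mtop M)"
    have "\<Phi> (A (vzero \<xi> x, (x, v0))) = \<Phi> (\<Phi>' (b x))" using A(2) a[OF x] x by simp
    also have "\<dots> = b x" using \<Phi>'(3) bB[OF x] by blast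
    finally show "\<Phi> (A (vzero \<xi> x, (x, v0))) = (vzero \<eta> x, (x, v0))" by (simp add: b_def)
  qed
qed

text \<open>
  Either \<open>u\<close> is itself antiinvariant, or \<open>u + \<rho> u\<close> is an invariant vector.
\<close>

lemma involution_eigenvector:
  assumes V: "involution_on V \<rho>" and u: "u \<in> V" "u \<noteq> 0"
  obtains \<sigma> v where "\<sigma> \<in> {1, -1::real}" "v \<in> V" "v \<noteq> 0" "\<rho> v = \<sigma> *\<^sub>R v"
proof (cases "u + \<rho> u = 0")
  case True
  then have "\<rho> u = (-1) *\<^sub>R u" by (simp add: add_eq_0_iff)
  then show ?thesis using that[of "-1" u] u by simp
next
  case False
  have "\<rho> (u + \<rho> u) = 1 *\<^sub>R (u + \<rho> u)" "u + \<rho> u \<in> V"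
    using V u by (auto simp: involution_on_def linear_add subspace_add add.commute)
  then show ?thesis using that[of 1 "u + \<rho> u"] False by simp
qed

text \<open>
  The action off \<open>V\<close> does not enter the bundles, so it may be chosen linear on the ambient space.
\<close>

lemma representation_linear_extension:
  assumes "c2_representation V \<rho>"
  shows "\<exists>\<rho>'. involution_on V \<rho>' \<and> (\<forall>v\<in>V. \<rho>' v = \<rho> v)"
proof -
  have sV: "subspace V" and \<rho>: "\<And>v. v \<in> V \<Longrightarrow> \<rho> v \<in> V \<and> \<rho> (\<rho> v) = v" 
    "\<And>v w. v \<in> V \<Longrightarrow> w \<in> V \<Longrightarrow> \<rho> (v + w) = \<rho> v + \<rho> w" "\<And>v c. v \<in> V \<Longrightarrow> \<rho> (c *\<^sub>R v) = c *\<^sub>R \<rho> v"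
    using assms by (auto simp: c2_representation_def)
  obtain B where B: "B \<subseteq> V" "independent B" "V \<subseteq> span B" by (rule basis_exists[of V])
  obtain \<rho>' where \<rho>': "linear \<rho>'" "\<forall>x\<in>B. \<rho>' x = \<rho> x" using linear_independent_extend[OF B(2), of \<rho>] by (elim exE conjE)
  have "\<rho> 0 = 0" using \<rho>(3)[OF subspace_0[OF sV], of 0] by simp
  then have "subspace {v \<in> V. \<rho>' v = \<rho> v}"
    using sV \<rho> by (auto simp: subspace_def linear_0[OF \<rho>'(1)] linear_add[OF \<rho>'(1)] linear_scale[OF \<rho>'(1)])
  then have "span B \<subseteq> {v \<in> V. \<rho>' v = \<rho> v}" using B(1) \<rho>'(2) by (intro span_minimal) auto
  then have eq: "\<rho>' v = \<rho> v" if "v \<in> V" for v using that B(3) by blast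
  then have "involution_on V \<rho>'" using sV \<rho> \<rho>'(1) by (simp add: involution_on_def)
  then show ?thesis using eq by blast
qed

lemma whitney_zero_iso:
  assumes X1: "c2_bundle_over M \<xi>" and X2: "c2_bundle_over M \<eta>" and V: "V = {0}" "involution_on V \<rho>"
    and iso: "c2_isomorphic (whitney_sum \<xi> (trivial_bundle M V \<rho>)) (whitney_sum \<eta> (trivial_bundle M V \<rho>))"
  shows "c2_isomorphic \<xi> \<eta>"
proof -
  interpret X1: c2_bundle_over M \<xi> by (rule X1)
  interpret X2: c2_bundle_over M \<eta> by (rule X2)
  have lin: "\<rho> 0 = 0" using V(2) by (auto simp: involution_on_def linear_0)
  have step: "c2_bundle_iso \<zeta> (whitney_sum \<zeta> (trivial_bundle M V \<rho>)) (\<lambda>e. (e, (proj \<zeta> e, 0)))"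
    if "c2_bundle_over M \<zeta>" for \<zeta> :: "('a, 'z) c2_bundle"
  proof -
    interpret X3: c2_bundle_over M \<zeta> by (rule that)
    let ?Z = "whitney_sum \<zeta> (trivial_bundle M V \<rho>)"
    have "continuous_map (total \<zeta>) (total ?Z) (\<lambda>e. (e, (proj \<zeta> e, 0)))"
      by (rule X3.stab_continuousI) (auto simp: V(1) continuous_map_id[unfolded id_def])
    moreover have "(fst z, (proj \<zeta> (fst z), 0)) = z" if zZ: "z \<in> topspace (total ?Z)" for z
    proof -
      obtain e x u where "z = (e, (x, u))" "u \<in> V" "proj \<zeta> e = x" by (rule X3.stab_memE[OF zZ])
      then show ?thesis using V(1) by simp
    qed
    ultimately have "homeomorphic_maps (total \<zeta>) (total ?Z) (\<lambda>e. (e, (proj \<zeta> e, 0))) fst"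
      using X3.stab_continuousD(1) by (simp add: homeomorphic_maps_def)
    then have "homeomorphic_map (total \<zeta>) (total ?Z) (\<lambda>e. (e, (proj \<zeta> e, 0)))" by (rule homeomorphic_maps_imp_map)
    moreover have "proj \<zeta> (act \<zeta> e) = flip M (proj \<zeta> e)" "proj \<zeta> (vscale \<zeta> c e) = proj \<zeta> e" if "e \<in> topspace (total \<zeta>)" for e c
      using X3.act_fib[of e "proj \<zeta> e"] X3.scale_fib[of e "proj \<zeta> e" c] that by (auto simp: X3.fib_iff)
    moreover have "proj \<zeta> (vadd \<zeta> e e') = proj \<zeta> e" if "e \<in> topspace (total \<zeta>)" "e' \<in> fibre \<zeta> (proj \<zeta> e)" for e e'
      using X3.add_fib[of e "proj \<zeta> e" e'] that by (auto simp: X3.fib_iff)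
    ultimately show ?thesis by (simp add: c2_bundle_iso_def whitney_trivial_simps lin fibre_def)
  qed
  obtain \<Phi> where \<Phi>: "c2_bundle_iso (whitney_sum \<xi> (trivial_bundle M V \<rho>)) (whitney_sum \<eta> (trivial_bundle M V \<rho>)) \<Phi>"
    using iso by (auto simp: c2_isomorphic_def)
  have "\<exists>k. c2_bundle_iso (whitney_sum \<eta> (trivial_bundle M V \<rho>)) \<eta> k \<and> 
      (\<forall>e\<in>topspace (total \<eta>). k (e, (proj \<eta> e, 0)) = e) \<and> 
      (\<forall>f\<in>topspace (total (whitney_sum \<eta> (trivial_bundle M V \<rho>))). (k f, (proj \<eta> (k f), 0)) = f)"
  proof (rule c2_bundle_iso_inverse[OF step[OF X2]])
    fix e assume e: "e \<in> topspace (total \<eta>)"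
    then have ef: "e \<in> fibre \<eta> (proj \<eta> e)" by (simp add: X2.fib_iff)
    show "vadd \<eta> e e' \<in> topspace (total \<eta>)" if "e' \<in> fibre \<eta> (proj \<eta> e)" for e'
      using X2.add_fib[OF ef that] by (simp add: X2.fib_iff)
    show "vscale \<eta> c e \<in> topspace (total \<eta>)" for c using X2.scale_fib[OF ef, of c] by (simp add: X2.fib_iff)
    show "act \<eta> e \<in> topspace (total \<eta>)" using X2.act_fib[OF ef] by (simp add: X2.fib_iff)
  qed
  then obtain k where "c2_bundle_iso (whitney_sum \<eta> (trivial_bundle M V \<rho>)) \<eta> k" by blast
  from c2_bundle_iso_compose[OF step[OF X1] c2_bundle_iso_compose[OF \<Phi> this]]
  show ?thesis by (auto simp: c2_isomorphic_def)
qed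

lemma c2_cancellation:
  fixes M :: "'m c2_manifold" and \<xi> :: "('m, 'e) c2_bundle" and \<eta> :: "('m, 'f) c2_bundle"
    and V :: "'v::euclidean_space set"
  assumes X1: "c2_bundle_over M \<xi>" and X2: "c2_bundle_over M \<eta>"
    and rk: "\<forall>x\<in>topspace (mtop M). rank_at \<xi> x > mdim M"
    and rkF: "\<And>\<sigma>. \<sigma> \<in> {1, -1} \<Longrightarrow> \<forall>x\<in>fixed_set M. rank_at (eigenbundle M \<sigma> \<xi>) x > fixed_dim M"
  shows "involution_on V \<rho> \<Longrightarrow>
    c2_isomorphic (whitney_sum \<xi> (trivial_bundle M V \<rho>)) (whitney_sum \<eta> (trivial_bundle M V \<rho>)) \<Longrightarrow> c2_isomorphic \<xi> \<eta>"
proof (induction "dim V" arbitrary: V rule: less_induct)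
  case less
  show ?case
  proof (cases "V \<subseteq> {0}")
    case True
    then have "V = {0}" using less.prems(1) subspace_0 unfolding involution_on_def by blast
    then show ?thesis by (rule whitney_zero_iso[OF X1 X2 _ less.prems])
  next
    case False
    then obtain u where "u \<in> V" "u \<noteq> 0" by blast
    then obtain \<sigma> v0 where v0: "\<sigma> \<in> {1, -1::real}" "v0 \<in> V" "v0 \<noteq> 0" "\<rho> v0 = \<sigma> *\<^sub>R v0"
      by (rule involution_eigenvector[OF less.prems(1)])
    note P = line_proj_facts[OF less.prems(1) v0(2-4,1)]
    show ?thesis
      by (rule less.hyps[OF P(9,7) cancel_line[OF X1 X2 less.prems(1) v0(2-4,1) less.prems(2) rk rkF[OF v0(1)]]])
  qed
qed

theorem theorem4p12:
  fixes M :: "'m c2_manifold"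
    and \<xi> :: "('m, 'e) c2_bundle"
    and \<eta> :: "('m, 'f) c2_bundle"
    and V :: "'v::euclidean_space set"
    and \<rho> :: "'v \<Rightarrow> 'v"
  assumes "smooth_c2_manifold M"
    and "c2_vector_bundle M \<xi>"
    and "c2_vector_bundle M \<eta>"
    and "c2_representation V \<rho>"
    and "c2_isomorphic (whitney_sum \<xi> (trivial_bundle M V \<rho>))
                       (whitney_sum \<eta> (trivial_bundle M V \<rho>))"
    and "\<forall>x\<in>topspace (mtop M). rank_at \<xi> x > mdim M + 1"
    and "\<forall>x\<in>fixed_set M. rank_at (eigenbundle M 1 \<xi>) x > fixed_dim M + 1"
    and "\<forall>x\<in>fixed_set M. rank_at (eigenbundle M (-1) \<xi>) x > fixed_dim M + 1"
  shows "c2_isomorphic \<xi> \<eta>"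
proof -
  have X1: "c2_bundle_over M \<xi>" and X2: "c2_bundle_over M \<eta>"
    using assms(1-3) by (auto simp: c2_bundle_over_def)
  interpret X1: c2_bundle_over M \<xi> by (rule X1)
  interpret X2: c2_bundle_over M \<eta> by (rule X2)
  obtain \<rho>' where \<rho>': "involution_on V \<rho>'" "\<forall>v\<in>V. \<rho>' v = \<rho> v"
    using representation_linear_extension[OF assms(4)] by (elim exE conjE)
  obtain h where h: "c2_bundle_iso (whitney_sum \<xi> (trivial_bundle M V \<rho>)) (whitney_sum \<eta> (trivial_bundle M V \<rho>)) h"
    using assms(5) by (auto simp: c2_isomorphic_def)
  \<comment> \<open>\<open>\<rho>\<close> and \<open>\<rho>'\<close> define bundles that differ only in the action outside the total space\<close>
  have same: "total (whitney_sum \<zeta> (trivial_bundle M V \<rho>')) = total (whitney_sum \<zeta> (trivial_bundle M V \<rho>))"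
    "proj (whitney_sum \<zeta> (trivial_bundle M V \<rho>')) = proj (whitney_sum \<zeta> (trivial_bundle M V \<rho>))"
    "vadd (whitney_sum \<zeta> (trivial_bundle M V \<rho>')) = vadd (whitney_sum \<zeta> (trivial_bundle M V \<rho>))"
    "vscale (whitney_sum \<zeta> (trivial_bundle M V \<rho>')) = vscale (whitney_sum \<zeta> (trivial_bundle M V \<rho>))"
    "fibre (whitney_sum \<zeta> (trivial_bundle M V \<rho>')) = fibre (whitney_sum \<zeta> (trivial_bundle M V \<rho>))"
    for \<zeta> :: "('m, 'z) c2_bundle"
    by (auto simp: whitney_sum_def trivial_bundle_def fibre_def fun_eq_iff)
  have a1: "act (whitney_sum \<xi> (trivial_bundle M V \<rho>')) z = act (whitney_sum \<xi> (trivial_bundle M V \<rho>)) z"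
    if "z \<in> topspace (total (whitney_sum \<xi> (trivial_bundle M V \<rho>)))" for z
    using that by (rule X1.stab_memE) (simp add: whitney_trivial_simps \<rho>'(2))
  have a2: "act (whitney_sum \<eta> (trivial_bundle M V \<rho>')) z = act (whitney_sum \<eta> (trivial_bundle M V \<rho>)) z"
    if "z \<in> topspace (total (whitney_sum \<eta> (trivial_bundle M V \<rho>)))" for z
    using that by (rule X2.stab_memE) (simp add: whitney_trivial_simps \<rho>'(2))
  have hin: "h z \<in> topspace (total (whitney_sum \<eta> (trivial_bundle M V \<rho>)))"
    if "z \<in> topspace (total (whitney_sum \<xi> (trivial_bundle M V \<rho>)))" for z
    using h that homeomorphic_imp_surjective_map unfolding c2_bundle_iso_def by blast
  have "c2_bundle_iso (whitney_sum \<xi> (trivial_bundle M V \<rho>')) (whitney_sum \<eta> (trivial_bundle M V \<rho>')) h"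
    using h a1 a2 hin unfolding c2_bundle_iso_def same by simp
  then have iso: "c2_isomorphic (whitney_sum \<xi> (trivial_bundle M V \<rho>')) (whitney_sum \<eta> (trivial_bundle M V \<rho>'))"
    by (auto simp: c2_isomorphic_def)
  show ?thesis
  proof (rule c2_cancellation[OF X1 X2 _ _ \<rho>'(1) iso])
    show "\<forall>x\<in>topspace (mtop M). rank_at \<xi> x > mdim M" using assms(6) by fastforce
    show "\<forall>x\<in>fixed_set M. rank_at (eigenbundle M \<sigma> \<xi>) x > fixed_dim M" if "\<sigma> \<in> {1, -1}" for \<sigma>
      using that assms(7,8) by fastforce
  qed
qed

end
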